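(* Let $\mathcal G$ be a compact nonabelian group and denote its center by $\mathcal C$. Let $\mathfrak C(\mathcal G)=\{[D]\mid D\in\widehat{\mathcal G}\}$ be the set of chain equivalence classes in $\widehat{\mathcal G}$. (i) The set $\mathfrak C(\mathcal G)$ becomes an abelian group with respect to the multiplication defined, for $D_0,D_1\in\widehat{\mathcal G}$, by $$[D_0]\boxtimes[D_1]:=[D_0\times D_1].$$ (ii) The character $\Upsilon_D\in\widehat{\mathcal C}$ depends on $D$ only through the chain equivalence class $[D]$, so that one may write $\Upsilon_{[D]}:=\Upsilon_D$. The group $\mathfrak C(\mathcal G)$ and the character group $\widehat{\mathcal C}$ of the center of $\mathcal G$ are isomorphic, the isomorphism being given by $$\eta:\mathfrak C(\mathcal G)\to\widehat{\mathcal C},\qquad \eta([D]):=\Upsilon_{[D]}.$$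
   Context: $\widehat{\mathcal G}$ is the set of equivalence classes of irreducible (continuous, unitary, finite-dimensional) representations of $\mathcal G$. For $D_1,D_2\in\widehat{\mathcal G}$, $D_1\times D_2\subset\widehat{\mathcal G}$ is the set of classes appearing in the decomposition of $U_{D_1}\otimes U_{D_2}$ into irreducibles, $U_{D_i}\in D_i$. For subsets, $\Gamma_1\times\Gamma_2=\bigcup\{D_1\times D_2\mid D_i\in\Gamma_i\}$, which gives a meaning to $D_1\times\dots\times D_n$. Chain equivalence: $D\approx D'$ if there exist $D_1,\dots,D_n\in\widehat{\mathcal G}$ with $D,D'\in D_1\times\dots\times D_n$. This is an equivalence relation; $[D]$ denotes the class of $D$. Any two elements of $D_0\times D_1$ are equivalent, and $[D_0\times D_1]:=[D]$ for any $D\in D_0\times D_1$. For $D\in\widehat{\mathcal G}$ and $U_D\in D$, Schur's lemma gives $U_D|_{\mathcal C}=\Upsilon_D\cdot\mathbf 1$ with a character $\Upsilon_D\in\widehat{\mathcal C}$ depending only on $D$ (called the conjugacy class of the representation). *)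

theory Defs
  imports
    "HOL-Analysis.T1_Spaces"
    "Jordan_Normal_Form.Schur_Decomposition"
    "Jordan_Normal_Form.VS_Connect"
    "Jordan_Normal_Form.Spectral_Radius"
begin

locale topological_group = group G for G :: "('g, 'b) monoid_scheme" (structure) +
  fixes T :: "'g topology"
  assumes topspace_eq: "topspace T = carrier G"
    and continuous_mult: "continuous_map (prod_topology T T) T (\<lambda>(x, y). x \<otimes> y)"
    and continuous_inv: "continuous_map T T (\<lambda>x. inv x)"

text \<open>As usual, compact groups are Hausdorff.\<close>

locale compact_group = topological_group +
  assumes compact: "compact_space T"
    and Hausdorff: "Hausdorff_space T"

definition center :: "('g, 'b) monoid_scheme \<Rightarrow> 'g set" where
  "center G = {z \<in> carrier G. \<forall>g\<in>carrier G. z \<otimes>\<^bsub>G\<^esub> g = g \<otimes>\<^bsub>G\<^esub> z}"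

text \<open>The group of continuous characters, as functions that are \<^const>\<open>extensional\<close> on the
  carrier, so that equality of characters is equality of functions.\<close>

definition character_group ::
    "('g, 'b) monoid_scheme \<Rightarrow> 'g topology \<Rightarrow> ('g \<Rightarrow> complex) monoid" where
  "character_group G T =
     \<lparr> carrier = {\<chi> \<in> extensional (carrier G).
         (\<forall>x\<in>carrier G. cmod (\<chi> x) = 1) \<and>
         (\<forall>x\<in>carrier G. \<forall>y\<in>carrier G. \<chi> (x \<otimes>\<^bsub>G\<^esub> y) = \<chi> x * \<chi> y) \<and>
         continuous_map T euclidean \<chi>},
       mult = (\<lambda>\<chi> \<psi>. \<lambda>x\<in>carrier G. \<chi> x * \<psi> x),
       one = (\<lambda>x\<in>carrier G. 1) \<rparr>"

definition center_dual :: "('g, 'b) monoid_scheme \<Rightarrow> 'g topology \<Rightarrow> ('g \<Rightarrow> complex) monoid" where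
  "center_dual G T = character_group (G\<lparr>carrier := center G\<rparr>) (subtopology T (center G))"

text \<open>Representations are unitary matrix representations: choosing an orthonormal basis, every
  finite-dimensional unitary representation is unitarily equivalent to one of these. Only the
  values on the carrier matter.\<close>

definition unitary_mat :: "nat \<Rightarrow> complex mat \<Rightarrow> bool" where
  "unitary_mat n A \<longleftrightarrow> A \<in> carrier_mat n n \<and> mat_adjoint A * A = 1\<^sub>m n"

definition unitary_rep ::
    "('g, 'b) monoid_scheme \<Rightarrow> 'g topology \<Rightarrow> nat \<Rightarrow> ('g \<Rightarrow> complex mat) \<Rightarrow> bool" where
  "unitary_rep G T n U \<longleftrightarrow>
     (\<forall>g\<in>carrier G. unitary_mat n (U g)) \<and>
     (\<forall>g\<in>carrier G. \<forall>h\<in>carrier G. U (g \<otimes>\<^bsub>G\<^esub> h) = U g * U h) \<and>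
     (\<forall>i<n. \<forall>j<n. continuous_map T euclidean (\<lambda>g. U g $$ (i, j)))"

definition irreducible_rep ::
    "('g, 'b) monoid_scheme \<Rightarrow> 'g topology \<Rightarrow> ('g \<Rightarrow> complex mat) \<Rightarrow> bool" where
  "irreducible_rep G T U \<longleftrightarrow>
     (\<exists>n>0. unitary_rep G T n U \<and>
        (\<forall>W. VectorSpace.subspace class_ring W (module_vec TYPE(complex) n) \<and>
             (\<forall>g\<in>carrier G. \<forall>w\<in>W. U g *\<^sub>v w \<in> W)
           \<longrightarrow> W = {0\<^sub>v n} \<or> W = carrier_vec n))"

definition unitarily_equiv ::
    "('g, 'b) monoid_scheme \<Rightarrow> ('g \<Rightarrow> complex mat) \<Rightarrow> ('g \<Rightarrow> complex mat) \<Rightarrow> bool" where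
  "unitarily_equiv G U V \<longleftrightarrow>
     (\<exists>n S. unitary_mat n S \<and>
        (\<forall>g\<in>carrier G. U g \<in> carrier_mat n n \<and> V g \<in> carrier_mat n n \<and> S * U g = V g * S))"

definition irr_equiv_rel ::
    "('g, 'b) monoid_scheme \<Rightarrow> 'g topology \<Rightarrow> (('g \<Rightarrow> complex mat) \<times> ('g \<Rightarrow> complex mat)) set" where
  "irr_equiv_rel G T =
     {(U, V). irreducible_rep G T U \<and> irreducible_rep G T V \<and> unitarily_equiv G U V}"

definition irr_classes ::
    "('g, 'b) monoid_scheme \<Rightarrow> 'g topology \<Rightarrow> ('g \<Rightarrow> complex mat) set set" where
  "irr_classes G T = {U. irreducible_rep G T U} // irr_equiv_rel G T"

text \<open>The Kronecker product, i.e. the matrix of the tensor product of two linear maps with respect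
  to the lexicographically ordered product basis.\<close>

definition kronecker :: "complex mat \<Rightarrow> complex mat \<Rightarrow> complex mat" where
  "kronecker A B =
     mat (dim_row A * dim_row B) (dim_col A * dim_col B)
       (\<lambda>(i, j). A $$ (i div dim_row B, j div dim_col B) * B $$ (i mod dim_row B, j mod dim_col B))"

definition tensor_rep ::
    "('g \<Rightarrow> complex mat) \<Rightarrow> ('g \<Rightarrow> complex mat) \<Rightarrow> 'g \<Rightarrow> complex mat" where
  "tensor_rep U V = (\<lambda>g. kronecker (U g) (V g))"

definition direct_sum_rep :: "('g \<Rightarrow> complex mat) list \<Rightarrow> 'g \<Rightarrow> complex mat" where
  "direct_sum_rep Us = (\<lambda>g. diag_block_mat (map (\<lambda>U. U g) Us))"

definition irr_constituents ::
    "('g, 'b) monoid_scheme \<Rightarrow> 'g topology \<Rightarrow> ('g \<Rightarrow> complex mat) \<Rightarrow> ('g \<Rightarrow> complex mat) set set" where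
  "irr_constituents G T U =
     {D \<in> irr_classes G T.
        \<exists>Us. (\<forall>V\<in>set Us. irreducible_rep G T V) \<and> unitarily_equiv G U (direct_sum_rep Us) \<and>
             (\<exists>V\<in>set Us. V \<in> D)}"

definition class_prod ::
    "('g, 'b) monoid_scheme \<Rightarrow> 'g topology \<Rightarrow> ('g \<Rightarrow> complex mat) set \<Rightarrow> ('g \<Rightarrow> complex mat) set
      \<Rightarrow> ('g \<Rightarrow> complex mat) set set" where
  "class_prod G T D1 D2 = (\<Union>U1\<in>D1. \<Union>U2\<in>D2. irr_constituents G T (tensor_rep U1 U2))"

definition set_prod ::
    "('g, 'b) monoid_scheme \<Rightarrow> 'g topology \<Rightarrow> ('g \<Rightarrow> complex mat) set set
      \<Rightarrow> ('g \<Rightarrow> complex mat) set set \<Rightarrow> ('g \<Rightarrow> complex mat) set set" where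
  "set_prod G T \<Gamma>1 \<Gamma>2 = (\<Union>D1\<in>\<Gamma>1. \<Union>D2\<in>\<Gamma>2. class_prod G T D1 D2)"

text \<open>\<open>chain_prod G T D1 [D2, \<dots>, Dn]\<close> is $D_1 \times \dots \times D_n$, bracketed to the left;
  the separate first argument makes $n \ge 1$.\<close>

definition chain_prod ::
    "('g, 'b) monoid_scheme \<Rightarrow> 'g topology \<Rightarrow> ('g \<Rightarrow> complex mat) set
      \<Rightarrow> ('g \<Rightarrow> complex mat) set list \<Rightarrow> ('g \<Rightarrow> complex mat) set set" where
  "chain_prod G T D Ds = foldl (\<lambda>\<Gamma> E. set_prod G T \<Gamma> {E}) {D} Ds"

definition chain_equiv ::
    "('g, 'b) monoid_scheme \<Rightarrow> 'g topology \<Rightarrow> ('g \<Rightarrow> complex mat) set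
      \<Rightarrow> ('g \<Rightarrow> complex mat) set \<Rightarrow> bool" where
  "chain_equiv G T D D' \<longleftrightarrow>
     (\<exists>D1\<in>irr_classes G T. \<exists>Ds\<in>lists (irr_classes G T).
        D \<in> chain_prod G T D1 Ds \<and> D' \<in> chain_prod G T D1 Ds)"

definition chain_class ::
    "('g, 'b) monoid_scheme \<Rightarrow> 'g topology \<Rightarrow> ('g \<Rightarrow> complex mat) set
      \<Rightarrow> ('g \<Rightarrow> complex mat) set set" where
  "chain_class G T D = {D' \<in> irr_classes G T. chain_equiv G T D D'}"

text \<open>The class $[\Gamma]$ of a set $\Gamma$ of pairwise chain equivalent elements, i.e. the class
  of any of its members, is rendered as the union of the (coinciding) classes of the members;
  similarly, \<open>chain_mult\<close> unites over all representatives of the two factors.\<close>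

definition set_chain_class ::
    "('g, 'b) monoid_scheme \<Rightarrow> 'g topology \<Rightarrow> ('g \<Rightarrow> complex mat) set set
      \<Rightarrow> ('g \<Rightarrow> complex mat) set set" where
  "set_chain_class G T \<Gamma> = (\<Union>D\<in>\<Gamma>. chain_class G T D)"

definition chain_mult ::
    "('g, 'b) monoid_scheme \<Rightarrow> 'g topology \<Rightarrow> ('g \<Rightarrow> complex mat) set set
      \<Rightarrow> ('g \<Rightarrow> complex mat) set set \<Rightarrow> ('g \<Rightarrow> complex mat) set set" where
  "chain_mult G T X Y = (\<Union>D0\<in>X. \<Union>D1\<in>Y. set_chain_class G T (class_prod G T D0 D1))"

definition trivial_class ::
    "('g, 'b) monoid_scheme \<Rightarrow> 'g topology \<Rightarrow> ('g \<Rightarrow> complex mat) set" where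
  "trivial_class G T = irr_equiv_rel G T `` {\<lambda>_. 1\<^sub>m 1}"

definition chain_group ::
    "('g, 'b) monoid_scheme \<Rightarrow> 'g topology \<Rightarrow> ('g \<Rightarrow> complex mat) set set monoid" where
  "chain_group G T =
     \<lparr> carrier = chain_class G T ` irr_classes G T,
       mult = chain_mult G T,
       one = chain_class G T (trivial_class G T) \<rparr>"

definition central_character ::
    "('g, 'b) monoid_scheme \<Rightarrow> ('g \<Rightarrow> complex mat) set \<Rightarrow> 'g \<Rightarrow> complex" where
  "central_character G D =
     (\<lambda>c\<in>center G. THE z. \<forall>U\<in>D. U c = z \<cdot>\<^sub>m 1\<^sub>m (dim_row (U c)))"

text \<open>The description in \<open>central_character\<close> is proper, by Schur's lemma.\<close>

lemma irreducible_central_scalar: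
  assumes irr: "irreducible_rep G T U" and c: "c \<in> center G"
  obtains n z where "n > 0" "unitary_rep G T n U" "U c = z \<cdot>\<^sub>m 1\<^sub>m n"
proof -
  from irr obtain n where n: "n > 0" and rep: "unitary_rep G T n U"
    and inv: "\<forall>W. VectorSpace.subspace class_ring W (module_vec TYPE(complex) n) \<and>
             (\<forall>g\<in>carrier G. \<forall>w\<in>W. U g *\<^sub>v w \<in> W)
           \<longrightarrow> W = {0\<^sub>v n} \<or> W = carrier_vec n"
    unfolding irreducible_rep_def by (elim exE conjE) (rule that)
  have cG: "c \<in> carrier G" and comm: "\<And>g. g \<in> carrier G \<Longrightarrow> c \<otimes>\<^bsub>G\<^esub> g = g \<otimes>\<^bsub>G\<^esub> c"
    using c by (auto simp: center_def)
  have car: "\<And>g. g \<in> carrier G \<Longrightarrow> U g \<in> carrier_mat n n"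
    using rep by (auto simp: unitary_rep_def unitary_mat_def)
  have hom: "\<And>g h. g \<in> carrier G \<Longrightarrow> h \<in> carrier G \<Longrightarrow> U (g \<otimes>\<^bsub>G\<^esub> h) = U g * U h"
    using rep by (auto simp: unitary_rep_def)
  note Uc = car[OF cG]
  have "spectrum (U c) \<noteq> {}" using spectrum_non_empty[OF Uc] n by auto
  then obtain k where "eigenvalue (U c) k" by (auto simp: spectrum_def)
  then obtain v where v: "v \<in> carrier_vec n" "v \<noteq> 0\<^sub>v n" "U c *\<^sub>v v = k \<cdot>\<^sub>v v"
    using Uc by (auto simp: eigenvalue_def eigenvector_def)
  define W where "W = {w \<in> carrier_vec n. U c *\<^sub>v w = k \<cdot>\<^sub>v w}"
  interpret V: vec_space "TYPE(complex)" n .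
  have sub: "VectorSpace.subspace class_ring W (module_vec TYPE(complex) n)"
  proof (unfold_locales, goal_cases)
    case 1 show ?case by (auto simp: W_def module_vec_simps)
  next
    case (2 v w) then show ?case
      using Uc by (auto simp: W_def module_vec_simps mult_add_distrib_mat_vec smult_add_distrib_vec)
  next
    case 3 show ?case using Uc by (auto simp: W_def module_vec_simps)
  next
    case (4 a w) then show ?case
      using Uc by (auto simp: W_def module_vec_simps mult_mat_vec smult_smult_assoc mult.commute)
  qed
  have "W = {0\<^sub>v n} \<or> W = carrier_vec n"
  proof (rule inv[rule_format, OF conjI[OF sub]], intro ballI)
    fix g w assume g: "g \<in> carrier G" and w: "w \<in> W"
    then have wc: "w \<in> carrier_vec n" and we: "U c *\<^sub>v w = k \<cdot>\<^sub>v w" by (auto simp: W_def)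
    have "U c *\<^sub>v (U g *\<^sub>v w) = (U c * U g) *\<^sub>v w"
      using Uc car[OF g] wc by simp
    also have "U c * U g = U g * U c" using hom[OF cG g] hom[OF g cG] comm[OF g] by simp
    also have "(U g * U c) *\<^sub>v w = U g *\<^sub>v (U c *\<^sub>v w)"
      using Uc car[OF g] wc by simp
    also have "\<dots> = k \<cdot>\<^sub>v (U g *\<^sub>v w)" using car[OF g] wc we by (simp add: mult_mat_vec)
    finally show "U g *\<^sub>v w \<in> W" using car[OF g] wc by (simp add: W_def)
  qed
  moreover have "v \<in> W" using v by (simp add: W_def)
  ultimately have "W = carrier_vec n" using v(2) by blast
  then have all: "U c *\<^sub>v w = k \<cdot>\<^sub>v w" if "w \<in> carrier_vec n" for w
    using that unfolding W_def by blast
  have "U c = k \<cdot>\<^sub>m 1\<^sub>m n"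
  proof (rule eq_matI)
    fix i j assume "i < dim_row (k \<cdot>\<^sub>m 1\<^sub>m n :: complex mat)" "j < dim_col (k \<cdot>\<^sub>m 1\<^sub>m n :: complex mat)"
    then have ij: "i < n" "j < n" by auto
    have "U c $$ (i, j) = (U c *\<^sub>v unit_vec n j) $ i"
      using Uc ij by auto
    also have "\<dots> = (k \<cdot>\<^sub>m 1\<^sub>m n) $$ (i, j)" using all[of "unit_vec n j"] ij by auto
    finally show "U c $$ (i, j) = (k \<cdot>\<^sub>m 1\<^sub>m n) $$ (i, j)" .
  qed (use Uc in auto)
  then show thesis using that n rep by blast
qed

lemma central_character_scalar:
  assumes D: "D \<in> irr_classes G T" and U: "U \<in> D" and c: "c \<in> center G"
  shows "U c = central_character G D c \<cdot>\<^sub>m 1\<^sub>m (dim_row (U c))"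
proof -
  have cG: "c \<in> carrier G" using c by (simp add: center_def)
  from D obtain U0 where U0: "irreducible_rep G T U0" and DU0: "D = irr_equiv_rel G T `` {U0}"
    by (auto simp: irr_classes_def elim: quotientE)
  obtain n z where n: "n > 0" and rep: "unitary_rep G T n U0" and z: "U0 c = z \<cdot>\<^sub>m 1\<^sub>m n"
    using irreducible_central_scalar[OF U0 c] .
  have scal: "V c = z \<cdot>\<^sub>m 1\<^sub>m n" if V: "V \<in> D" for V
  proof -
    from V obtain m S where S: "unitary_mat m S" and "U0 c \<in> carrier_mat m m"
      and Vc: "V c \<in> carrier_mat m m" and SU: "S * U0 c = V c * S"
      using cG unfolding DU0 irr_equiv_rel_def unitarily_equiv_def by blast
    then have mn: "m = n" using z by auto
    have Sc: "S \<in> carrier_mat n n" and SS: "mat_adjoint S * S = 1\<^sub>m n"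
      using S by (auto simp: unitary_mat_def mn)
    have Sa: "mat_adjoint S \<in> carrier_mat n n" using Sc by (auto simp: mat_adjoint_def)
    have SS': "S * mat_adjoint S = 1\<^sub>m n" using mat_mult_left_right_inverse[OF Sa Sc SS] .
    have "V c = V c * (S * mat_adjoint S)" using Vc SS' mn by simp
    also have "\<dots> = (V c * S) * mat_adjoint S" using Vc Sc Sa mn by simp
    also have "V c * S = z \<cdot>\<^sub>m S"
      unfolding SU[symmetric] z using Sc mult_smult_distrib[OF Sc one_carrier_mat] by simp
    also have "(z \<cdot>\<^sub>m S) * mat_adjoint S = z \<cdot>\<^sub>m (S * mat_adjoint S)"
      using Sc Sa by (rule mult_smult_assoc_mat)
    finally show ?thesis by (simp add: SS')
  qed
  have "(THE z. \<forall>U\<in>D. U c = z \<cdot>\<^sub>m 1\<^sub>m (dim_row (U c))) = z"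
  proof (rule the_equality)
    have "V c = z \<cdot>\<^sub>m 1\<^sub>m n \<and> dim_row (V c) = n" if "V \<in> D" for V
      unfolding scal[OF that] by simp
    then show "\<forall>U\<in>D. U c = z \<cdot>\<^sub>m 1\<^sub>m (dim_row (U c))" by metis
  next
    fix y assume "\<forall>U\<in>D. U c = y \<cdot>\<^sub>m 1\<^sub>m (dim_row (U c))"
    then have "U c = y \<cdot>\<^sub>m 1\<^sub>m (dim_row (U c))" using U by blast
    then have "y \<cdot>\<^sub>m 1\<^sub>m n = z \<cdot>\<^sub>m (1\<^sub>m n :: complex mat)" unfolding scal[OF U] by simp
    then have "(y \<cdot>\<^sub>m 1\<^sub>m n) $$ (0, 0) = (z \<cdot>\<^sub>m (1\<^sub>m n :: complex mat)) $$ (0, 0)" by simp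
    then show "y = z" using n by simp
  qed
  then have "central_character G D c = z" using c by (simp add: central_character_def)
  then show ?thesis unfolding scal[OF U] by simp
qed

end

theory Submission
  imports Defs
    "HOL-Analysis.Weierstrass_Theorems"
    "HOL-Analysis.Urysohn"
    "HOL-Complex_Analysis.Great_Picard"
begin

text \<open>A class \<open>E\<close> occurs in \<open>D \<times> V\<close> iff the Haar mean of a product of matrix coefficients of
  \<open>D\<close>, \<open>V\<close> and the conjugate of \<open>E\<close> is nonzero; translation by a central element then shows that
  central characters multiply, hence are constant on chain classes. Conversely, the continuous
  functions with Fourier support in the chain class of \<open>D\<close> form a module over the coefficients of
  all \<open>V \<otimes> V\<^sup>*\<close>. These separate points modulo the centre, since unitary representations
  separate the points of the group (a form of the Peter--Weyl theorem, obtained from the eigenspaces of a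
  convolution operator). If \<open>D'\<close> has the same central character as \<open>D\<close>, then the product \<open>F\<close> of a
  coefficient of \<open>D'\<close> with the conjugate of a coefficient \<open>u\<close> of \<open>D\<close> is a function on the quotient by
  the centre, so by Stone--Weierstrass it is a uniform limit of multipliers of the module; thus
  \<open>F u\<close> lies in its closure, and it is not orthogonal to the coefficients of \<open>D'\<close>. The characters
  \<open>\<Upsilon>\<^sub>D\<close> separate the points of the centre, and a separating group of characters of a compact
  group contains all of them, again by Stone--Weierstrass.\<close>

unbundle no vec_syntax
hide_type (open) Finite_Cartesian_Product.vec
hide_const (open) Finite_Cartesian_Product.vec Finite_Cartesian_Product.row
  Finite_Cartesian_Product.column Finite_Cartesian_Product.transpose Finite_Cartesian_Product.mat

section \<open>The invariant mean of a compact group\<close>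

text \<open>Averages over finitely many translates produce it. Left and right averages commute, so
  they can only shrink to one common constant, and the uniqueness of this constant on the square of
  the group gives Fubini's rule. The functions supported on one chain class do not form an algebra,
  so the approximation has to take place among their multipliers. Their module property comes from
  the fact that \<open>D\<close> lies again in D x V x conj V: appending such a pair prolongs a
  chain without losing its starting point. The statements about classes rest on one equivalence: two
  classes are chain equivalent exactly if their central characters agree. Transitivity, independence
  of representatives and the group laws then become identities between functions on the
  centre.\<close>

text \<open>The tube lemma: compactness of \<open>X\<close> turns the neighbourhoods found for
  single points \<open>x\<close> into one that serves them all. It is the source of uniform
  continuity and of continuity under the mean.\<close>

lemma continuous_map_near_fixed_slice:
  fixes F :: "'a \<times> 'b \<Rightarrow> real"
  assumes "compact_space X" and F: "continuous_map (prod_topology X Y) euclideanreal F"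
    and y: "y \<in> topspace Y" and e: "e > 0"
  obtains V where "openin Y V" "y \<in> V"
    "\<And>x v. x \<in> topspace X \<Longrightarrow> v \<in> V \<Longrightarrow> \<bar>F (x, v) - F (x, y)\<bar> < e"
proof -
  have c2: "continuous_map (prod_topology X Y) euclideanreal (\<lambda>p. F (fst p, y))"
  proof -
    have "continuous_map (prod_topology X Y) (prod_topology X Y) (\<lambda>p. (fst p, y))"
      using y by (intro continuous_map_pairedI) (auto simp: continuous_map_fst)
    then show ?thesis using continuous_map_compose[OF _ F] by (auto simp: o_def)
  qed
  define W where "W = {p \<in> topspace (prod_topology X Y). F p - F (fst p, y) \<in> {-e<..<e}}"
  have W: "openin (prod_topology X Y) W"
    unfolding W_def
    by (rule openin_continuous_map_preimage[OF continuous_map_diff[OF F c2]]) auto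
  have "compactin X (topspace X)" "compactin Y {y}"
    using assms by (auto simp: compact_space_def)
  moreover have "topspace X \<times> {y} \<subseteq> W" using y e by (auto simp: W_def)
  ultimately obtain U V where UV: "openin X U" "openin Y V" "topspace X \<subseteq> U" "{y} \<subseteq> V" "U \<times> V \<subseteq> W"
    using Wallace_theorem_prod_topology[OF _ _ W] by metis
  show thesis
  proof (rule that[of V])
    fix x v assume "x \<in> topspace X" "v \<in> V"
    then have "(x, v) \<in> W" using UV by auto
    then show "\<bar>F (x, v) - F (x, y)\<bar> < e" by (auto simp: W_def)
  qed (use UV in auto)
qed

lemma continuous_map_real_bounded:
  fixes f :: "'a \<Rightarrow> real"
  assumes "compact_space X" "continuous_map X euclideanreal f"
  obtains B where "B > 0" "\<And>x. x \<in> topspace X \<Longrightarrow> \<bar>f x\<bar> \<le> B"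
proof -
  have "compactin euclideanreal (f ` topspace X)"
    using assms image_compactin compact_space_def by blast
  then have "bounded (f ` topspace X)" by (simp add: compact_imp_bounded)
  then obtain B where "\<forall>x\<in>topspace X. \<bar>f x\<bar> \<le> B" by (auto simp: bounded_iff)
  then show thesis using that[of "max B 1"] by force
qed

context topological_group
begin

lemma continuous_map_mult[continuous_intros]:
  assumes "continuous_map X T f" "continuous_map X T g"
  shows "continuous_map X T (\<lambda>x. f x \<otimes> g x)"
  using continuous_map_compose[OF continuous_map_pairedI[OF assms] continuous_mult]
  by (simp add: o_def)

lemma continuous_map_m_inv[continuous_intros]:
  assumes "continuous_map X T f"
  shows "continuous_map X T (\<lambda>x. inv (f x))"
  using continuous_map_compose[OF assms continuous_inv] by (simp add: o_def)

lemma continuous_map_const_carrier: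
  "a \<in> carrier G \<Longrightarrow> continuous_map X T (\<lambda>x. a)"
  by (simp add: topspace_eq)

lemma continuous_map_translate:
  assumes "continuous_map T Y f" "a \<in> carrier G"
  shows "continuous_map T Y (\<lambda>x. f (a \<otimes> x))" "continuous_map T Y (\<lambda>x. f (x \<otimes> a))"
proof -
  have "continuous_map T T (\<lambda>x. a \<otimes> x)" "continuous_map T T (\<lambda>x. x \<otimes> a)"
    using assms(2) by (auto intro!: continuous_map_mult continuous_map_const_carrier)
  from this[THEN continuous_map_compose, OF assms(1)]
  show "continuous_map T Y (\<lambda>x. f (a \<otimes> x))" "continuous_map T Y (\<lambda>x. f (x \<otimes> a))"
    by (auto simp: o_def)
qed

section \<open>Averages over finitely many translates\<close>

definition lavg :: "nat \<Rightarrow> (nat \<Rightarrow> 'g) \<Rightarrow> ('g \<Rightarrow> real) \<Rightarrow> 'g \<Rightarrow> real" where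
  "lavg n a f = (\<lambda>x. (\<Sum>i<n. f (a i \<otimes> x)) / n)"

definition ravg :: "nat \<Rightarrow> (nat \<Rightarrow> 'g) \<Rightarrow> ('g \<Rightarrow> real) \<Rightarrow> 'g \<Rightarrow> real" where
  "ravg n a f = (\<lambda>x. (\<Sum>i<n. f (x \<otimes> a i)) / n)"

text \<open>Whole operators are generated, not single averaged functions, because one and the same
  average has to act on several functions and to be moved past averages from the other side.\<close>

inductive lop :: "(('g \<Rightarrow> real) \<Rightarrow> 'g \<Rightarrow> real) \<Rightarrow> bool" where
  id: "lop (\<lambda>f. f)"
| step: "lop A \<Longrightarrow> n > 0 \<Longrightarrow> (\<And>i. i < n \<Longrightarrow> a i \<in> carrier G) \<Longrightarrow> lop (\<lambda>f. lavg n a (A f))"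

inductive rop :: "(('g \<Rightarrow> real) \<Rightarrow> 'g \<Rightarrow> real) \<Rightarrow> bool" where
  id: "rop (\<lambda>f. f)"
| step: "rop A \<Longrightarrow> n > 0 \<Longrightarrow> (\<And>i. i < n \<Longrightarrow> a i \<in> carrier G) \<Longrightarrow> rop (\<lambda>f. ravg n a (A f))"

lemma mean_bounds:
  fixes h :: "nat \<Rightarrow> real"
  assumes "n > 0" "\<And>i. i < n \<Longrightarrow> l \<le> h i" "\<And>i. i < n \<Longrightarrow> h i \<le> u"
  shows "l \<le> (\<Sum>i<n. h i) / n" "(\<Sum>i<n. h i) / n \<le> u"
proof -
  have "(\<Sum>i<n. l) \<le> (\<Sum>i<n. h i)" "(\<Sum>i<n. h i) \<le> (\<Sum>i<n. u)"
    by (rule sum_mono; simp add: assms)+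
  then show "l \<le> (\<Sum>i<n. h i) / n" "(\<Sum>i<n. h i) / n \<le> u"
    using assms(1) by (auto simp: field_simps)
qed

lemma lop_bounds:
  assumes "lop A" "\<And>x. x \<in> carrier G \<Longrightarrow> l \<le> f x \<and> f x \<le> u" "x \<in> carrier G"
  shows "l \<le> A f x \<and> A f x \<le> u"
  using assms(1,3)
proof (induction arbitrary: x)
  case (step A n a)
  have "l \<le> A f (a i \<otimes> x) \<and> A f (a i \<otimes> x) \<le> u" if "i < n" for i
    using step that by auto
  then show ?case unfolding lavg_def using mean_bounds[OF step(2)] by (metis (no_types, lifting))
qed (use assms in auto)

lemma rop_bounds:
  assumes "rop A" "\<And>x. x \<in> carrier G \<Longrightarrow> l \<le> f x \<and> f x \<le> u" "x \<in> carrier G"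
  shows "l \<le> A f x \<and> A f x \<le> u"
  using assms(1,3)
proof (induction arbitrary: x)
  case (step A n a)
  have "l \<le> A f (x \<otimes> a i) \<and> A f (x \<otimes> a i) \<le> u" if "i < n" for i
    using step that by auto
  then show ?case unfolding ravg_def using mean_bounds[OF step(2)] by (metis (no_types, lifting))
qed (use assms in auto)

lemma lop_comp: "lop A \<Longrightarrow> lop B \<Longrightarrow> lop (\<lambda>f. A (B f))"
  by (induction rule: lop.induct) (auto intro: lop.step)

lemma lop_translate: "a \<in> carrier G \<Longrightarrow> lop (\<lambda>f x. f (a \<otimes> x))"
  using lop.step[OF lop.id, of 1 "\<lambda>_. a"] by (simp add: lavg_def)

lemma lop_linear:
  assumes "lop A"
  shows "A (\<lambda>x. c * f x + d * g x) = (\<lambda>x. c * A f x + d * A g x)"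
  using assms
  by (induction rule: lop.induct)
    (auto simp: lavg_def sum.distrib sum_distrib_left add_divide_distrib)

lemma rop_linear:
  assumes "rop A"
  shows "A (\<lambda>x. c * f x + d * g x) = (\<lambda>x. c * A f x + d * A g x)"
  using assms
  by (induction rule: rop.induct)
    (auto simp: ravg_def sum.distrib sum_distrib_left add_divide_distrib)

text \<open>Left and right translations commute by associativity, which is available on the carrier
  only; hence the pointwise form.\<close>

lemma lavg_rop_commute:
  assumes "rop B" "n > 0" "\<And>i. i < n \<Longrightarrow> a i \<in> carrier G" "x \<in> carrier G"
  shows "B (lavg n a f) x = lavg n a (B f) x"
  using assms(1,4)
proof (induction arbitrary: x)
  case (step B m b)
  have "ravg m b (B (lavg n a f)) x = (\<Sum>j<m. \<Sum>i<n. B f (a i \<otimes> (x \<otimes> b j)) / n) / m"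
    using step by (auto simp: ravg_def lavg_def sum_divide_distrib)
  also have "\<dots> = (\<Sum>i<n. \<Sum>j<m. B f (a i \<otimes> x \<otimes> b j) / m) / n"
    using step assms unfolding sum_divide_distrib
    by (subst sum.swap) (auto intro!: sum.cong simp: m_assoc)
  finally show ?case by (simp add: ravg_def lavg_def sum_divide_distrib)
qed simp

lemma lop_rop_commute:
  assumes "lop A" "rop B" "x \<in> carrier G"
  shows "A (B f) x = B (A f) x"
  using assms(1,3)
proof (induction arbitrary: x)
  case (step A n a)
  have "lavg n a (A (B f)) x = lavg n a (B (A f)) x"
    using step by (simp add: lavg_def)
  also have "\<dots> = B (lavg n a (A f)) x"
    using lavg_rop_commute[OF assms(2)] step by simp
  finally show ?case .
qed simp

lemma continuous_map_lavg:
  assumes "n > 0" "\<And>i. i < n \<Longrightarrow> a i \<in> carrier G" "continuous_map T euclideanreal f"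
  shows "continuous_map T euclideanreal (lavg n a f)"
  unfolding lavg_def using assms
  by (intro continuous_intros continuous_map_sum continuous_map_translate continuous_map_real_divide)
     auto

lemma continuous_map_lop:
  "lop A \<Longrightarrow> continuous_map T euclideanreal f \<Longrightarrow> continuous_map T euclideanreal (A f)"
  by (induction rule: lop.induct) (auto intro: continuous_map_lavg)

text \<open>Reversing the multiplication exchanges left and right averages, so that the oscillation
  estimate has to be carried out on one side only.\<close>

lemma topological_group_opposite:
  "topological_group \<lparr>carrier = carrier G, mult = (\<lambda>x y. y \<otimes> x), one = \<one>\<rparr> T" (is "topological_group ?H T")
  and m_inv_opposite: "x \<in> carrier G \<Longrightarrow> inv\<^bsub>\<lparr>carrier = carrier G, mult = (\<lambda>x y. y \<otimes> x), one = \<one>\<rparr>\<^esub> x = inv x"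
proof -
  have gr: "group ?H"
    by (rule groupI) (auto simp: m_assoc intro: r_inv r_inv_ex)
  have inv_eq: "inv\<^bsub>?H\<^esub> x = inv x" if "x \<in> carrier G" for x
    using that by (intro group.inv_equality[OF gr]) auto
  then show "x \<in> carrier G \<Longrightarrow> inv\<^bsub>?H\<^esub> x = inv x" .
  have "continuous_map T T (\<lambda>x. inv\<^bsub>?H\<^esub> x)"
    by (rule continuous_map_eq[OF continuous_inv]) (simp add: inv_eq topspace_eq)
  moreover have "continuous_map (prod_topology T T) T (\<lambda>(x, y). y \<otimes> x)"
    using continuous_map_mult[OF continuous_map_snd[of T T] continuous_map_fst[of T T]]
    by (simp add: case_prod_beta')
  ultimately show "topological_group ?H T"
    using gr topspace_eq by (intro topological_group.intro topological_group_axioms.intro) auto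
qed

lemma rop_eq_opposite_lop:
  "rop = topological_group.lop \<lparr>carrier = carrier G, mult = (\<lambda>x y. y \<otimes> x), one = \<one>\<rparr>"
    (is "_ = topological_group.lop ?H")
proof -
  interpret op: topological_group ?H T by (rule topological_group_opposite)
  have e: "op.lavg = ravg" by (auto simp: fun_eq_iff ravg_def op.lavg_def)
  have 1: "op.lop A" if "rop A" for A
    using that
  proof (induction rule: rop.induct)
    case (step A n a)
    then show ?case using op.lop.step[of A n a] by (simp add: e)
  qed (rule op.lop.id)
  have 2: "rop A" if "op.lop A" for A
    using that
  proof (induction rule: op.lop.induct)
    case (step A n a)
    then show ?case using rop.step[of A n a] by (simp add: e)
  qed (rule rop.id)
  show ?thesis using 1 2 by blast
qed

end

context compact_group
begin

lemma compact_group_opposite: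
  "compact_group \<lparr>carrier = carrier G, mult = (\<lambda>x y. y \<otimes> x), one = \<one>\<rparr> T"
  using topological_group_opposite compact Hausdorff
  by (intro compact_group.intro compact_group_axioms.intro)

lemma unif_cont_right:
  fixes f :: "'a \<Rightarrow> real"
  assumes f: "continuous_map T euclideanreal f" and e: "e > 0"
  obtains V where "openin T V" "\<one> \<in> V" "\<And>x v. x \<in> carrier G \<Longrightarrow> v \<in> V \<Longrightarrow> \<bar>f (x \<otimes> v) - f x\<bar> < e"
proof -
  have "continuous_map (prod_topology T T) euclideanreal (\<lambda>(x, y). f (x \<otimes> y))"
    using continuous_map_compose[OF continuous_mult f] by (simp add: o_def case_prod_beta')
  then obtain V where "openin T V" "\<one> \<in> V"
    "\<And>x v. x \<in> topspace T \<Longrightarrow> v \<in> V \<Longrightarrow> \<bar>f (x \<otimes> v) - f (x \<otimes> \<one>)\<bar> < e"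
    using continuous_map_near_fixed_slice[OF compact, of T "\<lambda>(x, y). f (x \<otimes> y)" \<one> e] e topspace_eq
    by auto
  then show thesis using that topspace_eq by auto
qed

text \<open>By compactness finitely many of the sets of those \<open>x\<close> with
  \<open>b \<otimes> x \<in> V\<close> cover the group. The indexing with \<open>n > 0\<close> is
  what an average needs.\<close>

lemma finite_translate_cover:
  assumes V: "openin T V" "V \<noteq> {}"
  obtains n and a :: "nat \<Rightarrow> 'a" where "n > 0" "\<And>i. i < n \<Longrightarrow> a i \<in> carrier G"
    "\<And>x. x \<in> carrier G \<Longrightarrow> \<exists>i<n. a i \<otimes> x \<in> V"
proof -
  have VG: "V \<subseteq> carrier G" using V openin_subset topspace_eq by fastforce
  obtain v where v: "v \<in> V" using V by auto
  define U where "U b = {x \<in> topspace T. b \<otimes> x \<in> V}" for b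
  have op: "openin T (U b)" if "b \<in> carrier G" for b
    unfolding U_def using that V
    by (intro openin_continuous_map_preimage[where Y=T]) (auto intro!: continuous_map_translate(1)[where f="\<lambda>x. x"])
  have cov: "topspace T \<subseteq> \<Union>(U ` carrier G)"
  proof
    fix x assume x: "x \<in> topspace T"
    \<comment> \<open>Translation by \<open>v \<otimes> inv x\<close> carries \<open>x\<close> to
      the chosen point \<open>v\<close> of \<open>V\<close>.\<close>
    then have "x \<in> U (v \<otimes> inv x)" using v VG by (auto simp: U_def topspace_eq m_assoc subset_iff)
    then show "x \<in> \<Union>(U ` carrier G)" using x v VG by (auto simp: topspace_eq)
  qed
  have "\<exists>\<F>. finite \<F> \<and> \<F> \<subseteq> U ` carrier G \<and> topspace T \<subseteq> \<Union>\<F>"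
    using compact op cov unfolding compact_space_alt by (metis (no_types, lifting) imageE)
  then obtain B where B: "finite B" "B \<subseteq> carrier G" "topspace T \<subseteq> \<Union>(U ` B)"
    by (metis finite_subset_image)
  have "B \<noteq> {}" using B(3) topspace_eq one_closed by auto
  obtain a where a: "bij_betw a {..<card B} B"
    using ex_bij_betw_nat_finite[OF B(1)] atLeast0LessThan by metis
  show thesis
  proof (rule that[of "card B" a])
    show "card B > 0" using B \<open>B \<noteq> {}\<close> by (simp add: card_gt_0_iff)
    show "a i \<in> carrier G" if "i < card B" for i using a B that by (auto simp: bij_betw_def)
    fix x assume "x \<in> carrier G"
    then obtain b where b: "b \<in> B" "b \<otimes> x \<in> V" using B(3) by (auto simp: topspace_eq U_def)
    then obtain i where "i < card B" "b = a i" using a by (auto simp: bij_betw_def)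
    then show "\<exists>i<card B. a i \<otimes> x \<in> V" using b by blast
  qed
qed

text \<open>If \<open>h\<close> takes a value below the middle of its range, it stays low on a translate of a fixed
  neighbourhood of \<open>\<one>\<close>; averaging over finitely many translates covering the group then lowers
  the upper bound by a fixed amount, which can be iterated as averaging keeps the modulus of
  continuity.\<close>

lemma lop_osc:
  assumes f: "continuous_map T euclideanreal f" and e: "e > 0"
  shows "\<exists>A. lop A \<and> (\<forall>x\<in>carrier G. \<forall>y\<in>carrier G. \<bar>A f x - A f y\<bar> \<le> e)"
proof -
  obtain V where V: "openin T V" "\<one> \<in> V"
    and Vf: "\<And>x v. x \<in> carrier G \<Longrightarrow> v \<in> V \<Longrightarrow> \<bar>f (x \<otimes> v) - f x\<bar> < e/2"
    using unif_cont_right[OF f half_gt_zero[OF e]] by blast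
  have VG: "V \<subseteq> carrier G" using V openin_subset topspace_eq by fastforce
  obtain n :: nat and a where n: "n > 0" and a: "\<And>i. i < n \<Longrightarrow> a i \<in> carrier G"
    and cov: "\<And>x. x \<in> carrier G \<Longrightarrow> \<exists>i<n. a i \<otimes> x \<in> V"
    using finite_translate_cover[OF V(1)] V(2) by blast
  \<comment> \<open>If one of the \<open>n\<close> averaged values is at most \<open>u - e/2\<close>
    and the others are at most \<open>u\<close>, then the average is at most
    \<open>u - d\<close>.\<close>
  define d where "d = e / (2 * n)"
  have d: "d > 0" using e n by (simp add: d_def)
  \<comment> \<open>The modulus is measured by right translations, so left averages inherit it with
    the same \<open>V\<close>.\<close>
  define mc where "mc h \<longleftrightarrow> (\<forall>x\<in>carrier G. \<forall>v\<in>V. \<bar>h (x \<otimes> v) - h x\<bar> \<le> e/2)" for h :: "'a \<Rightarrow> real"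
  have mc_avg: "mc (lavg n b h)" if "mc h" "\<And>i. i < n \<Longrightarrow> b i \<in> carrier G" for h b
    unfolding mc_def
  proof (intro ballI)
    fix x v assume xv: "x \<in> carrier G" "v \<in> V"
    have "\<bar>(\<Sum>i<n. h (b i \<otimes> (x \<otimes> v)) - h (b i \<otimes> x))\<bar> \<le> (\<Sum>i<n. e/2)"
    proof (rule order.trans[OF sum_abs sum_mono])
      fix i assume "i \<in> {..<n}"
      then have "b i \<otimes> (x \<otimes> v) = (b i \<otimes> x) \<otimes> v" "b i \<otimes> x \<in> carrier G" using xv VG that by (auto simp: m_assoc)
      then show "\<bar>h (b i \<otimes> (x \<otimes> v)) - h (b i \<otimes> x)\<bar> \<le> e/2" using that(1) xv by (simp add: mc_def)
    qed
    then show "\<bar>lavg n b h (x \<otimes> v) - lavg n b h x\<bar> \<le> e/2"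
      using n by (simp add: lavg_def sum_subtractf diff_divide_distrib[symmetric] abs_divide field_simps)
  qed
  \<comment> \<open>Induction on the number \<open>j\<close> of rounds still allowed: each round
    lowers the upper bound by \<open>d\<close>, and for \<open>j = 0\<close> the range has length at
    most \<open>e\<close>.\<close>
  have main: "\<exists>A. lop A \<and> (\<forall>x\<in>carrier G. \<forall>y\<in>carrier G. \<bar>A h x - A h y\<bar> \<le> e)"
    if "mc h" "\<And>x. x \<in> carrier G \<Longrightarrow> l \<le> h x \<and> h x \<le> u" "u - l \<le> e + j * d" for h l u and j :: nat
    using that
  proof (induction j arbitrary: h u)
    case 0
    have "\<bar>h x - h y\<bar> \<le> e" if "x \<in> carrier G" "y \<in> carrier G" for x y
      using 0(2)[OF that(1)] 0(2)[OF that(2)] 0(3) by linarith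
    then show ?case using lop.id by blast
  next
    case (Suc j)
    show ?case
    \<comment> \<open>Without such a point all values lie between \<open>u - e\<close> and
      \<open>u\<close>, and no further averaging is needed.\<close>
    proof (cases "\<exists>x0\<in>carrier G. h x0 \<le> u - e")
      case False
      have "\<bar>h x - h y\<bar> \<le> e" if "x \<in> carrier G" "y \<in> carrier G" for x y
      proof -
        have "h x > u - e" "h y > u - e" using False that by (auto simp: not_le)
        then show ?thesis using Suc.prems(2)[OF that(1)] Suc.prems(2)[OF that(2)] by linarith
      qed
      then show ?thesis using lop.id by blast
    next
      case True
      then obtain x0 where x0: "x0 \<in> carrier G" "h x0 \<le> u - e" by auto
      \<comment> \<open>Some \<open>a i\<close> brings \<open>x\<close> into \<open>V\<close>; the
        factor \<open>x0\<close> then brings it into \<open>x0 \<otimes> V\<close>, where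
        \<open>h\<close> is at most \<open>u - e/2\<close>.\<close>
      define b where "b i = x0 \<otimes> a i" for i
      have b: "b i \<in> carrier G" if "i < n" for i using that a x0 by (auto simp: b_def)
      have bnd: "l \<le> lavg n b h x \<and> lavg n b h x \<le> u - d" if x: "x \<in> carrier G" for x
      proof
        show "l \<le> lavg n b h x"
          using lop_bounds[OF lop.step[OF lop.id n b] Suc.prems(2) x] by simp
        obtain i where i: "i < n" "a i \<otimes> x \<in> V" using cov[OF x] by auto
        have bix: "b i \<otimes> x = x0 \<otimes> (a i \<otimes> x)" using i a x x0 by (simp add: b_def m_assoc)
        have "\<bar>h (b i \<otimes> x) - h x0\<bar> \<le> e/2" using Suc.prems(1) i x0 unfolding mc_def bix by blast
        then have hi: "h (b i \<otimes> x) \<le> u - e/2" using x0 by linarith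
        have "(\<Sum>i<n. h (b i \<otimes> x)) = h (b i \<otimes> x) + (\<Sum>i\<in>{..<n}-{i}. h (b i \<otimes> x))"
          using i by (simp add: sum.remove)
        also have "\<dots> \<le> (u - e/2) + (\<Sum>i\<in>{..<n}-{i}. u)"
          using hi b x Suc.prems(2) by (intro add_mono sum_mono) auto
        also have "\<dots> = n * u - e/2"
          using i n by (simp add: of_nat_diff algebra_simps)
        finally have "lavg n b h x \<le> (n * u - e/2) / n"
          unfolding lavg_def by (rule divide_right_mono) simp
        also have "\<dots> = u - d" using n by (simp add: d_def diff_divide_distrib)
        finally show "lavg n b h x \<le> u - d" .
      qed
      have "(u - d) - l \<le> e + j * d" using Suc.prems(3) by (simp add: algebra_simps)
      with Suc.IH[OF mc_avg[OF Suc.prems(1) b] bnd]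
      obtain A where "lop A" "\<forall>x\<in>carrier G. \<forall>y\<in>carrier G. \<bar>A (lavg n b h) x - A (lavg n b h) y\<bar> \<le> e"
        by auto
      moreover have "lop (\<lambda>f. A (lavg n b f))"
        using lop_comp[OF \<open>lop A\<close> lop.step[OF lop.id n b]] by simp
      ultimately show ?thesis by blast
    qed
  qed
  obtain B where B: "B > 0" "\<And>x. x \<in> carrier G \<Longrightarrow> \<bar>f x\<bar> \<le> B"
    using continuous_map_real_bounded[OF compact f] topspace_eq by metis
  obtain j :: nat where j: "2 * B / d \<le> j" using real_arch_simple by blast
  have "B - (-B) \<le> e + j * d" using j d e by (simp add: field_simps)
  moreover have "mc f" using Vf by (auto simp: mc_def intro: less_imp_le)
  moreover have "-B \<le> f x \<and> f x \<le> B" if "x \<in> carrier G" for x using B(2)[OF that] by auto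
  ultimately show ?thesis using main by blast
qed

lemma rop_osc:
  assumes f: "continuous_map T euclideanreal f" and e: "e > 0"
  shows "\<exists>A. rop A \<and> (\<forall>x\<in>carrier G. \<forall>y\<in>carrier G. \<bar>A f x - A f y\<bar> \<le> e)"
proof -
  interpret op: compact_group "\<lparr>carrier = carrier G, mult = (\<lambda>x y. y \<otimes> x), one = \<one>\<rparr>" T
    by (rule compact_group_opposite)
  show ?thesis using op.lop_osc[OF assms] by (simp add: rop_eq_opposite_lop)
qed

section \<open>The mean and its invariance\<close>

text \<open>An upper mean over left averages. For continuous \<open>f\<close> it is the only
  constant that left averages, and equally right averages, approximate uniformly.\<close>

definition haar :: "('a \<Rightarrow> real) \<Rightarrow> real" where
  "haar f = Inf {u. \<exists>A. lop A \<and> (\<forall>x\<in>carrier G. A f x \<le> u)}"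

text \<open>The common value of \<open>A (B f)\<close> and \<open>B (A f)\<close> at
  \<open>\<one>\<close> is squeezed by the bounds of \<open>B f\<close> as well as by those of
  \<open>A f\<close>. Hence the ranges of a left and a right average are never separated.\<close>

lemma lop_rop_range_meet:
  assumes "lop A" "rop B" and f: "continuous_map T euclideanreal f"
  shows "(\<And>x. x \<in> carrier G \<Longrightarrow> l \<le> B f x) \<Longrightarrow> (\<And>x. x \<in> carrier G \<Longrightarrow> A f x \<le> u) \<Longrightarrow> l \<le> u"
    and "(\<And>x. x \<in> carrier G \<Longrightarrow> l \<le> A f x) \<Longrightarrow> (\<And>x. x \<in> carrier G \<Longrightarrow> B f x \<le> u) \<Longrightarrow> l \<le> u"
proof -
  obtain C where C: "C > 0" "\<And>x. x \<in> carrier G \<Longrightarrow> \<bar>f x\<bar> \<le> C"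
    using continuous_map_real_bounded[OF compact f] topspace_eq by metis
  have fC: "-C \<le> f x \<and> f x \<le> C" if "x \<in> carrier G" for x using C(2)[OF that] by auto
  note AC = lop_bounds[OF assms(1) fC] and BC = rop_bounds[OF assms(2) fC]
  have comm: "A (B f) \<one> = B (A f) \<one>" by (rule lop_rop_commute[OF assms(1,2) one_closed])
  show "l \<le> u" if l: "\<And>x. x \<in> carrier G \<Longrightarrow> l \<le> B f x" and u: "\<And>x. x \<in> carrier G \<Longrightarrow> A f x \<le> u"
  proof -
    have "l \<le> A (B f) \<one>" using lop_bounds[OF assms(1), of l "B f" C \<one>] l BC by auto
    moreover have "B (A f) \<one> \<le> u" using rop_bounds[OF assms(2), of "-C" "A f" u \<one>] u AC by auto
    ultimately show ?thesis using comm by simp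
  qed
  show "l \<le> u" if l: "\<And>x. x \<in> carrier G \<Longrightarrow> l \<le> A f x" and u: "\<And>x. x \<in> carrier G \<Longrightarrow> B f x \<le> u"
  proof -
    have "l \<le> B (A f) \<one>" using rop_bounds[OF assms(2), of l "A f" C \<one>] l AC by auto
    moreover have "A (B f) \<one> \<le> u" using lop_bounds[OF assms(1), of "-C" "B f" u \<one>] u BC by auto
    ultimately show ?thesis using comm by simp
  qed
qed

text \<open>Every member of the set defining \<open>haar f\<close> is at least \<open>l\<close>. For
  the upper bound a left average oscillating by at most \<open>e/2\<close> is used: as its range is
  not separated from that of \<open>B f\<close>, it stays below \<open>u + e\<close>.\<close>

lemma haar_bounds_rop:
  assumes f: "continuous_map T euclideanreal f" and B: "rop B"
    and lu: "\<And>x. x \<in> carrier G \<Longrightarrow> l \<le> B f x \<and> B f x \<le> u"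
  shows "l \<le> haar f \<and> haar f \<le> u"
proof
  let ?S = "{u. \<exists>A. lop A \<and> (\<forall>x\<in>carrier G. A f x \<le> u)}"
  obtain C where C: "C > 0" "\<And>x. x \<in> carrier G \<Longrightarrow> \<bar>f x\<bar> \<le> C"
    using continuous_map_real_bounded[OF compact f] topspace_eq by metis
  have "\<forall>x\<in>carrier G. f x \<le> C" using C(2) by force
  then have ne: "?S \<noteq> {}" using lop.id by blast
  have lb: "l \<le> v" if "v \<in> ?S" for v using that lop_rop_range_meet(1)[OF _ B f] lu by blast
  show "l \<le> haar f" unfolding haar_def by (rule cInf_greatest[OF ne lb])
  show "haar f \<le> u"
  proof (rule field_le_epsilon)
    fix e :: real assume e: "e > 0"
    obtain A where A: "lop A" "\<forall>x\<in>carrier G. \<forall>y\<in>carrier G. \<bar>A f x - A f y\<bar> \<le> e/2"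
      using lop_osc[OF f, of "e/2"] e by auto
    have Ax: "A f \<one> - e/2 \<le> A f x \<and> A f x \<le> A f \<one> + e/2" if "x \<in> carrier G" for x
      using A(2) that one_closed unfolding abs_diff_le_iff by blast
    have "A f \<one> - e/2 \<le> u"
      using lu Ax by (intro lop_rop_range_meet(2)[OF A(1) B f, of "A f \<one> - e/2" u]) blast+
    then have "A f x \<le> u + e" if "x \<in> carrier G" for x using Ax[OF that] by (simp add: field_simps)
    then have "u + e \<in> ?S" using A(1) by auto
    moreover have "bdd_below ?S" using lb by (auto simp: bdd_below_def)
    ultimately show "haar f \<le> u + e" unfolding haar_def by (rule cInf_lower)
  qed
qed

lemma rop_near_haar:
  assumes f: "continuous_map T euclideanreal f" and e: "e > 0"
  obtains B where "rop B" "\<And>x. x \<in> carrier G \<Longrightarrow> \<bar>B f x - haar f\<bar> \<le> e"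
proof -
  obtain B where B: "rop B" "\<forall>x\<in>carrier G. \<forall>y\<in>carrier G. \<bar>B f x - B f y\<bar> \<le> e/2"
    using rop_osc[OF f, of "e/2"] e by auto
  have Bx: "B f \<one> - e/2 \<le> B f x \<and> B f x \<le> B f \<one> + e/2" if "x \<in> carrier G" for x
    using B(2) that one_closed unfolding abs_diff_le_iff by blast
  then have "B f \<one> - e/2 \<le> haar f \<and> haar f \<le> B f \<one> + e/2"
    by (rule haar_bounds_rop[OF f B(1)])
  then have "\<bar>B f x - haar f\<bar> \<le> e" if "x \<in> carrier G" for x using Bx[OF that] by linarith
  then show thesis using that B(1) by blast
qed

text \<open>The definition looks at left averages from above only. A right average close to
  \<open>haar f\<close> restores the symmetry, since its range cannot be separated from that of
  \<open>A f\<close>.\<close>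

lemma haar_bounds_lop:
  assumes f: "continuous_map T euclideanreal f" and A: "lop A"
    and lu: "\<And>x. x \<in> carrier G \<Longrightarrow> l \<le> A f x \<and> A f x \<le> u"
  shows "l \<le> haar f \<and> haar f \<le> u"
proof -
  have "l \<le> haar f + e \<and> haar f \<le> u + e" if e: "e > 0" for e
  proof -
    obtain B where B: "rop B" "\<And>x. x \<in> carrier G \<Longrightarrow> \<bar>B f x - haar f\<bar> \<le> e"
      using rop_near_haar[OF f e] by blast
    have Bx: "haar f - e \<le> B f x" "B f x \<le> haar f + e" if "x \<in> carrier G" for x
      using B(2)[OF that] by auto
    have "l \<le> haar f + e"
      using lu Bx by (intro lop_rop_range_meet(2)[OF A B(1) f, of l "haar f + e"]) auto
    moreover have "haar f - e \<le> u"
      using lu Bx by (intro lop_rop_range_meet(1)[OF A B(1) f, of "haar f - e" u]) auto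
    ultimately show ?thesis by simp
  qed
  then show ?thesis by (meson field_le_epsilon)
qed

lemma lop_near_haar:
  assumes f: "continuous_map T euclideanreal f" and e: "e > 0"
  obtains A where "lop A" "\<And>x. x \<in> carrier G \<Longrightarrow> \<bar>A f x - haar f\<bar> \<le> e"
proof -
  obtain B where B: "lop B" "\<forall>x\<in>carrier G. \<forall>y\<in>carrier G. \<bar>B f x - B f y\<bar> \<le> e/2"
    using lop_osc[OF f, of "e/2"] e by auto
  have Bx: "B f \<one> - e/2 \<le> B f x \<and> B f x \<le> B f \<one> + e/2" if "x \<in> carrier G" for x
    using B(2) that one_closed unfolding abs_diff_le_iff by blast
  then have "B f \<one> - e/2 \<le> haar f \<and> haar f \<le> B f \<one> + e/2"
    by (rule haar_bounds_lop[OF f B(1)])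
  then have "\<bar>B f x - haar f\<bar> \<le> e" if "x \<in> carrier G" for x using Bx[OF that] by linarith
  then show thesis using that B(1) by blast
qed

lemma haar_bounds:
  assumes f: "continuous_map T euclideanreal f"
    and lu: "\<And>x. x \<in> carrier G \<Longrightarrow> l \<le> f x \<and> f x \<le> u"
  shows "l \<le> haar f \<and> haar f \<le> u"
  by (rule haar_bounds_lop[OF f lop.id lu])

lemma haar_const: "haar (\<lambda>x. c) = c"
  using haar_bounds[of "\<lambda>x. c" c c] by auto

text \<open>A left average flattens \<open>f\<close> and a right one flattens \<open>g\<close>. As
  they commute, their composition flattens both summands at once; two averages from the same side
  need not commute.\<close>

lemma haar_linear:
  assumes f: "continuous_map T euclideanreal f" and g: "continuous_map T euclideanreal g"
  shows "haar (\<lambda>x. c * f x + d * g x) = c * haar f + d * haar g" (is "?L = ?R")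
proof -
  let ?h = "\<lambda>x. c * f x + d * g x"
  have h: "continuous_map T euclideanreal ?h" using f g by (intro continuous_intros)
  have "\<bar>?L - ?R\<bar> \<le> 0 + e'" if e': "e' > 0" for e'
  proof -
    \<comment> \<open>With the extra \<open>1\<close> the divisor is positive even for
      \<open>c = d = 0\<close>.\<close>
    define e where "e = e' / (\<bar>c\<bar> + \<bar>d\<bar> + 1)"
    have "e > 0" using e' unfolding e_def by (intro divide_pos_pos) auto
    obtain A where A: "lop A" "\<And>x. x \<in> carrier G \<Longrightarrow> \<bar>A f x - haar f\<bar> \<le> e"
      using lop_near_haar[OF f \<open>e > 0\<close>] by blast
    obtain B where B: "rop B" "\<And>x. x \<in> carrier G \<Longrightarrow> \<bar>B g x - haar g\<bar> \<le> e"
      using rop_near_haar[OF g \<open>e > 0\<close>] by blast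
    define k where "k = c * haar f + d * haar g"
    have Af: "haar f - e \<le> A f x \<and> A f x \<le> haar f + e" if "x \<in> carrier G" for x
      using A(2)[OF that] by linarith
    have Bg: "haar g - e \<le> B g x \<and> B g x \<le> haar g + e" if "x \<in> carrier G" for x
      using B(2)[OF that] by linarith
    have bnd: "\<bar>B (A ?h) x - k\<bar> \<le> e'" if x: "x \<in> carrier G" for x
    proof -
      have "B (A ?h) x = c * B (A f) x + d * B (A g) x"
        using lop_linear[OF A(1)] rop_linear[OF B(1)] by simp
      moreover have "B (A g) x = A (B g) x" using lop_rop_commute[OF A(1) B(1) x] by simp
      ultimately have eq: "B (A ?h) x - k = c * (B (A f) x - haar f) + d * (A (B g) x - haar g)"
        by (simp add: k_def algebra_simps)
      have "\<bar>B (A f) x - haar f\<bar> \<le> e"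
        unfolding abs_diff_le_iff by (rule rop_bounds[OF B(1) _ x]) (rule Af)
      moreover have "\<bar>A (B g) x - haar g\<bar> \<le> e"
        unfolding abs_diff_le_iff by (rule lop_bounds[OF A(1) _ x]) (rule Bg)
      ultimately have "\<bar>c * (B (A f) x - haar f)\<bar> \<le> \<bar>c\<bar> * e" "\<bar>d * (A (B g) x - haar g)\<bar> \<le> \<bar>d\<bar> * e"
        by (auto simp: abs_mult intro!: mult_left_mono)
      then have "\<bar>B (A ?h) x - k\<bar> \<le> \<bar>c\<bar> * e + \<bar>d\<bar> * e"
        unfolding eq by linarith
      also have "\<dots> \<le> (\<bar>c\<bar> + \<bar>d\<bar> + 1) * e" using \<open>e > 0\<close> by (simp add: algebra_simps)
      also have "\<dots> = e'" unfolding e_def by simp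
      finally show ?thesis .
    qed
    have Ah: "continuous_map T euclideanreal (A ?h)" by (rule continuous_map_lop[OF A(1) h])
    have "k - e' \<le> haar (A ?h) \<and> haar (A ?h) \<le> k + e'"
      by (rule haar_bounds_rop[OF Ah B(1)]) (rule bnd[unfolded abs_diff_le_iff])
    \<comment> \<open>Averaging on the left preserves the mean, because a left average of
      \<open>A ?h\<close> is also one of \<open>?h\<close>.\<close>
    moreover have "haar (A ?h) = haar ?h"
    proof -
      have "\<bar>haar (A ?h) - haar ?h\<bar> \<le> 0 + \<delta>" if "\<delta> > 0" for \<delta>
      proof -
        obtain A' where A': "lop A'" "\<And>x. x \<in> carrier G \<Longrightarrow> \<bar>A' (A ?h) x - haar (A ?h)\<bar> \<le> \<delta>"
          using lop_near_haar[OF Ah \<open>\<delta> > 0\<close>] by blast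
        have "haar (A ?h) - \<delta> \<le> haar ?h \<and> haar ?h \<le> haar (A ?h) + \<delta>"
          by (rule haar_bounds_lop[OF h lop_comp[OF A'(1) A(1)]]) (rule A'(2)[unfolded abs_diff_le_iff])
        then show ?thesis using that by linarith
      qed
      then have "\<bar>haar (A ?h) - haar ?h\<bar> \<le> 0" by (rule field_le_epsilon)
      then show ?thesis by simp
    qed
    ultimately show ?thesis by (simp add: k_def abs_le_iff)
  qed
  then have "\<bar>?L - ?R\<bar> \<le> 0" by (rule field_le_epsilon)
  then show ?thesis by simp
qed

lemma haar_add:
  assumes "continuous_map T euclideanreal f" "continuous_map T euclideanreal g"
  shows "haar (\<lambda>x. f x + g x) = haar f + haar g"
  using haar_linear[OF assms, of 1 1] by simp

lemma haar_diff:
  assumes "continuous_map T euclideanreal f" "continuous_map T euclideanreal g"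
  shows "haar (\<lambda>x. f x - g x) = haar f - haar g"
  using haar_linear[OF assms, of 1 "-1"] by simp

lemma haar_cmult:
  assumes "continuous_map T euclideanreal f"
  shows "haar (\<lambda>x. c * f x) = c * haar f"
  using haar_linear[OF assms assms, of c 0] by simp

lemma haar_sum:
  assumes "finite I" "\<And>i. i \<in> I \<Longrightarrow> continuous_map T euclideanreal (f i)"
  shows "haar (\<lambda>x. \<Sum>i\<in>I. f i x) = (\<Sum>i\<in>I. haar (f i))"
  using assms
proof (induction I)
  case (insert i I)
  have "haar (\<lambda>x. f i x + (\<Sum>i\<in>I. f i x)) = haar (f i) + haar (\<lambda>x. \<Sum>i\<in>I. f i x)"
    using insert by (intro haar_add continuous_map_sum) auto
  then show ?case using insert by simp
qed (simp add: haar_const)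

lemma haar_mono:
  assumes "continuous_map T euclideanreal f" "continuous_map T euclideanreal g"
    "\<And>x. x \<in> carrier G \<Longrightarrow> f x \<le> g x"
  shows "haar f \<le> haar g"
proof -
  have c: "continuous_map T euclideanreal (\<lambda>x. g x - f x)" using assms by (intro continuous_intros)
  obtain C where C: "\<And>x. x \<in> carrier G \<Longrightarrow> \<bar>g x - f x\<bar> \<le> C"
    using continuous_map_real_bounded[OF compact c] topspace_eq by metis
  have "0 \<le> haar (\<lambda>x. g x - f x)"
    using haar_bounds[OF c, of 0 C] assms(3) C by fastforce
  then show ?thesis using haar_diff[OF assms(2,1)] by simp
qed

lemma haar_cong:
  assumes "continuous_map T euclideanreal f" "\<And>x. x \<in> carrier G \<Longrightarrow> f x = g x"
  shows "haar f = haar g"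
proof -
  have "continuous_map T euclideanreal g"
    using assms continuous_map_eq topspace_eq by metis
  then show ?thesis using assms haar_mono[of f g] haar_mono[of g f] by (simp add: antisym)
qed

lemma haar_abs_le:
  assumes "continuous_map T euclideanreal f" "\<And>x. x \<in> carrier G \<Longrightarrow> \<bar>f x\<bar> \<le> B"
  shows "\<bar>haar f\<bar> \<le> B"
  using haar_bounds[OF assms(1), of "-B" B] assms(2) by (simp add: abs_le_iff) (metis add.inverse_inverse neg_le_iff_le)

text \<open>A translation is a left average with one term, so a nearly constant left average of the
  translate is one of \<open>f\<close> as well.\<close>

lemma haar_left:
  assumes f: "continuous_map T euclideanreal f" and a: "a \<in> carrier G"
  shows "haar (\<lambda>x. f (a \<otimes> x)) = haar f"
proof -
  let ?g = "\<lambda>x. f (a \<otimes> x)"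
  have g: "continuous_map T euclideanreal ?g" by (rule continuous_map_translate[OF f a])
  have "\<bar>haar ?g - haar f\<bar> \<le> 0 + e" if e: "e > 0" for e
  proof -
    obtain A where A: "lop A" "\<And>x. x \<in> carrier G \<Longrightarrow> \<bar>A ?g x - haar ?g\<bar> \<le> e"
      using lop_near_haar[OF g e] by blast
    have "haar ?g - e \<le> haar f \<and> haar f \<le> haar ?g + e"
      by (rule haar_bounds_lop[OF f lop_comp[OF A(1) lop_translate[OF a]]]) (rule A(2)[unfolded abs_diff_le_iff])
    then show ?thesis by linarith
  qed
  then have "\<bar>haar ?g - haar f\<bar> \<le> 0" by (rule field_le_epsilon)
  then show ?thesis by simp
qed

text \<open>Finitely many translations bring every point into the set where \<open>f\<close> exceeds
  half of \<open>f x0\<close>, so the corresponding average is at least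
  \<open>f x0 / (2 * n)\<close> everywhere.\<close>

lemma haar_pos:
  assumes f: "continuous_map T euclideanreal f" and nn: "\<And>x. x \<in> carrier G \<Longrightarrow> f x \<ge> 0"
    and x0: "x0 \<in> carrier G" "f x0 > 0"
  shows "haar f > 0"
proof -
  define V where "V = {x \<in> topspace T. f x \<in> {f x0 / 2<..}}"
  have "openin T V" unfolding V_def by (rule openin_continuous_map_preimage[OF f]) auto
  moreover have "x0 \<in> V" using x0 by (auto simp: V_def topspace_eq)
  ultimately obtain n :: nat and a where n: "n > 0" and a: "\<And>i. i < n \<Longrightarrow> a i \<in> carrier G"
    and cov: "\<And>x. x \<in> carrier G \<Longrightarrow> \<exists>i<n. a i \<otimes> x \<in> V"
    using finite_translate_cover[of V] by blast
  define A where "A = lavg n a"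
  have A: "lop A" using lop.step[OF lop.id n a] by (simp add: A_def)
  obtain C where C: "\<And>x. x \<in> carrier G \<Longrightarrow> \<bar>f x\<bar> \<le> C"
    using continuous_map_real_bounded[OF compact f] topspace_eq by metis
  have "f x0 / (2 * n) \<le> A f x \<and> A f x \<le> C" if x: "x \<in> carrier G" for x
  proof
    show "A f x \<le> C" using lop_bounds[OF A _ x, of 0 f C] nn C by (metis abs_le_iff)
    obtain i where i: "i < n" "a i \<otimes> x \<in> V" using cov[OF x] by auto
    have "f x0 / 2 \<le> f (a i \<otimes> x)" using i by (auto simp: V_def)
    also have "\<dots> \<le> (\<Sum>i<n. f (a i \<otimes> x))" using i a x nn by (intro member_le_sum) auto
    finally show "f x0 / (2 * n) \<le> A f x" using n by (simp add: A_def lavg_def field_simps)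
  qed
  then have "f x0 / (2 * n) \<le> haar f" using haar_bounds_lop[OF f A] by blast
  moreover have "f x0 / (2 * n) > 0" using x0 n by simp
  ultimately show ?thesis by linarith
qed

text \<open>\<open>L\<close> takes the same value on \<open>f\<close> and on its left averages, and
  some of these are uniformly close to the constant \<open>haar f\<close>. This is how both orders
  of iterated integration are identified.\<close>

lemma haar_unique:
  assumes mono: "\<And>f l u. continuous_map T euclideanreal f \<Longrightarrow>
      (\<And>x. x \<in> carrier G \<Longrightarrow> l \<le> f x \<and> f x \<le> u) \<Longrightarrow> l \<le> L f \<and> L f \<le> u"
    and add: "\<And>f g. continuous_map T euclideanreal f \<Longrightarrow> continuous_map T euclideanreal g \<Longrightarrow>
      L (\<lambda>x. f x + g x) = L f + L g"
    and cmult: "\<And>f c. continuous_map T euclideanreal f \<Longrightarrow> L (\<lambda>x. c * f x) = c * L f"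
    and left: "\<And>f a. continuous_map T euclideanreal f \<Longrightarrow> a \<in> carrier G \<Longrightarrow> L (\<lambda>x. f (a \<otimes> x)) = L f"
    and f: "continuous_map T euclideanreal f"
  shows "L f = haar f"
proof -
  have L0: "L (\<lambda>x. 0) = 0" using mono[of "\<lambda>x. 0" 0 0] by auto
  have Lsum: "L (\<lambda>x. \<Sum>i<n. h i x) = (\<Sum>i<n. L (h i))"
    if "\<And>i. i < n \<Longrightarrow> continuous_map T euclideanreal (h i)" for n :: nat and h
    using that
  proof (induction n)
    case (Suc n)
    have "L (\<lambda>x. (\<Sum>i<n. h i x) + h n x) = L (\<lambda>x. \<Sum>i<n. h i x) + L (h n)"
      using Suc.prems by (intro add continuous_map_sum) auto
    then show ?case using Suc by simp
  qed (simp add: L0)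
  have LA: "L (A f) = L f" if "lop A" for A
    using that
  proof (induction rule: lop.induct)
    case (step A n a)
    have Af: "continuous_map T euclideanreal (A f)" by (rule continuous_map_lop[OF step(1) f])
    have "L (lavg n a (A f)) = L (\<lambda>x. (1 / n) * (\<Sum>i<n. A f (a i \<otimes> x)))" by (simp add: lavg_def)
    also have "\<dots> = (1 / n) * (\<Sum>i<n. L (\<lambda>x. A f (a i \<otimes> x)))"
      using step Af by (subst cmult) (auto intro!: continuous_map_sum continuous_map_translate Lsum)
    also have "\<dots> = L f" using step Af by (simp add: left)
    finally show ?case .
  qed simp
  have "\<bar>L f - haar f\<bar> \<le> 0 + e" if e: "e > 0" for e
  proof -
    obtain A where A: "lop A" "\<And>x. x \<in> carrier G \<Longrightarrow> \<bar>A f x - haar f\<bar> \<le> e"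
      using lop_near_haar[OF f e] by blast
    have "haar f - e \<le> L (A f) \<and> L (A f) \<le> haar f + e"
      by (rule mono[OF continuous_map_lop[OF A(1) f]]) (rule A(2)[unfolded abs_diff_le_iff])
    then show ?thesis by (simp add: LA[OF A(1)]) linarith
  qed
  then have "\<bar>L f - haar f\<bar> \<le> 0" by (rule field_le_epsilon)
  then show ?thesis by simp
qed

text \<open>By the tube lemma nearby slices differ uniformly little, and the mean does not increase
  uniform bounds.\<close>

lemma continuous_map_haar_param:
  assumes F: "continuous_map (prod_topology T Y) euclideanreal F"
  shows "continuous_map Y euclideanreal (\<lambda>y. haar (\<lambda>x. F (x, y)))"
    and "y \<in> topspace Y \<Longrightarrow> continuous_map T euclideanreal (\<lambda>x. F (x, y))"
proof -
  show slice: "continuous_map T euclideanreal (\<lambda>x. F (x, y))" if "y \<in> topspace Y" for y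
  proof -
    have "continuous_map T (prod_topology T Y) (\<lambda>x. (x, y))"
      using that by (intro continuous_map_pairedI) auto
    from continuous_map_compose[OF this F] show ?thesis by (simp add: o_def)
  qed
  show "continuous_map Y euclideanreal (\<lambda>y. haar (\<lambda>x. F (x, y)))"
    unfolding continuous_map_eq_topcontinuous_at
  proof
    fix y assume y: "y \<in> topspace Y"
    show "topcontinuous_at Y euclideanreal (\<lambda>y. haar (\<lambda>x. F (x, y))) y"
      unfolding topcontinuous_at_def
    proof (intro conjI allI impI)
      fix V assume "openin euclideanreal V \<and> haar (\<lambda>x. F (x, y)) \<in> V"
      then obtain e where e: "e > 0" "\<And>z. \<bar>z - haar (\<lambda>x. F (x, y))\<bar> < e \<Longrightarrow> z \<in> V"
        by (auto simp: open_real)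
      obtain U where U: "openin Y U" "y \<in> U"
        "\<And>x v. x \<in> topspace T \<Longrightarrow> v \<in> U \<Longrightarrow> \<bar>F (x, v) - F (x, y)\<bar> < e/2"
        using continuous_map_near_fixed_slice[OF compact F y, of "e/2"] e by (metis half_gt_zero)
      have "\<bar>haar (\<lambda>x. F (x, v)) - haar (\<lambda>x. F (x, y))\<bar> \<le> e/2" if v: "v \<in> U" for v
      proof -
        have vY: "v \<in> topspace Y" using v U openin_subset by fastforce
        have "\<bar>haar (\<lambda>x. F (x, v) - F (x, y))\<bar> \<le> e/2"
          using U(3) v by (intro haar_abs_le continuous_intros slice vY y) (auto simp: topspace_eq less_imp_le)
        then show ?thesis using haar_diff[OF slice[OF vY] slice[OF y]] by simp
      qed
      then have "\<forall>v\<in>U. haar (\<lambda>x. F (x, v)) \<in> V" using e by fastforce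
      then show "\<exists>U. openin Y U \<and> y \<in> U \<and> (\<forall>v\<in>U. haar (\<lambda>x. F (x, v)) \<in> V)" using U by blast
    qed (use y in auto)
  qed
qed

end

section \<open>Products of compact groups and Fubini's rule\<close>

lemma compact_group_DirProd:
  assumes "compact_group G S" "compact_group H T"
  shows "compact_group (G \<times>\<times> H) (prod_topology S T)"
proof -
  interpret G: compact_group G S by fact
  interpret H: compact_group H T by fact
  let ?P = "prod_topology S T"
  have gr: "group (G \<times>\<times> H)" by (rule DirProd_group[OF G.is_group H.is_group])
  note comps = continuous_map_compose[OF continuous_map_fst[of ?P ?P] continuous_map_fst[of S T]]
    continuous_map_compose[OF continuous_map_snd[of ?P ?P] continuous_map_fst[of S T]]
    continuous_map_compose[OF continuous_map_fst[of ?P ?P] continuous_map_snd[of S T]]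
    continuous_map_compose[OF continuous_map_snd[of ?P ?P] continuous_map_snd[of S T]]
  have "continuous_map (prod_topology ?P ?P) ?P
      (\<lambda>p. (fst (fst p) \<otimes>\<^bsub>G\<^esub> fst (snd p), snd (fst p) \<otimes>\<^bsub>H\<^esub> snd (snd p)))"
    by (intro continuous_map_pairedI G.continuous_map_mult H.continuous_map_mult comps[unfolded o_def])
  then have m: "continuous_map (prod_topology ?P ?P) ?P (\<lambda>(x, y). x \<otimes>\<^bsub>G \<times>\<times> H\<^esub> y)"
    by (simp add: DirProd_def case_prod_beta')
  have "continuous_map ?P ?P (\<lambda>x. (inv\<^bsub>G\<^esub> (fst x), inv\<^bsub>H\<^esub> (snd x)))"
    by (intro continuous_map_pairedI G.continuous_map_m_inv H.continuous_map_m_inv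
        continuous_map_fst continuous_map_snd)
  then have i: "continuous_map ?P ?P (\<lambda>x. inv\<^bsub>G \<times>\<times> H\<^esub> x)"
    by (rule continuous_map_eq)
      (auto simp: G.topspace_eq H.topspace_eq inv_DirProd[OF G.is_group H.is_group])
  show ?thesis
    by (intro compact_group.intro topological_group.intro topological_group_axioms.intro
        compact_group_axioms.intro gr m i)
      (simp_all add: G.topspace_eq H.topspace_eq G.compact H.compact G.Hausdorff H.Hausdorff
        compact_space_prod_topology Hausdorff_space_prod_topology)
qed

context compact_group
begin

text \<open>With \<open>s\<close> the identity or the swap both orders of iteration are treated
  together: each is a normalised invariant functional on the square of the group and therefore
  equals the mean there.\<close>

lemma haar_iterated:
  fixes s :: "'a \<times> 'a \<Rightarrow> 'a \<times> 'a"
  assumes F: "continuous_map (prod_topology T T) euclideanreal F"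
    and s: "s = id \<or> s = prod.swap"
  shows "haar (\<lambda>y. haar (\<lambda>x. F (s (x, y)))) = compact_group.haar (G \<times>\<times> G) F"
proof -
  interpret P: compact_group "G \<times>\<times> G" "prod_topology T T"
    by (rule compact_group_DirProd) unfold_locales
  have "continuous_map (prod_topology T T) (prod_topology T T) (\<lambda>p. (snd p, fst p))"
    by (intro continuous_map_pairedI continuous_map_fst continuous_map_snd)
  then have sw: "continuous_map (prod_topology T T) (prod_topology T T) s"
    using s continuous_map_id[of "prod_topology T T"] by (auto simp: prod.swap_def[abs_def])
  have Fs: "continuous_map (prod_topology T T) euclideanreal (\<lambda>p. F (s p))"
    if "continuous_map (prod_topology T T) euclideanreal F" for F
    using continuous_map_compose[OF sw that] by (simp add: o_def)
  note par = continuous_map_haar_param(1)[OF Fs] continuous_map_haar_param(2)[OF Fs, unfolded topspace_eq]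
  show ?thesis
  proof (rule P.haar_unique[where L="\<lambda>F. haar (\<lambda>y. haar (\<lambda>x. F (s (x, y))))", OF _ _ _ _ F])
    fix f :: "'a \<times> 'a \<Rightarrow> real" and l u
    assume f: "continuous_map (prod_topology T T) euclideanreal f"
      and lu: "\<And>x. x \<in> carrier (G \<times>\<times> G) \<Longrightarrow> l \<le> f x \<and> f x \<le> u"
    have "s (x, y) \<in> carrier (G \<times>\<times> G)" if "x \<in> carrier G" "y \<in> carrier G" for x y
      using s that by auto
    then show "l \<le> haar (\<lambda>y. haar (\<lambda>x. f (s (x, y)))) \<and> haar (\<lambda>y. haar (\<lambda>x. f (s (x, y)))) \<le> u"
      using lu by (intro haar_bounds par f) auto
  next
    fix f g :: "'a \<times> 'a \<Rightarrow> real"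
    assume f: "continuous_map (prod_topology T T) euclideanreal f"
      and g: "continuous_map (prod_topology T T) euclideanreal g"
    have "haar (\<lambda>y. haar (\<lambda>x. f (s (x, y)) + g (s (x, y)))) =
        haar (\<lambda>y. haar (\<lambda>x. f (s (x, y))) + haar (\<lambda>x. g (s (x, y))))"
      by (rule haar_cong[symmetric, OF continuous_map_add[OF par(1)[OF f] par(1)[OF g]]])
        (rule haar_add[symmetric, OF par(2)[OF f] par(2)[OF g]])
    then show "haar (\<lambda>y. haar (\<lambda>x. f (s (x, y)) + g (s (x, y)))) =
        haar (\<lambda>y. haar (\<lambda>x. f (s (x, y)))) + haar (\<lambda>y. haar (\<lambda>x. g (s (x, y))))"
      using haar_add[OF par(1)[OF f] par(1)[OF g]] by simp
  next
    fix f :: "'a \<times> 'a \<Rightarrow> real" and c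
    assume f: "continuous_map (prod_topology T T) euclideanreal f"
    have "haar (\<lambda>y. haar (\<lambda>x. c * f (s (x, y)))) = haar (\<lambda>y. c * haar (\<lambda>x. f (s (x, y))))"
      by (rule haar_cong[symmetric, OF continuous_map_real_mult_left[OF par(1)[OF f]]])
        (rule haar_cmult[symmetric, OF par(2)[OF f]])
    then show "haar (\<lambda>y. haar (\<lambda>x. c * f (s (x, y)))) = c * haar (\<lambda>y. haar (\<lambda>x. f (s (x, y))))"
      using haar_cmult[OF par(1)[OF f]] by simp
  next
    fix f :: "'a \<times> 'a \<Rightarrow> real" and a
    assume f: "continuous_map (prod_topology T T) euclideanreal f" and "a \<in> carrier (G \<times>\<times> G)"
    then obtain b1 b2 where b: "b1 \<in> carrier G" "b2 \<in> carrier G"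
      and eq: "\<And>x y. a \<otimes>\<^bsub>G \<times>\<times> G\<^esub> s (x, y) = s (b1 \<otimes> x, b2 \<otimes> y)"
      using s by (cases a) auto
    let ?h = "\<lambda>y. haar (\<lambda>x. f (s (x, y)))"
    have "haar (\<lambda>y. haar (\<lambda>x. f (s (b1 \<otimes> x, b2 \<otimes> y)))) = haar (\<lambda>y. ?h (b2 \<otimes> y))"
    proof (rule haar_cong[symmetric])
      show "continuous_map T euclideanreal (\<lambda>y. ?h (b2 \<otimes> y))"
        by (rule continuous_map_translate[OF par(1)[OF f] b(2)])
      show "?h (b2 \<otimes> y) = haar (\<lambda>x. f (s (b1 \<otimes> x, b2 \<otimes> y)))" if "y \<in> carrier G" for y
        using haar_left[OF par(2)[OF f, of "b2 \<otimes> y"] b(1)] b that by simp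
    qed
    also have "\<dots> = haar ?h" by (rule haar_left[OF par(1)[OF f] b(2)])
    finally show "haar (\<lambda>y. haar (\<lambda>x. f (a \<otimes>\<^bsub>G \<times>\<times> G\<^esub> s (x, y)))) = haar ?h" by (simp add: eq)
  qed
qed

lemma haar_Fubini:
  fixes F :: "'a \<times> 'a \<Rightarrow> real"
  assumes F: "continuous_map (prod_topology T T) euclideanreal F"
  shows "haar (\<lambda>y. haar (\<lambda>x. F (x, y))) = haar (\<lambda>x. haar (\<lambda>y. F (x, y)))"
  using haar_iterated[OF F, of id] haar_iterated[OF F, of prod.swap] by simp

end

section \<open>Complex Stone--Weierstrass theorem\<close>

lemma open_coordinate_vimage:
  fixes U :: "'b :: topological_space set"
  assumes "open U"
  shows "open ((\<lambda>h :: 'a \<Rightarrow> 'b. h i) -` U)"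
proof -
  have "continuous_on UNIV (\<lambda>h :: 'a \<Rightarrow> 'b. h i)" by simp
  then show ?thesis using assms by (intro open_vimage)
qed

text \<open>The library knows these instances only for metric codomains and countable domains, via the
  function metric.\<close>

instance "fun" :: (type, t0_space) t0_space
proof
  fix f g :: "'a \<Rightarrow> 'b"
  assume "f \<noteq> g"
  then obtain i where i: "f i \<noteq> g i" by (meson ext)
  obtain U where "open U" "\<not> (f i \<in> U \<longleftrightarrow> g i \<in> U)" using iffD1[OF separation_t0 i] by (elim exE conjE)
  then show "\<exists>U. open U \<and> \<not> (f \<in> U \<longleftrightarrow> g \<in> U)"
    by (intro exI[of _ "(\<lambda>h. h i) -` U"]) (simp add: open_coordinate_vimage)
qed

instance "fun" :: (type, t1_space) t1_space
proof
  fix f g :: "'a \<Rightarrow> 'b"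
  assume "f \<noteq> g"
  then obtain i where i: "f i \<noteq> g i" by (meson ext)
  obtain U where "open U" "f i \<in> U" "g i \<notin> U" using iffD1[OF separation_t1 i] by (elim exE conjE)
  then show "\<exists>U. open U \<and> f \<in> U \<and> g \<notin> U"
    by (intro exI[of _ "(\<lambda>h. h i) -` U"]) (simp add: open_coordinate_vimage)
qed

instance "fun" :: (type, t2_space) t2_space
proof
  fix f g :: "'a \<Rightarrow> 'b"
  assume "f \<noteq> g"
  then obtain i where i: "f i \<noteq> g i" by (meson ext)
  from hausdorff[OF i] obtain U V where UV: "open U" "open V" "f i \<in> U" "g i \<in> V" "U \<inter> V = {}"
    by blast
  then show "\<exists>U V. open U \<and> open V \<and> f \<in> U \<and> g \<in> V \<and> U \<inter> V = {}"
    by (intro exI[of _ "(\<lambda>h. h i) -` U"] exI[of _ "(\<lambda>h. h i) -` V"]) (auto simp: open_coordinate_vimage)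
qed

lemma continuous_map_compose_continuous_on:
  assumes "continuous_map X euclidean f" "continuous_on UNIV h"
  shows "continuous_map X euclidean (\<lambda>x. h (f x))"
  using continuous_map_compose[OF assms(1), of euclidean h] assms(2) by (simp add: o_def)

lemma continuous_map_mult_normed_algebra:
  fixes f g :: "'a \<Rightarrow> 'b :: real_normed_algebra"
  assumes "continuous_map X euclidean f" "continuous_map X euclidean g"
  shows "continuous_map X euclidean (\<lambda>x. f x * g x)"
proof -
  have "continuous_map X euclidean (\<lambda>x. (f x, g x))"
    using continuous_map_pairedI[OF assms] by simp
  moreover have "continuous_on UNIV (\<lambda>p :: 'b \<times> 'b. fst p * snd p)"
    by (intro continuous_intros)
  ultimately show ?thesis
    using continuous_map_compose_continuous_on[of X "\<lambda>x. (f x, g x)" "\<lambda>p. fst p * snd p"] by simp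
qed

text \<open>Evaluation at the members of \<open>R\<close> maps \<open>X\<close> onto a compact set
  of functions whose coordinates separate points, so the usual theorem applies there. Points that
  \<open>R\<close> does not distinguish are identified, and \<open>F\<close> descends because by
  \<open>sep\<close> it does not distinguish them either.\<close>

lemma Stone_Weierstrass_real_compact_space:
  fixes F :: "'a \<Rightarrow> real"
  assumes X: "compact_space X"
    and cont: "\<And>f. f \<in> R \<Longrightarrow> continuous_map X euclideanreal f"
    and const: "\<And>c. (\<lambda>_. c) \<in> R"
    and add: "\<And>f g. f \<in> R \<Longrightarrow> g \<in> R \<Longrightarrow> (\<lambda>x. f x + g x) \<in> R"
    and mult: "\<And>f g. f \<in> R \<Longrightarrow> g \<in> R \<Longrightarrow> (\<lambda>x. f x * g x) \<in> R"
    and F: "continuous_map X euclideanreal F"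
    and sep: "\<And>x y. x \<in> topspace X \<Longrightarrow> y \<in> topspace X \<Longrightarrow> (\<And>f. f \<in> R \<Longrightarrow> f x = f y) \<Longrightarrow> F x = F y"
    and e: "e > 0"
  shows "\<exists>g\<in>R. \<forall>x\<in>topspace X. \<bar>F x - g x\<bar> < e"
proof -
  \<comment> \<open>Coordinates outside \<open>R\<close> are set to 0, so that the target is a full
    function space while only members of \<open>R\<close> can tell images apart.\<close>
  define emb where "emb x = (\<lambda>f. if f \<in> R then f x else 0)" for x
  define K where "K = emb ` topspace X"
  have cemb: "continuous_map X euclidean emb"
    unfolding euclidean_product_topology[symmetric] continuous_map_componentwise_UNIV
    by (auto simp: emb_def cont)
  have K_img: "compact (emb ` S)" if "closedin X S" for S
    using image_compactin[OF closedin_compact_space[OF X that] cemb] by simp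
  have compK: "compact K" unfolding K_def by (rule K_img) simp
  \<comment> \<open>A preimage is chosen arbitrarily; \<open>sep\<close> makes the value independent
    of the choice.\<close>
  define F' where "F' u = F (SOME x. x \<in> topspace X \<and> emb x = u)" for u
  have F': "F' (emb x) = F x" if x: "x \<in> topspace X" for x
  proof -
    define y where "y = (SOME y. y \<in> topspace X \<and> emb y = emb x)"
    have y: "y \<in> topspace X \<and> emb y = emb x" unfolding y_def by (rule someI[of _ x]) (use x in auto)
    have "f y = f x" if "f \<in> R" for f
      using fun_cong[OF conjunct2[OF y], of f] that by (simp add: emb_def)
    then have "F y = F x" using sep y x by blast
    then show ?thesis by (simp add: F'_def y_def)
  qed
  \<comment> \<open>\<open>emb\<close> sends closed sets to compact and hence closed sets. It is
    thus a quotient map onto \<open>K\<close>, and continuity passes from \<open>F\<close> to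
    \<open>F'\<close>.\<close>
  have cF': "continuous_on K F'"
  proof (subst continuous_on_closed_vimage[OF compact_imp_closed[OF compK]], intro allI impI)
    fix B :: "real set" assume "closed B"
    then have "closedin X {x \<in> topspace X. F x \<in> B}"
      by (intro closedin_continuous_map_preimage[OF F]) simp
    moreover have "F' -` B \<inter> K = emb ` {x \<in> topspace X. F x \<in> B}"
      using F' by (auto simp: K_def)
    ultimately show "closed (F' -` B \<inter> K)" using K_img compact_imp_closed by metis
  qed
  define R' where "R' = {h. continuous_on K h \<and> (\<exists>f\<in>R. \<forall>x\<in>topspace X. h (emb x) = f x)}"
  have "function_ring_on R' K"
  proof
    fix f g assume fg: "f \<in> R'" "g \<in> R'"
    then obtain f1 g1 where 1: "f1 \<in> R" "\<forall>x\<in>topspace X. f (emb x) = f1 x"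
      "g1 \<in> R" "\<forall>x\<in>topspace X. g (emb x) = g1 x"
      by (auto simp: R'_def)
    show "(\<lambda>x. f x + g x) \<in> R'"
      using fg 1 add[OF 1(1,3)] by (auto simp: R'_def intro!: continuous_on_add bexI[of _ "\<lambda>x. f1 x + g1 x"])
    show "(\<lambda>x. f x * g x) \<in> R'"
      using fg 1 mult[OF 1(1,3)] by (auto simp: R'_def intro!: continuous_on_mult bexI[of _ "\<lambda>x. f1 x * g1 x"])
  next
    fix c show "(\<lambda>_. c) \<in> R'" using const by (auto simp: R'_def intro!: bexI[of _ "\<lambda>x. c"])
  next
    fix u v assume "u \<in> K" "v \<in> K" "u \<noteq> v"
    then obtain x y where xy: "x \<in> topspace X" "y \<in> topspace X" "u = emb x" "v = emb y" by (auto simp: K_def)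
    then obtain f where "emb x f \<noteq> emb y f" using \<open>u \<noteq> v\<close> by (meson ext)
    then have f: "f \<in> R" "f x \<noteq> f y" by (auto simp: emb_def split: if_splits)
    have "continuous_on K (\<lambda>u. u f)"
      by (rule continuous_on_subset[OF continuous_on_product_coordinates]) simp
    then have "(\<lambda>u. u f) \<in> R'" using f by (auto simp: R'_def emb_def intro!: bexI[of _ f])
    then show "\<exists>f\<in>R'. f u \<noteq> f v" using f xy by (intro bexI[of _ "\<lambda>u. u f"]) (auto simp: emb_def)
  qed (auto simp: R'_def compK)
  from function_ring_on.Stone_Weierstrass_basic[OF this cF' e]
  obtain h where h: "h \<in> R'" "\<forall>u\<in>K. \<bar>F' u - h u\<bar> < e" by auto
  then obtain f where "f \<in> R" "\<forall>x\<in>topspace X. h (emb x) = f x" by (auto simp: R'_def)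
  then show ?thesis using h F' by (intro bexI[of _ f]) (auto simp: K_def)
qed

text \<open>Closure under conjugation puts the real and imaginary parts of members of
  \<open>A\<close> into the real algebra \<open>R\<close>. The real theorem is then applied to both
  parts of \<open>F\<close>, each with half of the tolerance.\<close>

lemma Stone_Weierstrass_complex_compact_space:
  fixes F :: "'a \<Rightarrow> complex"
  assumes X: "compact_space X"
    and cont: "\<And>f. f \<in> A \<Longrightarrow> continuous_map X euclidean f"
    and const: "\<And>c. (\<lambda>_. c) \<in> A"
    and add: "\<And>f g. f \<in> A \<Longrightarrow> g \<in> A \<Longrightarrow> (\<lambda>x. f x + g x) \<in> A"
    and mult: "\<And>f g. f \<in> A \<Longrightarrow> g \<in> A \<Longrightarrow> (\<lambda>x. f x * g x) \<in> A"
    and conj: "\<And>f. f \<in> A \<Longrightarrow> (\<lambda>x. cnj (f x)) \<in> A"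
    and F: "continuous_map X euclidean F"
    and sep: "\<And>x y. x \<in> topspace X \<Longrightarrow> y \<in> topspace X \<Longrightarrow> (\<And>f. f \<in> A \<Longrightarrow> f x = f y) \<Longrightarrow> F x = F y"
    and e: "e > 0"
  shows "\<exists>g\<in>A. \<forall>x\<in>topspace X. cmod (F x - g x) < e"
proof -
  define R where "R = {r. (\<lambda>x. complex_of_real (r x)) \<in> A}"
  have re: "(\<lambda>x. Re (f x)) \<in> R" if "f \<in> A" for f
  proof -
    have "(\<lambda>x. complex_of_real (Re (f x))) = (\<lambda>x. (1/2) * (f x + cnj (f x)))"
      by (auto simp: complex_eq_iff)
    moreover have "(\<lambda>x. (1/2) * (f x + cnj (f x))) \<in> A"
      by (rule mult[OF const add[OF that conj[OF that]]])
    ultimately show ?thesis unfolding R_def by simp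
  qed
  \<comment> \<open>The imaginary part of \<open>f\<close> is the real part of
    \<open>-\<i> * f\<close>.\<close>
  have im: "(\<lambda>x. Im (f x)) \<in> R" if "f \<in> A" for f
    using re[OF mult[OF const[of "-\<i>"] that]] by simp
  have Rcont: "continuous_map X euclideanreal f" if f: "f \<in> R" for f
  proof -
    have "continuous_map X euclidean (\<lambda>x. complex_of_real (f x))" using f cont by (auto simp: R_def)
    from continuous_map_compose_continuous_on[OF this continuous_on_Re[OF continuous_on_id]]
    show ?thesis by simp
  qed
  have sep': "F x = F y" if "x \<in> topspace X" "y \<in> topspace X" "\<And>f. f \<in> R \<Longrightarrow> f x = f y" for x y
  proof (rule sep[OF that(1,2)])
    fix f assume "f \<in> A"
    then show "f x = f y" using that(3)[OF re] that(3)[OF im] by (simp add: complex_eq_iff)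
  qed
  have real: "\<exists>g\<in>R. \<forall>x\<in>topspace X. \<bar>f x - g x\<bar> < e/2"
    if "continuous_map X euclideanreal f" "\<And>x y. F x = F y \<Longrightarrow> f x = f y" for f
  proof (rule Stone_Weierstrass_real_compact_space[OF X Rcont _ _ _ that(1)])
    show "f x = f y" if "x \<in> topspace X" "y \<in> topspace X" "\<And>f. f \<in> R \<Longrightarrow> f x = f y" for x y
      using sep' that \<open>\<And>x y. F x = F y \<Longrightarrow> f x = f y\<close> by blast
  qed (use e const add mult in \<open>auto simp: R_def\<close>)
  have c: "continuous_map X euclideanreal (\<lambda>x. Re (F x))" "continuous_map X euclideanreal (\<lambda>x. Im (F x))"
    by (intro continuous_map_compose_continuous_on[OF F] continuous_intros)+
  obtain g where g: "g \<in> R" "\<forall>x\<in>topspace X. \<bar>Re (F x) - g x\<bar> < e/2" using real[OF c(1)] by auto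
  obtain h where h: "h \<in> R" "\<forall>x\<in>topspace X. \<bar>Im (F x) - h x\<bar> < e/2" using real[OF c(2)] by auto
  have "(\<lambda>x. complex_of_real (g x) + \<i> * complex_of_real (h x)) \<in> A"
    using g h by (intro add mult const) (auto simp: R_def)
  moreover have "cmod (F x - (complex_of_real (g x) + \<i> * complex_of_real (h x))) < e"
    if "x \<in> topspace X" for x
  proof -
    have "cmod (F x - (complex_of_real (g x) + \<i> * complex_of_real (h x)))
        \<le> \<bar>Re (F x) - g x\<bar> + \<bar>Im (F x) - h x\<bar>"
      using cmod_le[of "F x - (complex_of_real (g x) + \<i> * complex_of_real (h x))"] by simp
    moreover have "\<bar>Re (F x) - g x\<bar> < e/2" "\<bar>Im (F x) - h x\<bar> < e/2" using g(2) h(2) that by auto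
    ultimately show ?thesis by linarith
  qed
  ultimately show ?thesis
    by (intro bexI[of _ "\<lambda>x. complex_of_real (g x) + \<i> * complex_of_real (h x)"] ballI)
qed

section \<open>Compactness of convolution operators\<close>

lemma compact_space_finite_subcover:
  assumes "compact_space X" and U: "\<And>x. x \<in> topspace X \<Longrightarrow> openin X (U x) \<and> x \<in> U x"
  obtains P where "finite P" "P \<subseteq> topspace X" "topspace X \<subseteq> \<Union>(U ` P)"
proof -
  have "\<forall>V\<in>U ` topspace X. openin X V" "topspace X \<subseteq> \<Union>(U ` topspace X)" using U by auto
  then obtain \<F> where \<F>: "finite \<F>" "\<F> \<subseteq> U ` topspace X" "topspace X \<subseteq> \<Union>\<F>"
    using assms(1) unfolding compact_space_alt by (metis (no_types, lifting))
  obtain P where "P \<subseteq> topspace X" "finite P" "\<F> = U ` P"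
    using finite_subset_image[OF \<F>(1,2)] by blast
  then show thesis using that \<F> by auto
qed

text \<open>The theorem of Arzela and Ascoli. Equicontinuity provides for every \<open>m\<close> a
  finite net that controls the whole sequence up to \<open>1 / Suc m\<close>; the countable union of
  these nets plays the role of the dense sequence in the metric case.\<close>

lemma equicontinuous_subsequence:
  fixes f :: "nat \<Rightarrow> 'a \<Rightarrow> real"
  assumes X: "compact_space X"
    and bnd: "\<And>n x. x \<in> topspace X \<Longrightarrow> \<bar>f n x\<bar> \<le> B"
    and equi: "\<And>x0 e. x0 \<in> topspace X \<Longrightarrow> e > 0 \<Longrightarrow>
      \<exists>U. openin X U \<and> x0 \<in> U \<and> (\<forall>n. \<forall>x\<in>U. \<bar>f n x - f n x0\<bar> < e)"
  shows "\<exists>(k :: nat \<Rightarrow> nat) g. strict_mono k \<and> continuous_map X euclideanreal g \<and>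
    (\<forall>e>0. \<exists>N. \<forall>n\<ge>N. \<forall>x\<in>topspace X. \<bar>f (k n) x - g x\<bar> \<le> e)"
proof -
  have net: "\<exists>P. finite P \<and> P \<subseteq> topspace X \<and> (\<forall>x\<in>topspace X. \<exists>p\<in>P. \<forall>n. \<bar>f n x - f n p\<bar> < e)"
    if e: "e > 0" for e
  proof -
    obtain U where U: "\<And>x. x \<in> topspace X \<Longrightarrow> openin X (U x) \<and> x \<in> U x \<and> (\<forall>n. \<forall>y\<in>U x. \<bar>f n y - f n x\<bar> < e)"
      using equi[OF _ e] by metis
    obtain P where P: "finite P" "P \<subseteq> topspace X" "topspace X \<subseteq> \<Union>(U ` P)"
      using compact_space_finite_subcover[OF X, of U] U by auto
    have "\<exists>p\<in>P. \<forall>n. \<bar>f n x - f n p\<bar> < e" if "x \<in> topspace X" for x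
    proof -
      obtain p where p: "p \<in> P" "x \<in> U p" using P(3) \<open>x \<in> topspace X\<close> by auto
      then have "p \<in> topspace X" using P(2) by auto
      from U[OF this] have "\<forall>n. \<bar>f n x - f n p\<bar> < e" using p(2) by simp
      then show ?thesis using p(1) by (rule bexI)
    qed
    then show ?thesis using P by auto
  qed
  then have "\<forall>m::nat. \<exists>P. finite P \<and> P \<subseteq> topspace X \<and>
      (\<forall>x\<in>topspace X. \<exists>p\<in>P. \<forall>n. \<bar>f n x - f n p\<bar> < 1 / Suc m)"
    by simp
  from choice[OF this] obtain P where P0: "\<forall>m::nat. finite (P m) \<and> P m \<subseteq> topspace X \<and>
      (\<forall>x\<in>topspace X. \<exists>p\<in>P m. \<forall>n. \<bar>f n x - f n p\<bar> < 1 / Suc m)" ..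
  then have P: "\<And>m. finite (P m)" "\<And>m. P m \<subseteq> topspace X"
    and P3: "\<And>m x. x \<in> topspace X \<Longrightarrow> \<exists>p\<in>P m. \<forall>n. \<bar>f n x - f n p\<bar> < 1 / Suc m"
    by simp_all
  have "countable (\<Union>m. P m)" using P(1) by (auto intro: countable_finite)
  moreover have "norm (f n x) \<le> B" if "x \<in> (\<Union>m. P m)" for n x using that P(2) bnd by auto
  ultimately obtain k :: "nat \<Rightarrow> nat" where k: "strict_mono k"
    and conv: "\<And>x. x \<in> (\<Union>m. P m) \<Longrightarrow> \<exists>l. (\<lambda>n. f (k n) x) \<longlonglongrightarrow> l"
    using function_convergent_subsequence[of "\<Union>m. P m" f B] by metis
  have cauchy: "\<exists>N. \<forall>m\<ge>N. \<forall>n\<ge>N. \<forall>x\<in>topspace X. \<bar>f (k m) x - f (k n) x\<bar> \<le> e" if e: "e > 0" for e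
  proof -
    obtain M :: nat where M: "1 / Suc M < e / 3"
      using reals_Archimedean[of "e/3"] e by (auto simp: inverse_eq_divide)
    have "\<exists>N. \<forall>m\<ge>N. \<forall>n\<ge>N. \<bar>f (k m) p - f (k n) p\<bar> < e/3" if "p \<in> P M" for p
    proof -
      have "Cauchy (\<lambda>n. f (k n) p)" using conv[of p] that convergent_Cauchy convergentI by blast
      then show ?thesis using e unfolding Cauchy_def dist_real_def by (metis zero_less_divide_iff zero_less_numeral)
    qed
    then obtain N where N: "\<And>p. p \<in> P M \<Longrightarrow> \<forall>m\<ge>N p. \<forall>n\<ge>N p. \<bar>f (k m) p - f (k n) p\<bar> < e/3"
      by metis
    \<comment> \<open>The sum is a common upper bound of finitely many natural numbers that also
      makes sense for an empty net.\<close>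
    define N0 where "N0 = (\<Sum>p\<in>P M. N p)"
    have N0: "N p \<le> N0" if "p \<in> P M" for p
      unfolding N0_def using P(1) that by (intro member_le_sum) auto
    have "\<bar>f (k m) x - f (k n) x\<bar> \<le> e" if "m \<ge> N0" "n \<ge> N0" "x \<in> topspace X" for m n x
    proof -
      obtain p where p: "p \<in> P M" "\<forall>n. \<bar>f n x - f n p\<bar> < 1 / Suc M" using P3[OF \<open>x \<in> topspace X\<close>, of M] by auto
      have "\<bar>f (k m) p - f (k n) p\<bar> < e/3" using N[OF p(1)] N0[OF p(1)] that by (meson order_trans)
      moreover have "\<bar>f (k m) x - f (k m) p\<bar> < e/3" "\<bar>f (k n) x - f (k n) p\<bar> < e/3"
        using p(2) M order.strict_trans by blast+
      ultimately show ?thesis by linarith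
    qed
    then show ?thesis by blast
  qed
  define g where "g x = lim (\<lambda>n. f (k n) x)" for x
  have lim: "(\<lambda>n. f (k n) x) \<longlonglongrightarrow> g x" if "x \<in> topspace X" for x
  proof -
    have "Cauchy (\<lambda>n. f (k n) x)"
    proof (rule metric_CauchyI)
      fix e :: real assume "e > 0"
      then obtain N where "\<forall>m\<ge>N. \<forall>n\<ge>N. \<forall>x\<in>topspace X. \<bar>f (k m) x - f (k n) x\<bar> \<le> e/2"
        using cauchy[of "e/2"] by auto
      then have "dist (f (k m) x) (f (k n) x) < e" if "m \<ge> N" "n \<ge> N" for m n
        using that \<open>x \<in> topspace X\<close> \<open>e > 0\<close> by (force simp: dist_real_def)
      then show "\<exists>N. \<forall>m\<ge>N. \<forall>n\<ge>N. dist (f (k m) x) (f (k n) x) < e" by blast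
    qed
    then show ?thesis unfolding g_def by (simp add: Cauchy_convergent_iff convergent_LIMSEQ_iff)
  qed
  have unif: "\<exists>N. \<forall>n\<ge>N. \<forall>x\<in>topspace X. \<bar>f (k n) x - g x\<bar> \<le> e" if e: "e > 0" for e
  proof -
    obtain N where N: "\<forall>m\<ge>N. \<forall>n\<ge>N. \<forall>x\<in>topspace X. \<bar>f (k m) x - f (k n) x\<bar> \<le> e"
      using cauchy[OF e] by auto
    have "\<bar>f (k n) x - g x\<bar> \<le> e" if "n \<ge> N" "x \<in> topspace X" for n x
    proof (rule LIMSEQ_le_const2)
      show "(\<lambda>m. \<bar>f (k n) x - f (k m) x\<bar>) \<longlonglongrightarrow> \<bar>f (k n) x - g x\<bar>"
        by (intro tendsto_intros lim that)
      show "\<exists>N. \<forall>m\<ge>N. \<bar>f (k n) x - f (k m) x\<bar> \<le> e" using N that by auto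
    qed
    then show ?thesis by blast
  qed
  have "continuous_map X euclideanreal g"
    unfolding continuous_map_eq_topcontinuous_at
  proof
    fix x0 assume x0: "x0 \<in> topspace X"
    show "topcontinuous_at X euclideanreal g x0"
      unfolding topcontinuous_at_def
    proof (intro conjI allI impI)
      fix V assume "openin euclideanreal V \<and> g x0 \<in> V"
      then obtain e where e: "e > 0" "\<And>z. \<bar>z - g x0\<bar> < e \<Longrightarrow> z \<in> V"
        by (auto simp: open_real)
      obtain N where N: "\<forall>n\<ge>N. \<forall>x\<in>topspace X. \<bar>f (k n) x - g x\<bar> \<le> e/4" using unif[of "e/4"] e(1) by auto
      have "e/4 > 0" using e by simp
      from equi[OF x0 this] obtain U where "openin X U \<and> x0 \<in> U \<and> (\<forall>n. \<forall>x\<in>U. \<bar>f n x - f n x0\<bar> < e/4)" ..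
      then have U: "openin X U" "x0 \<in> U" "\<forall>n. \<forall>x\<in>U. \<bar>f n x - f n x0\<bar> < e/4" by simp_all
      have "g x \<in> V" if "x \<in> U" for x
      proof (rule e(2))
        have "x \<in> topspace X" using that U openin_subset by fastforce
        then have "\<bar>f (k N) x - g x\<bar> \<le> e/4" "\<bar>f (k N) x0 - g x0\<bar> \<le> e/4" using N x0 by auto
        moreover have "\<bar>f (k N) x - f (k N) x0\<bar> < e/4" using U that by auto
        ultimately show "\<bar>g x - g x0\<bar> < e" using e(1) by linarith
      qed
      then show "\<exists>U. openin X U \<and> x0 \<in> U \<and> (\<forall>y\<in>U. g y \<in> V)" using U by auto
    qed (use x0 in auto)
  qed
  then have "strict_mono k \<and> continuous_map X euclideanreal g \<and>
    (\<forall>e>0. \<exists>N. \<forall>n\<ge>N. \<forall>x\<in>topspace X. \<bar>f (k n) x - g x\<bar> \<le> e)"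
    using k unif by simp
  then show ?thesis by - (rule exI[of _ k], rule exI[of _ g])
qed

context compact_group
begin

section \<open>The inner product given by the mean\<close>

definition ip :: "('a \<Rightarrow> real) \<Rightarrow> ('a \<Rightarrow> real) \<Rightarrow> real" where
  "ip f g = haar (\<lambda>x. f x * g x)"

abbreviation cont :: "('a \<Rightarrow> real) \<Rightarrow> bool" where
  "cont f \<equiv> continuous_map T euclideanreal f"

lemma ip_commute: "ip f g = ip g f"
  by (simp add: ip_def mult.commute)

lemma ip_linear_left:
  assumes "cont f" "cont g" "cont h"
  shows "ip (\<lambda>x. c * f x + d * g x) h = c * ip f h + d * ip g h"
proof -
  have "cont (\<lambda>x. f x * h x)" "cont (\<lambda>x. g x * h x)"
    using assms by (auto intro: continuous_map_real_mult)
  from haar_linear[OF this, of c d] show ?thesis by (simp add: ip_def algebra_simps)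
qed

lemma ip_diff_left: "cont f \<Longrightarrow> cont g \<Longrightarrow> cont h \<Longrightarrow> ip (\<lambda>x. f x - g x) h = ip f h - ip g h"
  using ip_linear_left[of f g h 1 "-1"] by simp

lemma ip_scale_left: "cont f \<Longrightarrow> cont h \<Longrightarrow> ip (\<lambda>x. c * f x) h = c * ip f h"
  using ip_linear_left[of f f h c 0] by simp

lemma ip_sum_left:
  assumes "finite I" "\<And>i. i \<in> I \<Longrightarrow> cont (f i)" "cont h"
  shows "ip (\<lambda>x. \<Sum>i\<in>I. c i * f i x) h = (\<Sum>i\<in>I. c i * ip (f i) h)"
proof -
  have "ip (\<lambda>x. \<Sum>i\<in>I. c i * f i x) h = haar (\<lambda>x. \<Sum>i\<in>I. c i * (f i x * h x))"
    by (simp add: ip_def sum_distrib_right mult.assoc)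
  also have "\<dots> = (\<Sum>i\<in>I. haar (\<lambda>x. c i * (f i x * h x)))"
    using assms by (intro haar_sum continuous_map_real_mult_left continuous_map_real_mult) auto
  also have "\<dots> = (\<Sum>i\<in>I. c i * ip (f i) h)"
    using assms by (intro sum.cong refl) (simp add: ip_def haar_cmult continuous_map_real_mult)
  finally show ?thesis .
qed

lemma ip_cong:
  assumes "cont f" "cont g" "\<And>x. x \<in> carrier G \<Longrightarrow> f x = f' x" "\<And>x. x \<in> carrier G \<Longrightarrow> g x = g' x"
  shows "ip f g = ip f' g'"
  unfolding ip_def using assms by (intro haar_cong continuous_map_real_mult) auto

lemma ip_nonneg: "cont f \<Longrightarrow> ip f f \<ge> 0"
  using haar_mono[of "\<lambda>x. 0" "\<lambda>x. f x * f x"]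
  by (auto simp: ip_def haar_const intro: continuous_map_real_mult)

lemma ip_eq_0D:
  assumes f: "cont f" "ip f f = 0" "x \<in> carrier G"
  shows "f x = 0"
proof (rule ccontr)
  assume "f x \<noteq> 0"
  then have "haar (\<lambda>x. f x * f x) > 0"
    using f by (intro haar_pos[of _ x] continuous_map_real_mult) (auto simp: zero_less_mult_iff neq_iff)
  then show False using f by (simp add: ip_def)
qed

lemma ip_left_translate:
  assumes "cont f" "cont g" "a \<in> carrier G"
  shows "ip (\<lambda>x. f (a \<otimes> x)) (\<lambda>x. g (a \<otimes> x)) = ip f g"
  unfolding ip_def using haar_left[of "\<lambda>x. f x * g x" a] assms by (auto intro: continuous_map_real_mult)

definition nrm :: "('a \<Rightarrow> real) \<Rightarrow> real" where
  "nrm f = sqrt (ip f f)"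

lemma nrm_square: "cont f \<Longrightarrow> nrm f * nrm f = ip f f"
  by (simp add: nrm_def ip_nonneg)

lemma nrm_nonneg: "cont f \<Longrightarrow> nrm f \<ge> 0"
  by (simp add: nrm_def ip_nonneg)

lemma nrm_scale: "cont f \<Longrightarrow> nrm (\<lambda>x. c * f x) = \<bar>c\<bar> * nrm f"
  by (simp add: nrm_def ip_scale_left ip_commute[of f "\<lambda>x. c * f x"] real_sqrt_mult
      continuous_map_real_mult_left)

lemma nrm_le:
  assumes "cont f" "\<And>x. x \<in> carrier G \<Longrightarrow> \<bar>f x\<bar> \<le> B"
  shows "nrm f \<le> B"
proof -
  have B: "0 \<le> B" using assms(2)[OF one_closed] by linarith
  have "ip f f \<le> haar (\<lambda>x. B * B)"
    unfolding ip_def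
  proof (rule haar_mono)
    fix x assume "x \<in> carrier G"
    from mult_mono[OF assms(2)[OF this] assms(2)[OF this] B abs_ge_zero]
    show "f x * f x \<le> B * B" by (simp add: abs_mult_self_eq)
  qed (use assms in \<open>auto intro: continuous_map_real_mult\<close>)
  then have "sqrt (ip f f) \<le> sqrt (B * B)" unfolding haar_const by (rule real_sqrt_le_mono)
  then show ?thesis using B by (simp add: nrm_def)
qed

lemma ip_Cauchy_Schwarz:
  assumes f: "cont f" and g: "cont g"
  shows "\<bar>ip f g\<bar> \<le> nrm f * nrm g"
proof (cases "ip g g = 0")
  case True
  then have "ip f g = ip f (\<lambda>x. 0)" by (intro ip_cong f g) (auto intro: ip_eq_0D[OF g])
  also have "\<dots> = 0" by (simp add: ip_def haar_const)
  finally show ?thesis using True by (simp add: nrm_def)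
next
  case False
  then have gg: "ip g g > 0" using ip_nonneg[OF g] by simp
  define t where "t = ip f g / ip g g"
  \<comment> \<open>\<open>h\<close> is \<open>f\<close> minus its projection onto \<open>g\<close>;
    the factor \<open>1\<close> gives it the shape of \<open>ip_linear_left\<close>.\<close>
  define h where "h x = 1 * f x + (-t) * g x" for x
  have h: "cont h" unfolding h_def using f g by (intro continuous_map_add continuous_map_real_mult_left)
  have fh: "ip f h = ip f f - t * ip f g"
    using ip_linear_left[OF f g f, of 1 "-t"] unfolding h_def[symmetric]
    by (simp add: ip_commute[of f h] ip_commute[of g f])
  have gh: "ip g h = ip f g - t * ip g g"
    using ip_linear_left[OF f g g, of 1 "-t"] unfolding h_def[symmetric]
    by (simp add: ip_commute[of g h])
  have "ip h h = ip f h - t * ip g h"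
    using ip_linear_left[OF f g h, of 1 "-t"] unfolding h_def[symmetric] by simp
  also have "\<dots> = ip f f - ip f g * ip f g / ip g g"
    unfolding fh gh t_def using gg by (simp add: field_simps)
  finally have "ip f g * ip f g / ip g g \<le> ip f f" using ip_nonneg[OF h] by simp
  then have "ip f g * ip f g \<le> ip f f * ip g g" using gg by (simp add: pos_divide_le_eq)
  then have "sqrt (ip f g * ip f g) \<le> sqrt (ip f f * ip g g)" by (rule real_sqrt_le_mono)
  then show ?thesis by (simp add: nrm_def real_sqrt_mult)
qed

lemma ip_Bessel:
  fixes \<phi> :: "nat \<Rightarrow> 'a \<Rightarrow> real"
  assumes \<phi>: "\<And>i. i < d \<Longrightarrow> cont (\<phi> i)" and u: "cont u"
    and orth: "\<And>i j. i < d \<Longrightarrow> j < d \<Longrightarrow> ip (\<phi> i) (\<phi> j) = (if i = j then 1 else 0)"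
  shows "(\<Sum>i<d. (ip (\<phi> i) u)\<^sup>2) \<le> ip u u"
proof -
  define p where "p x = (\<Sum>i<d. ip (\<phi> i) u * \<phi> i x)" for x
  have p: "cont p" unfolding p_def using \<phi> by (intro continuous_map_sum continuous_map_real_mult_left) auto
  have pu: "ip p u = (\<Sum>i<d. (ip (\<phi> i) u)\<^sup>2)"
    unfolding p_def using \<phi> u by (subst ip_sum_left) (auto simp: power2_eq_square)
  have "ip p (\<phi> j) = ip (\<phi> j) u" if "j < d" for j
  proof -
    have "ip p (\<phi> j) = (\<Sum>i<d. ip (\<phi> i) u * ip (\<phi> i) (\<phi> j))"
      unfolding p_def using \<phi> that by (subst ip_sum_left) auto
    also have "\<dots> = (\<Sum>i<d. if i = j then ip (\<phi> i) u else 0)"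
      using orth that by (intro sum.cong) auto
    finally show ?thesis using that by simp
  qed
  then have pp: "ip p p = ip p u"
    unfolding pu using \<phi> p by (subst (1) p_def[abs_def], subst ip_sum_left)
      (auto simp: power2_eq_square ip_commute[of _ p])
  have "0 \<le> ip (\<lambda>x. u x - p x) (\<lambda>x. u x - p x)" using u p by (intro ip_nonneg continuous_map_diff)
  also have "\<dots> = ip u (\<lambda>x. u x - p x) - ip p (\<lambda>x. u x - p x)"
    using u p by (intro ip_diff_left continuous_map_diff)
  also have "\<dots> = ip u u - ip p u"
    using u p pp by (simp add: ip_commute[of _ "\<lambda>x. u x - p x"] ip_diff_left ip_commute[of u p])
  finally show ?thesis using pu by simp
qed

end

section \<open>Convolution operators with a symmetric kernel\<close>

locale symmetric_kernel = compact_group +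
  fixes k :: "'a \<Rightarrow> real"
  assumes cont_k: "continuous_map T euclideanreal k"
    and k_inv: "\<And>y. y \<in> carrier G \<Longrightarrow> k (inv y) = k y"
begin

text \<open>As \<open>inv x \<otimes> y\<close> is unchanged under a common left translation of
  \<open>x\<close> and \<open>y\<close>, this convolution commutes with left translations.\<close>

definition K :: "('a \<Rightarrow> real) \<Rightarrow> 'a \<Rightarrow> real" where
  "K f x = ip (\<lambda>y. k (inv x \<otimes> y)) f"

lemma cont_k_prod: "continuous_map (prod_topology T T) euclideanreal (\<lambda>p. k (inv (snd p) \<otimes> fst p))"
  using continuous_map_compose[OF continuous_map_mult[OF continuous_map_m_inv[OF continuous_map_snd[of T T]]
    continuous_map_fst[of T T]] cont_k] by (simp add: o_def)

lemma cont_slice: "x \<in> carrier G \<Longrightarrow> cont (\<lambda>y. k (inv x \<otimes> y))"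
  using continuous_map_haar_param(2)[OF cont_k_prod, of x] by (simp add: topspace_eq)

lemma cont_prod_fst: "cont f \<Longrightarrow> continuous_map (prod_topology T T) euclideanreal (\<lambda>p. f (fst p))"
  using continuous_map_compose[OF continuous_map_fst[of T T], of euclideanreal f] by (simp add: o_def)

lemma cont_prod_snd: "cont f \<Longrightarrow> continuous_map (prod_topology T T) euclideanreal (\<lambda>p. f (snd p))"
  using continuous_map_compose[OF continuous_map_snd[of T T], of euclideanreal f] by (simp add: o_def)

lemma cont_K: "cont f \<Longrightarrow> cont (K f)"
  using continuous_map_haar_param(1)[OF continuous_map_real_mult[OF cont_k_prod cont_prod_fst, of f]]
  by (simp add: K_def[abs_def] ip_def)

lemma K_linear:
  assumes "cont f" "cont g" "x \<in> carrier G"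
  shows "K (\<lambda>x. c * f x + d * g x) x = c * K f x + d * K g x"
  using ip_linear_left[OF assms(1,2) cont_slice[OF assms(3)], of c d]
  by (simp add: K_def ip_commute[of "\<lambda>y. k (inv x \<otimes> y)"])

lemma K_cong:
  assumes "cont f" "\<And>x. x \<in> carrier G \<Longrightarrow> f x = g x" "x \<in> carrier G"
  shows "K f x = K g x"
  unfolding K_def using assms by (intro ip_cong cont_slice) auto

text \<open>Fubini's rule, together with
  \<open>k (inv y \<otimes> x) = k (inv x \<otimes> y)\<close>, which is an instance of
  \<open>k_inv\<close>.\<close>

lemma K_symmetric:
  assumes f: "cont f" and g: "cont g"
  shows "ip (K f) g = ip f (K g)"
proof -
  let ?F = "\<lambda>p. k (inv (snd p) \<otimes> fst p) * f (fst p) * g (snd p)"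
  have F: "continuous_map (prod_topology T T) euclideanreal ?F"
    using f g by (intro continuous_map_real_mult cont_k_prod cont_prod_fst cont_prod_snd)
  have "ip (K f) g = haar (\<lambda>x. haar (\<lambda>y. ?F (y, x)))"
    unfolding ip_def
  proof (rule haar_cong)
    show "cont (\<lambda>x. K f x * g x)" using f g by (intro continuous_map_real_mult cont_K)
    fix x assume x: "x \<in> carrier G"
    have "cont (\<lambda>y. k (inv x \<otimes> y) * f y)" using x f by (intro continuous_map_real_mult cont_slice)
    from haar_cmult[OF this, of "g x"] show "K f x * g x = haar (\<lambda>y. ?F (y, x))"
      by (simp add: K_def ip_def mult_ac)
  qed
  also have "\<dots> = haar (\<lambda>y. haar (\<lambda>x. ?F (y, x)))" by (rule haar_Fubini[OF F])
  also have "\<dots> = ip f (K g)"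
    unfolding ip_def
  proof (rule haar_cong[symmetric])
    show "cont (\<lambda>x. f x * K g x)" using f g by (intro continuous_map_real_mult cont_K)
    fix y assume y: "y \<in> carrier G"
    have c: "cont (\<lambda>x. k (inv y \<otimes> x) * g x)" using y g by (intro continuous_map_real_mult cont_slice)
    have "f y * K g y = haar (\<lambda>x. f y * (k (inv y \<otimes> x) * g x))"
      using haar_cmult[OF c, of "f y"] by (simp add: K_def ip_def)
    also have "\<dots> = haar (\<lambda>x. ?F (y, x))"
    proof (rule haar_cong)
      show "cont (\<lambda>x. f y * (k (inv y \<otimes> x) * g x))" by (intro continuous_map_real_mult_left c)
      fix x assume x: "x \<in> carrier G"
      have "k (inv y \<otimes> x) = k (inv x \<otimes> y)"
        using k_inv[of "inv x \<otimes> y"] x y by (simp add: inv_mult_group)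
      then show "f y * (k (inv y \<otimes> x) * g x) = ?F (y, x)" by simp
    qed
    finally show "f y * K g y = haar (\<lambda>x. ?F (y, x))" .
  qed
  finally show ?thesis .
qed

lemma K_left_translate:
  assumes f: "cont f" and a: "a \<in> carrier G" and x: "x \<in> carrier G"
  shows "K (\<lambda>y. f (a \<otimes> y)) x = K f (a \<otimes> x)"
proof -
  have "K f (a \<otimes> x) = ip (\<lambda>y. k (inv (a \<otimes> x) \<otimes> (a \<otimes> y))) (\<lambda>y. f (a \<otimes> y))"
    unfolding K_def using ip_left_translate[OF cont_slice[of "a \<otimes> x"] f a] a x by simp
  also have "\<dots> = ip (\<lambda>y. k (inv x \<otimes> y)) (\<lambda>y. f (a \<otimes> y))"
  proof (rule ip_cong[symmetric])
    fix y assume y: "y \<in> carrier G"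
    have "inv a \<otimes> (a \<otimes> y) = y" using m_assoc[of "inv a" a y] a y by simp
    then have "inv (a \<otimes> x) \<otimes> (a \<otimes> y) = inv x \<otimes> y"
      using a x y by (simp add: inv_mult_group m_assoc)
    then show "k (inv x \<otimes> y) = k (inv (a \<otimes> x) \<otimes> (a \<otimes> y))" by simp
  qed (use a x f in \<open>auto intro: cont_slice continuous_map_translate\<close>)
  finally show ?thesis by (simp add: K_def)
qed

text \<open>Cauchy--Schwarz against a slice of the bounded kernel. The values of \<open>K f\<close>
  are controlled by the norm of \<open>f\<close> alone, so that convergence in norm becomes uniform
  convergence after one application of \<open>K\<close>.\<close>

lemma K_bound:
  obtains B where "B > 0" "\<And>f x. cont f \<Longrightarrow> x \<in> carrier G \<Longrightarrow> \<bar>K f x\<bar> \<le> B * nrm f"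
    "\<And>f. cont f \<Longrightarrow> nrm (K f) \<le> B * nrm f"
    "\<And>x. x \<in> carrier G \<Longrightarrow> nrm (\<lambda>y. k (inv x \<otimes> y)) \<le> B"
proof -
  obtain B where B: "B > 0" "\<And>x. x \<in> carrier G \<Longrightarrow> \<bar>k x\<bar> \<le> B"
    using continuous_map_real_bounded[OF compact cont_k] topspace_eq by metis
  have 1: "nrm (\<lambda>y. k (inv x \<otimes> y)) \<le> B" if "x \<in> carrier G" for x
    using that B by (intro nrm_le cont_slice) auto
  have 2: "\<bar>K f x\<bar> \<le> B * nrm f" if "cont f" "x \<in> carrier G" for f x
    unfolding K_def using ip_Cauchy_Schwarz[OF cont_slice[OF that(2)] that(1)]
      mult_right_mono[OF 1[OF that(2)] nrm_nonneg[OF that(1)]] by linarith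
  have 3: "nrm (K f) \<le> B * nrm f" if "cont f" for f
    using 2[OF that] by (intro nrm_le cont_K that)
  show thesis using that[OF B(1) 2 3 1] .
qed

text \<open>This is the compactness of the operator: nearby slices of the kernel are uniformly
  close, so \<open>U\<close> serves the whole unit ball.\<close>

lemma K_equicontinuous:
  assumes x0: "x0 \<in> carrier G" and e: "e > 0"
  shows "\<exists>U. openin T U \<and> x0 \<in> U \<and>
    (\<forall>f. cont f \<longrightarrow> nrm f \<le> 1 \<longrightarrow> (\<forall>x\<in>U. \<bar>K f x - K f x0\<bar> < e))"
proof -
  obtain U where U: "openin T U" "x0 \<in> U"
    "\<And>y x. y \<in> topspace T \<Longrightarrow> x \<in> U \<Longrightarrow> \<bar>k (inv x \<otimes> y) - k (inv x0 \<otimes> y)\<bar> < e/2"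
    using continuous_map_near_fixed_slice[OF compact cont_k_prod, of x0 "e/2"] x0 e
    by (auto simp: topspace_eq)
  show ?thesis
  proof (intro exI[of _ U] conjI U(1,2) allI impI ballI)
    fix f x assume f: "cont f" "nrm f \<le> 1" and xU: "x \<in> U"
    have x: "x \<in> carrier G" using xU openin_subset[OF U(1)] topspace_eq by auto
    let ?d = "\<lambda>y. k (inv x \<otimes> y) - k (inv x0 \<otimes> y)"
    have d: "cont ?d" using x x0 by (intro continuous_map_diff cont_slice)
    have "K f x - K f x0 = ip ?d f"
      unfolding K_def using x x0 f by (intro ip_diff_left[symmetric] cont_slice)
    then have "\<bar>K f x - K f x0\<bar> \<le> nrm ?d * nrm f" using ip_Cauchy_Schwarz[OF d f(1)] by simp
    moreover have "nrm ?d \<le> e/2"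
      using U(3)[OF _ xU] by (intro nrm_le d) (auto simp: topspace_eq less_imp_le)
    then have "nrm ?d * nrm f \<le> (e/2) * 1" using f e by (intro mult_mono nrm_nonneg) auto
    ultimately show "\<bar>K f x - K f x0\<bar> < e" using e by simp
  qed
qed

text \<open>The top eigenvector of the compact self-adjoint operator \<open>K\<^sup>2\<close> on the orthogonal complement
  of a \<open>K\<close>-invariant set \<open>F\<close>, as a uniform limit of \<open>K\<close> applied to a maximising sequence.\<close>

lemma top_eigenvector:
  assumes F: "\<And>g. g \<in> F \<Longrightarrow> cont g" and KF: "\<And>g. g \<in> F \<Longrightarrow> K g \<in> F"
    and f0: "cont f0" "\<And>g. g \<in> F \<Longrightarrow> ip f0 g = 0" and x0: "x0 \<in> carrier G" "K f0 x0 \<noteq> 0"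
  shows "\<exists>h c x. cont h \<and> (\<forall>g\<in>F. ip h g = 0) \<and> c > 0 \<and>
    (\<forall>x\<in>carrier G. K (K h) x = c * h x) \<and> x \<in> carrier G \<and> h x \<noteq> 0"
proof -
  \<comment> \<open>Everything takes place in the orthogonal complement of \<open>F\<close>, which
    is stable under \<open>K\<close> because \<open>K\<close> is symmetric and preserves
    \<open>F\<close>.\<close>
  define E where "E = {f. cont f \<and> (\<forall>g\<in>F. ip f g = 0)}"
  have EK: "K f \<in> E" if "f \<in> E" for f
    using that F KF by (auto simp: E_def cont_K K_symmetric)
  have Escale: "(\<lambda>x. c * f x) \<in> E" if "f \<in> E" for f c
    using that F by (auto simp: E_def ip_scale_left continuous_map_real_mult_left)
  have Ec: "cont f" if "f \<in> E" for f using that by (simp add: E_def)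
  obtain B where B: "B > 0" "\<And>f x. cont f \<Longrightarrow> x \<in> carrier G \<Longrightarrow> \<bar>K f x\<bar> \<le> B * nrm f"
    "\<And>f. cont f \<Longrightarrow> nrm (K f) \<le> B * nrm f"
    using K_bound by metis
  define N where "N = {nrm (K f) | f. f \<in> E \<and> nrm f \<le> 1}"
  \<comment> \<open>The norm of \<open>K\<close> on \<open>E\<close>; it is positive because
    \<open>K f0\<close> does not vanish.\<close>
  define s where "s = Sup N"
  have bdd: "bdd_above N"
  proof (rule bdd_aboveI)
    fix v assume "v \<in> N"
    then obtain f where f: "v = nrm (K f)" "f \<in> E" "nrm f \<le> 1" by (auto simp: N_def)
    then have "v \<le> B * nrm f" using B(3) Ec by simp
    also have "\<dots> \<le> B * 1" using f B(1) by (intro mult_left_mono) auto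
    finally show "v \<le> B" by simp
  qed
  have le_s: "nrm (K f) \<le> s * nrm f" if f: "f \<in> E" for f
  proof (cases "nrm f = 0")
    case True then show ?thesis using B(3)[OF Ec[OF f]] by simp
  next
    case False
    then have nf: "nrm f > 0" using nrm_nonneg[OF Ec[OF f]] by simp
    define c where "c = 1 / nrm f"
    have c: "c > 0" "c * nrm f = 1" using nf by (simp_all add: c_def)
    let ?g = "\<lambda>x. c * f x"
    have Kg: "K ?g x = c * K f x" if "x \<in> carrier G" for x
      using K_linear[OF Ec[OF f] Ec[OF f] that, of c 0] by simp
    have "ip (K ?g) (K ?g) = ip (\<lambda>x. c * K f x) (\<lambda>x. c * K f x)"
      using cont_K[OF Ec[OF Escale[OF f]]] by (intro ip_cong Kg)
    then have "nrm (K ?g) = nrm (\<lambda>x. c * K f x)" by (simp add: nrm_def)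
    also have "\<dots> = c * nrm (K f)" using c nrm_scale[OF cont_K[OF Ec[OF f]], of c] by simp
    finally have eq: "nrm (K ?g) = c * nrm (K f)" .
    have "nrm ?g = 1" using c nrm_scale[OF Ec[OF f], of c] by simp
    then have "nrm (K ?g) \<in> N" unfolding N_def using Escale[OF f] by (intro CollectI exI[of _ ?g]) auto
    then have "nrm (K ?g) \<le> s" unfolding s_def by (rule cSup_upper[OF _ bdd])
    then show ?thesis using eq nf by (simp add: c_def pos_divide_le_eq)
  qed
  have f0E: "f0 \<in> E" using f0 by (simp add: E_def)
  have "nrm (K f0) \<noteq> 0"
    using ip_eq_0D[OF cont_K[OF f0(1)] _ x0(1)] x0(2) by (auto simp: nrm_def)
  then have "nrm (K f0) > 0" using nrm_nonneg[OF cont_K[OF f0(1)]] by simp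
  then have "0 < s * nrm f0" using le_s[OF f0E] by linarith
  then have s: "s > 0" using nrm_nonneg[OF f0(1)] by (simp add: zero_less_mult_iff)
  have "N \<noteq> {}"
  proof -
    have "(\<lambda>x. 0 * f0 x) \<in> E" "nrm (\<lambda>x. 0 * f0 x) \<le> 1"
      using Escale[OF f0E, of 0] nrm_scale[OF f0(1), of 0] by auto
    then show ?thesis by (auto simp: N_def)
  qed
  have "\<exists>f. f \<in> E \<and> nrm f \<le> 1 \<and> s - 1 / Suc n < nrm (K f)" for n :: nat
  proof -
    have "s - 1 / Suc n < Sup N" by (simp add: s_def)
    then obtain v where "v \<in> N" "s - 1 / Suc n < v"
      using less_cSup_iff[OF \<open>N \<noteq> {}\<close> bdd] by blast
    then show ?thesis by (auto simp: N_def)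
  qed
  from choice[OF allI[OF this]] obtain f where
    f: "\<forall>n. f n \<in> E \<and> nrm (f n) \<le> 1 \<and> s - 1 / Suc n < nrm (K (f n))" ..
  then have fE: "f n \<in> E" and f1: "nrm (f n) \<le> 1" and fs: "s - 1 / Suc n < nrm (K (f n))" for n
    by auto
  note fc = Ec[OF fE]
  have "\<exists>(r :: nat \<Rightarrow> nat) h. strict_mono r \<and> cont h \<and>
    (\<forall>e>0. \<exists>N. \<forall>n\<ge>N. \<forall>x\<in>topspace T. \<bar>K (f (r n)) x - h x\<bar> \<le> e)"
  proof (rule equicontinuous_subsequence[OF compact])
    show "\<bar>K (f n) x\<bar> \<le> B * 1" if "x \<in> topspace T" for n x
    proof (rule order_trans)
      show "\<bar>K (f n) x\<bar> \<le> B * nrm (f n)" using B(2)[OF fc] that by (simp add: topspace_eq)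
      show "B * nrm (f n) \<le> B * 1" using f1 B(1) by (intro mult_left_mono) auto
    qed
    show "\<exists>U. openin T U \<and> x0 \<in> U \<and> (\<forall>n. \<forall>x\<in>U. \<bar>K (f n) x - K (f n) x0\<bar> < e)"
      if "x0 \<in> topspace T" "e > 0" for x0 e
    proof -
      from that topspace_eq have "x0 \<in> carrier G" by simp
      from K_equicontinuous[OF this \<open>e > 0\<close>] obtain U where "openin T U \<and> x0 \<in> U \<and>
        (\<forall>f. cont f \<longrightarrow> nrm f \<le> 1 \<longrightarrow> (\<forall>x\<in>U. \<bar>K f x - K f x0\<bar> < e))" ..
      then have "openin T U \<and> x0 \<in> U \<and> (\<forall>n. \<forall>x\<in>U. \<bar>K (f n) x - K (f n) x0\<bar> < e)"
        using fc f1 by simp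
      then show ?thesis by (rule exI)
    qed
  qed
  then obtain r :: "nat \<Rightarrow> nat" and h where "strict_mono r \<and> cont h \<and>
    (\<forall>e>0. \<exists>N. \<forall>n\<ge>N. \<forall>x\<in>topspace T. \<bar>K (f (r n)) x - h x\<bar> \<le> e)" by (elim exE)
  then have r: "strict_mono r" and h: "cont h"
    and unif: "\<forall>e>0. \<exists>N. \<forall>n\<ge>N. \<forall>x\<in>topspace T. \<bar>K (f (r n)) x - h x\<bar> \<le> e" by simp_all
  \<comment> \<open>Only the images under \<open>K\<close> converge along the subsequence; the
    maximising functions themselves need not.\<close>
  define h' where "h' n = K (f (r n))" for n
  have h'E: "h' n \<in> E" for n unfolding h'_def by (rule EK[OF fE])
  have diffc: "cont (\<lambda>x. h' n x - h x)" for n using Ec[OF h'E] h by (rule continuous_map_diff)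
  have nrm_lim: "(\<lambda>n. nrm (\<lambda>x. h' n x - h x)) \<longlonglongrightarrow> 0"
  proof (rule LIMSEQ_I)
    fix e :: real assume e: "e > 0"
    then obtain M where M: "\<forall>n\<ge>M. \<forall>x\<in>topspace T. \<bar>K (f (r n)) x - h x\<bar> \<le> e/2"
      using unif by (meson half_gt_zero)
    have "norm (nrm (\<lambda>x. h' n x - h x) - 0) < e" if "n \<ge> M" for n
    proof -
      have "nrm (\<lambda>x. h' n x - h x) \<le> e/2"
        using M that by (intro nrm_le diffc) (auto simp: h'_def topspace_eq)
      then show ?thesis using nrm_nonneg[OF diffc, of n] e by simp
    qed
    then show "\<exists>no. \<forall>n\<ge>no. norm (nrm (\<lambda>x. h' n x - h x) - 0) < e" by blast
  qed
  have hE: "ip h g = 0" if g: "g \<in> F" for g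
  proof -
    have "\<bar>ip h g\<bar> \<le> nrm (\<lambda>x. h' n x - h x) * nrm g" for n
    proof -
      have "ip (\<lambda>x. h' n x - h x) g = ip (h' n) g - ip h g"
        by (rule ip_diff_left[OF Ec[OF h'E] h F[OF g]])
      moreover have "ip (h' n) g = 0" using h'E g by (auto simp: E_def)
      ultimately show ?thesis using ip_Cauchy_Schwarz[OF diffc F[OF g], of n] by simp
    qed
    moreover have "(\<lambda>n. nrm (\<lambda>x. h' n x - h x) * nrm g) \<longlonglongrightarrow> 0 * nrm g"
      by (intro tendsto_mult nrm_lim tendsto_const)
    ultimately have "\<bar>ip h g\<bar> \<le> 0 * nrm g" by (intro LIMSEQ_le_const) auto
    then show ?thesis by simp
  qed
  have hn0: "nrm (h' n) \<ge> 0" for n by (rule nrm_nonneg[OF Ec[OF h'E]])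
  \<comment> \<open>The norm of \<open>h' n\<close> is at least \<open>s - 1 / Suc n\<close>, while
    a vanishing limit would force these norms to 0.\<close>
  have nz: "\<exists>x\<in>carrier G. h x \<noteq> 0"
  proof (rule ccontr)
    assume "\<not> ?thesis"
    then have "nrm (\<lambda>x. h' n x - h x) = nrm (h' n)" for n
      unfolding nrm_def using ip_cong[OF Ec[OF h'E] Ec[OF h'E], of n "\<lambda>x. h' n x - h x" n "\<lambda>x. h' n x - h x"] by simp
    then have 1: "(\<lambda>n. nrm (h' n)) \<longlonglongrightarrow> 0" using nrm_lim by simp
    have "s - 1 / Suc n \<le> nrm (h' n)" for n
    proof -
      have "1 / Suc (r n) \<le> 1 / Suc n" using seq_suble[OF r, of n] by (simp add: field_simps)
      then show ?thesis using fs[of "r n"] by (simp add: h'_def)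
    qed
    moreover have "(\<lambda>n. s - 1 / Suc n) \<longlonglongrightarrow> s - 0"
      by (intro tendsto_diff tendsto_const LIMSEQ_Suc[OF lim_1_over_n])
    ultimately have "s - 0 \<le> 0" using 1 by (intro LIMSEQ_le[of "\<lambda>n. s - 1 / Suc n" _ "\<lambda>n. nrm (h' n)"]) auto
    then show False using s by simp
  qed
  \<comment> \<open>The defect of \<open>f (r n)\<close> as an eigenvector for \<open>s * s\<close>.
    Expanding its square and using \<open>nrm (K g) \<le> s * nrm g\<close> leaves at most
    \<open>s * s * (s * s - ip (h' n) (h' n))\<close>, which tends to 0.\<close>
  define D where "D n x = 1 * K (h' n) x + (- (s * s)) * f (r n) x" for n x
  have Kh'c: "cont (K (h' n))" for n by (rule cont_K[OF Ec[OF h'E]])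
  have Dc: "cont (D n)" for n
    unfolding D_def by (intro continuous_map_add continuous_map_real_mult_left Kh'c fc)
  have D_lim: "(\<lambda>n. nrm (D n)) \<longlonglongrightarrow> 0"
  proof -
    have bnd: "ip (D n) (D n) \<le> 2 * (s * s * s) * (1 / Suc n)" for n
    proof -
      have cross: "ip (K (h' n)) (f (r n)) = ip (h' n) (h' n)"
        using K_symmetric[OF Ec[OF h'E, of n] fc[of "r n"]] unfolding h'_def[symmetric] .
      have lin: "ip (D n) g = ip (K (h' n)) g - s * s * ip (f (r n)) g" if "cont g" for g
        using ip_linear_left[OF Kh'c[of n] fc[of "r n"] that, of 1 "- (s * s)"]
        unfolding D_def[abs_def, symmetric] by (simp add: D_def[abs_def])
      have a: "ip (K (h' n)) (D n) = ip (K (h' n)) (K (h' n)) - s * s * ip (h' n) (h' n)"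
        using lin[OF Kh'c[of n]] cross ip_commute[of "K (h' n)" "D n"]
          ip_commute[of "f (r n)" "K (h' n)"] by simp
      have b: "ip (f (r n)) (D n) = ip (h' n) (h' n) - s * s * ip (f (r n)) (f (r n))"
        using lin[OF fc[of "r n"]] cross ip_commute[of "f (r n)" "D n"] by simp
      have "ip (D n) (D n) = ip (K (h' n)) (D n) - s * s * ip (f (r n)) (D n)"
        by (rule lin[OF Dc])
      then have eq: "ip (D n) (D n) = ip (K (h' n)) (K (h' n)) - 2 * (s * s) * ip (h' n) (h' n)
          + s * s * (s * s) * ip (f (r n)) (f (r n))"
        unfolding a b by (simp add: algebra_simps)
      have "nrm (K (h' n)) * nrm (K (h' n)) \<le> (s * nrm (h' n)) * (s * nrm (h' n))"
        using le_s[OF h'E] s hn0 by (intro mult_mono nrm_nonneg Kh'c) simp_all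
      also have "\<dots> = s * s * (nrm (h' n) * nrm (h' n))" by (simp only: mult_ac)
      finally have 1: "ip (K (h' n)) (K (h' n)) \<le> s * s * ip (h' n) (h' n)"
        unfolding nrm_square[OF Kh'c] nrm_square[OF Ec[OF h'E]] .
      have "nrm (f (r n)) * nrm (f (r n)) \<le> 1 * 1"
        using f1 by (intro mult_mono nrm_nonneg fc) auto
      then have 2: "s * s * (s * s) * ip (f (r n)) (f (r n)) \<le> s * s * (s * s) * 1"
        using nrm_square[OF fc] s by (intro mult_left_mono) auto
      have "ip (D n) (D n) \<le> s * s * (s * s - ip (h' n) (h' n))"
        using eq 1 2 by (simp add: algebra_simps)
      also have "\<dots> \<le> s * s * (2 * s * (1 / Suc n))"
      proof (rule mult_left_mono)
        have hs: "nrm (h' n) \<le> s"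
        proof -
          have "nrm (h' n) \<le> s * nrm (f (r n))" using le_s[OF fE] by (simp add: h'_def)
          also have "\<dots> \<le> s * 1" using f1 s by (intro mult_left_mono) auto
          finally show ?thesis by simp
        qed
        have "1 / Suc (r n) \<le> 1 / Suc n" using seq_suble[OF r, of n] by (simp add: field_simps)
        then have d: "s - nrm (h' n) \<le> 1 / Suc n" using fs[of "r n"] by (simp add: h'_def)
        have "s * s - ip (h' n) (h' n) = (s + nrm (h' n)) * (s - nrm (h' n))"
          using nrm_square[OF Ec[OF h'E], of n] by (simp add: algebra_simps)
        also have "\<dots> \<le> (2 * s) * (1 / Suc n)"
          using d hs s hn0[of n] by (intro mult_mono) auto
        finally show "s * s - ip (h' n) (h' n) \<le> 2 * s * (1 / Suc n)" .
      qed (use s in simp)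
      finally show ?thesis by (simp add: mult_ac)
    qed
    have "(\<lambda>n. ip (D n) (D n)) \<longlonglongrightarrow> 0"
    proof (rule tendsto_sandwich[OF _ _ tendsto_const])
      show "\<forall>\<^sub>F n in sequentially. 0 \<le> ip (D n) (D n)" using ip_nonneg[OF Dc] by simp
      show "\<forall>\<^sub>F n in sequentially. ip (D n) (D n) \<le> 2 * (s * s * s) * (1 / Suc n)" using bnd by simp
      have "(\<lambda>n. 2 * (s * s * s) * (1 / Suc n)) \<longlonglongrightarrow> 2 * (s * s * s) * 0"
        by (intro tendsto_mult tendsto_const LIMSEQ_Suc[OF lim_1_over_n])
      then show "(\<lambda>n. 2 * (s * s * s) * (1 / Suc n)) \<longlonglongrightarrow> 0" by simp
    qed
    then have "(\<lambda>n. sqrt (ip (D n) (D n))) \<longlonglongrightarrow> sqrt 0" by (rule tendsto_real_sqrt)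
    then show ?thesis by (simp add: nrm_def)
  qed
  \<comment> \<open>Applying \<open>K\<close> once more to the defect replaces
    \<open>f (r n)\<close> by \<open>h' n\<close>, which does converge.\<close>
  have eig: "K (K h) x = s * s * h x" if x: "x \<in> carrier G" for x
  proof -
    have KD: "K (D n) x = K (K (h' n)) x - s * s * h' n x" for n
      using K_linear[OF Kh'c[of n] fc[of "r n"] x, of 1 "- (s * s)"] by (simp add: D_def[abs_def] h'_def)
    have 1: "(\<lambda>n. K (D n) x) \<longlonglongrightarrow> 0"
    proof (rule Lim_null_comparison)
      show "\<forall>\<^sub>F n in sequentially. norm (K (D n) x) \<le> B * nrm (D n)" using B(2)[OF Dc x] by simp
      show "(\<lambda>n. B * nrm (D n)) \<longlonglongrightarrow> 0" using tendsto_mult[OF tendsto_const[of B] D_lim] by simp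
    qed
    have dK: "K (\<lambda>x. h' n x - h x) y = K (h' n) y - K h y" if "y \<in> carrier G" for n y
      using K_linear[OF Ec[OF h'E[of n]] h that, of 1 "-1"] by simp
    have dKK: "K (K (\<lambda>x. h' n x - h x)) x = K (K (h' n)) x - K (K h) x" for n
    proof -
      have "K (K (\<lambda>x. h' n x - h x)) x = K (\<lambda>y. 1 * K (h' n) y + (-1) * K h y) x"
        using dK by (intro K_cong cont_K diffc x) auto
      also have "\<dots> = K (K (h' n)) x - K (K h) x"
        using K_linear[OF Kh'c[of n] cont_K[OF h] x, of 1 "-1"] by simp
      finally show ?thesis .
    qed
    have 2: "(\<lambda>n. K (K (h' n)) x) \<longlonglongrightarrow> K (K h) x"
    proof (rule LIM_zero_cancel, rule Lim_null_comparison)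
      have "\<bar>K (K (\<lambda>x. h' n x - h x)) x\<bar> \<le> B * (B * nrm (\<lambda>x. h' n x - h x))" for n
        by (rule order_trans[OF B(2)[OF cont_K[OF diffc] x] mult_left_mono[OF B(3)[OF diffc]]])
          (use B(1) in simp)
      then show "\<forall>\<^sub>F n in sequentially. norm (K (K (h' n)) x - K (K h) x) \<le> B * (B * nrm (\<lambda>x. h' n x - h x))"
        by (simp add: dKK)
      show "(\<lambda>n. B * (B * nrm (\<lambda>x. h' n x - h x))) \<longlonglongrightarrow> 0"
        using tendsto_mult[OF tendsto_const[of B] tendsto_mult[OF tendsto_const[of B] nrm_lim]] by simp
    qed
    have 3: "(\<lambda>n. h' n x) \<longlonglongrightarrow> h x"
    proof (rule LIMSEQ_I)
      fix e :: real assume e: "e > 0"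
      then obtain M where M: "\<forall>n\<ge>M. \<forall>x\<in>topspace T. \<bar>K (f (r n)) x - h x\<bar> \<le> e/2"
        using unif by (meson half_gt_zero)
      have "norm (h' n x - h x) < e" if "n \<ge> M" for n
      proof -
        have "\<bar>h' n x - h x\<bar> \<le> e/2" using M that x by (auto simp: h'_def topspace_eq)
        then show ?thesis using e by simp
      qed
      then show "\<exists>no. \<forall>n\<ge>no. norm (h' n x - h x) < e" by blast
    qed
    have "(\<lambda>n. K (D n) x) \<longlonglongrightarrow> K (K h) x - s * s * h x"
      unfolding KD by (intro tendsto_intros 2 3)
    from LIMSEQ_unique[OF this 1] show ?thesis by simp
  qed
  obtain x where "x \<in> carrier G" "h x \<noteq> 0" using nz by auto
  then have "cont h \<and> (\<forall>g\<in>F. ip h g = 0) \<and> s * s > 0 \<and>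
    (\<forall>x\<in>carrier G. K (K h) x = s * s * h x) \<and> x \<in> carrier G \<and> h x \<noteq> 0"
    using h hE eig s by simp
  then show ?thesis by - (rule exI[of _ h], rule exI[of _ "s * s"], rule exI[of _ x])
qed

end

section \<open>Separation of points by unitary representations\<close>

context symmetric_kernel
begin

section \<open>Eigenspaces of the squared convolution operator\<close>

text \<open>The square is taken because the extremal argument yields an eigenvector of the square,
  not directly one of \<open>K\<close>.\<close>

definition eigenspace :: "real \<Rightarrow> ('a \<Rightarrow> real) set" where
  "eigenspace c = {f. cont f \<and> (\<forall>x\<in>carrier G. K (K f) x = c * f x)}"

definition orthonormal_in :: "('a \<Rightarrow> real) set \<Rightarrow> nat \<Rightarrow> (nat \<Rightarrow> 'a \<Rightarrow> real) \<Rightarrow> bool" where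
  "orthonormal_in V d \<phi> \<longleftrightarrow> (\<forall>i<d. \<phi> i \<in> V) \<and>
     (\<forall>i<d. \<forall>j<d. ip (\<phi> i) (\<phi> j) = (if i = j then 1 else 0))"

lemma eigenspace_linear:
  assumes f: "f \<in> eigenspace c" and g: "g \<in> eigenspace c"
  shows "(\<lambda>x. a * f x + b * g x) \<in> eigenspace c"
proof -
  have fc: "cont f" "cont (K f)" and gc: "cont g" "cont (K g)"
    using f g by (auto simp: eigenspace_def cont_K)
  let ?h = "\<lambda>x. a * f x + b * g x"
  have h: "cont ?h" using fc gc by (intro continuous_map_add continuous_map_real_mult_left)
  have "K (K ?h) x = c * ?h x" if x: "x \<in> carrier G" for x
  proof -
    have "K (K ?h) x = K (\<lambda>x. a * K f x + b * K g x) x"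
      by (rule K_cong[OF cont_K[OF h] _ x]) (rule K_linear[OF fc(1) gc(1)])
    also have "\<dots> = a * K (K f) x + b * K (K g) x" by (rule K_linear[OF fc(2) gc(2) x])
    also have "\<dots> = c * ?h x" using f g x by (simp add: eigenspace_def algebra_simps)
    finally show ?thesis .
  qed
  then show ?thesis using h by (simp add: eigenspace_def)
qed

lemma eigenspace_translate:
  assumes f: "f \<in> eigenspace c" and a: "a \<in> carrier G"
  shows "(\<lambda>x. f (a \<otimes> x)) \<in> eigenspace c"
proof -
  have fc: "cont f" "cont (K f)" using f by (auto simp: eigenspace_def cont_K)
  let ?h = "\<lambda>x. f (a \<otimes> x)"
  have h: "cont ?h" by (rule continuous_map_translate[OF fc(1) a])
  have "K (K ?h) x = c * ?h x" if x: "x \<in> carrier G" for x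
  proof -
    have "K (K ?h) x = K (\<lambda>x. K f (a \<otimes> x)) x"
      by (rule K_cong[OF cont_K[OF h] _ x]) (rule K_left_translate[OF fc(1) a])
    also have "\<dots> = K (K f) (a \<otimes> x)" by (rule K_left_translate[OF fc(2) a x])
    also have "\<dots> = c * ?h x" using f x a by (simp add: eigenspace_def)
    finally show ?thesis .
  qed
  then show ?thesis using h by (simp add: eigenspace_def)
qed

text \<open>The Hilbert--Schmidt count. For each \<open>x\<close> the number
  \<open>c * \<phi> i x\<close> is the coefficient at \<open>\<phi> i\<close> of \<open>K\<close>
  applied to the kernel slice of \<open>x\<close>, so Bessel's inequality bounds the sum of the
  squares by \<open>(B * B)\<^sup>2\<close>. Taking the mean over \<open>x\<close> turns this sum
  into \<open>c\<^sup>2 * d\<close>.\<close>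

lemma orthonormal_in_eigenspace_bounded:
  assumes "c > 0"
  obtains C where "\<And>d \<phi>. orthonormal_in (eigenspace c) d \<phi> \<Longrightarrow> real d \<le> C"
proof -
  obtain B where B: "B > 0" "\<And>f. cont f \<Longrightarrow> nrm (K f) \<le> B * nrm f"
    "\<And>x. x \<in> carrier G \<Longrightarrow> nrm (\<lambda>y. k (inv x \<otimes> y)) \<le> B"
    using K_bound by metis
  have "real d \<le> (B * B)\<^sup>2 / c\<^sup>2" if o: "orthonormal_in (eigenspace c) d \<phi>" for d \<phi>
  proof -
    have \<phi>: "cont (\<phi> i)" "\<And>x. x \<in> carrier G \<Longrightarrow> K (K (\<phi> i)) x = c * \<phi> i x" if "i < d" for i
      using o that by (auto simp: orthonormal_in_def eigenspace_def)
    have sq: "cont (\<lambda>x. (c * \<phi> i x)\<^sup>2)" if "i < d" for i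
      using \<phi>(1)[OF that] unfolding power2_eq_square
      by (intro continuous_map_real_mult continuous_map_real_mult_left)
    have pt: "(\<Sum>i<d. (c * \<phi> i x)\<^sup>2) \<le> (B * B)\<^sup>2" if x: "x \<in> carrier G" for x
    proof -
      let ?k = "\<lambda>y. k (inv x \<otimes> y)"
      have kc: "cont ?k" "cont (K ?k)" using cont_slice[OF x] by (auto simp: cont_K)
      have eq: "c * \<phi> i x = ip (\<phi> i) (K ?k)" if "i < d" for i
      proof -
        have "ip (\<phi> i) (K ?k) = ip (K (\<phi> i)) ?k" using K_symmetric[OF \<phi>(1)[OF that] kc(1)] by simp
        also have "\<dots> = K (K (\<phi> i)) x" by (simp add: K_def[of "K (\<phi> i)"] ip_commute[of "K (\<phi> i)" ?k])
        finally show ?thesis using \<phi>(2)[OF that x] by simp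
      qed
      have "(\<Sum>i<d. (c * \<phi> i x)\<^sup>2) = (\<Sum>i<d. (ip (\<phi> i) (K ?k))\<^sup>2)" using eq by simp
      also have "\<dots> \<le> ip (K ?k) (K ?k)"
        using o by (intro ip_Bessel \<phi>(1) kc) (auto simp: orthonormal_in_def)
      also have "\<dots> = nrm (K ?k) * nrm (K ?k)" by (rule nrm_square[OF kc(2), symmetric])
      also have "\<dots> \<le> (B * B) * (B * B)"
      proof -
        have "nrm (K ?k) \<le> B * nrm ?k" by (rule B(2)[OF kc(1)])
        also have "\<dots> \<le> B * B" using B(3)[OF x] B(1) by (intro mult_left_mono) auto
        finally show ?thesis using B(1) by (intro mult_mono nrm_nonneg kc) auto
      qed
      finally show ?thesis by (simp add: power2_eq_square)
    qed
    have "c\<^sup>2 * real d = (\<Sum>i<d. c\<^sup>2 * ip (\<phi> i) (\<phi> i))" using o by (simp add: orthonormal_in_def)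
    also have "\<dots> = (\<Sum>i<d. haar (\<lambda>x. (c * \<phi> i x)\<^sup>2))"
    proof (rule sum.cong[OF refl])
      fix i assume "i \<in> {..<d}"
      then have "cont (\<lambda>x. \<phi> i x * \<phi> i x)" using \<phi>(1) by (intro continuous_map_real_mult) auto
      from haar_cmult[OF this, of "c\<^sup>2"] show "c\<^sup>2 * ip (\<phi> i) (\<phi> i) = haar (\<lambda>x. (c * \<phi> i x)\<^sup>2)"
        by (simp add: ip_def power2_eq_square mult_ac)
    qed
    also have "\<dots> = haar (\<lambda>x. \<Sum>i<d. (c * \<phi> i x)\<^sup>2)" using sq by (intro haar_sum[symmetric]) auto
    also have "\<dots> \<le> haar (\<lambda>x. (B * B)\<^sup>2)"
      using sq pt by (intro haar_mono continuous_map_sum) auto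
    also have "\<dots> = (B * B)\<^sup>2" by (rule haar_const)
    finally show ?thesis using assms by (simp add: field_simps)
  qed
  then show thesis using that by blast
qed

text \<open>The bound on orthonormal families allows one of maximal size to be chosen. A nonzero
  remainder of the expansion of \<open>f\<close> could be normalised and added to it.\<close>

lemma eigenspace_basis:
  assumes c: "c > 0"
  shows "\<exists>d \<phi>. orthonormal_in (eigenspace c) d \<phi> \<and>
    (\<forall>f\<in>eigenspace c. \<forall>x\<in>carrier G. f x = (\<Sum>i<d. ip (\<phi> i) f * \<phi> i x))"
proof -
  obtain C where C: "\<And>d \<phi>. orthonormal_in (eigenspace c) d \<phi> \<Longrightarrow> real d \<le> C"
    using orthonormal_in_eigenspace_bounded[OF c] by metis
  define P where "P d \<longleftrightarrow> (\<exists>\<phi>. orthonormal_in (eigenspace c) d \<phi>)" for d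
  have "P 0" by (simp add: P_def orthonormal_in_def)
  moreover have "\<forall>d. P d \<longrightarrow> d \<le> nat \<lceil>C\<rceil>"
  proof (intro allI impI)
    fix d assume "P d"
    then have "real d \<le> C" using C by (auto simp: P_def)
    then show "d \<le> nat \<lceil>C\<rceil>" by linarith
  qed
  ultimately obtain d where d: "P d" and max: "\<And>d'. P d' \<Longrightarrow> d' \<le> d"
    using Nat.ex_has_greatest_nat[of P 0 "nat \<lceil>C\<rceil>"] by blast
  obtain \<phi> where o: "orthonormal_in (eigenspace c) d \<phi>" using d by (auto simp: P_def)
  have \<phi>: "\<phi> i \<in> eigenspace c" "cont (\<phi> i)" if "i < d" for i
    using o that by (auto simp: orthonormal_in_def eigenspace_def)
  have exp: "f x = (\<Sum>i<d. ip (\<phi> i) f * \<phi> i x)" if f: "f \<in> eigenspace c" and x: "x \<in> carrier G" for f x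
  proof (rule ccontr)
    assume ne: "f x \<noteq> (\<Sum>i<d. ip (\<phi> i) f * \<phi> i x)"
    have fc: "cont f" using f by (simp add: eigenspace_def)
    have partial: "(\<lambda>x. \<Sum>i<m. ip (\<phi> i) f * \<phi> i x) \<in> eigenspace c" if "m \<le> d" for m
      using that
    proof (induction m)
      case 0
      show ?case using eigenspace_linear[OF f f, of 0 0] by simp
    next
      case (Suc m)
      then show ?case
        using eigenspace_linear[OF Suc.IH \<phi>(1)[of m], of 1 "ip (\<phi> m) f"] by simp
    qed
    define p where "p x = (\<Sum>i<d. ip (\<phi> i) f * \<phi> i x)" for x
    define r where "r x = f x - p x" for x
    have pV: "p \<in> eigenspace c" using partial[of d] by (simp add: p_def[abs_def])
    then have pc: "cont p" by (simp add: eigenspace_def)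
    have rV: "r \<in> eigenspace c" using eigenspace_linear[OF f pV, of 1 "-1"] by (simp add: r_def[abs_def])
    then have rc: "cont r" by (simp add: eigenspace_def)
    have r\<phi>: "ip r (\<phi> j) = 0" if j: "j < d" for j
    proof -
      have "ip p (\<phi> j) = (\<Sum>i<d. ip (\<phi> i) f * ip (\<phi> i) (\<phi> j))"
        unfolding p_def using \<phi> j by (subst ip_sum_left) auto
      also have "\<dots> = (\<Sum>i<d. if i = j then ip (\<phi> i) f else 0)"
        using o j by (intro sum.cong) (auto simp: orthonormal_in_def)
      also have "\<dots> = ip (\<phi> j) f" using j by simp
      finally have "ip p (\<phi> j) = ip (\<phi> j) f" .
      then show ?thesis
        using ip_diff_left[OF fc pc \<phi>(2)[OF j]] by (simp add: r_def[abs_def] ip_commute[of f])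
    qed
    have "ip r r \<noteq> 0" using ip_eq_0D[OF rc _ x] ne by (auto simp: r_def p_def)
    then have nr: "nrm r > 0" using ip_nonneg[OF rc] by (simp add: nrm_def)
    define u where "u x = (1 / nrm r) * r x" for x
    have uV: "u \<in> eigenspace c" using eigenspace_linear[OF rV rV, of "1 / nrm r" 0] by (simp add: u_def[abs_def])
    then have uc: "cont u" by (simp add: eigenspace_def)
    have u\<phi>: "ip u (\<phi> j) = 0" if "j < d" for j
      using ip_scale_left[OF rc \<phi>(2)[OF that], of "1 / nrm r"] r\<phi>[OF that] by (simp add: u_def[abs_def])
    have "nrm u = 1" using nrm_scale[OF rc, of "1 / nrm r"] nr by (simp add: u_def[abs_def])
    then have uu: "ip u u = 1" using nrm_square[OF uc] by simp
    have "orthonormal_in (eigenspace c) (Suc d) (\<phi>(d := u))"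
      unfolding orthonormal_in_def
    proof (intro conjI allI impI)
      have \<phi>u: "ip (\<phi> j) u = 0" if "j < d" for j using u\<phi>[OF that] by (simp add: ip_commute)
      fix i assume i: "i < Suc d"
      show "(\<phi>(d := u)) i \<in> eigenspace c" using i uV \<phi>(1) by (cases "i = d") auto
      fix j assume j: "j < Suc d"
      show "ip ((\<phi>(d := u)) i) ((\<phi>(d := u)) j) = (if i = j then 1 else 0)"
        using i j u\<phi> \<phi>u uu o by (cases "i = d"; cases "j = d") (auto simp: orthonormal_in_def)
    qed
    then have "Suc d \<le> d" by (intro max) (auto simp: P_def)
    then show False by simp
  qed
  have "orthonormal_in (eigenspace c) d \<phi> \<and> (\<forall>f\<in>eigenspace c. \<forall>x\<in>carrier G. f x = (\<Sum>i<d. ip (\<phi> i) f * \<phi> i x))"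
    using o exp by simp
  then show ?thesis by - (rule exI[of _ d], rule exI[of _ \<phi>])
qed

text \<open>Left translations preserve the eigenspace and the inner product, so their matrices in an
  orthonormal basis are unitary; translating by \<open>inv g\<close> makes the assignment
  multiplicative. Continuity of the entries is that of a mean depending on a parameter.\<close>

lemma eigenspace_rep:
  assumes c: "c > 0"
  shows "\<exists>d \<phi>. orthonormal_in (eigenspace c) d \<phi> \<and>
    (\<forall>f\<in>eigenspace c. \<forall>x\<in>carrier G. f x = (\<Sum>i<d. ip (\<phi> i) f * \<phi> i x)) \<and>
    unitary_rep G T d (\<lambda>g. mat d d (\<lambda>(i, j). complex_of_real (ip (\<phi> i) (\<lambda>x. \<phi> j (inv g \<otimes> x)))))"
proof -
  obtain d \<phi> where "orthonormal_in (eigenspace c) d \<phi> \<and>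
    (\<forall>f\<in>eigenspace c. \<forall>x\<in>carrier G. f x = (\<Sum>i<d. ip (\<phi> i) f * \<phi> i x))"
    using eigenspace_basis[OF c] by (elim exE)
  then have o: "orthonormal_in (eigenspace c) d \<phi>"
    and exp: "\<And>f x. f \<in> eigenspace c \<Longrightarrow> x \<in> carrier G \<Longrightarrow> f x = (\<Sum>i<d. ip (\<phi> i) f * \<phi> i x)"
    by simp_all
  define u where "u i j g = ip (\<phi> i) (\<lambda>x. \<phi> j (inv g \<otimes> x))" for i j g
  have \<phi>: "\<phi> i \<in> eigenspace c" "cont (\<phi> i)" if "i < d" for i
    using o that by (auto simp: orthonormal_in_def eigenspace_def)
  have orth: "ip (\<phi> i) (\<phi> j) = (if i = j then 1 else 0)" if "i < d" "j < d" for i j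
    using o that by (auto simp: orthonormal_in_def)
  have trans: "\<phi> j (inv g \<otimes> x) = (\<Sum>i<d. u i j g * \<phi> i x)"
    if "j < d" "g \<in> carrier G" "x \<in> carrier G" for j g x
    using exp[OF eigenspace_translate[OF \<phi>(1)[OF that(1)] inv_closed[OF that(2)]] that(3)]
    by (simp add: u_def)
  have ct: "cont (\<lambda>x. \<phi> j (inv g \<otimes> x))" if "j < d" "g \<in> carrier G" for j g
    using that by (intro continuous_map_translate \<phi>) auto
  have coef: "ip (\<lambda>x. \<Sum>i<d. a i * \<phi> i x) (\<phi> m) = a m" if "m < d" for a m
  proof -
    have "ip (\<lambda>x. \<Sum>i<d. a i * \<phi> i x) (\<phi> m) = (\<Sum>i<d. a i * ip (\<phi> i) (\<phi> m))"
      using \<phi> that by (subst ip_sum_left) auto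
    also have "\<dots> = (\<Sum>i<d. if i = m then a i else 0)" using orth that by (intro sum.cong) auto
    finally show ?thesis using that by simp
  qed
  have hom: "u m j (g \<otimes> h) = (\<Sum>i<d. u m i g * u i j h)"
    if m: "m < d" and j: "j < d" and g: "g \<in> carrier G" and h: "h \<in> carrier G" for m j g h
  proof -
    have "\<phi> j (inv (g \<otimes> h) \<otimes> x) = (\<Sum>l<d. (\<Sum>i<d. u l i g * u i j h) * \<phi> l x)"
      if x: "x \<in> carrier G" for x
    proof -
      have "\<phi> j (inv (g \<otimes> h) \<otimes> x) = \<phi> j (inv h \<otimes> (inv g \<otimes> x))"
        using g h x by (simp add: inv_mult_group m_assoc)
      also have "\<dots> = (\<Sum>i<d. u i j h * \<phi> i (inv g \<otimes> x))" using j g h x by (intro trans) auto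
      also have "\<dots> = (\<Sum>i<d. u i j h * (\<Sum>l<d. u l i g * \<phi> l x))"
        using g x by (intro sum.cong) (auto simp: trans)
      also have "\<dots> = (\<Sum>l<d. (\<Sum>i<d. u l i g * u i j h) * \<phi> l x)"
        unfolding sum_distrib_left sum_distrib_right by (subst sum.swap) (simp add: mult_ac)
      finally show ?thesis .
    qed
    then have "u m j (g \<otimes> h) = ip (\<phi> m) (\<lambda>x. \<Sum>l<d. (\<Sum>i<d. u l i g * u i j h) * \<phi> l x)"
      unfolding u_def[of m j] using m j g h by (intro ip_cong ct \<phi>) auto
    then show ?thesis using coef[OF m] by (simp add: ip_commute[of "\<phi> m"])
  qed
  have unit: "(\<Sum>m<d. u m i g * u m j g) = (if i = j then 1 else 0)"
    if i: "i < d" and j: "j < d" and g: "g \<in> carrier G" for i j g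
  proof -
    let ?i = "\<lambda>x. \<phi> i (inv g \<otimes> x)" and ?j = "\<lambda>x. \<phi> j (inv g \<otimes> x)"
    have "ip ?i ?j = ip (\<lambda>x. \<Sum>m<d. u m i g * \<phi> m x) ?j"
      using i j g by (intro ip_cong ct) (auto simp: trans)
    also have "\<dots> = (\<Sum>m<d. u m i g * u m j g)"
      using \<phi> ct[OF j g] by (subst ip_sum_left) (auto simp: u_def)
    finally show ?thesis
      using ip_left_translate[OF \<phi>(2)[OF i] \<phi>(2)[OF j], of "inv g"] orth[OF i j] g by simp
  qed
  have uc: "cont (u i j)" if "i < d" "j < d" for i j
  proof -
    have "continuous_map (prod_topology T T) euclideanreal (\<lambda>p. \<phi> j (inv (snd p) \<otimes> fst p))"
      using continuous_map_compose[OF continuous_map_mult[OF continuous_map_m_inv[OF continuous_map_snd[of T T]]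
        continuous_map_fst[of T T]] \<phi>(2)[OF that(2)]] by (simp add: o_def)
    from continuous_map_haar_param(1)[OF continuous_map_real_mult[OF cont_prod_fst[OF \<phi>(2)[OF that(1)]] this]]
    show ?thesis by (simp add: u_def[abs_def] ip_def)
  qed
  let ?U = "\<lambda>g. mat d d (\<lambda>(i, j). complex_of_real (u i j g))"
  have rep: "unitary_rep G T d ?U"
    unfolding unitary_rep_def unitary_mat_def
  proof (intro conjI ballI allI impI)
    fix g assume g: "g \<in> carrier G"
    show "?U g \<in> carrier_mat d d" by simp
    show "mat_adjoint (?U g) * ?U g = 1\<^sub>m d"
    proof (rule eq_matI)
      fix i j assume "i < dim_row (1\<^sub>m d :: complex mat)" "j < dim_col (1\<^sub>m d :: complex mat)"
      then have ij: "i < d" "j < d" by auto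
      have "(mat_adjoint (?U g) * ?U g) $$ (i, j) = (\<Sum>m<d. complex_of_real (u m i g * u m j g))"
        using ij by (simp add: mat_adjoint_def mat_of_rows_def scalar_prod_def atLeast0LessThan)
      also have "\<dots> = complex_of_real (if i = j then 1 else 0)"
        unfolding unit[OF ij g, symmetric] by simp
      finally show "(mat_adjoint (?U g) * ?U g) $$ (i, j) = 1\<^sub>m d $$ (i, j)" using ij by simp
    qed (auto simp: mat_adjoint_def)
    fix h assume h: "h \<in> carrier G"
    show "?U (g \<otimes> h) = ?U g * ?U h"
      using hom[OF _ _ g h] by (intro eq_matI) (auto simp: scalar_prod_def atLeast0LessThan)
  next
    fix i j assume ij: "i < d" "j < d"
    have "continuous_map T euclidean (\<lambda>g. complex_of_real (u i j g))"
      by (rule continuous_map_compose_continuous_on[OF uc[OF ij]]) (intro continuous_intros)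
    then show "continuous_map T euclidean (\<lambda>g. ?U g $$ (i, j))" using ij by simp
  qed
  have "orthonormal_in (eigenspace c) d \<phi> \<and> (\<forall>f\<in>eigenspace c. \<forall>x\<in>carrier G. f x = (\<Sum>i<d. ip (\<phi> i) f * \<phi> i x)) \<and>
    unitary_rep G T d ?U" using o exp rep by simp
  then show ?thesis unfolding u_def by - (rule exI[of _ d], rule exI[of _ \<phi>])
qed

end

context compact_group
begin

text \<open>If \<open>g0\<close> acted trivially in every representation, each eigenspace with
  positive eigenvalue would consist of functions fixed by \<open>g0\<close>. The kernel is built so
  that some nonzero eigenfunction is orthogonal to all fixed functions, which is then
  impossible.\<close>

theorem unitary_rep_separates:
  assumes g0: "g0 \<in> carrier G" "g0 \<noteq> \<one>"
  shows "\<exists>n U. unitary_rep G T n U \<and> U g0 \<noteq> 1\<^sub>m n"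
proof (rule ccontr)
  assume "\<not> ?thesis"
  then have triv: "U g0 = 1\<^sub>m n" if "unitary_rep G T n U" for n U using that by blast
  have ig0: "inv g0 \<in> carrier G" "inv g0 \<noteq> \<one>" using g0 by auto
  obtain h0 where h0: "cont h0" "h0 \<one> \<noteq> h0 (inv g0)"
  proof -
    have "normal_space T" using compact_Hausdorff_or_regular_imp_normal_space compact Hausdorff by blast
    moreover have "closedin T {\<one>}" "closedin T {inv g0}"
      using closedin_Hausdorff_singleton[OF Hausdorff] ig0 by (auto simp: topspace_eq)
    moreover have "disjnt {\<one>} {inv g0}" using ig0 by auto
    ultimately obtain h where "cont h" "h ` {\<one>} \<subseteq> {0}" "h ` {inv g0} \<subseteq> {1}"
      using Urysohn_lemma_alt[of T "{\<one>}" "{inv g0}" 0 1] by metis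
    then show thesis using that[of h] by auto
  qed
  define L where "L f = (\<lambda>x. f (inv g0 \<otimes> x))" for f :: "'a \<Rightarrow> real"
  have Lc: "cont (L f)" if "cont f" for f unfolding L_def by (rule continuous_map_translate[OF that ig0(1)])
  \<comment> \<open>The representation on an eigenspace translates by \<open>inv g\<close>, so the
    functions fixed by \<open>g0\<close> are those invariant under translation by
    \<open>inv g0\<close>.\<close>
  define F where "F = {g. cont g \<and> (\<forall>x\<in>carrier G. g (inv g0 \<otimes> x) = g x)}"
  \<comment> \<open>Translation by \<open>inv g0\<close> is an isometry that fixes the members of
    \<open>F\<close>. Hence \<open>h0\<close> and its translate have the same inner products with
    \<open>F\<close>, and their difference is orthogonal to it.\<close>
  define f1 where "f1 x = h0 x - L h0 x" for x
  have f1c: "cont f1" unfolding f1_def by (intro continuous_map_diff Lc h0)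
  have f1F: "ip f1 g = 0" if g: "g \<in> F" for g
  proof -
    have gc: "cont g" using g by (simp add: F_def)
    have "ip f1 g = ip h0 g - ip (L h0) g" unfolding f1_def[abs_def] by (rule ip_diff_left[OF h0(1) Lc[OF h0(1)] gc])
    also have "ip (L h0) g = ip (L h0) (L g)"
      using g by (intro ip_cong Lc h0 gc) (auto simp: F_def L_def)
    also have "\<dots> = ip h0 g" unfolding L_def by (rule ip_left_translate[OF h0(1) gc ig0(1)])
    finally show ?thesis by simp
  qed
  have "f1 \<one> \<noteq> 0" using h0 ig0 by (simp add: f1_def L_def)
  define f0 where "f0 x = sgn (f1 \<one>) * f1 x" for x
  have f0c: "cont f0" unfolding f0_def by (intro continuous_map_real_mult_left f1c)
  have f0F: "ip f0 g = 0" if "g \<in> F" for g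
    using ip_scale_left[OF f1c, of g "sgn (f1 \<one>)"] f1F[OF that] that by (simp add: f0_def[abs_def] F_def)
  have f0pos: "f0 \<one> > 0" using \<open>f1 \<one> \<noteq> 0\<close> by (simp add: f0_def sgn_if)
  \<comment> \<open>\<open>k0\<close> vanishes where \<open>f0\<close> is at most half of its value
    at \<open>\<one>\<close>, so the integrand of \<open>K f0 \<one>\<close> is nonnegative and
    positive at \<open>\<one>\<close>. In \<open>k\<close> the factor \<open>k0 (inv x)\<close>
    provides the symmetry.\<close>
  define k0 where "k0 x = max 0 (f0 x - f0 \<one> / 2)" for x
  define k where "k x = k0 x * k0 (inv x)" for x
  have k0c: "cont k0" unfolding k0_def by (intro continuous_map_real_max continuous_map_diff f0c) auto
  have kc: "cont k"
    unfolding k_def using continuous_map_compose[OF continuous_inv k0c]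
    by (intro continuous_map_real_mult k0c) (simp add: o_def)
  interpret symmetric_kernel G T k
    by unfold_locales (auto simp: kc k_def)
  have KF: "K g \<in> F" if g: "g \<in> F" for g
  proof -
    have gc: "cont g" using g by (simp add: F_def)
    have "K g (inv g0 \<otimes> x) = K g x" if x: "x \<in> carrier G" for x
    proof -
      have "K g (inv g0 \<otimes> x) = K (\<lambda>x. g (inv g0 \<otimes> x)) x"
        by (rule K_left_translate[OF gc ig0(1) x, symmetric])
      also have "\<dots> = K g x"
        using g by (intro K_cong[symmetric] gc x) (auto simp: F_def)
      finally show ?thesis .
    qed
    then show ?thesis using cont_K[OF gc] by (simp add: F_def)
  qed
  have "K f0 \<one> > 0"
  proof -
    have "0 < haar (\<lambda>y. k (inv \<one> \<otimes> y) * f0 y)"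
    proof (rule haar_pos[of _ \<one>])
      show "cont (\<lambda>y. k (inv \<one> \<otimes> y) * f0 y)" by (intro continuous_map_real_mult cont_slice f0c) simp
      show "0 \<le> k (inv \<one> \<otimes> x) * f0 x" if "x \<in> carrier G" for x
        using that f0pos by (cases "f0 x > f0 \<one> / 2") (auto simp: k_def k0_def intro!: mult_nonneg_nonneg)
      show "0 < k (inv \<one> \<otimes> \<one>) * f0 \<one>" using f0pos by (simp add: k_def k0_def)
    qed simp
    then show ?thesis by (simp add: K_def ip_def)
  qed
  then have Kf0: "K f0 \<one> \<noteq> 0" by simp
  have Fc: "cont g" if "g \<in> F" for g using that by (simp add: F_def)
  have "\<exists>h c x. cont h \<and> (\<forall>g\<in>F. ip h g = 0) \<and> c > 0 \<and>
    (\<forall>x\<in>carrier G. K (K h) x = c * h x) \<and> x \<in> carrier G \<and> h x \<noteq> 0"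
    by (rule top_eigenvector[OF _ _ f0c _ one_closed Kf0]) (simp_all add: Fc KF f0F)
  then obtain h c x where "cont h \<and> (\<forall>g\<in>F. ip h g = 0) \<and> c > 0 \<and>
    (\<forall>x\<in>carrier G. K (K h) x = c * h x) \<and> x \<in> carrier G \<and> h x \<noteq> 0"
    by (elim exE)
  then have h: "cont h" "\<And>g. g \<in> F \<Longrightarrow> ip h g = 0" "c > 0"
    "\<And>x. x \<in> carrier G \<Longrightarrow> K (K h) x = c * h x" and x: "x \<in> carrier G" "h x \<noteq> 0"
    by simp_all
  have hV: "h \<in> eigenspace c" using h by (simp add: eigenspace_def)
  obtain d \<phi> where "orthonormal_in (eigenspace c) d \<phi> \<and>
    (\<forall>f\<in>eigenspace c. \<forall>x\<in>carrier G. f x = (\<Sum>i<d. ip (\<phi> i) f * \<phi> i x)) \<and>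
    unitary_rep G T d (\<lambda>g. mat d d (\<lambda>(i, j). complex_of_real (ip (\<phi> i) (\<lambda>x. \<phi> j (inv g \<otimes> x)))))"
    using eigenspace_rep[OF h(3)] by (elim exE)
  then have o: "orthonormal_in (eigenspace c) d \<phi>"
    and exp: "\<And>f x. f \<in> eigenspace c \<Longrightarrow> x \<in> carrier G \<Longrightarrow> f x = (\<Sum>i<d. ip (\<phi> i) f * \<phi> i x)"
    and rep: "unitary_rep G T d (\<lambda>g. mat d d (\<lambda>(i, j). complex_of_real (ip (\<phi> i) (\<lambda>x. \<phi> j (inv g \<otimes> x)))))"
    by simp_all
  have ident: "ip (\<phi> i) (\<lambda>x. \<phi> j (inv g0 \<otimes> x)) = (if i = j then 1 else 0)" if "i < d" "j < d" for i j
    using arg_cong[OF triv[OF rep], of "\<lambda>A. A $$ (i, j)"] that by (simp split: if_splits)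
  have \<phi>fix: "\<phi> j (inv g0 \<otimes> y) = \<phi> j y" if j: "j < d" and y: "y \<in> carrier G" for j y
  proof -
    have "\<phi> j \<in> eigenspace c" using o j by (simp add: orthonormal_in_def)
    from exp[OF eigenspace_translate[OF this ig0(1)] y]
    have "\<phi> j (inv g0 \<otimes> y) = (\<Sum>i<d. ip (\<phi> i) (\<lambda>x. \<phi> j (inv g0 \<otimes> x)) * \<phi> i y)" .
    also have "\<dots> = (\<Sum>i<d. if i = j then \<phi> i y else 0)"
      using j ident by (intro sum.cong) auto
    finally have "\<phi> j (inv g0 \<otimes> y) = (\<Sum>i<d. if i = j then \<phi> i y else 0)" .
    then show ?thesis using j by simp
  qed
  have "h (inv g0 \<otimes> y) = h y" if "y \<in> carrier G" for y
    using exp[OF hV, of "inv g0 \<otimes> y"] exp[OF hV that] \<phi>fix[OF _ that] that ig0(1) by simp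
  \<comment> \<open>Now \<open>h\<close> belongs both to \<open>F\<close> and to the orthogonal
    complement of \<open>F\<close>.\<close>
  then have "h \<in> F" using h(1) by (simp add: F_def)
  then have "ip h h = 0" by (rule h(2))
  then show False using ip_eq_0D[OF h(1) _ x(1)] x(2) by simp
qed

end

section \<open>Unitary representations\<close>

lemma mat_adjoint_index [simp]:
  "i < dim_col A \<Longrightarrow> j < dim_row A \<Longrightarrow> mat_adjoint A $$ (i, j) = conjugate (A $$ (j, i))"
  by (simp add: mat_adjoint_def mat_of_rows_def)

lemma mat_adjoint_dim [simp]:
  "dim_row (mat_adjoint A) = dim_col A" "dim_col (mat_adjoint A) = dim_row A"
  by (simp_all add: mat_adjoint_def)

lemma mat_adjoint_carrier: "A \<in> carrier_mat n m \<Longrightarrow> mat_adjoint A \<in> carrier_mat m n"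
  by (intro carrier_matI) auto

lemma mat_adjoint_entry:
  "A \<in> carrier_mat n m \<Longrightarrow> i < m \<Longrightarrow> j < n \<Longrightarrow> mat_adjoint A $$ (i, j) = cnj (A $$ (j, i))"
  by simp

lemma mat_adjoint_adjoint [simp]: "mat_adjoint (mat_adjoint A) = (A :: complex mat)"
  by (rule eq_matI) auto

lemma mat_adjoint_one [simp]: "mat_adjoint (1\<^sub>m n) = (1\<^sub>m n :: complex mat)"
  by (rule eq_matI) auto

lemma mat_adjoint_smult: "mat_adjoint (c \<cdot>\<^sub>m A) = cnj c \<cdot>\<^sub>m mat_adjoint (A :: complex mat)"
  by (rule eq_matI) auto

lemma mat_mult_index:
  assumes "A \<in> carrier_mat n k" "B \<in> carrier_mat k m" "i < n" "j < m"
  shows "(A * B) $$ (i, j) = (\<Sum>l<k. A $$ (i, l) * B $$ (l, j))"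
  using assms by (auto simp: scalar_prod_def atLeast0LessThan intro!: sum.cong)

lemma mat_adjoint_mult:
  fixes A B :: "complex mat"
  assumes A: "A \<in> carrier_mat n k" and B: "B \<in> carrier_mat k m"
  shows "mat_adjoint (A * B) = mat_adjoint B * mat_adjoint A"
proof (rule eq_matI)
  fix i j assume "i < dim_row (mat_adjoint B * mat_adjoint A)" "j < dim_col (mat_adjoint B * mat_adjoint A)"
  then have ij: "i < m" "j < n" using A B by auto
  have AB: "A * B \<in> carrier_mat n m" using A B by simp
  have "mat_adjoint (A * B) $$ (i, j) = cnj ((A * B) $$ (j, i))" by (rule mat_adjoint_entry[OF AB ij])
  also have "\<dots> = (\<Sum>l<k. cnj (A $$ (j, l)) * cnj (B $$ (l, i)))"
    using mat_mult_index[OF A B ij(2,1)] by simp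
  also have "\<dots> = (\<Sum>l<k. mat_adjoint B $$ (i, l) * mat_adjoint A $$ (l, j))"
    using A B ij by (intro sum.cong) (auto simp: mat_adjoint_entry mult.commute)
  also have "\<dots> = (mat_adjoint B * mat_adjoint A) $$ (i, j)"
    using mat_mult_index[OF mat_adjoint_carrier[OF B] mat_adjoint_carrier[OF A] ij] by simp
  finally show "mat_adjoint (A * B) $$ (i, j) = (mat_adjoint B * mat_adjoint A) $$ (i, j)" .
qed (use A B in auto)

lemma unitary_matD:
  assumes "unitary_mat n S"
  shows "S \<in> carrier_mat n n" "mat_adjoint S \<in> carrier_mat n n"
    "mat_adjoint S * S = 1\<^sub>m n" "S * mat_adjoint S = 1\<^sub>m n"
proof -
  show S: "S \<in> carrier_mat n n" and SS: "mat_adjoint S * S = 1\<^sub>m n"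
    using assms by (auto simp: unitary_mat_def)
  show Sa: "mat_adjoint S \<in> carrier_mat n n" using S by (rule mat_adjoint_carrier)
  show "S * mat_adjoint S = 1\<^sub>m n" by (rule mat_mult_left_right_inverse[OF Sa S SS])
qed

lemma unitary_mat_adjoint: "unitary_mat n S \<Longrightarrow> unitary_mat n (mat_adjoint S)"
  by (simp add: unitary_mat_def[of n "mat_adjoint S"] unitary_matD)

lemma unitary_mat_mult:
  assumes "unitary_mat n R" "unitary_mat n S"
  shows "unitary_mat n (R * S)"
proof -
  note R = unitary_matD[OF assms(1)] and S = unitary_matD[OF assms(2)]
  have "mat_adjoint S * mat_adjoint R * (R * S) = mat_adjoint S * (mat_adjoint R * R) * S"
    using R(1,2) S(1,2) by (simp add: assoc_mult_mat[of _ n n _ n _ n])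
  also have "\<dots> = 1\<^sub>m n" using R S by simp
  finally show ?thesis
    using mat_adjoint_mult[OF R(1) S(1)] R(1) S(1) by (simp add: unitary_mat_def)
qed

lemma unitary_mat_one: "unitary_mat n (1\<^sub>m n)"
  by (simp add: unitary_mat_def)

section \<open>Unitary representations and their equivalence\<close>

lemma unitary_repD:
  assumes "unitary_rep G T n U" "g \<in> carrier G"
  shows "U g \<in> carrier_mat n n" "unitary_mat n (U g)"
  using assms by (auto simp: unitary_rep_def unitary_mat_def)

lemma unitary_rep_mult:
  "unitary_rep G T n U \<Longrightarrow> g \<in> carrier G \<Longrightarrow> h \<in> carrier G \<Longrightarrow> U (g \<otimes>\<^bsub>G\<^esub> h) = U g * U h"
  by (auto simp: unitary_rep_def)

lemma unitary_rep_one: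
  assumes "group G" and U: "unitary_rep G T n U"
  shows "U \<one>\<^bsub>G\<^esub> = 1\<^sub>m n"
proof -
  interpret group G by fact
  note U1 = unitary_matD[OF unitary_repD(2)[OF U one_closed]]
  have "U \<one>\<^bsub>G\<^esub> * U \<one>\<^bsub>G\<^esub> = U \<one>\<^bsub>G\<^esub>" using unitary_rep_mult[OF U one_closed one_closed] by simp
  then have "mat_adjoint (U \<one>\<^bsub>G\<^esub>) * (U \<one>\<^bsub>G\<^esub> * U \<one>\<^bsub>G\<^esub>) = 1\<^sub>m n" using U1 by simp
  then have "(mat_adjoint (U \<one>\<^bsub>G\<^esub>) * U \<one>\<^bsub>G\<^esub>) * U \<one>\<^bsub>G\<^esub> = 1\<^sub>m n"
    using U1(1,2) by (simp add: assoc_mult_mat[of _ n n _ n _ n])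
  then show ?thesis using U1 by simp
qed

lemma unitary_rep_inv:
  assumes "group G" and U: "unitary_rep G T n U" and g: "g \<in> carrier G"
  shows "U (inv\<^bsub>G\<^esub> g) = mat_adjoint (U g)"
proof -
  interpret group G by fact
  note Ug = unitary_matD[OF unitary_repD(2)[OF U g]]
  have ig: "inv\<^bsub>G\<^esub> g \<in> carrier G" using g by simp
  have "U (inv\<^bsub>G\<^esub> g) * U g = 1\<^sub>m n"
    using unitary_rep_mult[OF U ig g] unitary_rep_one[OF is_group U] g by simp
  then have "(U (inv\<^bsub>G\<^esub> g) * U g) * mat_adjoint (U g) = mat_adjoint (U g)" using Ug by simp
  then have "U (inv\<^bsub>G\<^esub> g) * (U g * mat_adjoint (U g)) = mat_adjoint (U g)"
    using Ug(1,2) unitary_repD(1)[OF U ig] by (simp add: assoc_mult_mat[of _ n n _ n _ n])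
  then show ?thesis using Ug unitary_repD(1)[OF U ig] by simp
qed

lemma unitary_rep_dim_unique:
  assumes "group G" "unitary_rep G T n U" "unitary_rep G T m U"
  shows "n = m"
proof -
  interpret group G by fact
  show ?thesis using unitary_repD(1)[OF assms(2) one_closed] unitary_repD(1)[OF assms(3) one_closed] by auto
qed

lemma unitarily_equivI:
  assumes "unitary_mat n S" "\<And>g. g \<in> carrier G \<Longrightarrow> U g \<in> carrier_mat n n"
    "\<And>g. g \<in> carrier G \<Longrightarrow> V g \<in> carrier_mat n n"
    "\<And>g. g \<in> carrier G \<Longrightarrow> S * U g = V g * S"
  shows "unitarily_equiv G U V"
  using assms unfolding unitarily_equiv_def by blast

text \<open>Evaluation at the unit identifies the size hidden in \<open>unitarily_equiv\<close> with
  the degree of \<open>U\<close>; the intertwining relation can then be solved for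
  \<open>U g\<close>.\<close>

lemma unitarily_equiv_conjugation:
  assumes "unitarily_equiv G U V" "group G" "unitary_rep G T n U"
  shows "\<exists>S. unitary_mat n S \<and> (\<forall>g\<in>carrier G. V g \<in> carrier_mat n n \<and> S * U g = V g * S \<and>
    U g = mat_adjoint S * V g * S)"
proof -
  interpret group G by fact
  from assms(1) obtain m S where S: "unitary_mat m S"
    and eq: "\<forall>g\<in>carrier G. U g \<in> carrier_mat m m \<and> V g \<in> carrier_mat m m \<and> S * U g = V g * S"
    unfolding unitarily_equiv_def by blast
  have "U \<one>\<^bsub>G\<^esub> \<in> carrier_mat m m" using eq by simp
  with unitary_repD(1)[OF assms(3) one_closed] have "m = n" by (metis carrier_matD(1))
  note S' = unitary_matD[OF S]
  have "U g = mat_adjoint S * V g * S" if "g \<in> carrier G" for g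
  proof -
    have c: "U g \<in> carrier_mat m m" "V g \<in> carrier_mat m m" "S * U g = V g * S" using eq that by simp_all
    have "mat_adjoint S * V g * S = mat_adjoint S * (S * U g)"
      using S' c by (simp add: assoc_mult_mat[of _ m m _ m _ m])
    also have "\<dots> = (mat_adjoint S * S) * U g" using S'(1,2) c(1) by (simp add: assoc_mult_mat[of _ m m _ m _ m])
    finally show ?thesis using S' c by simp
  qed
  then have "unitary_mat n S \<and> (\<forall>g\<in>carrier G. V g \<in> carrier_mat n n \<and> S * U g = V g * S \<and>
    U g = mat_adjoint S * V g * S)"
    using S eq unfolding \<open>m = n\<close> by simp
  then show ?thesis by (rule exI)
qed

lemma unitarily_equiv_refl:
  assumes "unitary_rep G T n U"
  shows "unitarily_equiv G U U"
proof (rule unitarily_equivI[OF unitary_mat_one[of n]])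
  fix g assume "g \<in> carrier G"
  note Ug = unitary_repD(1)[OF assms this]
  show "U g \<in> carrier_mat n n" "U g \<in> carrier_mat n n" by (rule Ug)+
  show "1\<^sub>m n * U g = U g * 1\<^sub>m n" using Ug by simp
qed

lemma unitarily_equiv_sym:
  assumes "unitarily_equiv G U V"
  shows "unitarily_equiv G V U"
proof -
  from assms obtain n S where S: "unitary_mat n S"
    and eq: "\<And>g. g \<in> carrier G \<Longrightarrow> U g \<in> carrier_mat n n \<and> V g \<in> carrier_mat n n \<and> S * U g = V g * S"
    unfolding unitarily_equiv_def by blast
  note S' = unitary_matD[OF S]
  show ?thesis
  proof (rule unitarily_equivI[OF unitary_mat_adjoint[OF S]])
    fix g assume "g \<in> carrier G"
    then have c: "U g \<in> carrier_mat n n" "V g \<in> carrier_mat n n" and e: "S * U g = V g * S" using eq by auto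
    show "V g \<in> carrier_mat n n" "U g \<in> carrier_mat n n" by fact+
    have "mat_adjoint S * V g = mat_adjoint S * V g * (S * mat_adjoint S)" using S' c by simp
    also have "\<dots> = mat_adjoint S * (V g * S) * mat_adjoint S"
      using S'(1,2) c by (simp add: assoc_mult_mat[of _ n n _ n _ n])
    also have "\<dots> = (mat_adjoint S * S) * U g * mat_adjoint S"
      unfolding e[symmetric] using S'(1,2) c by (simp add: assoc_mult_mat[of _ n n _ n _ n])
    finally show "mat_adjoint S * V g = U g * mat_adjoint S" using S' c by simp
  qed
qed

lemma unitarily_equiv_trans:
  assumes "group G" "unitarily_equiv G U V" "unitarily_equiv G V W"
  shows "unitarily_equiv G U W"
proof -
  interpret group G by fact
  from assms(2) obtain n S where S: "unitary_mat n S"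
    and eq: "\<And>g. g \<in> carrier G \<Longrightarrow> U g \<in> carrier_mat n n \<and> V g \<in> carrier_mat n n \<and> S * U g = V g * S"
    unfolding unitarily_equiv_def by blast
  from assms(3) obtain m R where R: "unitary_mat m R"
    and eq': "\<And>g. g \<in> carrier G \<Longrightarrow> V g \<in> carrier_mat m m \<and> W g \<in> carrier_mat m m \<and> R * V g = W g * R"
    unfolding unitarily_equiv_def by blast
  have "V \<one>\<^bsub>G\<^esub> \<in> carrier_mat n n" "V \<one>\<^bsub>G\<^esub> \<in> carrier_mat m m" using eq eq' by simp_all
  then have "m = n" by (metis carrier_matD(1))
  note R = R[unfolded this] and eq' = eq'[unfolded this]
  show ?thesis
  proof (rule unitarily_equivI[OF unitary_mat_mult[OF R S]])
    fix g assume "g \<in> carrier G"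
    then have c: "U g \<in> carrier_mat n n" "V g \<in> carrier_mat n n" "W g \<in> carrier_mat n n"
      and e: "S * U g = V g * S" "R * V g = W g * R" using eq eq' by auto
    show "U g \<in> carrier_mat n n" "W g \<in> carrier_mat n n" by fact+
    note RS = unitary_matD(1)[OF R] unitary_matD(1)[OF S]
    have "R * S * U g = (R * V g) * S" using RS c e(1) by (simp add: assoc_mult_mat[of _ n n _ n _ n])
    also have "\<dots> = W g * (R * S)" unfolding e(2) using RS c by (simp add: assoc_mult_mat[of _ n n _ n _ n])
    finally show "R * S * U g = W g * (R * S)" .
  qed
qed

section \<open>Invariant subspaces and Schur's lemma\<close>

definition vec_subspace :: "nat \<Rightarrow> complex vec set \<Rightarrow> bool" where
  "vec_subspace n W \<longleftrightarrow> W \<subseteq> carrier_vec n \<and> 0\<^sub>v n \<in> W \<and> (\<forall>v\<in>W. \<forall>w\<in>W. v + w \<in> W) \<and>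
     (\<forall>c. \<forall>v\<in>W. c \<cdot>\<^sub>v v \<in> W)"

lemma subspace_module_vec_iff:
  "VectorSpace.subspace class_ring W (module_vec TYPE(complex) n) \<longleftrightarrow> vec_subspace n W"
proof
  interpret V: vec_space "TYPE(complex)" n .
  assume "vec_subspace n W"
  note W = this[unfolded vec_subspace_def]
  show "VectorSpace.subspace class_ring W (module_vec TYPE(complex) n)"
  proof (unfold_locales, goal_cases)
    case 1 show ?case using W by (auto simp: module_vec_simps)
  next
    case (2 v w) then show ?case using W by (auto simp: module_vec_simps)
  next
    case 3 show ?case using W by (auto simp: module_vec_simps)
  next
    case (4 a w) then show ?case using W by (auto simp: module_vec_simps)
  qed
next
  interpret V: vec_space "TYPE(complex)" n .
  assume "VectorSpace.subspace class_ring W (module_vec TYPE(complex) n)"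
  then interpret S: submodule class_ring W "module_vec TYPE(complex) n" by (simp add: subspace_def)
  show "vec_subspace n W"
    using S.subset S.m_closed S.zero_closed S.smult_closed
    by (auto simp: vec_subspace_def module_vec_simps)
qed

lemma irreducible_rep_iff:
  "irreducible_rep G T U \<longleftrightarrow> (\<exists>n>0. unitary_rep G T n U \<and>
     (\<forall>W. vec_subspace n W \<and> (\<forall>g\<in>carrier G. \<forall>w\<in>W. U g *\<^sub>v w \<in> W) \<longrightarrow> W = {0\<^sub>v n} \<or> W = carrier_vec n))"
  unfolding irreducible_rep_def subspace_module_vec_iff ..

lemma irreducible_repD:
  assumes G: "group G" and irr: "irreducible_rep G T U" and U: "unitary_rep G T n U"
  shows "n > 0"
    and "vec_subspace n W \<Longrightarrow> (\<And>g w. g \<in> carrier G \<Longrightarrow> w \<in> W \<Longrightarrow> U g *\<^sub>v w \<in> W) \<Longrightarrow>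
      W = {0\<^sub>v n} \<or> W = carrier_vec n"
proof -
  obtain m where "m > 0 \<and> unitary_rep G T m U \<and>
     (\<forall>W. vec_subspace m W \<and> (\<forall>g\<in>carrier G. \<forall>w\<in>W. U g *\<^sub>v w \<in> W) \<longrightarrow> W = {0\<^sub>v m} \<or> W = carrier_vec m)"
    using irr unfolding irreducible_rep_iff by (elim exE)
  moreover from this have "m = n" using unitary_rep_dim_unique[OF G _ U] by simp
  ultimately have *: "n > 0 \<and>
     (\<forall>W. vec_subspace n W \<and> (\<forall>g\<in>carrier G. \<forall>w\<in>W. U g *\<^sub>v w \<in> W) \<longrightarrow> W = {0\<^sub>v n} \<or> W = carrier_vec n)"
    by simp
  then show "n > 0" ..
  show "W = {0\<^sub>v n} \<or> W = carrier_vec n"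
    if "vec_subspace n W" "\<And>g w. g \<in> carrier G \<Longrightarrow> w \<in> W \<Longrightarrow> U g *\<^sub>v w \<in> W"
    by (rule conjunct2[OF *, rule_format]) (use that in simp)
qed

text \<open>An eigenspace of \<open>A\<close> is nonzero and invariant, hence the whole
  space.\<close>

lemma Schur_commutant:
  assumes irr: "irreducible_rep G T U" and U: "unitary_rep G T n U" and G: "group G"
    and A: "A \<in> carrier_mat n n" and comm: "\<And>g. g \<in> carrier G \<Longrightarrow> A * U g = U g * A"
  obtains z where "A = z \<cdot>\<^sub>m 1\<^sub>m n"
proof -
  have "spectrum A \<noteq> {}" using spectrum_non_empty[OF A] irreducible_repD(1)[OF G irr U] by auto
  then obtain k where "eigenvalue A k" by (auto simp: spectrum_def)
  then obtain v where v: "v \<in> carrier_vec n" "v \<noteq> 0\<^sub>v n" "A *\<^sub>v v = k \<cdot>\<^sub>v v"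
    using A by (auto simp: eigenvalue_def eigenvector_def)
  define W where "W = {w \<in> carrier_vec n. A *\<^sub>v w = k \<cdot>\<^sub>v w}"
  have "W = {0\<^sub>v n} \<or> W = carrier_vec n"
  proof (rule irreducible_repD(2)[OF G irr U])
    show "vec_subspace n W"
      using A by (auto simp: vec_subspace_def W_def mult_add_distrib_mat_vec smult_add_distrib_vec
          mult_mat_vec smult_smult_assoc mult.commute)
    show "U g *\<^sub>v w \<in> W" if g: "g \<in> carrier G" and "w \<in> W" for g w
    proof -
      have wc: "w \<in> carrier_vec n" and we: "A *\<^sub>v w = k \<cdot>\<^sub>v w" using that by (auto simp: W_def)
      note Ug = unitary_repD(1)[OF U g]
      have "A *\<^sub>v (U g *\<^sub>v w) = (A * U g) *\<^sub>v w" using A Ug wc by simp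
      also have "\<dots> = (U g * A) *\<^sub>v w" by (simp add: comm[OF g])
      also have "\<dots> = U g *\<^sub>v (A *\<^sub>v w)" using A Ug wc by simp
      also have "\<dots> = k \<cdot>\<^sub>v (U g *\<^sub>v w)" using Ug wc we by (simp add: mult_mat_vec)
      finally show ?thesis using Ug wc by (simp add: W_def)
    qed
  qed
  moreover have "v \<in> W" using v by (simp add: W_def)
  ultimately have "W = carrier_vec n" using v(2) by blast
  then have all: "A *\<^sub>v w = k \<cdot>\<^sub>v w" if "w \<in> carrier_vec n" for w
    using that unfolding W_def by blast
  have "A = k \<cdot>\<^sub>m 1\<^sub>m n"
  proof (rule eq_matI)
    fix i j assume "i < dim_row (k \<cdot>\<^sub>m 1\<^sub>m n :: complex mat)" "j < dim_col (k \<cdot>\<^sub>m 1\<^sub>m n :: complex mat)"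
    then have ij: "i < n" "j < n" by auto
    have "A $$ (i, j) = (A *\<^sub>v unit_vec n j) $ i" using A ij by auto
    also have "\<dots> = (k \<cdot>\<^sub>m 1\<^sub>m n) $$ (i, j)" using all[of "unit_vec n j"] ij by auto
    finally show "A $$ (i, j) = (k \<cdot>\<^sub>m 1\<^sub>m n) $$ (i, j)" .
  qed (use A in auto)
  then show thesis by (rule that)
qed

text \<open>Both products of \<open>S\<close> with its adjoint commute with an irreducible
  representation and are therefore scalar. The scalars agree because \<open>S\<close> is nonzero,
  the traces then give \<open>m = n\<close>, and dividing \<open>S\<close> by the root of the scalar
  makes it unitary.\<close>

lemma Schur_intertwiner:
  assumes G: "group G" and irrU: "irreducible_rep G T U" and irrV: "irreducible_rep G T V"
    and U: "unitary_rep G T m U" and V: "unitary_rep G T n V"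
    and S: "S \<in> carrier_mat n m" and inter: "\<And>g. g \<in> carrier G \<Longrightarrow> S * U g = V g * S"
    and nz: "i < n" "j < m" "S $$ (i, j) \<noteq> 0"
  shows "unitarily_equiv G U V"
proof -
  interpret group G by fact
  have Sa: "mat_adjoint S \<in> carrier_mat m n" by (rule mat_adjoint_carrier[OF S])
  have inter': "mat_adjoint S * V g = U g * mat_adjoint S" if g: "g \<in> carrier G" for g
  proof -
    have ig: "inv\<^bsub>G\<^esub> g \<in> carrier G" using g by simp
    have "mat_adjoint (S * U (inv\<^bsub>G\<^esub> g)) = mat_adjoint (V (inv\<^bsub>G\<^esub> g) * S)" using inter[OF ig] by simp
    then have "mat_adjoint (U (inv\<^bsub>G\<^esub> g)) * mat_adjoint S = mat_adjoint S * mat_adjoint (V (inv\<^bsub>G\<^esub> g))"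
      using mat_adjoint_mult[OF S unitary_repD(1)[OF U ig]] mat_adjoint_mult[OF unitary_repD(1)[OF V ig] S] by simp
    then show ?thesis
      using unitary_rep_inv[OF G U g] unitary_rep_inv[OF G V g] by simp
  qed
  obtain z where z: "mat_adjoint S * S = z \<cdot>\<^sub>m 1\<^sub>m m"
  proof (rule Schur_commutant[OF irrU U G])
    show "mat_adjoint S * S \<in> carrier_mat m m" using S Sa by simp
    fix g assume g: "g \<in> carrier G"
    note c = unitary_repD(1)[OF U g] unitary_repD(1)[OF V g]
    have "mat_adjoint S * S * U g = mat_adjoint S * (V g * S)"
      using S Sa c inter[OF g] by (simp add: assoc_mult_mat[of _ m n _ m _ m])
    also have "\<dots> = (mat_adjoint S * V g) * S" using S Sa c by (simp add: assoc_mult_mat[of _ m n _ n _ m])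
    also have "\<dots> = U g * (mat_adjoint S * S)"
      unfolding inter'[OF g] using S Sa c by (simp add: assoc_mult_mat[of _ m m _ n _ m])
    finally show "mat_adjoint S * S * U g = U g * (mat_adjoint S * S)" .
  qed
  obtain y where y: "S * mat_adjoint S = y \<cdot>\<^sub>m 1\<^sub>m n"
  proof (rule Schur_commutant[OF irrV V G])
    show "S * mat_adjoint S \<in> carrier_mat n n" using S Sa by simp
    fix g assume g: "g \<in> carrier G"
    note c = unitary_repD(1)[OF U g] unitary_repD(1)[OF V g]
    have "S * mat_adjoint S * V g = S * (U g * mat_adjoint S)"
      using S Sa c inter'[OF g] by (simp add: assoc_mult_mat[of _ n m _ n _ n])
    also have "\<dots> = (S * U g) * mat_adjoint S" using S Sa c by (simp add: assoc_mult_mat[of _ n m _ m _ n])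
    also have "\<dots> = V g * (S * mat_adjoint S)"
      unfolding inter[OF g] using S Sa c by (simp add: assoc_mult_mat[of _ n n _ m _ n])
    finally show "S * mat_adjoint S * V g = V g * (S * mat_adjoint S)" .
  qed
  have "z \<cdot>\<^sub>m S = S * (mat_adjoint S * S)" unfolding z using S mult_smult_distrib[OF S one_carrier_mat[of m]] by simp
  also have "\<dots> = (S * mat_adjoint S) * S" using S Sa by (simp add: assoc_mult_mat[of _ n m _ n _ m])
  also have "\<dots> = y \<cdot>\<^sub>m S" unfolding y using S mult_smult_assoc_mat[OF one_carrier_mat[of n] S] by simp
  finally have "(z \<cdot>\<^sub>m S) $$ (i, j) = (y \<cdot>\<^sub>m S) $$ (i, j)" by simp
  then have yz: "y = z" using S nz by auto
  have d1: "(mat_adjoint S * S) $$ (l, l) = (\<Sum>k<n. cnj (S $$ (k, l)) * S $$ (k, l))" if "l < m" for l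
    unfolding mat_mult_index[OF Sa S that that] using S that
    by (intro sum.cong) (simp_all add: mat_adjoint_entry[OF S])
  have d2: "(S * mat_adjoint S) $$ (k, k) = (\<Sum>l<m. S $$ (k, l) * cnj (S $$ (k, l)))" if "k < n" for k
    unfolding mat_mult_index[OF S Sa that that] using S that
    by (intro sum.cong) (simp_all add: mat_adjoint_entry[OF S])
  \<comment> \<open>The scalar is read off from column \<open>j\<close> as its squared length; the
    nonzero entry makes it positive.\<close>
  define q where "q = (\<Sum>k<n. (cmod (S $$ (k, j)))\<^sup>2)"
  have zq: "z = complex_of_real q"
  proof -
    have "z = (mat_adjoint S * S) $$ (j, j)" unfolding z using nz by simp
    also have "\<dots> = (\<Sum>k<n. cnj (S $$ (k, j)) * S $$ (k, j))"
      by (rule d1[OF nz(2)])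
    also have "\<dots> = complex_of_real q" by (simp add: q_def complex_norm_square mult.commute del: of_real_power)
    finally show ?thesis .
  qed
  have "(cmod (S $$ (i, j)))\<^sup>2 \<le> q" unfolding q_def using nz by (intro member_le_sum) auto
  then have q: "q > 0" using nz(3) by (smt (verit) zero_less_power zero_less_norm_iff)
  \<comment> \<open>Both traces equal the sum of the squared moduli of all entries of
    \<open>S\<close>.\<close>
  have "complex_of_nat m * z = (\<Sum>l<m. (mat_adjoint S * S) $$ (l, l))" unfolding z by simp
  also have "\<dots> = (\<Sum>l<m. \<Sum>k<n. cnj (S $$ (k, l)) * S $$ (k, l))"
    by (intro sum.cong refl) (simp only: d1 lessThan_iff)
  also have "\<dots> = (\<Sum>k<n. \<Sum>l<m. S $$ (k, l) * cnj (S $$ (k, l)))"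
    by (subst sum.swap) (simp add: mult.commute)
  also have "\<dots> = (\<Sum>k<n. (S * mat_adjoint S) $$ (k, k))"
    by (intro sum.cong refl) (simp only: d2 lessThan_iff)
  also have "\<dots> = complex_of_nat n * z" unfolding y yz by simp
  finally have "m = n" using q zq by simp
  define R where "R = complex_of_real (1 / sqrt q) \<cdot>\<^sub>m S"
  have R: "R \<in> carrier_mat n n" using S \<open>m = n\<close> by (simp add: R_def)
  let ?c = "complex_of_real (1 / sqrt q)"
  have "mat_adjoint R * R = (?c \<cdot>\<^sub>m mat_adjoint S) * (?c \<cdot>\<^sub>m S)"
    by (simp add: R_def mat_adjoint_smult)
  also have "\<dots> = ?c \<cdot>\<^sub>m (mat_adjoint S * (?c \<cdot>\<^sub>m S))"
    by (rule mult_smult_assoc_mat[OF Sa smult_carrier_mat[OF S]])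
  also have "mat_adjoint S * (?c \<cdot>\<^sub>m S) = ?c \<cdot>\<^sub>m (mat_adjoint S * S)"
    by (rule mult_smult_distrib[OF Sa S])
  also have "?c \<cdot>\<^sub>m (?c \<cdot>\<^sub>m (mat_adjoint S * S)) = (?c * ?c * z) \<cdot>\<^sub>m 1\<^sub>m n"
    unfolding z \<open>m = n\<close> by (intro eq_matI) auto
  also have "?c * ?c * z = 1"
    unfolding zq of_real_mult[symmetric] using q by simp
  also have "1 \<cdot>\<^sub>m 1\<^sub>m n = (1\<^sub>m n :: complex mat)" by (intro eq_matI) auto
  finally have "unitary_mat n R" using R by (simp add: unitary_mat_def)
  then show ?thesis
  proof (rule unitarily_equivI)
    fix g assume g: "g \<in> carrier G"
    show Ug: "U g \<in> carrier_mat n n" and Vg: "V g \<in> carrier_mat n n"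
      using unitary_repD(1)[OF U g] unitary_repD(1)[OF V g] \<open>m = n\<close> by auto
    have S': "S \<in> carrier_mat n n" using S \<open>m = n\<close> by simp
    have "R * U g = ?c \<cdot>\<^sub>m (S * U g)" unfolding R_def by (rule mult_smult_assoc_mat[OF S' Ug])
    also have "\<dots> = V g * R" unfolding R_def inter[OF g] by (rule mult_smult_distrib[OF Vg S', symmetric])
    finally show "R * U g = V g * R" .
  qed
qed

section \<open>Orthonormal families in finite dimension\<close>

text \<open>Vectors are functions of which only the first \<open>n\<close> values matter; linear
  combinations are then pointwise and carry no size conditions.\<close>

definition cin :: "nat \<Rightarrow> (nat \<Rightarrow> complex) \<Rightarrow> (nat \<Rightarrow> complex) \<Rightarrow> complex" where
  "cin n f g = (\<Sum>a<n. f a * cnj (g a))"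

lemma cin_linear: "cin n (\<lambda>x. c * f x + d * g x) h = c * cin n f h + d * cin n g h"
  by (simp add: cin_def sum.distrib sum_distrib_left algebra_simps)

lemma cin_cnj: "cnj (cin n f g) = cin n g f"
  by (simp add: cin_def mult.commute)

lemma cin_sum: "cin n (\<lambda>x. \<Sum>i<k. c i * f i x) h = (\<Sum>i<k. c i * cin n (f i) h)"
proof -
  have "cin n (\<lambda>x. \<Sum>i<k. c i * f i x) h = (\<Sum>a<n. \<Sum>i<k. c i * f i a * cnj (h a))"
    by (simp add: cin_def sum_distrib_right)
  also have "\<dots> = (\<Sum>i<k. \<Sum>a<n. c i * f i a * cnj (h a))" by (rule sum.swap)
  finally show ?thesis by (simp add: cin_def sum_distrib_left mult.assoc)
qed

lemma cin_self: "cin n f f = complex_of_real (\<Sum>a<n. (cmod (f a))\<^sup>2)"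
  by (simp add: cin_def complex_norm_square del: of_real_power)

definition orthonormal_family :: "nat \<Rightarrow> nat \<Rightarrow> (nat \<Rightarrow> nat \<Rightarrow> complex) \<Rightarrow> bool" where
  "orthonormal_family n k q \<longleftrightarrow> (\<forall>i<k. \<forall>j<k. cin n (q i) (q j) = (if i = j then 1 else 0))"

lemma orthonormal_family_coef:
  assumes "orthonormal_family n k q" "j < k"
  shows "cin n (\<lambda>x. \<Sum>i<k. c i * q i x) (q j) = c j"
proof -
  have "cin n (\<lambda>x. \<Sum>i<k. c i * q i x) (q j) = (\<Sum>i<k. if i = j then c i else 0)"
    unfolding cin_sum using assms by (intro sum.cong) (auto simp: orthonormal_family_def)
  then show ?thesis using assms by simp
qed

lemma orthonormal_family_Bessel:
  assumes q: "orthonormal_family n k q"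
  shows "(\<Sum>i<k. (cmod (cin n f (q i)))\<^sup>2) \<le> (\<Sum>a<n. (cmod (f a))\<^sup>2)"
proof -
  define p where "p x = (\<Sum>i<k. cin n f (q i) * q i x)" for x
  define r where "r x = 1 * f x + (-1) * p x" for x
  have pq: "cin n p (q j) = cin n f (q j)" if "j < k" for j
    unfolding p_def by (rule orthonormal_family_coef[OF q that])
  have pp: "cin n p h = (\<Sum>i<k. cin n f (q i) * cin n (q i) h)" for h
    unfolding p_def by (rule cin_sum)
  have S: "(\<Sum>i<k. cin n f (q i) * cin n (q i) f) = complex_of_real (\<Sum>i<k. (cmod (cin n f (q i)))\<^sup>2)"
    by (simp add: complex_norm_square cin_cnj del: of_real_power)
  have "cin n (q i) p = cin n (q i) f" if "i < k" for i
    using arg_cong[OF pq[OF that], of cnj] by (simp add: cin_cnj)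
  then have 1: "cin n p p = complex_of_real (\<Sum>i<k. (cmod (cin n f (q i)))\<^sup>2)"
    unfolding pp[of p] S[symmetric] by simp
  have 2: "cin n p f = complex_of_real (\<Sum>i<k. (cmod (cin n f (q i)))\<^sup>2)"
    unfolding pp[of f] S[symmetric] by simp
  have 3: "cin n f p = complex_of_real (\<Sum>i<k. (cmod (cin n f (q i)))\<^sup>2)"
    using arg_cong[OF 2, of cnj] by (simp only: cin_cnj complex_cnj_complex_of_real)
  have l: "cin n r h = cin n f h - cin n p h" for h
    using cin_linear[of n 1 f "-1" p h] by (simp add: r_def[abs_def])
  have l': "cin n h r = cin n h f - cin n h p" for h
    using arg_cong[OF l[of h], of cnj] by (simp add: cin_cnj)
  have "cin n r r = cin n f f - complex_of_real (\<Sum>i<k. (cmod (cin n f (q i)))\<^sup>2)"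
    unfolding l'[of r] l[of f] l[of p] 1 2 3 by simp
  then have "complex_of_real (\<Sum>a<n. (cmod (r a))\<^sup>2) =
      complex_of_real ((\<Sum>a<n. (cmod (f a))\<^sup>2) - (\<Sum>i<k. (cmod (cin n f (q i)))\<^sup>2))"
    unfolding cin_self by (simp only: of_real_diff)
  then have "(\<Sum>a<n. (cmod (r a))\<^sup>2) = (\<Sum>a<n. (cmod (f a))\<^sup>2) - (\<Sum>i<k. (cmod (cin n f (q i)))\<^sup>2)"
    by (simp only: of_real_eq_iff)
  moreover have "(\<Sum>a<n. (cmod (r a))\<^sup>2) \<ge> 0" by (intro sum_nonneg) auto
  ultimately show ?thesis by linarith
qed

lemma cin_unit: "a < n \<Longrightarrow> cin n (\<lambda>x. if x = a then 1 else 0) h = cnj (h a)"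
proof -
  assume a: "a < n"
  have "cin n (\<lambda>x. if x = a then 1 else 0) h = (\<Sum>x<n. if x = a then cnj (h x) else 0)"
    unfolding cin_def by (intro sum.cong) auto
  then show ?thesis using a by simp
qed

lemma orthonormal_family_total:
  assumes "orthonormal_family n k q"
  shows "(\<Sum>a<n. \<Sum>i<k. (cmod (q i a))\<^sup>2) = real k"
proof -
  have "(\<Sum>a<n. (cmod (q i a))\<^sup>2) = 1" if "i < k" for i
  proof -
    have "complex_of_real (\<Sum>a<n. (cmod (q i a))\<^sup>2) = complex_of_real 1"
      using assms that unfolding cin_self[symmetric] by (simp add: orthonormal_family_def)
    then show ?thesis by (simp only: of_real_eq_iff)
  qed
  then have "(\<Sum>i<k. \<Sum>a<n. (cmod (q i a))\<^sup>2) = real k" by simp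
  then show ?thesis by (subst sum.swap)
qed

text \<open>For each coordinate Bessel's inequality, applied to the unit vector, bounds the sum of
  the squared moduli over the family by 1. Summing over the coordinates counts the family.\<close>

lemma orthonormal_family_card_le:
  assumes q: "orthonormal_family n k q"
  shows "k \<le> n"
proof -
  have "(\<Sum>i<k. (cmod (q i a))\<^sup>2) \<le> 1" if "a < n" for a
  proof -
    have "(\<Sum>i<k. (cmod (q i a))\<^sup>2) = (\<Sum>i<k. (cmod (cin n (\<lambda>x. if x = a then 1 else 0) (q i)))\<^sup>2)"
      using that by (simp add: cin_unit)
    also have "\<dots> \<le> (\<Sum>x<n. (cmod (if x = a then 1 else 0))\<^sup>2)"
      by (rule orthonormal_family_Bessel[OF q])
    also have "\<dots> = (\<Sum>x<n. if x = a then 1 else 0)" by (intro sum.cong) auto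
    also have "\<dots> = 1" using that by simp
    finally show ?thesis .
  qed
  then have "(\<Sum>a<n. \<Sum>i<k. (cmod (q i a))\<^sup>2) \<le> (\<Sum>a<n. 1)" by (intro sum_mono) auto
  then show ?thesis using orthonormal_family_total[OF q] by simp
qed

definition fun_subspace :: "(nat \<Rightarrow> complex) set \<Rightarrow> bool" where
  "fun_subspace W \<longleftrightarrow> (\<lambda>_. 0) \<in> W \<and> (\<forall>f\<in>W. \<forall>g\<in>W. \<forall>c d. (\<lambda>x. c * f x + d * g x) \<in> W)"

lemma fun_subspace_linear:
  "fun_subspace W \<Longrightarrow> f \<in> W \<Longrightarrow> g \<in> W \<Longrightarrow> (\<lambda>x. c * f x + d * g x) \<in> W"
  by (simp add: fun_subspace_def)

lemma fun_subspace_sum: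
  fixes k :: nat
  assumes "fun_subspace W" "\<And>i. i < k \<Longrightarrow> q i \<in> W"
  shows "(\<lambda>x. \<Sum>i<k. c i * q i x) \<in> W"
  using assms(2)
proof (induction k)
  case (Suc k)
  then have "(\<lambda>x. 1 * (\<Sum>i<k. c i * q i x) + c k * q k x) \<in> W"
    by (intro fun_subspace_linear[OF assms(1)]) auto
  then show ?case by simp
qed (use assms(1) in \<open>simp add: fun_subspace_def\<close>)

text \<open>A family in \<open>W\<close> of maximal size spans it: a remainder with a nonzero value
  below \<open>n\<close> could be normalised and added.\<close>

lemma orthonormal_basis_exists:
  assumes W: "fun_subspace W"
  shows "\<exists>k q. (\<forall>i<k. q i \<in> W) \<and> orthonormal_family n k q \<and>
    (\<forall>f\<in>W. \<forall>a<n. f a = (\<Sum>i<k. cin n f (q i) * q i a))"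
proof -
  define P where "P k \<longleftrightarrow> (\<exists>q. (\<forall>i<k. q i \<in> W) \<and> orthonormal_family n k q)" for k
  have "P 0" by (simp add: P_def orthonormal_family_def)
  moreover have "\<forall>k. P k \<longrightarrow> k \<le> n" using orthonormal_family_card_le by (auto simp: P_def)
  ultimately obtain k where k: "P k" and max: "\<And>k'. P k' \<Longrightarrow> k' \<le> k"
    using Nat.ex_has_greatest_nat[of P 0 n] by auto
  obtain q where q: "\<forall>i<k. q i \<in> W" and o: "orthonormal_family n k q" using k by (auto simp: P_def)
  have "f a = (\<Sum>i<k. cin n f (q i) * q i a)" if f: "f \<in> W" and a: "a < n" for f a
  proof (rule ccontr)
    assume ne: "f a \<noteq> (\<Sum>i<k. cin n f (q i) * q i a)"
    define p where "p x = (\<Sum>i<k. cin n f (q i) * q i x)" for x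
    define r where "r x = 1 * f x + (-1) * p x" for x
    have pW: "p \<in> W" unfolding p_def using q by (intro fun_subspace_sum[OF W]) auto
    have rW: "r \<in> W" unfolding r_def by (rule fun_subspace_linear[OF W f pW])
    have rq: "cin n r (q j) = 0" if "j < k" for j
      using orthonormal_family_coef[OF o that, of "\<lambda>i. cin n f (q i)"]
      unfolding r_def cin_linear p_def by simp
    define s where "s = (\<Sum>a<n. (cmod (r a))\<^sup>2)"
    have "(cmod (r a))\<^sup>2 \<le> s" unfolding s_def using a by (intro member_le_sum) auto
    moreover have "r a \<noteq> 0" using ne by (simp add: r_def p_def)
    then have "(cmod (r a))\<^sup>2 > 0" by simp
    ultimately have s: "s > 0" by linarith
    define c where "c = complex_of_real (1 / sqrt s)"
    have cc: "c * cnj c * complex_of_real s = 1"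
      using s by (simp add: c_def flip: of_real_mult)
    define u where "u x = c * r x + 0 * r x" for x
    have uW: "u \<in> W" unfolding u_def by (rule fun_subspace_linear[OF W rW rW])
    have ul: "cin n u h = c * cin n r h" for h unfolding u_def cin_linear by simp
    have uq: "cin n u (q j) = 0" if "j < k" for j using rq[OF that] by (simp add: ul)
    have qu: "cin n (q j) u = 0" if "j < k" for j using arg_cong[OF uq[OF that], of cnj] by (simp add: cin_cnj)
    have "cin n r u = cnj c * cin n r r"
      using arg_cong[OF ul[of r], of cnj] by (simp add: cin_cnj)
    moreover have "cin n r r = complex_of_real s" unfolding s_def by (rule cin_self)
    ultimately have "cin n u u = c * cnj c * complex_of_real s" using ul[of u] by simp
    then have uu: "cin n u u = 1" using cc by simp
    have "orthonormal_family n (Suc k) (q(k := u))"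
      unfolding orthonormal_family_def
    proof (intro allI impI)
      fix i j assume "i < Suc k" "j < Suc k"
      then show "cin n ((q(k := u)) i) ((q(k := u)) j) = (if i = j then 1 else 0)"
        using uq qu uu o by (cases "i = k"; cases "j = k") (auto simp: orthonormal_family_def)
    qed
    moreover have "\<forall>i<Suc k. (q(k := u)) i \<in> W" using q uW by (simp add: less_Suc_eq)
    ultimately have "P (Suc k)" unfolding P_def by - (rule exI[of _ "q(k := u)"], simp)
    then show False using max by fastforce
  qed
  then have "(\<forall>i<k. q i \<in> W) \<and> orthonormal_family n k q \<and>
    (\<forall>f\<in>W. \<forall>a<n. f a = (\<Sum>i<k. cin n f (q i) * q i a))" using q o by simp
  then show ?thesis by - (rule exI[of _ k], rule exI[of _ q])
qed

text \<open>Orthonormal bases of \<open>W\<close> and of its orthogonal complement are joined. That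
  they have \<open>n\<close> members together is again a count of squares, now with equality for
  every unit vector.\<close>

lemma adapted_orthonormal_basis:
  assumes W: "fun_subspace W"
  shows "\<exists>k p. k \<le> n \<and> orthonormal_family n n p \<and> (\<forall>i<k. p i \<in> W) \<and>
    (\<forall>f\<in>W. \<forall>i<n. k \<le> i \<longrightarrow> cin n f (p i) = 0) \<and>
    (\<forall>f\<in>W. \<forall>a<n. f a = (\<Sum>i<k. cin n f (p i) * p i a)) \<and>
    (\<forall>f. \<forall>a<n. f a = (\<Sum>i<n. cin n f (p i) * p i a))"
proof -
  obtain k q where q: "\<forall>i<k. q i \<in> W" and oq: "orthonormal_family n k q"
    and eq: "\<forall>f\<in>W. \<forall>a<n. f a = (\<Sum>i<k. cin n f (q i) * q i a)"
    using orthonormal_basis_exists[OF W, of n] by (elim exE conjE)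
  define W' where "W' = {f. \<forall>w\<in>W. cin n f w = 0}"
  have W': "fun_subspace W'"
    unfolding fun_subspace_def W'_def by (simp add: cin_linear) (simp add: cin_def)
  obtain l r where r: "\<forall>i<l. r i \<in> W'" and or: "orthonormal_family n l r"
    and er: "\<forall>f\<in>W'. \<forall>a<n. f a = (\<Sum>i<l. cin n f (r i) * r i a)"
    using orthonormal_basis_exists[OF W', of n] by (elim exE conjE)
  define p where "p i = (if i < k then q i else r (i - k))" for i
  have rw: "cin n (r i) w = 0" "cin n w (r i) = 0" if "i < l" "w \<in> W" for i w
  proof -
    show 1: "cin n (r i) w = 0" using r that by (simp add: W'_def)
    show "cin n w (r i) = 0" using arg_cong[OF 1, of cnj] by (simp add: cin_cnj)
  qed
  have op: "orthonormal_family n (k + l) p"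
    unfolding orthonormal_family_def
  proof (intro allI impI)
    fix i j assume ij: "i < k + l" "j < k + l"
    show "cin n (p i) (p j) = (if i = j then 1 else 0)"
    proof (cases "i < k")
      case True
      show ?thesis
      proof (cases "j < k")
        case True then show ?thesis using \<open>i < k\<close> oq by (simp add: p_def orthonormal_family_def)
      next
        case False
        then have "j - k < l" using ij by linarith
        then show ?thesis using rw(2) q \<open>i < k\<close> False by (simp add: p_def)
      qed
    next
      case False
      then have i: "i - k < l" using ij by linarith
      show ?thesis
      proof (cases "j < k")
        case True then show ?thesis using rw(1)[OF i] q \<open>\<not> i < k\<close> by (simp add: p_def)
      next
        case False
        then have "j - k < l" "(i - k = j - k) = (i = j)" using ij \<open>\<not> i < k\<close> by linarith+
        then show ?thesis using or i \<open>\<not> i < k\<close> False by (simp add: p_def orthonormal_family_def)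
      qed
    qed
  qed
  have split: "(\<Sum>i<k + l. h (p i)) = (\<Sum>i<k. h (q i)) + (\<Sum>i<l. h (r i))" for h :: "(nat \<Rightarrow> complex) \<Rightarrow> complex"
  proof -
    have "(\<Sum>i<k + l. h (p i)) = (\<Sum>i<k. h (p i)) + (\<Sum>i<l. h (p (k + i)))"
      by (induction l) (simp_all add: add.assoc)
    then show ?thesis by (simp add: p_def)
  qed
  have complete: "f a = (\<Sum>i<k + l. cin n f (p i) * p i a)" if a: "a < n" for f a
  proof -
    define m where "m x = (\<Sum>i<k. cin n f (q i) * q i x)" for x
    \<comment> \<open>What remains of \<open>f\<close> after the projection to \<open>W\<close>; it
      lies in the complement and is expanded in the basis there.\<close>
    define t where "t x = 1 * f x + (-1) * m x" for x
    have tl: "cin n t h = cin n f h - cin n m h" for h unfolding t_def cin_linear by simp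
    have tq: "cin n t (q j) = 0" if "j < k" for j
      unfolding tl m_def using orthonormal_family_coef[OF oq that] by simp
    have "t \<in> W'"
      unfolding W'_def
    proof (intro CollectI ballI)
      fix w assume w: "w \<in> W"
      have "cin n w t = cin n (\<lambda>x. \<Sum>i<k. cin n w (q i) * q i x) t"
        unfolding cin_def[of n _ t] using eq w by simp
      also have "\<dots> = (\<Sum>i<k. cin n w (q i) * cin n (q i) t)" by (rule cin_sum)
      also have "\<dots> = 0"
      proof (rule sum.neutral, rule ballI)
        fix i assume "i \<in> {..<k}"
        then have "cin n (q i) t = 0" using arg_cong[OF tq[of i], of cnj] by (simp add: cin_cnj)
        then show "cin n w (q i) * cin n (q i) t = 0" by simp
      qed
      finally show "cin n t w = 0" using cin_cnj[of n w t] by simp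
    qed
    then have "t a = (\<Sum>i<l. cin n t (r i) * r i a)" using er a by simp
    also have "\<dots> = (\<Sum>i<l. cin n f (r i) * r i a)"
    proof (rule sum.cong[OF refl])
      fix i assume "i \<in> {..<l}"
      then have i: "i < l" by simp
      have "cin n m (r i) = (\<Sum>j<k. cin n f (q j) * cin n (q j) (r i))" unfolding m_def by (rule cin_sum)
      also have "\<dots> = 0" using rw(2)[OF i] q by (intro sum.neutral) simp
      finally show "cin n t (r i) * r i a = cin n f (r i) * r i a" by (simp add: tl)
    qed
    finally have "f a = m a + (\<Sum>i<l. cin n f (r i) * r i a)" by (simp add: t_def algebra_simps)
    then show ?thesis using split[of "\<lambda>u. cin n f u * u a"] by (simp add: m_def)
  qed
  have kl: "k + l = n"
  proof -
    have "(\<Sum>i<k + l. (cmod (p i a))\<^sup>2) = 1" if a: "a < n" for a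
    proof -
      have "complex_of_real 1 = (\<Sum>i<k + l. cin n (\<lambda>x. if x = a then 1 else 0) (p i) * p i a)"
        using complete[OF a, of "\<lambda>x. if x = a then 1 else 0"] by simp
      also have "\<dots> = complex_of_real (\<Sum>i<k + l. (cmod (p i a))\<^sup>2)"
        using a by (simp add: cin_unit complex_norm_square mult.commute del: of_real_power)
      finally show ?thesis by (simp only: of_real_eq_iff)
    qed
    then have "(\<Sum>a<n. \<Sum>i<k + l. (cmod (p i a))\<^sup>2) = real n" by simp
    then show ?thesis using orthonormal_family_total[OF op] by simp
  qed
  have "k \<le> n" using kl by simp
  moreover have "\<forall>i<k. p i \<in> W" using q by (simp add: p_def)
  moreover have "\<forall>f\<in>W. \<forall>i<n. k \<le> i \<longrightarrow> cin n f (p i) = 0"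
  proof (intro ballI allI impI)
    fix f i assume "f \<in> W" "i < n" "k \<le> i"
    then have "i - k < l" using kl by linarith
    then show "cin n f (p i) = 0" using rw(2) \<open>f \<in> W\<close> \<open>k \<le> i\<close> by (simp add: p_def)
  qed
  moreover have "\<forall>f\<in>W. \<forall>a<n. f a = (\<Sum>i<k. cin n f (p i) * p i a)" using eq by (simp add: p_def)
  ultimately have "k \<le> n \<and> orthonormal_family n n p \<and> (\<forall>i<k. p i \<in> W) \<and>
    (\<forall>f\<in>W. \<forall>i<n. k \<le> i \<longrightarrow> cin n f (p i) = 0) \<and>
    (\<forall>f\<in>W. \<forall>a<n. f a = (\<Sum>i<k. cin n f (p i) * p i a)) \<and>
    (\<forall>f. \<forall>a<n. f a = (\<Sum>i<n. cin n f (p i) * p i a))"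
    using op complete unfolding kl by blast
  then show ?thesis by - (rule exI[of _ k], rule exI[of _ p])
qed

section \<open>Kronecker products\<close>

text \<open>Division with remainder by \<open>m\<close> is the lexicographic numbering of pairs in
  \<open>kronecker\<close>; this turns sums over its indices into double sums.\<close>

lemma sum_div_mod:
  fixes f :: "nat \<Rightarrow> nat \<Rightarrow> 'a :: comm_monoid_add"
  shows "(\<Sum>p<n * m. f (p div m) (p mod m)) = (\<Sum>i<n. \<Sum>j<m. f i j)"
proof -
  have "(\<Sum>p<n * m. f (p div m) (p mod m)) = (\<Sum>(i, j)\<in>{..<n} \<times> {..<m}. f i j)"
  proof (rule sum.reindex_bij_witness[of _ "\<lambda>(i, j). i * m + j" "\<lambda>p. (p div m, p mod m)"])
    fix p assume "p \<in> {..<n * m}"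
    then have p: "p < n * m" by simp
    then have "m > 0" by (cases m) auto
    then show "(p div m, p mod m) \<in> {..<n} \<times> {..<m}" using p by (simp add: less_mult_imp_div_less)
    show "(case (p div m, p mod m) of (i, j) \<Rightarrow> i * m + j) = p" by simp
    show "(case (p div m, p mod m) of (i, j) \<Rightarrow> f i j) = f (p div m) (p mod m)" by simp
  next
    fix q assume "q \<in> {..<n} \<times> {..<m}"
    then obtain i j where q: "q = (i, j)" "i < n" "j < m" by auto
    have "i * m + j < (i + 1) * m" using q by simp
    also have "\<dots> \<le> n * m" using q by (intro mult_right_mono) auto
    finally show "(case q of (i, j) \<Rightarrow> i * m + j) \<in> {..<n * m}" using q by simp
    show "((case q of (i, j) \<Rightarrow> i * m + j) div m, (case q of (i, j) \<Rightarrow> i * m + j) mod m) = q"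
      using q by simp
  qed
  then show ?thesis by (simp add: sum.cartesian_product)
qed

lemma div_mod_less:
  fixes p :: nat
  assumes "p < n * m"
  shows "p div m < n" "p mod m < m"
proof -
  have "m > 0" using assms by (cases m) auto
  then show "p div m < n" "p mod m < m" using assms by (simp_all add: less_mult_imp_div_less)
qed

lemma kronecker_carrier:
  "A \<in> carrier_mat n n \<Longrightarrow> B \<in> carrier_mat m m \<Longrightarrow> kronecker A B \<in> carrier_mat (n * m) (n * m)"
  by (auto simp: kronecker_def)

lemma kronecker_index:
  "A \<in> carrier_mat n n \<Longrightarrow> B \<in> carrier_mat m m \<Longrightarrow> p < n * m \<Longrightarrow> q < n * m \<Longrightarrow>
    kronecker A B $$ (p, q) = A $$ (p div m, q div m) * B $$ (p mod m, q mod m)"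
  by (auto simp: kronecker_def)

lemma kronecker_mult:
  assumes A: "A \<in> carrier_mat n n" "A' \<in> carrier_mat n n" and B: "B \<in> carrier_mat m m" "B' \<in> carrier_mat m m"
  shows "kronecker (A * A') (B * B') = kronecker A B * kronecker A' B'"
proof (rule eq_matI)
  note c = kronecker_carrier[OF A(1) B(1)] kronecker_carrier[OF A(2) B(2)]
  have AA: "A * A' \<in> carrier_mat n n" and BB: "B * B' \<in> carrier_mat m m" using A B by auto
  fix p q assume "p < dim_row (kronecker A B * kronecker A' B')" "q < dim_col (kronecker A B * kronecker A' B')"
  then have pq: "p < n * m" "q < n * m" using c by auto
  note p = div_mod_less[OF pq(1)] and q = div_mod_less[OF pq(2)]
  have "(kronecker A B * kronecker A' B') $$ (p, q) =
      (\<Sum>r<n * m. (A $$ (p div m, r div m) * B $$ (p mod m, r mod m)) * (A' $$ (r div m, q div m) * B' $$ (r mod m, q mod m)))"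
    unfolding mat_mult_index[OF c pq] using A B pq
    by (intro sum.cong refl) (simp add: kronecker_index[of _ n _ m])
  also have "\<dots> = (\<Sum>i<n. \<Sum>j<m. (A $$ (p div m, i) * B $$ (p mod m, j)) * (A' $$ (i, q div m) * B' $$ (j, q mod m)))"
    by (rule sum_div_mod)
  also have "\<dots> = (\<Sum>i<n. A $$ (p div m, i) * A' $$ (i, q div m)) * (\<Sum>j<m. B $$ (p mod m, j) * B' $$ (j, q mod m))"
    unfolding sum_product by (intro sum.cong refl) (simp add: mult_ac)
  also have "\<dots> = kronecker (A * A') (B * B') $$ (p, q)"
    unfolding kronecker_index[OF AA BB pq] mat_mult_index[OF A p(1) q(1)] mat_mult_index[OF B p(2) q(2)] ..
  finally show "kronecker (A * A') (B * B') $$ (p, q) = (kronecker A B * kronecker A' B') $$ (p, q)" by simp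
qed (use A B in \<open>auto simp: kronecker_def\<close>)

lemma kronecker_adjoint:
  assumes A: "A \<in> carrier_mat n n" and B: "B \<in> carrier_mat m m"
  shows "mat_adjoint (kronecker A B) = kronecker (mat_adjoint A) (mat_adjoint B)"
proof (rule eq_matI)
  note Aa = mat_adjoint_carrier[OF A] and Ba = mat_adjoint_carrier[OF B]
  fix p q assume "p < dim_row (kronecker (mat_adjoint A) (mat_adjoint B))"
    "q < dim_col (kronecker (mat_adjoint A) (mat_adjoint B))"
  then have pq: "p < n * m" "q < n * m" using kronecker_carrier[OF Aa Ba] by auto
  note p = div_mod_less[OF pq(1)] and q = div_mod_less[OF pq(2)]
  show "mat_adjoint (kronecker A B) $$ (p, q) = kronecker (mat_adjoint A) (mat_adjoint B) $$ (p, q)"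
    unfolding mat_adjoint_entry[OF kronecker_carrier[OF A B] pq] kronecker_index[OF A B pq(2,1)]
      kronecker_index[OF Aa Ba pq] mat_adjoint_entry[OF A p(1) q(1)] mat_adjoint_entry[OF B p(2) q(2)]
    by simp
qed (use A B in \<open>auto simp: kronecker_def\<close>)

lemma kronecker_smult_one:
  "kronecker (x \<cdot>\<^sub>m 1\<^sub>m n) (y \<cdot>\<^sub>m 1\<^sub>m m) = (x * y) \<cdot>\<^sub>m 1\<^sub>m (n * m)"
proof (rule eq_matI)
  fix p q assume "p < dim_row ((x * y) \<cdot>\<^sub>m 1\<^sub>m (n * m))" "q < dim_col ((x * y) \<cdot>\<^sub>m 1\<^sub>m (n * m))"
  then have pq: "p < n * m" "q < n * m" by auto
  note p = div_mod_less[OF pq(1)] and q = div_mod_less[OF pq(2)]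
  have eq: "p = q \<longleftrightarrow> p div m = q div m \<and> p mod m = q mod m" by (metis div_mult_mod_eq)
  show "kronecker (x \<cdot>\<^sub>m 1\<^sub>m n) (y \<cdot>\<^sub>m 1\<^sub>m m) $$ (p, q) = ((x * y) \<cdot>\<^sub>m 1\<^sub>m (n * m)) $$ (p, q)"
    using p q pq eq by (simp add: kronecker_index[of _ n _ m])
qed (auto simp: kronecker_def)

lemma kronecker_unitary:
  assumes "unitary_mat n A" "unitary_mat m B"
  shows "unitary_mat (n * m) (kronecker A B)"
proof -
  note A = unitary_matD[OF assms(1)] and B = unitary_matD[OF assms(2)]
  have "mat_adjoint (kronecker A B) * kronecker A B = kronecker (1\<^sub>m n) (1\<^sub>m m)"
    unfolding kronecker_adjoint[OF A(1) B(1)] kronecker_mult[OF A(2,1) B(2,1), symmetric] A(3) B(3) ..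
  also have "\<dots> = 1\<^sub>m (n * m)"
  proof -
    have one: "1 \<cdot>\<^sub>m 1\<^sub>m k = (1\<^sub>m k :: complex mat)" for k by (rule eq_matI) auto
    show ?thesis using kronecker_smult_one[of 1 n 1 m] by (simp add: one)
  qed
  finally show ?thesis using kronecker_carrier[OF A(1) B(1)] by (simp add: unitary_mat_def)
qed

section \<open>Conjugates, tensor products and blocks of representations\<close>

text \<open>For unitary matrices the entrywise conjugate is the transposed inverse, so this is the
  dual representation.\<close>

definition conj_rep :: "('g \<Rightarrow> complex mat) \<Rightarrow> 'g \<Rightarrow> complex mat" where
  "conj_rep U = (\<lambda>g. map_mat cnj (U g))"

lemma map_mat_cnj_mult:
  assumes A: "A \<in> carrier_mat n k" and B: "B \<in> carrier_mat k m"
  shows "map_mat cnj (A * B) = map_mat cnj A * map_mat cnj B"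
proof (rule eq_matI)
  have cA: "map_mat cnj A \<in> carrier_mat n k" and cB: "map_mat cnj B \<in> carrier_mat k m" using A B by auto
  fix i j assume "i < dim_row (map_mat cnj A * map_mat cnj B)" "j < dim_col (map_mat cnj A * map_mat cnj B)"
  then have ij: "i < n" "j < m" using A B by auto
  have "map_mat cnj (A * B) $$ (i, j) = cnj ((A * B) $$ (i, j))" using A B ij by simp
  also have "\<dots> = (\<Sum>l<k. map_mat cnj A $$ (i, l) * map_mat cnj B $$ (l, j))"
    unfolding mat_mult_index[OF A B ij] using A B ij by simp
  finally show "map_mat cnj (A * B) $$ (i, j) = (map_mat cnj A * map_mat cnj B) $$ (i, j)"
    unfolding mat_mult_index[OF cA cB ij] .
qed (use A B in auto)

lemma unitary_mat_cnj:
  assumes "unitary_mat n A"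
  shows "unitary_mat n (map_mat cnj A)"
proof -
  note A = unitary_matD[OF assms]
  have "mat_adjoint (map_mat cnj A) = map_mat cnj (mat_adjoint A)" using A(1) by (intro eq_matI) auto
  then have "mat_adjoint (map_mat cnj A) * map_mat cnj A = map_mat cnj (1\<^sub>m n)"
    using map_mat_cnj_mult[OF A(2,1)] A(3) by simp
  also have "\<dots> = 1\<^sub>m n" by (intro eq_matI) auto
  finally show ?thesis using A(1) by (simp add: unitary_mat_def)
qed

context topological_group
begin

lemma continuous_map_cong_carrier:
  "continuous_map T Y f \<Longrightarrow> (\<And>x. x \<in> carrier G \<Longrightarrow> f x = h x) \<Longrightarrow> continuous_map T Y h"
  using continuous_map_eq topspace_eq by metis

lemma unitary_rep_cont: "unitary_rep G T n U \<Longrightarrow> i < n \<Longrightarrow> j < n \<Longrightarrow> continuous_map T euclidean (\<lambda>g. U g $$ (i, j))"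
  by (simp add: unitary_rep_def)

lemma unitary_rep_tensor:
  assumes U: "unitary_rep G T n U" and V: "unitary_rep G T m V"
  shows "unitary_rep G T (n * m) (tensor_rep U V)"
  unfolding unitary_rep_def tensor_rep_def
proof (intro conjI ballI allI impI)
  fix g assume g: "g \<in> carrier G"
  show "unitary_mat (n * m) (kronecker (U g) (V g))"
    by (rule kronecker_unitary[OF unitary_repD(2)[OF U g] unitary_repD(2)[OF V g]])
  fix h assume h: "h \<in> carrier G"
  show "kronecker (U (g \<otimes> h)) (V (g \<otimes> h)) = kronecker (U g) (V g) * kronecker (U h) (V h)"
    unfolding unitary_rep_mult[OF U g h] unitary_rep_mult[OF V g h]
    by (rule kronecker_mult) (rule unitary_repD(1)[OF U g] unitary_repD(1)[OF U h] unitary_repD(1)[OF V g] unitary_repD(1)[OF V h])+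
next
  fix p q assume pq: "p < n * m" "q < n * m"
  note p = div_mod_less[OF pq(1)] and q = div_mod_less[OF pq(2)]
  have "continuous_map T euclidean (\<lambda>g. U g $$ (p div m, q div m) * V g $$ (p mod m, q mod m))"
    by (intro continuous_map_mult_normed_algebra unitary_rep_cont[OF U] unitary_rep_cont[OF V] p q)
  then show "continuous_map T euclidean (\<lambda>g. kronecker (U g) (V g) $$ (p, q))"
    by (rule continuous_map_cong_carrier)
      (simp add: kronecker_index[OF unitary_repD(1)[OF U] unitary_repD(1)[OF V] pq])
qed

lemma unitary_rep_conj:
  assumes U: "unitary_rep G T n U"
  shows "unitary_rep G T n (conj_rep U)"
  unfolding unitary_rep_def conj_rep_def
proof (intro conjI ballI allI impI)
  fix g assume g: "g \<in> carrier G"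
  show "unitary_mat n (map_mat cnj (U g))" by (rule unitary_mat_cnj[OF unitary_repD(2)[OF U g]])
  fix h assume h: "h \<in> carrier G"
  show "map_mat cnj (U (g \<otimes> h)) = map_mat cnj (U g) * map_mat cnj (U h)"
    unfolding unitary_rep_mult[OF U g h] by (rule map_mat_cnj_mult[OF unitary_repD(1)[OF U g] unitary_repD(1)[OF U h]])
next
  fix i j assume ij: "i < n" "j < n"
  have "continuous_map T euclidean (\<lambda>g. cnj (U g $$ (i, j)))"
    by (rule continuous_map_compose_continuous_on[OF unitary_rep_cont[OF U ij]]) (intro continuous_intros)
  then show "continuous_map T euclidean (\<lambda>g. map_mat cnj (U g) $$ (i, j))"
  proof (rule continuous_map_cong_carrier)
    fix g assume "g \<in> carrier G"
    from unitary_repD(1)[OF U this] show "cnj (U g $$ (i, j)) = map_mat cnj (U g) $$ (i, j)" using ij by simp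
  qed
qed

text \<open>Entrywise conjugation of vectors is an antilinear bijection that carries subspaces
  invariant under \<open>conj_rep U\<close> to subspaces invariant under \<open>U\<close>.\<close>

lemma irreducible_rep_conj:
  assumes irr: "irreducible_rep G T U"
  shows "irreducible_rep G T (conj_rep U)"
proof -
  obtain n where n: "n > 0" "unitary_rep G T n U" using irr unfolding irreducible_rep_def by auto
  note U = n(2)
  have cc: "map_vec cnj (map_vec cnj v) = v" for v by (rule eq_vecI) auto
  have key: "W = {0\<^sub>v n} \<or> W = carrier_vec n"
    if W: "vec_subspace n W" and inv: "\<forall>g\<in>carrier G. \<forall>w\<in>W. conj_rep U g *\<^sub>v w \<in> W" for W
  proof -
    define W' where "W' = map_vec cnj ` W"
    have WW': "W = map_vec cnj ` W'" by (simp add: W'_def image_image cc)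
    have Wc: "w \<in> carrier_vec n" if "w \<in> W" for w using W that by (auto simp: vec_subspace_def)
    have sub: "vec_subspace n W'"
      unfolding vec_subspace_def
    proof (intro conjI ballI allI)
      show "W' \<subseteq> carrier_vec n" using Wc by (auto simp: W'_def)
      have "0\<^sub>v n = map_vec cnj (0\<^sub>v n)" by (rule eq_vecI) auto
      then show "0\<^sub>v n \<in> W'" using W unfolding W'_def vec_subspace_def by blast
    next
      fix v' w' assume "v' \<in> W'" "w' \<in> W'"
      then obtain v w where vw: "v \<in> W" "w \<in> W" "v' = map_vec cnj v" "w' = map_vec cnj w" by (auto simp: W'_def)
      have "v' + w' = map_vec cnj (v + w)" using vw Wc[of v] Wc[of w] by (intro eq_vecI) auto
      then show "v' + w' \<in> W'" using vw W unfolding W'_def vec_subspace_def by blast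
    next
      fix c v' assume "v' \<in> W'"
      then obtain v where v: "v \<in> W" "v' = map_vec cnj v" by (auto simp: W'_def)
      have "c \<cdot>\<^sub>v v' = map_vec cnj (cnj c \<cdot>\<^sub>v v)" using v by (intro eq_vecI) auto
      then show "c \<cdot>\<^sub>v v' \<in> W'" using v W unfolding W'_def vec_subspace_def by blast
    qed
    have "U g *\<^sub>v w' \<in> W'" if g: "g \<in> carrier G" and w': "w' \<in> W'" for g w'
    proof -
      obtain w where w: "w \<in> W" "w' = map_vec cnj w" using w' by (auto simp: W'_def)
      note Ug = unitary_repD(1)[OF U g]
      have "U g *\<^sub>v w' = map_vec cnj (conj_rep U g *\<^sub>v w)"
        using Ug w Wc[of w] by (intro eq_vecI) (auto simp: conj_rep_def scalar_prod_def)
      then show ?thesis using inv g w unfolding W'_def by blast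
    qed
    from irreducible_repD(2)[OF is_group irr U sub this] have "W' = {0\<^sub>v n} \<or> W' = carrier_vec n" .
    then show ?thesis
    proof
      assume "W' = {0\<^sub>v n}"
      moreover have "map_vec cnj (0\<^sub>v n) = 0\<^sub>v n" by (rule eq_vecI) auto
      ultimately show ?thesis using WW' by simp
    next
      assume a: "W' = carrier_vec n"
      have "carrier_vec n \<subseteq> W"
      proof
        fix v :: "complex vec" assume "v \<in> carrier_vec n"
        then have "map_vec cnj v \<in> W'" using a by simp
        then have "map_vec cnj (map_vec cnj v) \<in> W" unfolding WW' by (rule imageI)
        then show "v \<in> W" by (simp add: cc)
      qed
      then show ?thesis using Wc by blast
    qed
  qed
  show ?thesis
    unfolding irreducible_rep_iff
    by (intro exI[of _ n] conjI allI impI n(1) unitary_rep_conj[OF U]) (elim conjE, rule key)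
qed

lemma unitary_rep_conjugate:
  assumes U: "unitary_rep G T n U" and S: "unitary_mat n S"
  shows "unitary_rep G T n (\<lambda>g. S * U g * mat_adjoint S)"
    and "unitarily_equiv G U (\<lambda>g. S * U g * mat_adjoint S)"
proof -
  note S' = unitary_matD[OF S]
  have um: "unitary_mat n (S * U g * mat_adjoint S)" if "g \<in> carrier G" for g
    by (intro unitary_mat_mult unitary_mat_adjoint S unitary_repD(2)[OF U that])
  show "unitary_rep G T n (\<lambda>g. S * U g * mat_adjoint S)"
    unfolding unitary_rep_def
  proof (intro conjI ballI allI impI um)
    fix g h assume g: "g \<in> carrier G" and h: "h \<in> carrier G"
    note c = unitary_repD(1)[OF U g] unitary_repD(1)[OF U h]
    have "S * U g * mat_adjoint S * (S * U h * mat_adjoint S) =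
        S * U g * (mat_adjoint S * S) * U h * mat_adjoint S"
      using S'(1,2) c by (simp add: assoc_mult_mat[of _ n n _ n _ n])
    also have "\<dots> = S * (U g * U h) * mat_adjoint S"
      unfolding S'(3) using S'(1,2) c by (simp add: assoc_mult_mat[of _ n n _ n _ n])
    finally show "S * U (g \<otimes> h) * mat_adjoint S = S * U g * mat_adjoint S * (S * U h * mat_adjoint S)"
      using unitary_rep_mult[OF U g h] by simp
  next
    fix i j assume ij: "i < n" "j < n"
    have ent: "(\<Sum>b<n. (\<Sum>a<n. S $$ (i, a) * U g $$ (a, b)) * mat_adjoint S $$ (b, j)) = (S * U g * mat_adjoint S) $$ (i, j)"
      if g: "g \<in> carrier G" for g
    proof -
      note c = unitary_repD(1)[OF U g]
      have SU: "S * U g \<in> carrier_mat n n" using S'(1) c by simp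
      show ?thesis
        unfolding mat_mult_index[OF SU S'(2) ij]
        by (intro sum.cong refl) (simp only: mat_mult_index[OF S'(1) c ij(1)] lessThan_iff)
    qed
    have "continuous_map T euclidean (\<lambda>g. \<Sum>b<n. (\<Sum>a<n. S $$ (i, a) * U g $$ (a, b)) * mat_adjoint S $$ (b, j))"
      by (intro continuous_map_sum continuous_map_mult_normed_algebra unitary_rep_cont[OF U]) auto
    then show "continuous_map T euclidean (\<lambda>g. (S * U g * mat_adjoint S) $$ (i, j))"
      by (rule continuous_map_cong_carrier) (rule ent)
  qed
  show "unitarily_equiv G U (\<lambda>g. S * U g * mat_adjoint S)"
  proof (rule unitarily_equivI[OF S])
    fix g assume g: "g \<in> carrier G"
    note c = unitary_repD(1)[OF U g]
    show "U g \<in> carrier_mat n n" by (rule c)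
    show "S * U g * mat_adjoint S \<in> carrier_mat n n" using S'(1,2) c by simp
    have "S * U g * mat_adjoint S * S = S * U g * (mat_adjoint S * S)"
      using S'(1,2) c by (simp add: assoc_mult_mat[of _ n n _ n _ n])
    then show "S * U g = S * U g * mat_adjoint S * S" unfolding S'(3) using S'(1) c by simp
  qed
qed

text \<open>The rows and columns of the block vanish outside it, so the sums in a matrix product and
  in the unitarity relation collapse to the block.\<close>

lemma unitary_rep_block:
  assumes M: "unitary_rep G T n M" and os: "s + t \<le> n"
    and z1: "\<And>g i j. g \<in> carrier G \<Longrightarrow> i < t \<Longrightarrow> j < n \<Longrightarrow> \<not> (s \<le> j \<and> j < s + t) \<Longrightarrow> M g $$ (s + i, j) = 0"
    and z2: "\<And>g i j. g \<in> carrier G \<Longrightarrow> i < t \<Longrightarrow> j < n \<Longrightarrow> \<not> (s \<le> j \<and> j < s + t) \<Longrightarrow> M g $$ (j, s + i) = 0"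
  shows "unitary_rep G T t (\<lambda>g. mat t t (\<lambda>(i, j). M g $$ (s + i, s + j)))" (is "unitary_rep G T t ?B")
proof -
  have restrict: "(\<Sum>l<n. f l) = (\<Sum>l<t. f (s + l))"
    if "\<And>l. l < n \<Longrightarrow> \<not> (s \<le> l \<and> l < s + t) \<Longrightarrow> f l = 0" for f :: "nat \<Rightarrow> complex"
  proof -
    have "(\<Sum>l<n. f l) = (\<Sum>l\<in>{s..<s + t}. f l)"
      using that os by (intro sum.mono_neutral_right) auto
    also have "\<dots> = (\<Sum>l<t. f (s + l))"
      using sum.shift_bounds_nat_ivl[of f 0 s t] by (simp add: atLeast0LessThan add.commute)
    finally show ?thesis .
  qed
  have Bc: "?B g \<in> carrier_mat t t" for g by simp
  show ?thesis
    unfolding unitary_rep_def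
  proof (intro conjI ballI allI impI)
    fix g assume g: "g \<in> carrier G"
    note Mg = unitary_matD[OF unitary_repD(2)[OF M g]]
    show "unitary_mat t (?B g)"
      unfolding unitary_mat_def
    proof (intro conjI Bc eq_matI)
      fix i j assume "i < dim_row (1\<^sub>m t :: complex mat)" "j < dim_col (1\<^sub>m t :: complex mat)"
      then have ij: "i < t" "j < t" by auto
      then have sij: "s + i < n" "s + j < n" using os by auto
      have "(1\<^sub>m n :: complex mat) $$ (s + i, s + j) = (\<Sum>l<n. mat_adjoint (M g) $$ (s + i, l) * M g $$ (l, s + j))"
        using mat_mult_index[OF Mg(2,1) sij] unfolding Mg(3) .
      also have "\<dots> = (\<Sum>l<t. mat_adjoint (M g) $$ (s + i, s + l) * M g $$ (s + l, s + j))"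
        by (rule restrict) (simp add: z2[OF g ij(2)])
      also have "\<dots> = (\<Sum>l<t. mat_adjoint (?B g) $$ (i, l) * ?B g $$ (l, j))"
        using ij os sij by (intro sum.cong refl) (simp add: mat_adjoint_entry[OF Mg(1)] mat_adjoint_entry[OF Bc])
      also have "\<dots> = (mat_adjoint (?B g) * ?B g) $$ (i, j)"
        by (rule mat_mult_index[OF mat_adjoint_carrier[OF Bc] Bc ij, symmetric])
      finally show "(mat_adjoint (?B g) * ?B g) $$ (i, j) = 1\<^sub>m t $$ (i, j)" using ij sij by simp
    qed auto
    fix h assume h: "h \<in> carrier G"
    note Mh = unitary_repD(1)[OF M h]
    show "?B (g \<otimes> h) = ?B g * ?B h"
    proof (rule eq_matI)
      fix i j assume "i < dim_row (?B g * ?B h)" "j < dim_col (?B g * ?B h)"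
      then have ij: "i < t" "j < t" by auto
      then have sij: "s + i < n" "s + j < n" using os by auto
      have "?B (g \<otimes> h) $$ (i, j) = (M g * M h) $$ (s + i, s + j)"
        using ij unitary_rep_mult[OF M g h] by simp
      also have "\<dots> = (\<Sum>l<n. M g $$ (s + i, l) * M h $$ (l, s + j))"
        by (rule mat_mult_index[OF Mg(1) Mh sij])
      also have "\<dots> = (\<Sum>l<t. M g $$ (s + i, s + l) * M h $$ (s + l, s + j))"
        by (rule restrict) (simp add: z1[OF g ij(1)])
      also have "\<dots> = (\<Sum>l<t. ?B g $$ (i, l) * ?B h $$ (l, j))" using ij by (intro sum.cong refl) simp
      finally show "?B (g \<otimes> h) $$ (i, j) = (?B g * ?B h) $$ (i, j)"
        unfolding mat_mult_index[OF Bc Bc ij] .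
    qed auto
  next
    fix i j assume ij: "i < t" "j < t"
    then have "continuous_map T euclidean (\<lambda>g. M g $$ (s + i, s + j))"
      using os by (intro unitary_rep_cont[OF M]) auto
    then show "continuous_map T euclidean (\<lambda>g. ?B g $$ (i, j))" using ij by simp
  qed
qed

text \<open>In an orthonormal basis adapted to \<open>W\<close> invariance makes one off-diagonal
  block vanish. The other one is its adjoint at the inverse group element and vanishes too.\<close>

lemma reducible_rep_block_form:
  assumes U: "unitary_rep G T n U" and W: "vec_subspace n W"
    and inv: "\<forall>g\<in>carrier G. \<forall>w\<in>W. U g *\<^sub>v w \<in> W"
    and nt: "W \<noteq> {0\<^sub>v n}" "W \<noteq> carrier_vec n"
  shows "\<exists>k S. 0 < k \<and> k < n \<and> unitary_mat n S \<and>
    (\<forall>g\<in>carrier G. \<forall>i<n. \<forall>j<n. (i < k) \<noteq> (j < k) \<longrightarrow> (S * U g * mat_adjoint S) $$ (i, j) = 0)"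
proof -
  define W' where "W' = {f. vec n f \<in> W}"
  have sub: "fun_subspace W'"
    unfolding fun_subspace_def
  proof (intro conjI ballI allI)
    have "vec n (\<lambda>_. 0) = (0\<^sub>v n :: complex vec)" by (rule eq_vecI) auto
    then show "(\<lambda>_. 0) \<in> W'" using W by (simp add: W'_def vec_subspace_def)
    fix f g c d assume fg: "f \<in> W'" "g \<in> W'"
    have "vec n (\<lambda>x. c * f x + d * g x) = c \<cdot>\<^sub>v vec n f + d \<cdot>\<^sub>v vec n g" by (rule eq_vecI) auto
    then show "(\<lambda>x. c * f x + d * g x) \<in> W'" using W fg by (simp add: W'_def vec_subspace_def)
  qed
  obtain k p where k: "k \<le> n" and p: "orthonormal_family n n p" "\<forall>i<k. p i \<in> W'"
    "\<forall>f\<in>W'. \<forall>i<n. k \<le> i \<longrightarrow> cin n f (p i) = 0"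
    and exp: "\<forall>f\<in>W'. \<forall>a<n. f a = (\<Sum>i<k. cin n f (p i) * p i a)"
    and compl: "\<forall>f. \<forall>a<n. f a = (\<Sum>i<n. cin n f (p i) * p i a)"
    using adapted_orthonormal_basis[OF sub, of n] by (elim exE conjE)
  have Wc: "W \<subseteq> carrier_vec n" "0\<^sub>v n \<in> W" using W by (auto simp: vec_subspace_def)
  have "k \<noteq> 0"
  proof
    assume k0: "k = 0"
    have "w = 0\<^sub>v n" if w: "w \<in> W" for w
    proof (rule eq_vecI)
      have "w \<in> carrier_vec n" using w Wc by auto
      then have "vec n (\<lambda>i. w $ i) = w" by (intro eq_vecI) auto
      then have "(\<lambda>i. w $ i) \<in> W'" using w by (simp add: W'_def)
      then show "w $ i = 0\<^sub>v n $ i" if "i < dim_vec (0\<^sub>v n :: complex vec)" for i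
        using exp k0 that by simp
      show "dim_vec w = dim_vec (0\<^sub>v n :: complex vec)" using \<open>w \<in> carrier_vec n\<close> by simp
    qed
    then have "W = {0\<^sub>v n}" using Wc by blast
    then show False using nt by simp
  qed
  moreover have "k \<noteq> n"
  proof
    assume kn: "k = n"
    have "v \<in> W" if v: "v \<in> carrier_vec n" for v
    proof -
      have "(\<lambda>a. \<Sum>i<n. cin n (\<lambda>i. v $ i) (p i) * p i a) \<in> W'"
        using p(2) kn by (intro fun_subspace_sum[OF sub]) auto
      then have "vec n (\<lambda>a. \<Sum>i<n. cin n (\<lambda>i. v $ i) (p i) * p i a) \<in> W" by (simp add: W'_def)
      moreover have "vec n (\<lambda>a. \<Sum>i<n. cin n (\<lambda>i. v $ i) (p i) * p i a) = v"
      proof (rule eq_vecI)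
        fix a assume "a < dim_vec v"
        then have a: "a < n" using v by simp
        then show "vec n (\<lambda>a. \<Sum>i<n. cin n (\<lambda>i. v $ i) (p i) * p i a) $ a = v $ a"
          using compl[rule_format, of a "\<lambda>i. v $ i"] by simp
      qed (use v in simp)
      ultimately show ?thesis by simp
    qed
    then show False using nt Wc by blast
  qed
  ultimately have k': "0 < k" "k < n" using k by auto
  \<comment> \<open>Row \<open>i\<close> holds the conjugates of \<open>p i\<close>, so
    \<open>S\<close> computes coefficients with respect to the adapted basis.\<close>
  define S where "S = mat n n (\<lambda>(i, a). cnj (p i a))"
  have Sc: "S \<in> carrier_mat n n" by (simp add: S_def)
  note Sa = mat_adjoint_carrier[OF Sc]
  have "S * mat_adjoint S = 1\<^sub>m n"
  proof (rule eq_matI)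
    fix i j assume "i < dim_row (1\<^sub>m n :: complex mat)" "j < dim_col (1\<^sub>m n :: complex mat)"
    then have ij: "i < n" "j < n" by auto
    have "(S * mat_adjoint S) $$ (i, j) = (\<Sum>a<n. p j a * cnj (p i a))"
      unfolding mat_mult_index[OF Sc Sa ij] using ij
      by (intro sum.cong refl) (simp add: mat_adjoint_entry[OF Sc] S_def mult.commute)
    also have "\<dots> = cin n (p j) (p i)" by (simp add: cin_def)
    finally show "(S * mat_adjoint S) $$ (i, j) = 1\<^sub>m n $$ (i, j)"
      using p(1) ij by (simp add: orthonormal_family_def)
  qed (use Sc Sa in auto)
  from mat_mult_left_right_inverse[OF Sc Sa this] have S: "unitary_mat n S"
    using Sc by (simp add: unitary_mat_def)
  let ?M = "\<lambda>g. S * U g * mat_adjoint S"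
  have M: "unitary_rep G T n ?M" by (rule unitary_rep_conjugate(1)[OF U S])
  \<comment> \<open>The entry is the inner product of \<open>U g\<close> applied to
    \<open>p j\<close>, which lies in \<open>W\<close>, with \<open>p i\<close>, which is orthogonal
    to \<open>W\<close>.\<close>
  have lower: "?M g $$ (i, j) = 0" if g: "g \<in> carrier G" and ij: "j < k" "k \<le> i" "i < n" for g i j
  proof -
    note c = unitary_repD(1)[OF U g]
    have SU: "S * U g \<in> carrier_mat n n" using Sc c by simp
    have j: "j < n" using ij k by simp
    have "?M g $$ (i, j) = (\<Sum>b<n. (S * U g) $$ (i, b) * mat_adjoint S $$ (b, j))"
      by (rule mat_mult_index[OF SU Sa ij(3) j])
    also have "\<dots> = (\<Sum>b<n. (\<Sum>a<n. cnj (p i a) * U g $$ (a, b)) * p j b)"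
    proof (intro sum.cong refl)
      fix b assume "b \<in> {..<n}"
      then have b: "b < n" by simp
      have "(S * U g) $$ (i, b) = (\<Sum>a<n. cnj (p i a) * U g $$ (a, b))"
        unfolding mat_mult_index[OF Sc c ij(3) b] using ij by (intro sum.cong refl) (simp add: S_def)
      then show "(S * U g) $$ (i, b) * mat_adjoint S $$ (b, j) = (\<Sum>a<n. cnj (p i a) * U g $$ (a, b)) * p j b"
        using b j by (simp add: mat_adjoint_entry[OF Sc] S_def)
    qed
    also have "\<dots> = (\<Sum>b<n. \<Sum>a<n. U g $$ (a, b) * p j b * cnj (p i a))"
      unfolding sum_distrib_right by (intro sum.cong refl) (simp add: mult_ac)
    also have "\<dots> = (\<Sum>a<n. (\<Sum>b<n. U g $$ (a, b) * p j b) * cnj (p i a))"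
      by (subst sum.swap) (simp add: sum_distrib_right)
    also have "\<dots> = cin n (\<lambda>a. \<Sum>b<n. U g $$ (a, b) * p j b) (p i)" by (simp add: cin_def)
    also have "\<dots> = 0"
    proof -
      have "vec n (p j) \<in> W" using p(2) ij by (simp add: W'_def)
      then have "U g *\<^sub>v vec n (p j) \<in> W" using inv g by blast
      moreover have "U g *\<^sub>v vec n (p j) = vec n (\<lambda>a. \<Sum>b<n. U g $$ (a, b) * p j b)"
        using c by (intro eq_vecI) (auto simp: scalar_prod_def atLeast0LessThan)
      ultimately have "(\<lambda>a. \<Sum>b<n. U g $$ (a, b) * p j b) \<in> W'" by (simp add: W'_def)
      then show ?thesis using p(3) ij by blast
    qed
    finally show ?thesis .
  qed
  have "?M g $$ (i, j) = 0" if g: "g \<in> carrier G" and ij: "i < n" "j < n" "(i < k) \<noteq> (j < k)" for g i j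
  proof (cases "j < k")
    case True
    then show ?thesis using lower[OF g] ij by simp
  next
    case False
    then have l: "i < k" "k \<le> j" using ij by auto
    have ig: "inv g \<in> carrier G" using g by simp
    have "mat_adjoint (?M (inv g)) = ?M g"
      using unitary_rep_inv[OF is_group M ig] g by simp
    then have "?M g $$ (i, j) = cnj (?M (inv g) $$ (j, i))"
      using mat_adjoint_entry[OF unitary_repD(1)[OF M ig] ij(1,2)] by simp
    then show ?thesis using lower[OF ig l ij(2)] by simp
  qed
  then have "0 < k \<and> k < n \<and> unitary_mat n S \<and>
    (\<forall>g\<in>carrier G. \<forall>i<n. \<forall>j<n. (i < k) \<noteq> (j < k) \<longrightarrow> ?M g $$ (i, j) = 0)"
    using k' S by simp
  then show ?thesis by - (rule exI[of _ k], rule exI[of _ S])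
qed

section \<open>Complete reducibility\<close>

lemma block_diagonal_mult:
  fixes A A' B B' :: "complex mat"
  assumes A: "A \<in> carrier_mat k k" "A' \<in> carrier_mat k k" and B: "B \<in> carrier_mat l l" "B' \<in> carrier_mat l l"
  shows "four_block_mat A (0\<^sub>m k l) (0\<^sub>m l k) B * four_block_mat A' (0\<^sub>m k l) (0\<^sub>m l k) B' =
    four_block_mat (A * A') (0\<^sub>m k l) (0\<^sub>m l k) (B * B')"
  using A B by (subst mult_four_block_mat[OF A(1) _ _ B(1) A(2) _ _ B(2)]) auto

lemma direct_sum_rep_append_equiv:
  assumes A: "unitary_rep G T k A" and B: "unitary_rep G T l B"
    and eA: "unitarily_equiv G A (direct_sum_rep Us)" and eB: "unitarily_equiv G B (direct_sum_rep Vs)"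
  shows "unitarily_equiv G (\<lambda>g. four_block_mat (A g) (0\<^sub>m k l) (0\<^sub>m l k) (B g)) (direct_sum_rep (Us @ Vs))"
proof -
  obtain R where R: "unitary_mat k R" and eR: "\<forall>g\<in>carrier G. direct_sum_rep Us g \<in> carrier_mat k k \<and>
      R * A g = direct_sum_rep Us g * R \<and> A g = mat_adjoint R * direct_sum_rep Us g * R"
    using unitarily_equiv_conjugation[OF eA is_group A] by (elim exE conjE)
  obtain Q where Q: "unitary_mat l Q" and eQ: "\<forall>g\<in>carrier G. direct_sum_rep Vs g \<in> carrier_mat l l \<and>
      Q * B g = direct_sum_rep Vs g * Q \<and> B g = mat_adjoint Q * direct_sum_rep Vs g * Q"
    using unitarily_equiv_conjugation[OF eB is_group B] by (elim exE conjE)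
  note R' = unitary_matD[OF R] and Q' = unitary_matD[OF Q]
  define S where "S = four_block_mat R (0\<^sub>m k l) (0\<^sub>m l k) Q"
  have adjS: "mat_adjoint S = four_block_mat (mat_adjoint R) (0\<^sub>m k l) (0\<^sub>m l k) (mat_adjoint Q)"
    unfolding S_def using R'(1) Q'(1) by (intro eq_matI) auto
  have "mat_adjoint S * S = four_block_mat (1\<^sub>m k) (0\<^sub>m k l) (0\<^sub>m l k) (1\<^sub>m l)"
    unfolding adjS by (simp only: S_def block_diagonal_mult[OF R'(2,1) Q'(2,1)] R'(3) Q'(3))
  then have S: "unitary_mat (k + l) S" unfolding unitary_mat_def S_def using R'(1) Q'(1) by simp
  show ?thesis
  proof (rule unitarily_equivI[OF S])
    fix g assume g: "g \<in> carrier G"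
    note c = unitary_repD(1)[OF A g] unitary_repD(1)[OF B g]
    have d: "direct_sum_rep Us g \<in> carrier_mat k k" "direct_sum_rep Vs g \<in> carrier_mat l l"
      and e: "R * A g = direct_sum_rep Us g * R" "Q * B g = direct_sum_rep Vs g * Q"
      using bspec[OF eR g] bspec[OF eQ g] by blast+
    have app: "direct_sum_rep (Us @ Vs) g =
        four_block_mat (direct_sum_rep Us g) (0\<^sub>m k l) (0\<^sub>m l k) (direct_sum_rep Vs g)"
      using d by (simp add: direct_sum_rep_def diag_block_mat_append Let_def)
    show "four_block_mat (A g) (0\<^sub>m k l) (0\<^sub>m l k) (B g) \<in> carrier_mat (k + l) (k + l)" using c by simp
    show "direct_sum_rep (Us @ Vs) g \<in> carrier_mat (k + l) (k + l)" unfolding app using d by simp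
    show "S * four_block_mat (A g) (0\<^sub>m k l) (0\<^sub>m l k) (B g) = direct_sum_rep (Us @ Vs) g * S"
      unfolding app S_def block_diagonal_mult[OF R'(1) c(1) Q'(1) c(2)]
        block_diagonal_mult[OF d(1) R'(1) d(2) Q'(1)] e ..
  qed
qed

text \<open>Induction on the degree: a proper invariant subspace splits the representation into two
  diagonal blocks of smaller degree, whose decompositions are concatenated.\<close>

theorem complete_reducibility:
  assumes "unitary_rep G T n U"
  shows "\<exists>Us. (\<forall>V\<in>set Us. irreducible_rep G T V) \<and> unitarily_equiv G U (direct_sum_rep Us)"
  using assms
proof (induction n arbitrary: U rule: less_induct)
  case (less n)
  note U = less.prems
  consider "n = 0" | "irreducible_rep G T U" | "n > 0" "\<not> irreducible_rep G T U" by auto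
  then show ?case
  proof cases
    \<comment> \<open>Degree 0 is allowed for \<open>unitary_rep\<close> but excluded for
      irreducible representations; it is the empty direct sum.\<close>
    case 1
    have "unitarily_equiv G U (direct_sum_rep [])"
    proof (rule unitarily_equivI[OF unitary_mat_one[of 0]])
      fix g assume "g \<in> carrier G"
      note Ug = unitary_repD(1)[OF U this, unfolded 1]
      show "U g \<in> carrier_mat 0 0" by (rule Ug)
      show "direct_sum_rep [] g \<in> carrier_mat 0 0" by (simp add: direct_sum_rep_def)
      show "1\<^sub>m 0 * U g = direct_sum_rep [] g * 1\<^sub>m 0"
        using Ug by (intro eq_matI) (auto simp: direct_sum_rep_def)
    qed
    then show ?thesis by (intro exI[of _ "[]"]) simp
  next
    case 2
    have "direct_sum_rep [U] = U" by (simp add: direct_sum_rep_def del: diag_block_mat.simps)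
    then show ?thesis using 2 unitarily_equiv_refl[OF U] by (intro exI[of _ "[U]"]) simp
  next
    case 3
    then have "\<exists>W. vec_subspace n W \<and> (\<forall>g\<in>carrier G. \<forall>w\<in>W. U g *\<^sub>v w \<in> W) \<and>
        W \<noteq> {0\<^sub>v n} \<and> W \<noteq> carrier_vec n"
      using U unfolding irreducible_rep_iff by metis
    then obtain W where W: "vec_subspace n W" "\<forall>g\<in>carrier G. \<forall>w\<in>W. U g *\<^sub>v w \<in> W"
      "W \<noteq> {0\<^sub>v n}" "W \<noteq> carrier_vec n"
      by (elim exE conjE)
    obtain k S where k: "0 < k" "k < n" and S: "unitary_mat n S"
      and zero: "\<forall>g\<in>carrier G. \<forall>i<n. \<forall>j<n. (i < k) \<noteq> (j < k) \<longrightarrow> (S * U g * mat_adjoint S) $$ (i, j) = 0"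
      using reducible_rep_block_form[OF U W] by (elim exE conjE)
    define M where "M g = S * U g * mat_adjoint S" for g
    define l where "l = n - k"
    have l: "k + l = n" "l < n" using k by (auto simp: l_def)
    have M: "unitary_rep G T n M" and UM: "unitarily_equiv G U M"
      using unitary_rep_conjugate[OF U S] by (simp_all add: M_def[abs_def])
    have z: "M g $$ (i, j) = 0" if "g \<in> carrier G" "i < n" "j < n" "(i < k) \<noteq> (j < k)" for g i j
      using zero that by (simp add: M_def)
    define A where "A g = mat k k (\<lambda>(i, j). M g $$ (0 + i, 0 + j))" for g
    define B where "B g = mat l l (\<lambda>(i, j). M g $$ (k + i, k + j))" for g
    have A: "unitary_rep G T k A" unfolding A_def
      by (rule unitary_rep_block[OF M]) (use k z in auto)
    have B: "unitary_rep G T l B" unfolding B_def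
      by (rule unitary_rep_block[OF M]) (use k l z in auto)
    obtain As where As: "\<forall>V\<in>set As. irreducible_rep G T V" "unitarily_equiv G A (direct_sum_rep As)"
      using less.IH[OF k(2) A] by (elim exE conjE)
    obtain Bs where Bs: "\<forall>V\<in>set Bs. irreducible_rep G T V" "unitarily_equiv G B (direct_sum_rep Bs)"
      using less.IH[OF l(2) B] by (elim exE conjE)
    let ?F = "\<lambda>g. four_block_mat (A g) (0\<^sub>m k l) (0\<^sub>m l k) (B g)"
    have MF: "M g = ?F g" if g: "g \<in> carrier G" for g
    proof (rule eq_matI)
      have c: "M g \<in> carrier_mat n n" by (rule unitary_repD(1)[OF M g])
      show "dim_row (M g) = dim_row (?F g)" "dim_col (M g) = dim_col (?F g)"
        using c l by (auto simp: A_def B_def)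
      fix i j assume "i < dim_row (?F g)" "j < dim_col (?F g)"
      then have ij: "i < n" "j < n" using l by (auto simp: A_def B_def)
      show "M g $$ (i, j) = ?F g $$ (i, j)"
        using ij l z[OF g ij] by (auto simp: A_def B_def)
    qed
    have "unitarily_equiv G M ?F"
      using unitarily_equiv_refl[OF M] MF unfolding unitarily_equiv_def by simp
    with UM have "unitarily_equiv G U ?F" by (rule unitarily_equiv_trans[OF is_group])
    from unitarily_equiv_trans[OF is_group this direct_sum_rep_append_equiv[OF A B As(2) Bs(2)]]
    have "unitarily_equiv G U (direct_sum_rep (As @ Bs))" .
    then show ?thesis using As(1) Bs(1) by (intro exI[of _ "As @ Bs"]) auto
  qed
qed

end

section \<open>Matrix coefficients\<close>

context compact_group
begin

section \<open>The mean of complex functions\<close>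

abbreviation ccont :: "('a \<Rightarrow> complex) \<Rightarrow> bool" where
  "ccont f \<equiv> continuous_map T euclidean f"

definition hc :: "('a \<Rightarrow> complex) \<Rightarrow> complex" where
  "hc f = Complex (haar (\<lambda>x. Re (f x))) (haar (\<lambda>x. Im (f x)))"

lemma ccont_Re: "ccont f \<Longrightarrow> cont (\<lambda>x. Re (f x))"
  by (rule continuous_map_compose_continuous_on[of T f Re]) (auto intro: continuous_intros)

lemma ccont_Im: "ccont f \<Longrightarrow> cont (\<lambda>x. Im (f x))"
  by (rule continuous_map_compose_continuous_on[of T f Im]) (auto intro: continuous_intros)

lemma ccont_cnj: "ccont f \<Longrightarrow> ccont (\<lambda>x. cnj (f x))"
  by (rule continuous_map_compose_continuous_on[of T f cnj]) (auto intro: continuous_intros)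

lemmas ccont_mult = continuous_map_mult_normed_algebra[where X=T and 'b=complex]

lemma ccont_const: "ccont (\<lambda>_. c)" by simp

lemma hc_add: "ccont f \<Longrightarrow> ccont g \<Longrightarrow> hc (\<lambda>x. f x + g x) = hc f + hc g"
  by (simp add: hc_def complex_eq_iff haar_add ccont_Re ccont_Im)

lemma hc_cmult:
  assumes "ccont f"
  shows "hc (\<lambda>x. c * f x) = c * hc f"
  using haar_linear[OF ccont_Re[OF assms] ccont_Im[OF assms], of "Re c" "- Im c"]
    haar_linear[OF ccont_Im[OF assms] ccont_Re[OF assms], of "Re c" "Im c"]
  by (simp add: hc_def complex_eq_iff)

lemma hc_zero: "hc (\<lambda>x. 0) = 0"
  by (simp add: hc_def complex_eq_iff haar_const)

lemma hc_one: "hc (\<lambda>x. 1) = 1"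
  by (simp add: hc_def complex_eq_iff haar_const)

lemma hc_cnj: "ccont f \<Longrightarrow> hc (\<lambda>x. cnj (f x)) = cnj (hc f)"
  using haar_cmult[OF ccont_Im, of f "-1"] by (simp add: hc_def complex_eq_iff)

lemma hc_cong: "ccont f \<Longrightarrow> (\<And>x. x \<in> carrier G \<Longrightarrow> f x = g x) \<Longrightarrow> hc f = hc g"
  using haar_cong[OF ccont_Re, of f "\<lambda>x. Re (g x)"] haar_cong[OF ccont_Im, of f "\<lambda>x. Im (g x)"]
  by (simp add: hc_def)

lemma hc_left: "ccont f \<Longrightarrow> a \<in> carrier G \<Longrightarrow> hc (\<lambda>x. f (a \<otimes> x)) = hc f"
  by (simp add: hc_def haar_left[OF ccont_Re] haar_left[OF ccont_Im])

lemma hc_sum: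
  assumes "finite I" "\<And>i. i \<in> I \<Longrightarrow> ccont (f i)"
  shows "hc (\<lambda>x. \<Sum>i\<in>I. f i x) = (\<Sum>i\<in>I. hc (f i))"
  using assms
proof (induction I)
  case (insert i I)
  have "hc (\<lambda>x. f i x + (\<Sum>i\<in>I. f i x)) = hc (f i) + hc (\<lambda>x. \<Sum>i\<in>I. f i x)"
    using insert by (intro hc_add continuous_map_sum) auto
  then show ?case using insert by simp
qed (simp add: hc_zero)

text \<open>Estimating real and imaginary parts separately costs the factor 2; the tolerances in the
  approximation arguments are chosen accordingly.\<close>

lemma hc_bound:
  assumes f: "ccont f" and B: "\<And>x. x \<in> carrier G \<Longrightarrow> cmod (f x) \<le> B"
  shows "cmod (hc f) \<le> 2 * B"
proof -
  have "\<bar>haar (\<lambda>x. Re (f x))\<bar> \<le> B"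
    using B abs_Re_le_cmod order_trans by (intro haar_abs_le ccont_Re[OF f]) blast
  moreover have "\<bar>haar (\<lambda>x. Im (f x))\<bar> \<le> B"
    using B abs_Im_le_cmod order_trans by (intro haar_abs_le ccont_Im[OF f]) blast
  moreover have "cmod (hc f) \<le> \<bar>haar (\<lambda>x. Re (f x))\<bar> + \<bar>haar (\<lambda>x. Im (f x))\<bar>"
    using cmod_le[of "hc f"] by (simp add: hc_def)
  ultimately show ?thesis by linarith
qed

definition cip :: "('a \<Rightarrow> complex) \<Rightarrow> ('a \<Rightarrow> complex) \<Rightarrow> complex" where
  "cip f h = hc (\<lambda>x. f x * cnj (h x))"

lemma cip_cnj:
  assumes "ccont f" "ccont h"
  shows "cip h f = cnj (cip f h)"
  using hc_cnj[OF ccont_mult[OF assms(1) ccont_cnj[OF assms(2)]]] by (simp add: cip_def mult.commute)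

lemma cip_self_nonzero:
  assumes f: "ccont f" and x: "x \<in> carrier G" "f x \<noteq> 0"
  shows "cip f f \<noteq> 0"
proof -
  have c: "cont (\<lambda>x. Re (f x * cnj (f x)))" using f by (intro ccont_Re ccont_mult ccont_cnj)
  have eq: "Re (f y * cnj (f y)) = (cmod (f y))\<^sup>2" for y
    by (metis Re_complex_of_real complex_norm_square)
  have "haar (\<lambda>x. Re (f x * cnj (f x))) > 0"
    by (rule haar_pos[OF c _ x(1)]) (simp_all only: eq, use x in simp_all)
  then show ?thesis by (auto simp: cip_def hc_def complex_eq_iff)
qed

lemma cip_sum_right:
  assumes f: "ccont f" and I: "finite I" and h: "\<And>i. i \<in> I \<Longrightarrow> ccont (h i)"
  shows "cip f (\<lambda>x. \<Sum>i\<in>I. c i * h i x) = (\<Sum>i\<in>I. cnj (c i) * cip f (h i))"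
proof -
  have "cip f (\<lambda>x. \<Sum>i\<in>I. c i * h i x) = hc (\<lambda>x. \<Sum>i\<in>I. cnj (c i) * (f x * cnj (h i x)))"
    unfolding cip_def by (simp add: sum_distrib_left mult_ac)
  also have "\<dots> = (\<Sum>i\<in>I. hc (\<lambda>x. cnj (c i) * (f x * cnj (h i x))))"
    using f h I by (intro hc_sum ccont_mult ccont_cnj ccont_const) auto
  also have "\<dots> = (\<Sum>i\<in>I. cnj (c i) * cip f (h i))"
    unfolding cip_def using f h by (intro sum.cong refl hc_cmult ccont_mult ccont_cnj) auto
  finally show ?thesis .
qed

lemma cip_cong_right:
  assumes "ccont f" "ccont h" "\<And>x. x \<in> carrier G \<Longrightarrow> h x = h' x"
  shows "cip f h = cip f h'"
  unfolding cip_def using assms by (intro hc_cong ccont_mult ccont_cnj) auto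

text \<open>A linear space of continuous functions that absorbs multiplication by a self-conjugate set
  of functions is also stable under an algebra to which the Stone--Weierstrass theorem applies.\<close>

lemma multiplier_approximation:
  assumes S_cont: "\<And>f. f \<in> S \<Longrightarrow> ccont f"
    and S_add: "\<And>f h. f \<in> S \<Longrightarrow> h \<in> S \<Longrightarrow> (\<lambda>x. f x + h x) \<in> S"
    and S_cmult: "\<And>f c. f \<in> S \<Longrightarrow> (\<lambda>x. c * f x) \<in> S"
    and B_cont: "\<And>b. b \<in> B \<Longrightarrow> ccont b"
    and B_mult: "\<And>b f. b \<in> B \<Longrightarrow> f \<in> S \<Longrightarrow> (\<lambda>x. b x * f x) \<in> S"
    and B_cnj: "\<And>b f. b \<in> B \<Longrightarrow> f \<in> S \<Longrightarrow> (\<lambda>x. cnj (b x) * f x) \<in> S"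
    and F: "ccont F"
    and sep: "\<And>x y. x \<in> carrier G \<Longrightarrow> y \<in> carrier G \<Longrightarrow> (\<And>b. b \<in> B \<Longrightarrow> b x = b y) \<Longrightarrow> F x = F y"
    and e: "e > 0"
  shows "\<exists>a. ccont a \<and> (\<forall>f\<in>S. (\<lambda>x. a x * f x) \<in> S) \<and> (\<forall>x\<in>carrier G. cmod (F x - a x) < e)"
proof -
  \<comment> \<open>Requiring \<open>a\<close> and its conjugate to be multipliers makes
    \<open>A\<close> closed under conjugation.\<close>
  define A where "A = {a. ccont a \<and> (\<forall>f\<in>S. (\<lambda>x. a x * f x) \<in> S) \<and> (\<forall>f\<in>S. (\<lambda>x. cnj (a x) * f x) \<in> S)}"
  have A1: "(\<lambda>x. a x * f x) \<in> S" and A2: "(\<lambda>x. cnj (a x) * f x) \<in> S" if "a \<in> A" "f \<in> S" for a f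
    using that by (simp_all add: A_def)
  have BA: "B \<subseteq> A" using B_cont B_mult B_cnj by (auto simp: A_def)
  have "\<exists>g\<in>A. \<forall>x\<in>topspace T. cmod (F x - g x) < e"
  proof (rule Stone_Weierstrass_complex_compact_space[OF compact _ _ _ _ _ F _ e])
    show "ccont f" if "f \<in> A" for f using that by (simp add: A_def)
    show "(\<lambda>_. c) \<in> A" for c using S_cmult by (simp add: A_def)
    show "(\<lambda>x. f x + g x) \<in> A" if "f \<in> A" "g \<in> A" for f g
    proof -
      have "(\<lambda>x. (f x + g x) * h x) \<in> S" "(\<lambda>x. cnj (f x + g x) * h x) \<in> S" if "h \<in> S" for h
        using S_add[of "\<lambda>x. f x * h x" "\<lambda>x. g x * h x"]
          S_add[of "\<lambda>x. cnj (f x) * h x" "\<lambda>x. cnj (g x) * h x"] \<open>f \<in> A\<close> \<open>g \<in> A\<close> that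
        by (simp_all add: A_def distrib_right)
      then show ?thesis using that by (simp add: A_def continuous_map_add)
    qed
    show "(\<lambda>x. f x * g x) \<in> A" if "f \<in> A" "g \<in> A" for f g
    proof -
      have "(\<lambda>x. (f x * g x) * h x) \<in> S \<and> (\<lambda>x. cnj (f x * g x) * h x) \<in> S" if h: "h \<in> S" for h
      proof -
        have "(\<lambda>x. f x * (g x * h x)) \<in> S" by (rule A1[OF \<open>f \<in> A\<close> A1[OF \<open>g \<in> A\<close> h]])
        moreover have "(\<lambda>x. cnj (f x) * (cnj (g x) * h x)) \<in> S"
          by (rule A2[OF \<open>f \<in> A\<close> A2[OF \<open>g \<in> A\<close> h]])
        ultimately show ?thesis by (simp add: mult.assoc)
      qed
      then show ?thesis using that by (simp add: A_def ccont_mult)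
    qed
    show "(\<lambda>x. cnj (f x)) \<in> A" if "f \<in> A" for f using that by (simp add: A_def ccont_cnj)
    show "F x = F y" if "x \<in> topspace T" "y \<in> topspace T" "\<And>f. f \<in> A \<Longrightarrow> f x = f y" for x y
      by (rule sep) (use that topspace_eq BA in auto)
  qed
  then obtain a where "a \<in> A" "\<forall>x\<in>topspace T. cmod (F x - a x) < e" ..
  then have "ccont a \<and> (\<forall>f\<in>S. (\<lambda>x. a x * f x) \<in> S) \<and> (\<forall>x\<in>carrier G. cmod (F x - a x) < e)"
    by (simp add: A_def topspace_eq)
  then show ?thesis by - (rule exI[of _ a])
qed

section \<open>Continuous characters\<close>

lemma character_group_carrierD:
  assumes "\<chi> \<in> carrier (character_group G T)"
  shows "\<chi> \<in> extensional (carrier G)" "ccont \<chi>" "\<And>x. x \<in> carrier G \<Longrightarrow> cmod (\<chi> x) = 1"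
    "\<And>x y. x \<in> carrier G \<Longrightarrow> y \<in> carrier G \<Longrightarrow> \<chi> (x \<otimes> y) = \<chi> x * \<chi> y"
    "\<And>x. x \<in> carrier G \<Longrightarrow> \<chi> x * cnj (\<chi> x) = 1"
proof -
  show "\<chi> \<in> extensional (carrier G)" "ccont \<chi>" and n: "\<And>x. x \<in> carrier G \<Longrightarrow> cmod (\<chi> x) = 1"
    and "\<And>x y. x \<in> carrier G \<Longrightarrow> y \<in> carrier G \<Longrightarrow> \<chi> (x \<otimes> y) = \<chi> x * \<chi> y"
    using assms by (auto simp: character_group_def)
  show "\<chi> x * cnj (\<chi> x) = 1" if "x \<in> carrier G" for x
    using n[OF that] by (simp add: complex_norm_square[symmetric])
qed

text \<open>Translation by a point where the characters differ multiplies the mean of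
  \<open>\<chi> x * cnj (\<psi> x)\<close> by a factor other than 1 and yet leaves it
  unchanged.\<close>

lemma distinct_characters_orthogonal:
  assumes \<chi>: "\<chi> \<in> carrier (character_group G T)" and \<psi>: "\<psi> \<in> carrier (character_group G T)"
    and ne: "\<chi> \<noteq> \<psi>"
  shows "cip \<chi> \<psi> = 0"
proof -
  note c = character_group_carrierD[OF \<chi>] and p = character_group_carrierD[OF \<psi>]
  obtain a where a: "a \<in> carrier G" "\<chi> a \<noteq> \<psi> a"
    using ne extensionalityI[OF c(1) p(1)] by blast
  let ?f = "\<lambda>x. \<chi> x * cnj (\<psi> x)"
  have f: "ccont ?f" by (intro ccont_mult ccont_cnj c(2) p(2))
  have "hc ?f = hc (\<lambda>x. ?f (a \<otimes> x))" by (rule hc_left[OF f a(1), symmetric])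
  also have "\<dots> = hc (\<lambda>x. ?f a * ?f x)"
    by (rule hc_cong[OF continuous_map_translate(1)[OF f a(1)]]) (simp add: c(4) p(4) a(1))
  also have "\<dots> = ?f a * hc ?f" by (rule hc_cmult[OF f])
  finally have "hc ?f = 0 \<or> ?f a = 1" by (metis mult_cancel_right1)
  moreover have "?f a \<noteq> 1"
  proof
    assume "?f a = 1"
    then have "(\<chi> a * cnj (\<psi> a)) * \<psi> a = \<psi> a" by simp
    then have "\<chi> a * (\<psi> a * cnj (\<psi> a)) = \<psi> a" by (simp add: mult_ac)
    then show False using p(5)[OF a(1)] a(2) by simp
  qed
  ultimately show ?thesis by (simp add: cip_def)
qed

text \<open>A missing character \<open>\<chi>\<close> is orthogonal to all of \<open>L\<close>. The
  functions whose products with members of \<open>L\<close> are orthogonal to \<open>\<chi>\<close>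
  absorb \<open>L\<close>, so some multiplier of them is close to \<open>\<chi>\<close>. Applied to
  the constant 1 it is itself orthogonal to \<open>\<chi>\<close>, although
  \<open>cip \<chi> \<chi>\<close> is 1.\<close>

lemma separating_characters_exhaust:
  assumes L: "L \<subseteq> carrier (character_group G T)" and one: "(\<lambda>x\<in>carrier G. 1) \<in> L"
    and mult: "\<And>\<chi> \<psi>. \<chi> \<in> L \<Longrightarrow> \<psi> \<in> L \<Longrightarrow> (\<lambda>x\<in>carrier G. \<chi> x * \<psi> x) \<in> L"
    and conj: "\<And>\<chi>. \<chi> \<in> L \<Longrightarrow> (\<lambda>x\<in>carrier G. cnj (\<chi> x)) \<in> L"
    and sep: "\<And>x y. x \<in> carrier G \<Longrightarrow> y \<in> carrier G \<Longrightarrow> (\<And>\<chi>. \<chi> \<in> L \<Longrightarrow> \<chi> x = \<chi> y) \<Longrightarrow> x = y"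
  shows "L = carrier (character_group G T)"
proof (rule ccontr)
  assume "L \<noteq> carrier (character_group G T)"
  then obtain \<chi> where \<chi>: "\<chi> \<in> carrier (character_group G T)" "\<chi> \<notin> L" using L by blast
  note c = character_group_carrierD[OF \<chi>(1)]
  have Lc: "ccont \<psi>" if "\<psi> \<in> L" for \<psi> using character_group_carrierD(2) L that by blast
  define S where "S = {f. ccont f \<and> (\<forall>\<psi>\<in>L. hc (\<lambda>x. f x * \<psi> x * cnj (\<chi> x)) = 0)}"
  have Scont: "ccont (\<lambda>x. f x * \<psi> x * cnj (\<chi> x))" if "ccont f" "\<psi> \<in> L" for f \<psi>
    by (rule ccont_mult[OF ccont_mult[OF that(1) Lc[OF that(2)]] ccont_cnj[OF c(2)]])
  have SD: "hc (\<lambda>x. f x * \<psi> x * cnj (\<chi> x)) = 0" if "f \<in> S" "\<psi> \<in> L" for f \<psi>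
    using that by (simp add: S_def)
  have absorb: "(\<lambda>x. b x * f x) \<in> S" if b: "(\<lambda>x\<in>carrier G. b x) \<in> L" "ccont b" and f: "f \<in> S" for b f
  proof -
    have "hc (\<lambda>x. (b x * f x) * \<psi> x * cnj (\<chi> x)) = 0" if \<psi>: "\<psi> \<in> L" for \<psi>
    proof -
      have fc: "ccont f" using f by (simp add: S_def)
      let ?p = "\<lambda>x\<in>carrier G. (\<lambda>x\<in>carrier G. b x) x * \<psi> x"
      have p: "?p \<in> L" by (rule mult[OF b(1) \<psi>])
      have "hc (\<lambda>x. (b x * f x) * \<psi> x * cnj (\<chi> x)) = hc (\<lambda>x. f x * ?p x * cnj (\<chi> x))"
        using fc b(2) by (intro hc_cong Scont \<psi> ccont_mult) (auto simp: mult_ac)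
      also have "\<dots> = 0" by (rule SD[OF f p])
      finally show ?thesis .
    qed
    then show ?thesis using f b(2) by (simp add: S_def ccont_mult)
  qed
  have ext: "(\<lambda>x\<in>carrier G. \<psi> x) = \<psi>" if "\<psi> \<in> L" for \<psi>
    using character_group_carrierD(1) L that by (intro extensional_restrict) blast
  \<comment> \<open>The tolerance \<open>1/4\<close> survives the factor 2 of
    \<open>hc_bound\<close>: in the end 1 would be at most \<open>2 * (1/4)\<close>.\<close>
  have "\<exists>a. ccont a \<and> (\<forall>f\<in>S. (\<lambda>x. a x * f x) \<in> S) \<and> (\<forall>x\<in>carrier G. cmod (\<chi> x - a x) < 1/4)"
  proof (rule multiplier_approximation[where B=L])
    show "ccont f" if "f \<in> S" for f using that by (simp add: S_def)
    show "(\<lambda>x. f x + h x) \<in> S" if "f \<in> S" "h \<in> S" for f h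
    proof -
      have "hc (\<lambda>x. f x * \<psi> x * cnj (\<chi> x) + h x * \<psi> x * cnj (\<chi> x)) = 0" if "\<psi> \<in> L" for \<psi>
        using hc_add[OF Scont Scont, of f \<psi> h \<psi>] \<open>f \<in> S\<close> \<open>h \<in> S\<close> that by (simp add: S_def)
      then show ?thesis using that by (simp add: S_def continuous_map_add distrib_right)
    qed
    show "(\<lambda>x. k * f x) \<in> S" if "f \<in> S" for f k
    proof -
      have "hc (\<lambda>x. k * (f x * \<psi> x * cnj (\<chi> x))) = 0" if "\<psi> \<in> L" for \<psi>
        using hc_cmult[OF Scont, of f \<psi> k] \<open>f \<in> S\<close> that by (simp add: S_def)
      then show ?thesis using that by (simp add: S_def ccont_mult mult.assoc)
    qed
    show "ccont b" if "b \<in> L" for b by (rule Lc[OF that])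
    show "(\<lambda>x. b x * f x) \<in> S" if "b \<in> L" "f \<in> S" for b f
      using absorb[OF _ Lc[OF that(1)] that(2)] ext[OF that(1)] that(1) by simp
    show "(\<lambda>x. cnj (b x) * f x) \<in> S" if "b \<in> L" "f \<in> S" for b f
      by (rule absorb[OF conj[OF that(1)] ccont_cnj[OF Lc[OF that(1)]] that(2)])
    show "\<chi> x = \<chi> y" if "x \<in> carrier G" "y \<in> carrier G" "\<And>b. b \<in> L \<Longrightarrow> b x = b y" for x y
      using sep[OF that] by simp
  qed (use c(2) in auto)
  then obtain a where a: "ccont a" "\<forall>f\<in>S. (\<lambda>x. a x * f x) \<in> S" "\<forall>x\<in>carrier G. cmod (\<chi> x - a x) < 1/4"
    by (elim exE conjE)
  have "(\<lambda>x. 1) \<in> S"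
  proof -
    have "hc (\<lambda>x. \<psi> x * cnj (\<chi> x)) = 0" if "\<psi> \<in> L" for \<psi>
    proof -
      have "\<psi> \<in> carrier (character_group G T)" "\<psi> \<noteq> \<chi>" using that L \<chi>(2) by auto
      from distinct_characters_orthogonal[OF this(1) \<chi>(1) this(2)] show ?thesis by (simp add: cip_def)
    qed
    then show ?thesis by (simp add: S_def)
  qed
  from bspec[OF a(2) this] have "(\<lambda>x. a x * 1) \<in> S" .
  then have 0: "hc (\<lambda>x. a x * 1 * (\<lambda>x\<in>carrier G. 1) x * cnj (\<chi> x)) = 0" by (rule SD[OF _ one])
  have ac: "ccont (\<lambda>x. a x * cnj (\<chi> x))" by (intro ccont_mult a(1) ccont_cnj c(2))
  have z: "hc (\<lambda>x. a x * cnj (\<chi> x)) = 0"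
    by (rule trans[OF hc_cong[OF ac] 0]) simp
  have cc: "hc (\<lambda>x. \<chi> x * cnj (\<chi> x)) = 1"
    by (rule trans[OF hc_cong[OF ccont_mult[OF c(2) ccont_cnj[OF c(2)]]] hc_one]) (rule c(5))
  have dc: "ccont (\<lambda>x. (\<chi> x - a x) * cnj (\<chi> x))"
    by (rule ccont_mult[OF continuous_map_diff[OF c(2) a(1)] ccont_cnj[OF c(2)]])
  have "hc (\<lambda>x. \<chi> x * cnj (\<chi> x)) = hc (\<lambda>x. (\<chi> x - a x) * cnj (\<chi> x) + a x * cnj (\<chi> x))"
    by (simp add: algebra_simps)
  also have "\<dots> = hc (\<lambda>x. (\<chi> x - a x) * cnj (\<chi> x)) + hc (\<lambda>x. a x * cnj (\<chi> x))"
    by (rule hc_add[OF dc ac])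
  finally have "hc (\<lambda>x. (\<chi> x - a x) * cnj (\<chi> x)) = 1" unfolding cc z by simp
  moreover have "cmod (hc (\<lambda>x. (\<chi> x - a x) * cnj (\<chi> x))) \<le> 2 * (1/4)"
    by (rule hc_bound[OF dc]) (use a(3) in \<open>simp add: norm_mult c(3) less_imp_le\<close>)
  ultimately show False by simp
qed

end

section \<open>Classes of irreducible representations, entries of direct sums\<close>

definition irr_class :: "('g, 'b) monoid_scheme \<Rightarrow> 'g topology \<Rightarrow> ('g \<Rightarrow> complex mat) \<Rightarrow> ('g \<Rightarrow> complex mat) set" where
  "irr_class G T U = irr_equiv_rel G T `` {U}"

lemma conj_rep_conj_rep [simp]: "conj_rep (conj_rep U) = U"
  by (rule ext) (auto simp: conj_rep_def intro!: eq_matI)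

lemma conj_rep_entry:
  "U g \<in> carrier_mat n n \<Longrightarrow> i < n \<Longrightarrow> j < n \<Longrightarrow> conj_rep U g $$ (i, j) = cnj (U g $$ (i, j))"
  by (auto simp: conj_rep_def)

lemma direct_sum_rep_Cons:
  assumes "V g \<in> carrier_mat n n" "direct_sum_rep Us g \<in> carrier_mat N N"
  shows "direct_sum_rep (V # Us) g = four_block_mat (V g) (0\<^sub>m n N) (0\<^sub>m N n) (direct_sum_rep Us g)"
  using assms by (simp add: direct_sum_rep_def Let_def)

text \<open>Positions of blocks are abstracted away, so that constituents can be detected through
  coefficient functions. The second conjunct leads from a nonzero coefficient of the sum to a
  summand, the last one from a summand back to the sum.\<close>

lemma direct_sum_rep_entries:
  assumes "\<forall>V\<in>set Us. \<exists>n. \<forall>g\<in>carrier G. V g \<in> carrier_mat n n"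
  shows "\<exists>N. (\<forall>g\<in>carrier G. direct_sum_rep Us g \<in> carrier_mat N N) \<and>
    (\<forall>a<N. \<forall>b<N. (\<forall>g\<in>carrier G. direct_sum_rep Us g $$ (a, b) = 0) \<or>
      (\<exists>V\<in>set Us. \<exists>n p q. p < n \<and> q < n \<and> (\<forall>g\<in>carrier G. V g \<in> carrier_mat n n \<and>
         direct_sum_rep Us g $$ (a, b) = V g $$ (p, q)))) \<and>
    (\<forall>V\<in>set Us. \<exists>n. (\<forall>g\<in>carrier G. V g \<in> carrier_mat n n) \<and>
       (\<forall>p<n. \<forall>q<n. \<exists>a<N. \<exists>b<N. \<forall>g\<in>carrier G. direct_sum_rep Us g $$ (a, b) = V g $$ (p, q)))"
  using assms
proof (induction Us)
  case Nil
  show ?case by (intro exI[of _ 0]) (simp add: direct_sum_rep_def)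
next
  case (Cons V Us)
  have sub: "\<forall>V\<in>set Us. \<exists>n. \<forall>g\<in>carrier G. V g \<in> carrier_mat n n"
    using Cons.prems by simp
  obtain N where N: "\<forall>g\<in>carrier G. direct_sum_rep Us g \<in> carrier_mat N N"
    and ent: "\<forall>a<N. \<forall>b<N. (\<forall>g\<in>carrier G. direct_sum_rep Us g $$ (a, b) = 0) \<or>
      (\<exists>V\<in>set Us. \<exists>n p q. p < n \<and> q < n \<and> (\<forall>g\<in>carrier G. V g \<in> carrier_mat n n \<and>
         direct_sum_rep Us g $$ (a, b) = V g $$ (p, q)))"
    and occ: "\<forall>V\<in>set Us. \<exists>n. (\<forall>g\<in>carrier G. V g \<in> carrier_mat n n) \<and>
       (\<forall>p<n. \<forall>q<n. \<exists>a<N. \<exists>b<N. \<forall>g\<in>carrier G. direct_sum_rep Us g $$ (a, b) = V g $$ (p, q))"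
    using Cons.IH[OF sub] by (elim exE conjE)
  obtain n where n: "\<forall>g\<in>carrier G. V g \<in> carrier_mat n n" using bspec[OF Cons.prems, of V] by auto
  have D: "direct_sum_rep (V # Us) g = four_block_mat (V g) (0\<^sub>m n N) (0\<^sub>m N n) (direct_sum_rep Us g)"
    if "g \<in> carrier G" for g
    using direct_sum_rep_Cons[of V g n Us N] n N that by simp
  have 1: "\<forall>g\<in>carrier G. direct_sum_rep (V # Us) g \<in> carrier_mat (n + N) (n + N)"
    using D n N by simp
  have idx: "direct_sum_rep (V # Us) g $$ (a, b) =
      (if a < n then if b < n then V g $$ (a, b) else 0
       else if b < n then 0 else direct_sum_rep Us g $$ (a - n, b - n))"
    if "g \<in> carrier G" "a < n + N" "b < n + N" for g a b
  proof -
    have "V g \<in> carrier_mat n n" "direct_sum_rep Us g \<in> carrier_mat N N" using n N that by auto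
    then show ?thesis unfolding D[OF that(1)] using that by auto
  qed
  have 2: "(\<forall>g\<in>carrier G. direct_sum_rep (V # Us) g $$ (a, b) = 0) \<or>
      (\<exists>W\<in>set (V # Us). \<exists>n p q. p < n \<and> q < n \<and> (\<forall>g\<in>carrier G. W g \<in> carrier_mat n n \<and>
         direct_sum_rep (V # Us) g $$ (a, b) = W g $$ (p, q)))" if ab: "a < n + N" "b < n + N" for a b
  proof -
    consider "a < n" "b < n" | "(a < n) \<noteq> (b < n)" | "\<not> a < n" "\<not> b < n" by auto
    then show ?thesis
    proof cases
      case 1
      then have "a < n \<and> b < n \<and> (\<forall>g\<in>carrier G. V g \<in> carrier_mat n n \<and>
         direct_sum_rep (V # Us) g $$ (a, b) = V g $$ (a, b))" using idx ab n by simp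
      then show ?thesis by (intro disjI2 bexI[of _ V] exI[of _ n] exI[of _ a] exI[of _ b]) simp_all
    next
      case 2
      then have "\<forall>g\<in>carrier G. direct_sum_rep (V # Us) g $$ (a, b) = 0" using idx ab by auto
      then show ?thesis by (rule disjI1)
    next
      case 3
      then have lt: "a - n < N" "b - n < N" using ab by linarith+
      have eq: "direct_sum_rep (V # Us) g $$ (a, b) = direct_sum_rep Us g $$ (a - n, b - n)"
        if "g \<in> carrier G" for g using idx[OF that ab] 3 by simp
      from ent lt have "(\<forall>g\<in>carrier G. direct_sum_rep Us g $$ (a - n, b - n) = 0) \<or>
        (\<exists>V\<in>set Us. \<exists>n' p q. p < n' \<and> q < n' \<and> (\<forall>g\<in>carrier G. V g \<in> carrier_mat n' n' \<and>
         direct_sum_rep Us g $$ (a - n, b - n) = V g $$ (p, q)))" by simp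
      then show ?thesis
      proof
        assume "\<forall>g\<in>carrier G. direct_sum_rep Us g $$ (a - n, b - n) = 0"
        then show ?thesis using eq by simp
      next
        assume "\<exists>V\<in>set Us. \<exists>n' p q. p < n' \<and> q < n' \<and> (\<forall>g\<in>carrier G. V g \<in> carrier_mat n' n' \<and>
         direct_sum_rep Us g $$ (a - n, b - n) = V g $$ (p, q))"
        then obtain W n' p q where W: "W \<in> set Us" "p < n'" "q < n'" "\<forall>g\<in>carrier G. W g \<in> carrier_mat n' n' \<and>
         direct_sum_rep Us g $$ (a - n, b - n) = W g $$ (p, q)" by (elim bexE exE conjE)
        then show ?thesis using eq
          by (intro disjI2 bexI[of _ W] exI[of _ n'] exI[of _ p] exI[of _ q]) simp_all
      qed
    qed
  qed
  have 3: "\<exists>m. (\<forall>g\<in>carrier G. W g \<in> carrier_mat m m) \<and> (\<forall>p<m. \<forall>q<m. \<exists>a<n + N. \<exists>b<n + N. \<forall>g\<in>carrier G.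
         direct_sum_rep (V # Us) g $$ (a, b) = W g $$ (p, q))" if W: "W \<in> set (V # Us)" for W
  proof (cases "W = V")
    case True
    have occ': "\<forall>p<n. \<forall>q<n. \<exists>a<n + N. \<exists>b<n + N. \<forall>g\<in>carrier G.
      direct_sum_rep (V # Us) g $$ (a, b) = W g $$ (p, q)"
    proof (intro allI impI)
      fix p q assume pq: "p < n" "q < n"
      have "\<forall>g\<in>carrier G. direct_sum_rep (V # Us) g $$ (p, q) = W g $$ (p, q)"
        using True pq idx by simp
      then show "\<exists>a<n + N. \<exists>b<n + N. \<forall>g\<in>carrier G. direct_sum_rep (V # Us) g $$ (a, b) = W g $$ (p, q)"
        using pq by - (rule exI[of _ p], rule conjI, simp, rule exI[of _ q], simp)
    qed
    have "\<forall>g\<in>carrier G. W g \<in> carrier_mat n n" using n True by simp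
    with occ' show ?thesis by - (rule exI[of _ n], rule conjI)
  next
    case False
    then have "W \<in> set Us" using W by simp
    from bspec[OF occ this] obtain m where mc: "\<forall>g\<in>carrier G. W g \<in> carrier_mat m m"
      and m: "\<forall>p<m. \<forall>q<m. \<exists>a<N. \<exists>b<N. \<forall>g\<in>carrier G. direct_sum_rep Us g $$ (a, b) = W g $$ (p, q)"
      by (elim exE conjE)
    have occ': "\<forall>p<m. \<forall>q<m. \<exists>a<n + N. \<exists>b<n + N. \<forall>g\<in>carrier G.
      direct_sum_rep (V # Us) g $$ (a, b) = W g $$ (p, q)"
    proof (intro allI impI)
      fix p q assume pq: "p < m" "q < m"
      have "\<exists>a<N. \<exists>b<N. \<forall>g\<in>carrier G. direct_sum_rep Us g $$ (a, b) = W g $$ (p, q)"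
        using m pq by simp
      then obtain a b where ab: "a < N" "b < N" "\<forall>g\<in>carrier G. direct_sum_rep Us g $$ (a, b) = W g $$ (p, q)"
        by (elim exE conjE)
      have "\<forall>g\<in>carrier G. direct_sum_rep (V # Us) g $$ (n + a, n + b) = W g $$ (p, q)"
        using idx ab by simp
      then show "\<exists>a<n + N. \<exists>b<n + N. \<forall>g\<in>carrier G. direct_sum_rep (V # Us) g $$ (a, b) = W g $$ (p, q)"
        using ab by - (rule exI[of _ "n + a"], rule conjI, simp, rule exI[of _ "n + b"], simp)
    qed
    with mc show ?thesis by - (rule exI[of _ m], rule conjI)
  qed
  show ?case
    by (rule exI[of _ "n + N"], intro conjI, rule 1, intro allI impI, rule 2, assumption, assumption,
        rule ballI, rule 3, assumption)
qed

context topological_group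
begin

lemma unitary_rep_cong:
  assumes U: "unitary_rep G T n U" and eq: "\<And>g. g \<in> carrier G \<Longrightarrow> U g = V g"
  shows "unitary_rep G T n V"
  unfolding unitary_rep_def
proof (intro conjI ballI allI impI)
  fix g assume g: "g \<in> carrier G"
  show "unitary_mat n (V g)" using unitary_repD(2)[OF U g] eq[OF g] by simp
  fix h assume h: "h \<in> carrier G"
  show "V (g \<otimes> h) = V g * V h" using unitary_rep_mult[OF U g h] eq g h by simp
next
  fix i j assume "i < n" "j < n"
  from unitary_rep_cont[OF U this] show "continuous_map T euclidean (\<lambda>g. V g $$ (i, j))"
    by (rule continuous_map_cong_carrier) (simp add: eq)
qed

lemma unitary_rep_equiv:
  assumes U: "unitary_rep G T n U" and e: "unitarily_equiv G U V"
  shows "unitary_rep G T n V"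
proof -
  obtain S where S: "unitary_mat n S" and eS: "\<forall>g\<in>carrier G. V g \<in> carrier_mat n n \<and> S * U g = V g * S \<and>
    U g = mat_adjoint S * V g * S"
    using unitarily_equiv_conjugation[OF e is_group U] by (elim exE conjE)
  note S' = unitary_matD[OF S]
  show ?thesis
  proof (rule unitary_rep_cong[OF unitary_rep_conjugate(1)[OF U S]])
    fix g assume g: "g \<in> carrier G"
    then have Vg: "V g \<in> carrier_mat n n" and SU: "S * U g = V g * S" using bspec[OF eS g] by blast+
    have "S * U g * mat_adjoint S = V g * (S * mat_adjoint S)"
      unfolding SU using S'(1,2) Vg by (simp add: assoc_mult_mat[of _ n n _ n _ n])
    then show "S * U g * mat_adjoint S = V g" unfolding S'(4) using Vg by simp
  qed
qed

lemma irreducible_rep_unitary: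
  assumes "irreducible_rep G T U"
  obtains n where "n > 0" "unitary_rep G T n U"
  using assms unfolding irreducible_rep_def by auto

lemma irr_equiv_rel_iff:
  "(U, V) \<in> irr_equiv_rel G T \<longleftrightarrow> irreducible_rep G T U \<and> irreducible_rep G T V \<and> unitarily_equiv G U V"
  by (simp add: irr_equiv_rel_def)

lemma irr_class_iff:
  "V \<in> irr_class G T U \<longleftrightarrow> irreducible_rep G T U \<and> irreducible_rep G T V \<and> unitarily_equiv G U V"
  by (simp add: irr_class_def irr_equiv_rel_iff)

lemma irr_class_self: "irreducible_rep G T U \<Longrightarrow> U \<in> irr_class G T U"
  by (metis irr_class_iff irreducible_rep_unitary unitarily_equiv_refl)

lemma irr_class_in: "irreducible_rep G T U \<Longrightarrow> irr_class G T U \<in> irr_classes G T"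
  by (auto simp: irr_class_def irr_classes_def intro: quotientI)

lemma irr_class_eq:
  assumes "irreducible_rep G T U" "irreducible_rep G T V" "unitarily_equiv G U V"
  shows "irr_class G T U = irr_class G T V"
proof (rule Set.set_eqI)
  fix W
  show "W \<in> irr_class G T U \<longleftrightarrow> W \<in> irr_class G T V"
    unfolding irr_class_iff using assms unitarily_equiv_trans[OF is_group] unitarily_equiv_sym by meson
qed

lemma irr_classesE:
  assumes "D \<in> irr_classes G T"
  obtains U where "irreducible_rep G T U" "D = irr_class G T U"
  using assms by (auto simp: irr_classes_def irr_class_def elim!: quotientE)

lemma irr_classes_memD:
  assumes D: "D \<in> irr_classes G T" and U: "U \<in> D"
  shows "irreducible_rep G T U" "D = irr_class G T U"
proof -
  obtain V where V: "irreducible_rep G T V" "D = irr_class G T V" using irr_classesE[OF D] .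
  then have VU: "irreducible_rep G T U" "unitarily_equiv G V U" using U by (simp_all add: irr_class_iff)
  then show "irreducible_rep G T U" by simp
  show "D = irr_class G T U" unfolding V(2) by (rule irr_class_eq[OF V(1) VU])
qed

lemma irr_classes_nonempty:
  assumes "D \<in> irr_classes G T"
  obtains U where "U \<in> D"
  using irr_classesE[OF assms] irr_class_self by metis

end

context compact_group
begin

section \<open>Orthogonality of matrix coefficients\<close>

abbreviation coef :: "('a \<Rightarrow> complex mat) \<Rightarrow> nat \<Rightarrow> nat \<Rightarrow> 'a \<Rightarrow> complex" where
  "coef U i j \<equiv> (\<lambda>g. U g $$ (i, j))"

lemma hc_linear_combination:
  fixes n :: nat
  assumes "\<And>i. i < n \<Longrightarrow> ccont (f i)"
  shows "hc (\<lambda>g. \<Sum>i<n. c i * f i g) = (\<Sum>i<n. c i * hc (f i))"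
proof -
  have "hc (\<lambda>g. \<Sum>i<n. c i * f i g) = (\<Sum>i<n. hc (\<lambda>g. c i * f i g))"
    using assms by (intro hc_sum ccont_mult[OF ccont_const]) auto
  also have "\<dots> = (\<Sum>i<n. c i * hc (f i))"
    using assms by (intro sum.cong refl hc_cmult) auto
  finally show ?thesis .
qed

text \<open>Conjugation by the intertwiner writes a coefficient of \<open>Y\<close> as a linear
  combination of coefficients of \<open>Z\<close>, so \<open>f\<close> cannot be orthogonal to all
  of the latter.\<close>

lemma cip_coef_equiv:
  assumes f: "ccont f" and Y: "unitary_rep G T n Y" and e: "unitarily_equiv G Y Z"
    and kl: "k < n" "l < n" and nz: "cip f (coef Y k l) \<noteq> 0"
  shows "\<exists>a<n. \<exists>b<n. cip f (coef Z a b) \<noteq> 0"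
proof (rule ccontr)
  assume neg: "\<not> ?thesis"
  have Z: "unitary_rep G T n Z" by (rule unitary_rep_equiv[OF Y e])
  obtain S where S: "unitary_mat n S" and eS: "\<forall>g\<in>carrier G. Z g \<in> carrier_mat n n \<and> S * Y g = Z g * S \<and>
    Y g = mat_adjoint S * Z g * S"
    using unitarily_equiv_conjugation[OF e is_group Y] by (elim exE conjE)
  note S' = unitary_matD[OF S]
  let ?I = "{..<n} \<times> {..<n}"
  let ?c = "\<lambda>p. mat_adjoint S $$ (k, snd p) * S $$ (fst p, l)"
  have exp: "Y g $$ (k, l) = (\<Sum>p\<in>?I. ?c p * Z g $$ (snd p, fst p))" if g: "g \<in> carrier G" for g
  proof -
    note Zg = unitary_repD(1)[OF Z g]
    have SZ: "mat_adjoint S * Z g \<in> carrier_mat n n" using S'(2) Zg by simp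
    have "Y g = mat_adjoint S * Z g * S" using bspec[OF eS g] by blast
    then have "Y g $$ (k, l) = (\<Sum>b<n. (mat_adjoint S * Z g) $$ (k, b) * S $$ (b, l))"
      using mat_mult_index[OF SZ S'(1) kl] by simp
    also have "\<dots> = (\<Sum>b<n. \<Sum>a<n. ?c (b, a) * Z g $$ (a, b))"
    proof (intro sum.cong refl)
      fix b assume "b \<in> {..<n}"
      then have e: "(mat_adjoint S * Z g) $$ (k, b) = (\<Sum>a<n. mat_adjoint S $$ (k, a) * Z g $$ (a, b))"
        by (intro mat_mult_index[OF S'(2) Zg kl(1)]) simp
      show "(mat_adjoint S * Z g) $$ (k, b) * S $$ (b, l) = (\<Sum>a<n. ?c (b, a) * Z g $$ (a, b))"
        unfolding e sum_distrib_right by (simp add: mult_ac)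
    qed
    finally show ?thesis by (simp add: sum.cartesian_product case_prod_beta')
  qed
  have "cip f (coef Y k l) = cip f (\<lambda>g. \<Sum>p\<in>?I. ?c p * Z g $$ (snd p, fst p))"
    using exp by (intro cip_cong_right f unitary_rep_cont[OF Y] kl) auto
  also have "\<dots> = (\<Sum>p\<in>?I. cnj (?c p) * cip f (coef Z (snd p) (fst p)))"
    using f unitary_rep_cont[OF Z] by (intro cip_sum_right) auto
  also have "\<dots> = 0" using neg by (intro sum.neutral) auto
  finally show False using nz by simp
qed

text \<open>Pairing the entries \<open>(q, l)\<close> of \<open>X\<close> with the entries
  \<open>(p, j)\<close> of \<open>W\<close> gives the mean of \<open>X g\<close> times a matrix unit
  times the adjoint of \<open>W g\<close>. By invariance this matrix intertwines \<open>W\<close>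
  and \<open>X\<close>, and \<open>nz\<close> says that it is not zero.\<close>

lemma irreducible_coef_orthogonal:
  assumes irrW: "irreducible_rep G T W" and irrX: "irreducible_rep G T X"
    and W: "unitary_rep G T m W" and X: "unitary_rep G T n X"
    and kl: "k < n" "l < n" and ij: "i < m" "j < m" and nz: "cip (coef X k l) (coef W i j) \<noteq> 0"
  shows "unitarily_equiv G W X"
proof (rule Schur_intertwiner[OF is_group irrW irrX W X])
  let ?s = "\<lambda>q p. cip (coef X q l) (coef W p j)"
  let ?S = "mat n m (\<lambda>(q, p). ?s q p)"
  show "?S \<in> carrier_mat n m" by simp
  show "k < n" "i < m" "?S $$ (k, i) \<noteq> 0" using kl ij nz by simp_all
  note cX = unitary_rep_cont[OF X] and cW = unitary_rep_cont[OF W]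
  fix h assume h: "h \<in> carrier G"
  have ih: "inv h \<in> carrier G" using h by simp
  note Xh = unitary_repD(1)[OF X h] and Wh = unitary_repD(1)[OF W h]
  show "?S * W h = X h * ?S"
  proof (rule eq_matI)
    fix q p assume "q < dim_row (X h * ?S)" "p < dim_col (X h * ?S)"
    then have qp: "q < n" "p < m" using Xh by auto
    have "(X h * ?S) $$ (q, p) = (\<Sum>r<n. X h $$ (q, r) * ?s r p)"
      using qp by (simp add: mat_mult_index[OF Xh, of ?S m q p] del: index_mult_mat)
    also have "\<dots> = hc (\<lambda>g. \<Sum>r<n. X h $$ (q, r) * (X g $$ (r, l) * cnj (W g $$ (p, j))))"
    proof -
      have c: "ccont (\<lambda>g. X g $$ (r, l) * cnj (W g $$ (p, j)))" if "r < n" for r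
        by (intro ccont_mult ccont_cnj cX cW that kl qp ij)
      show ?thesis by (simp only: cip_def hc_linear_combination[OF c])
    qed
    also have "\<dots> = hc (\<lambda>g. X (h \<otimes> g) $$ (q, l) * cnj (W g $$ (p, j)))"
    proof (rule hc_cong[symmetric])
      show "ccont (\<lambda>g. X (h \<otimes> g) $$ (q, l) * cnj (W g $$ (p, j)))"
        by (intro ccont_mult ccont_cnj cW qp ij continuous_map_translate(1)[OF cX h] kl)
      fix g assume g: "g \<in> carrier G"
      show "X (h \<otimes> g) $$ (q, l) * cnj (W g $$ (p, j)) =
          (\<Sum>r<n. X h $$ (q, r) * (X g $$ (r, l) * cnj (W g $$ (p, j))))"
        unfolding unitary_rep_mult[OF X h g] mat_mult_index[OF Xh unitary_repD(1)[OF X g] qp(1) kl(2)]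
        by (simp add: sum_distrib_right mult.assoc)
    qed
    \<comment> \<open>Substituting \<open>inv h \<otimes> g\<close> for \<open>g\<close> removes
      \<open>h\<close> from the argument of \<open>X\<close> and puts its inverse into that of
      \<open>W\<close>, where unitarity turns it into entries of \<open>W h\<close>.\<close>
    also have "\<dots> = hc (\<lambda>g. X (h \<otimes> (inv h \<otimes> g)) $$ (q, l) * cnj (W (inv h \<otimes> g) $$ (p, j)))"
      by (rule hc_left[OF _ ih, symmetric])
        (intro ccont_mult ccont_cnj cW qp ij continuous_map_translate(1)[OF cX h] kl)
    also have "\<dots> = hc (\<lambda>g. \<Sum>r<m. W h $$ (r, p) * (X g $$ (q, l) * cnj (W g $$ (r, j))))"
    proof (rule hc_cong[symmetric])
      show "ccont (\<lambda>g. \<Sum>r<m. W h $$ (r, p) * (X g $$ (q, l) * cnj (W g $$ (r, j))))"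
        by (intro continuous_map_sum ccont_mult ccont_cnj ccont_const cX cW qp ij kl) auto
      fix g assume g: "g \<in> carrier G"
      have "h \<otimes> (inv h \<otimes> g) = g" using h g m_assoc[of h "inv h" g] by simp
      moreover have "cnj (W (inv h \<otimes> g) $$ (p, j)) = (\<Sum>r<m. W h $$ (r, p) * cnj (W g $$ (r, j)))"
        unfolding unitary_rep_mult[OF W ih g] unitary_rep_inv[OF is_group W h]
          mat_mult_index[OF mat_adjoint_carrier[OF Wh] unitary_repD(1)[OF W g] qp(2) ij(2)]
        using qp by (simp add: mat_adjoint_entry[OF Wh])
      ultimately show "(\<Sum>r<m. W h $$ (r, p) * (X g $$ (q, l) * cnj (W g $$ (r, j)))) =
          X (h \<otimes> (inv h \<otimes> g)) $$ (q, l) * cnj (W (inv h \<otimes> g) $$ (p, j))"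
        by (simp add: sum_distrib_left mult_ac)
    qed
    also have "\<dots> = (\<Sum>r<m. W h $$ (r, p) * ?s q r)"
    proof -
      have c: "ccont (\<lambda>g. X g $$ (q, l) * cnj (W g $$ (r, j)))" if "r < m" for r
        by (intro ccont_mult ccont_cnj cX cW that kl qp ij)
      show ?thesis by (simp only: cip_def hc_linear_combination[OF c])
    qed
    also have "\<dots> = (?S * W h) $$ (q, p)"
      using qp by (simp add: mat_mult_index[OF _ Wh, of ?S n q p] mult.commute del: index_mult_mat)
    finally show "(?S * W h) $$ (q, p) = (X h * ?S) $$ (q, p)" by simp
  qed (use Xh Wh in auto)
qed

end

section \<open>Constituents of tensor products\<close>

context compact_group
begin

lemma irreducible_reps_square:
  assumes "\<forall>V\<in>set Us. irreducible_rep G T V"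
  shows "\<forall>V\<in>set Us. \<exists>n. \<forall>g\<in>carrier G. V g \<in> carrier_mat n n"
proof
  fix V assume "V \<in> set Us"
  then have irr: "irreducible_rep G T V" using assms by simp
  obtain n where n: "n > 0" "unitary_rep G T n V" using irreducible_rep_unitary[OF irr] .
  show "\<exists>n. \<forall>g\<in>carrier G. V g \<in> carrier_mat n n"
    by (rule exI[of _ n], rule ballI, rule unitary_repD(1)[OF n(2)])
qed

text \<open>After complete reduction a coefficient of \<open>Y\<close> is a combination of
  coefficients of the summands, so one of these is not orthogonal to \<open>f\<close>. As
  \<open>f\<close> is arbitrary, known constituents can be recognised and new ones produced.\<close>

lemma constituent_of_nonzero_cip:
  assumes f: "ccont f" and Y: "unitary_rep G T N Y" and kl: "k < N" "l < N"
    and nz: "cip f (coef Y k l) \<noteq> 0"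
  shows "\<exists>V n p q. irreducible_rep G T V \<and> unitary_rep G T n V \<and> p < n \<and> q < n \<and>
    irr_class G T V \<in> irr_constituents G T Y \<and> cip f (coef V p q) \<noteq> 0"
proof -
  obtain Us where Us: "\<forall>V\<in>set Us. irreducible_rep G T V" and e: "unitarily_equiv G Y (direct_sum_rep Us)"
    using complete_reducibility[OF Y] by (elim exE conjE)
  let ?Z = "direct_sum_rep Us"
  have Z: "unitary_rep G T N ?Z" by (rule unitary_rep_equiv[OF Y e])
  obtain a b where ab: "a < N" "b < N" "cip f (coef ?Z a b) \<noteq> 0"
    using cip_coef_equiv[OF f Y e kl nz] by (elim exE conjE)
  from direct_sum_rep_entries[OF irreducible_reps_square[OF Us]]
  obtain N' where N': "\<forall>g\<in>carrier G. ?Z g \<in> carrier_mat N' N'"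
    and ent: "\<forall>a<N'. \<forall>b<N'. (\<forall>g\<in>carrier G. ?Z g $$ (a, b) = 0) \<or>
      (\<exists>V\<in>set Us. \<exists>n p q. p < n \<and> q < n \<and> (\<forall>g\<in>carrier G. V g \<in> carrier_mat n n \<and>
         ?Z g $$ (a, b) = V g $$ (p, q)))" by (elim exE conjE)
  have "?Z \<one> \<in> carrier_mat N' N'" "?Z \<one> \<in> carrier_mat N N" using N' unitary_repD(1)[OF Z] by simp_all
  then have "N' = N" by (metis carrier_matD(1))
  then have "(\<forall>g\<in>carrier G. ?Z g $$ (a, b) = 0) \<or>
      (\<exists>V\<in>set Us. \<exists>n p q. p < n \<and> q < n \<and> (\<forall>g\<in>carrier G. V g \<in> carrier_mat n n \<and>
         ?Z g $$ (a, b) = V g $$ (p, q)))" using ent ab by simp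
  moreover have "\<not> (\<forall>g\<in>carrier G. ?Z g $$ (a, b) = 0)"
  proof
    assume "\<forall>g\<in>carrier G. ?Z g $$ (a, b) = 0"
    then have "cip f (coef ?Z a b) = cip f (\<lambda>_. 0)"
      by (intro cip_cong_right f unitary_rep_cont[OF Z] ab) simp
    then show False using ab by (simp add: cip_def hc_zero)
  qed
  ultimately obtain V n p q where V: "V \<in> set Us" "p < n" "q < n"
    "\<forall>g\<in>carrier G. V g \<in> carrier_mat n n \<and> ?Z g $$ (a, b) = V g $$ (p, q)"
    by (elim disjE) (blast, elim bexE exE conjE, blast)
  have irrV: "irreducible_rep G T V" using Us V by simp
  obtain m where m: "m > 0" "unitary_rep G T m V" using irreducible_rep_unitary[OF irrV] .
  have "V \<one> \<in> carrier_mat n n" "V \<one> \<in> carrier_mat m m" using V(4) unitary_repD(1)[OF m(2)] by simp_all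
  then have "n = m" by (metis carrier_matD(1))
  have "cip f (coef ?Z a b) = cip f (coef V p q)"
    using V(4) by (intro cip_cong_right f unitary_rep_cont[OF Z] ab) simp
  then have nz': "cip f (coef V p q) \<noteq> 0" using ab by simp
  have "irr_class G T V \<in> irr_constituents G T Y"
    unfolding irr_constituents_def using Us e V(1) irr_class_in[OF irrV] irr_class_self[OF irrV] by blast
  then have "irreducible_rep G T V \<and> unitary_rep G T n V \<and> p < n \<and> q < n \<and>
    irr_class G T V \<in> irr_constituents G T Y \<and> cip f (coef V p q) \<noteq> 0"
    using irrV m(2) V nz' \<open>n = m\<close> by simp
  then show ?thesis by - (rule exI[of _ V], rule exI[of _ n], rule exI[of _ p], rule exI[of _ q])
qed

text \<open>The given \<open>W\<close> need not be a summand itself. Its coefficients are compared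
  with those of an equivalent summand, and these occur literally in the direct sum.\<close>

lemma constituent_nonzero_cip:
  assumes Y: "unitary_rep G T N Y" and F: "F \<in> irr_constituents G T Y" and W: "W \<in> F"
    and m: "unitary_rep G T m W"
  shows "\<exists>k<N. \<exists>l<N. \<exists>i<m. \<exists>j<m. cip (coef Y k l) (coef W i j) \<noteq> 0"
proof -
  obtain Us V where FC: "F \<in> irr_classes G T" and Us: "\<forall>V\<in>set Us. irreducible_rep G T V"
    and e: "unitarily_equiv G Y (direct_sum_rep Us)" and V: "V \<in> set Us" "V \<in> F"
    using F unfolding irr_constituents_def by blast
  let ?Z = "direct_sum_rep Us"
  have Z: "unitary_rep G T N ?Z" by (rule unitary_rep_equiv[OF Y e])
  have irr: "irreducible_rep G T V" "irreducible_rep G T W" using irr_classes_memD(1)[OF FC] V W by auto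
  have "V \<in> irr_class G T W" using irr_classes_memD(2)[OF FC W] V by simp
  then have WV: "unitarily_equiv G W V" by (simp add: irr_class_iff)
  have n: "unitary_rep G T m V" by (rule unitary_rep_equiv[OF m WV])
  have m0: "m > 0" by (rule irreducible_repD(1)[OF is_group irr(2) m])
  have cV: "ccont (coef V 0 0)" by (rule unitary_rep_cont[OF n m0 m0])
  \<comment> \<open>The corner entry at the unit is 1, so this coefficient is not the zero
    function.\<close>
  have "V \<one> $$ (0, 0) \<noteq> 0" using unitary_rep_one[OF is_group n] m0 by simp
  from cip_self_nonzero[OF cV one_closed this] have "cip (coef V 0 0) (coef V 0 0) \<noteq> 0" .
  from cip_coef_equiv[OF cV n unitarily_equiv_sym[OF WV] m0 m0 this]
  obtain i j where ij: "i < m" "j < m" "cip (coef V 0 0) (coef W i j) \<noteq> 0" by (elim exE conjE)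
  have cW: "ccont (coef W i j)" by (rule unitary_rep_cont[OF m ij(1,2)])
  from direct_sum_rep_entries[OF irreducible_reps_square[OF Us]]
  obtain N' where N': "\<forall>g\<in>carrier G. ?Z g \<in> carrier_mat N' N'"
    and occ: "\<forall>V\<in>set Us. \<exists>n. (\<forall>g\<in>carrier G. V g \<in> carrier_mat n n) \<and>
       (\<forall>p<n. \<forall>q<n. \<exists>a<N'. \<exists>b<N'. \<forall>g\<in>carrier G. ?Z g $$ (a, b) = V g $$ (p, q))"
    by (elim exE conjE)
  have "?Z \<one> \<in> carrier_mat N' N'" "?Z \<one> \<in> carrier_mat N N" using N' unitary_repD(1)[OF Z] by simp_all
  then have NN: "N' = N" by (metis carrier_matD(1))
  obtain n' where n': "\<forall>g\<in>carrier G. V g \<in> carrier_mat n' n'"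
      "\<forall>p<n'. \<forall>q<n'. \<exists>a<N. \<exists>b<N. \<forall>g\<in>carrier G. ?Z g $$ (a, b) = V g $$ (p, q)"
    using bspec[OF occ V(1)] unfolding NN by (elim exE conjE)
  have "V \<one> \<in> carrier_mat n' n'" "V \<one> \<in> carrier_mat m m" using n'(1) unitary_repD(1)[OF n] by simp_all
  then have "n' = m" by (metis carrier_matD(1))
  then have "\<exists>a<N. \<exists>b<N. \<forall>g\<in>carrier G. ?Z g $$ (a, b) = V g $$ (0, 0)"
    using n'(2) m0 by simp
  then obtain a b where ab: "a < N" "b < N" "\<forall>g\<in>carrier G. ?Z g $$ (a, b) = V g $$ (0, 0)"
    by (elim exE conjE)
  have cZ: "ccont (coef ?Z a b)" by (rule unitary_rep_cont[OF Z ab(1,2)])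
  have "cip (coef W i j) (coef V 0 0) \<noteq> 0" using cip_cnj[OF cV cW] ij(3) by simp
  moreover have "cip (coef W i j) (coef ?Z a b) = cip (coef W i j) (coef V 0 0)"
    using ab(3) by (intro cip_cong_right cW cZ) simp
  ultimately have "cip (coef W i j) (coef ?Z a b) \<noteq> 0" by simp
  from cip_coef_equiv[OF cW Z unitarily_equiv_sym[OF e] ab(1,2) this]
  obtain k l where kl: "k < N" "l < N" "cip (coef W i j) (coef Y k l) \<noteq> 0" by (elim exE conjE)
  have "cip (coef Y k l) (coef W i j) \<noteq> 0"
    using cip_cnj[OF cW unitary_rep_cont[OF Y kl(1,2)]] kl(3) by simp
  then show ?thesis using kl(1,2) ij(1,2) by blast
qed

text \<open>Any constituent that meets a coefficient of \<open>W\<close> is equivalent to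
  \<open>W\<close> by orthogonality.\<close>

lemma constituentI:
  assumes Y: "unitary_rep G T N Y" and irr: "irreducible_rep G T W" and W: "unitary_rep G T m W"
    and kl: "k < N" "l < N" and ij: "i < m" "j < m"
    and nz: "cip (coef Y k l) (coef W i j) \<noteq> 0"
  shows "irr_class G T W \<in> irr_constituents G T Y"
proof -
  have cW: "ccont (coef W i j)" by (rule unitary_rep_cont[OF W ij])
  have cY: "ccont (coef Y k l)" by (rule unitary_rep_cont[OF Y kl])
  have "cip (coef W i j) (coef Y k l) \<noteq> 0" using cip_cnj[OF cY cW] nz by simp
  from constituent_of_nonzero_cip[OF cW Y kl this]
  obtain V n p q where V: "irreducible_rep G T V" "unitary_rep G T n V" "p < n" "q < n"
    "irr_class G T V \<in> irr_constituents G T Y" "cip (coef W i j) (coef V p q) \<noteq> 0" by (elim exE conjE)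
  have "unitarily_equiv G V W"
    by (rule irreducible_coef_orthogonal[OF V(1) irr V(2) W ij V(3,4,6)])
  then show ?thesis using irr_class_eq[OF V(1) irr] V(5) by simp
qed

text \<open>\<open>W\<close> is a constituent of the tensor product of \<open>U\<close> and \<open>V\<close>, expressed symmetrically enough
  to make Frobenius reciprocity (\<open>linked_dual\<close>) evident.\<close>

definition linked :: "('a \<Rightarrow> complex mat) \<Rightarrow> ('a \<Rightarrow> complex mat) \<Rightarrow> ('a \<Rightarrow> complex mat) \<Rightarrow> bool" where
  "linked U V W \<longleftrightarrow> (\<exists>n m r a b c d i j. unitary_rep G T n U \<and> unitary_rep G T m V \<and> unitary_rep G T r W \<and>
     a < n \<and> b < n \<and> c < m \<and> d < m \<and> i < r \<and> j < r \<and>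
     hc (\<lambda>g. U g $$ (a, b) * V g $$ (c, d) * cnj (W g $$ (i, j))) \<noteq> 0)"

lemma linkedE:
  assumes "linked U V W" "unitary_rep G T n U" "unitary_rep G T m V" "unitary_rep G T r W"
  obtains a b c d i j where "a < n" "b < n" "c < m" "d < m" "i < r" "j < r"
    "hc (\<lambda>g. U g $$ (a, b) * V g $$ (c, d) * cnj (W g $$ (i, j))) \<noteq> 0"
proof -
  obtain n' m' r' a b c d i j where reps: "unitary_rep G T n' U" "unitary_rep G T m' V" "unitary_rep G T r' W"
    and idx: "a < n'" "b < n'" "c < m'" "d < m'" "i < r'" "j < r'"
    and nz: "hc (\<lambda>g. U g $$ (a, b) * V g $$ (c, d) * cnj (W g $$ (i, j))) \<noteq> 0"
    using assms(1) unfolding linked_def by (elim exE conjE)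
  have "n' = n" "m' = m" "r' = r"
    using unitary_rep_dim_unique[OF is_group reps(1) assms(2)]
      unitary_rep_dim_unique[OF is_group reps(2) assms(3)]
      unitary_rep_dim_unique[OF is_group reps(3) assms(4)] .
  with idx nz show thesis by - (rule that[of a b c d i j], simp_all)
qed

lemma linkedI:
  assumes "unitary_rep G T n U" "unitary_rep G T m V" "unitary_rep G T r W"
    "a < n" "b < n" "c < m" "d < m" "i < r" "j < r"
    "hc (\<lambda>g. U g $$ (a, b) * V g $$ (c, d) * cnj (W g $$ (i, j))) \<noteq> 0"
  shows "linked U V W"
  unfolding linked_def
  by (rule exI[of _ n], rule exI[of _ m], rule exI[of _ r], rule exI[of _ a], rule exI[of _ b],
      rule exI[of _ c], rule exI[of _ d], rule exI[of _ i], rule exI[of _ j]) (simp add: assms)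

lemma linked_unitary_repE:
  assumes "linked U V W"
  obtains n m r where "unitary_rep G T n U" "unitary_rep G T m V" "unitary_rep G T r W"
  using assms unfolding linked_def by (elim exE conjE)

text \<open>Conjugating the mean exchanges the roles of \<open>U\<close> and \<open>W\<close> and
  conjugates the factor from \<open>V\<close>.\<close>

lemma linked_dual:
  assumes "linked U V W"
  shows "linked W (conj_rep V) U"
proof -
  obtain n m r where U: "unitary_rep G T n U" and V: "unitary_rep G T m V" and W: "unitary_rep G T r W"
    using linked_unitary_repE[OF assms] .
  obtain a b c d i j where idx: "a < n" "b < n" "c < m" "d < m" "i < r" "j < r"
    and nz: "hc (\<lambda>g. U g $$ (a, b) * V g $$ (c, d) * cnj (W g $$ (i, j))) \<noteq> 0"
    using linkedE[OF assms U V W] .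
  have cc: "ccont (\<lambda>g. U g $$ (a, b) * V g $$ (c, d) * cnj (W g $$ (i, j)))"
    by (intro ccont_mult ccont_cnj unitary_rep_cont[OF U] unitary_rep_cont[OF V] unitary_rep_cont[OF W] idx)
  have "hc (\<lambda>g. W g $$ (i, j) * conj_rep V g $$ (c, d) * cnj (U g $$ (a, b))) =
      hc (\<lambda>g. cnj (U g $$ (a, b) * V g $$ (c, d) * cnj (W g $$ (i, j))))"
  proof (rule hc_cong[symmetric, OF ccont_cnj[OF cc]])
    fix g assume "g \<in> carrier G"
    from conj_rep_entry[where U = V, OF unitary_repD(1)[OF V this] idx(3,4)]
    show "cnj (U g $$ (a, b) * V g $$ (c, d) * cnj (W g $$ (i, j))) =
      W g $$ (i, j) * conj_rep V g $$ (c, d) * cnj (U g $$ (a, b))" by (simp add: mult_ac)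
  qed
  then have "hc (\<lambda>g. W g $$ (i, j) * conj_rep V g $$ (c, d) * cnj (U g $$ (a, b))) \<noteq> 0"
    unfolding hc_cnj[OF cc] using nz by simp
  then show ?thesis
    by (rule linkedI[OF W unitary_rep_conj[OF V] U idx(5,6,3,4,1,2)])
qed

text \<open>Entries of a Kronecker product are products of entries, numbered by quotient and
  remainder, so both sides speak of the same nonzero mean.\<close>

lemma linked_iff_constituent:
  assumes U: "unitary_rep G T n U" and V: "unitary_rep G T m V" and irr: "irreducible_rep G T W"
  shows "linked U V W \<longleftrightarrow> irr_class G T W \<in> irr_constituents G T (tensor_rep U V)"
proof -
  obtain r where r: "r > 0" "unitary_rep G T r W" using irreducible_rep_unitary[OF irr] .
  note W = r(2)
  have UV: "unitary_rep G T (n * m) (tensor_rep U V)" by (rule unitary_rep_tensor[OF U V])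
  have ent: "cip (coef (tensor_rep U V) p q) (coef W i j) =
      hc (\<lambda>g. U g $$ (p div m, q div m) * V g $$ (p mod m, q mod m) * cnj (W g $$ (i, j)))"
    if "p < n * m" "q < n * m" "i < r" "j < r" for p q i j
    unfolding cip_def
    by (rule hc_cong[OF ccont_mult[OF unitary_rep_cont[OF UV that(1,2)] ccont_cnj[OF unitary_rep_cont[OF W that(3,4)]]]])
      (simp add: tensor_rep_def kronecker_index[OF unitary_repD(1)[OF U] unitary_repD(1)[OF V] that(1,2)])
  show ?thesis
  proof
    assume "linked U V W"
    from linkedE[OF this U V W] obtain a b c d i j
      where idx: "a < n" "b < n" "c < m" "d < m" "i < r" "j < r"
        and nz: "hc (\<lambda>g. U g $$ (a, b) * V g $$ (c, d) * cnj (W g $$ (i, j))) \<noteq> 0" .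
    have lt: "x * m + y < n * m" if "x < n" "y < m" for x y
    proof -
      have "x * m + y < (x + 1) * m" using that by simp
      also have "\<dots> \<le> n * m" using that by (intro mult_right_mono) auto
      finally show ?thesis .
    qed
    have "cip (coef (tensor_rep U V) (a * m + c) (b * m + d)) (coef W i j) \<noteq> 0"
      using ent[OF lt[OF idx(1,3)] lt[OF idx(2,4)] idx(5,6)] nz idx by simp
    then show "irr_class G T W \<in> irr_constituents G T (tensor_rep U V)"
      by (rule constituentI[OF UV irr W lt[OF idx(1,3)] lt[OF idx(2,4)] idx(5,6)])
  next
    assume "irr_class G T W \<in> irr_constituents G T (tensor_rep U V)"
    from constituent_nonzero_cip[OF UV this irr_class_self[OF irr] W]
    obtain k l i j where idx: "k < n * m" "l < n * m" "i < r" "j < r"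
      and nz: "cip (coef (tensor_rep U V) k l) (coef W i j) \<noteq> 0" by (elim exE conjE)
    show "linked U V W"
      by (rule linkedI[OF U V W div_mod_less(1)[OF idx(1)] div_mod_less(1)[OF idx(2)]
            div_mod_less(2)[OF idx(1)] div_mod_less(2)[OF idx(2)] idx(3,4)])
        (use nz ent[OF idx] in simp)
  qed
qed

lemma linked_equiv_left:
  assumes "linked U V W" "unitarily_equiv G U U'"
  shows "linked U' V W"
proof -
  obtain n m r where U: "unitary_rep G T n U" and V: "unitary_rep G T m V" and W: "unitary_rep G T r W"
    using linked_unitary_repE[OF assms(1)] .
  obtain a b c d i j where idx: "a < n" "b < n" "c < m" "d < m" "i < r" "j < r"
    and nz: "hc (\<lambda>g. U g $$ (a, b) * V g $$ (c, d) * cnj (W g $$ (i, j))) \<noteq> 0"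
    using linkedE[OF assms(1) U V W] .
  \<comment> \<open>The two other factors form the test function, up to conjugation; replacing
    \<open>U\<close> is then an instance of \<open>cip_coef_equiv\<close>.\<close>
  let ?f = "\<lambda>g. W g $$ (i, j) * cnj (V g $$ (c, d))"
  have cf: "ccont ?f" by (intro ccont_mult ccont_cnj unitary_rep_cont[OF V] unitary_rep_cont[OF W] idx)
  have conv: "cip ?f (coef X x y) = cnj (hc (\<lambda>g. X g $$ (x, y) * V g $$ (c, d) * cnj (W g $$ (i, j))))"
    if "unitary_rep G T n X" "x < n" "y < n" for X x y
  proof -
    have "ccont (\<lambda>g. X g $$ (x, y) * V g $$ (c, d) * cnj (W g $$ (i, j)))"
      by (intro ccont_mult ccont_cnj unitary_rep_cont[OF that(1)] unitary_rep_cont[OF V] unitary_rep_cont[OF W] idx that)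
    from hc_cnj[OF this] show ?thesis by (simp add: cip_def mult_ac)
  qed
  have "cip ?f (coef U a b) \<noteq> 0" using conv[OF U idx(1,2)] nz by simp
  from cip_coef_equiv[OF cf U assms(2) idx(1,2) this]
  obtain x y where xy: "x < n" "y < n" "cip ?f (coef U' x y) \<noteq> 0" by (elim exE conjE)
  have U': "unitary_rep G T n U'" by (rule unitary_rep_equiv[OF U assms(2)])
  show ?thesis
    by (rule linkedI[OF U' V W xy(1,2) idx(3-6)]) (use xy(3) conv[OF U' xy(1,2)] in simp)
qed

lemma linked_commute:
  assumes "linked U V W"
  shows "linked V U W"
proof -
  obtain n m r where U: "unitary_rep G T n U" and V: "unitary_rep G T m V" and W: "unitary_rep G T r W"
    using linked_unitary_repE[OF assms] .
  obtain a b c d i j where idx: "a < n" "b < n" "c < m" "d < m" "i < r" "j < r"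
    and nz: "hc (\<lambda>g. U g $$ (a, b) * V g $$ (c, d) * cnj (W g $$ (i, j))) \<noteq> 0"
    using linkedE[OF assms U V W] .
  show ?thesis
    by (rule linkedI[OF V U W idx(3,4,1,2,5,6)]) (use nz in \<open>simp add: mult.commute\<close>)
qed

text \<open>What the definition asserts for some representatives holds for all of them, because
  \<open>linked\<close> passes to equivalent representations in the first place and, through
  \<open>linked_commute\<close>, in the second.\<close>

lemma class_prod_iff_linked:
  assumes U: "U \<in> D1" "D1 \<in> irr_classes G T" and V: "V \<in> D2" "D2 \<in> irr_classes G T"
    and irr: "irreducible_rep G T W"
  shows "irr_class G T W \<in> class_prod G T D1 D2 \<longleftrightarrow> linked U V W"
proof
  obtain n where n: "unitary_rep G T n U" using irreducible_rep_unitary[OF irr_classes_memD(1)[OF U(2) U(1)]] .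
  obtain m where m: "unitary_rep G T m V" using irreducible_rep_unitary[OF irr_classes_memD(1)[OF V(2) V(1)]] .
  show "irr_class G T W \<in> class_prod G T D1 D2" if "linked U V W"
  proof -
    have "irr_class G T W \<in> irr_constituents G T (tensor_rep U V)"
      using that linked_iff_constituent[OF n m irr] by simp
    then show ?thesis unfolding class_prod_def by (rule UN_I[OF U(1) UN_I[OF V(1)]])
  qed
  assume "irr_class G T W \<in> class_prod G T D1 D2"
  then obtain U' V' where U': "U' \<in> D1" and V': "V' \<in> D2"
    and c: "irr_class G T W \<in> irr_constituents G T (tensor_rep U' V')"
    unfolding class_prod_def by (elim UN_E)
  obtain n' where n': "unitary_rep G T n' U'" using irreducible_rep_unitary[OF irr_classes_memD(1)[OF U(2) U']] .
  obtain m' where m': "unitary_rep G T m' V'" using irreducible_rep_unitary[OF irr_classes_memD(1)[OF V(2) V']] .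
  have l: "linked U' V' W" using linked_iff_constituent[OF n' m' irr] c by simp
  have U'U: "unitarily_equiv G U' U" using irr_classes_memD(2)[OF U(2) U'] U(1) by (simp add: irr_class_iff)
  have V'V: "unitarily_equiv G V' V" using irr_classes_memD(2)[OF V(2) V'] V(1) by (simp add: irr_class_iff)
  show "linked U V W"
    by (rule linked_commute[OF linked_equiv_left[OF linked_commute[OF linked_equiv_left[OF l U'U]] V'V]])
qed

lemma class_prod_subset: "class_prod G T D1 D2 \<subseteq> irr_classes G T"
  by (auto simp: class_prod_def irr_constituents_def)

text \<open>The corner coefficient of the tensor product is 1 at the unit; being nonzero, it meets
  some constituent.\<close>

lemma tensor_constituent_exists:
  assumes U: "irreducible_rep G T U" and V: "irreducible_rep G T V"
  shows "\<exists>W. irreducible_rep G T W \<and> linked U V W"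
proof -
  obtain n where n: "n > 0" "unitary_rep G T n U" using irreducible_rep_unitary[OF U] .
  obtain m where m: "m > 0" "unitary_rep G T m V" using irreducible_rep_unitary[OF V] .
  have UV: "unitary_rep G T (n * m) (tensor_rep U V)" by (rule unitary_rep_tensor[OF n(2) m(2)])
  have 0: "0 < n * m" using n m by simp
  have c: "ccont (coef (tensor_rep U V) 0 0)" by (rule unitary_rep_cont[OF UV 0 0])
  have "tensor_rep U V \<one> $$ (0, 0) \<noteq> 0" using unitary_rep_one[OF is_group UV] 0 by simp
  from constituent_of_nonzero_cip[OF c UV 0 0 cip_self_nonzero[OF c one_closed this]]
  obtain W where "irreducible_rep G T W" "irr_class G T W \<in> irr_constituents G T (tensor_rep U V)"
    by (elim exE conjE)
  then show ?thesis using linked_iff_constituent[OF n(2) m(2)] by blast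
qed

lemma class_prod_nonempty:
  assumes "D1 \<in> irr_classes G T" "D2 \<in> irr_classes G T"
  shows "class_prod G T D1 D2 \<noteq> {}"
proof -
  obtain U where U: "U \<in> D1" using irr_classes_nonempty[OF assms(1)] .
  obtain V where V: "V \<in> D2" using irr_classes_nonempty[OF assms(2)] .
  obtain W where W: "irreducible_rep G T W" "linked U V W"
    using tensor_constituent_exists[OF irr_classes_memD(1)[OF assms(1) U] irr_classes_memD(1)[OF assms(2) V]]
    by (elim exE conjE)
  then show ?thesis using class_prod_iff_linked[OF U assms(1) V assms(2) W(1)] by blast
qed

end

section \<open>Central characters and chain classes\<close>

context compact_group
begin

lemma center_carrier: "c \<in> center G \<Longrightarrow> c \<in> carrier G"
  by (simp add: center_def)

lemma center_commutes: "c \<in> center G \<Longrightarrow> g \<in> carrier G \<Longrightarrow> c \<otimes> g = g \<otimes> c"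
  by (simp add: center_def)

lemma center_subgroup: "subgroup (center G) G"
proof (rule subgroupI)
  show "center G \<noteq> {}" using one_closed by (auto simp: center_def intro!: exI[of _ \<one>])
  show "inv a \<in> center G" if "a \<in> center G" for a
  proof -
    have a: "a \<in> carrier G" by (rule center_carrier[OF that])
    have "inv a \<otimes> g = g \<otimes> inv a" if g: "g \<in> carrier G" for g
    proof -
      have "inv a \<otimes> g = inv a \<otimes> (g \<otimes> a) \<otimes> inv a" using a g by (simp add: m_assoc)
      also have "g \<otimes> a = a \<otimes> g" by (rule center_commutes[OF \<open>a \<in> center G\<close> g, symmetric])
      also have "inv a \<otimes> (a \<otimes> g) \<otimes> inv a = g \<otimes> inv a" using a g by (simp add: m_assoc[symmetric])
      finally show ?thesis .
    qed
    then show ?thesis using a by (simp add: center_def)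
  qed
  show "a \<otimes> b \<in> center G" if ab: "a \<in> center G" "b \<in> center G" for a b
  proof -
    have c: "a \<in> carrier G" "b \<in> carrier G" using ab by (simp_all add: center_carrier)
    have "a \<otimes> b \<otimes> g = g \<otimes> (a \<otimes> b)" if g: "g \<in> carrier G" for g
    proof -
      have "a \<otimes> b \<otimes> g = a \<otimes> (g \<otimes> b)" using c g center_commutes[OF ab(2) g] by (simp add: m_assoc)
      also have "\<dots> = g \<otimes> (a \<otimes> b)" using c g center_commutes[OF ab(1) g] by (simp add: m_assoc[symmetric])
      finally show ?thesis .
    qed
    then show ?thesis using c by (simp add: center_def)
  qed
qed (auto simp: center_def)

lemma central_value:
  assumes irr: "irreducible_rep G T U" and U: "unitary_rep G T n U" and c: "c \<in> center G"
  shows "U c = central_character G (irr_class G T U) c \<cdot>\<^sub>m 1\<^sub>m n"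
  using central_character_scalar[OF irr_class_in[OF irr] irr_class_self[OF irr] c]
    unitary_repD(1)[OF U center_carrier[OF c]] by simp

lemma central_value_entry:
  assumes "irreducible_rep G T U" "unitary_rep G T n U" "c \<in> center G" "i < n" "j < n"
  shows "U c $$ (i, j) = (if i = j then central_character G (irr_class G T U) c else 0)"
  unfolding central_value[OF assms(1-3)] using assms(4,5) by simp

lemma central_value_translate:
  assumes irr: "irreducible_rep G T U" and U: "unitary_rep G T n U" and c: "c \<in> center G"
    and g: "g \<in> carrier G" and ij: "i < n" "j < n"
  shows "U (c \<otimes> g) $$ (i, j) = central_character G (irr_class G T U) c * U g $$ (i, j)"
  unfolding unitary_rep_mult[OF U center_carrier[OF c] g] central_value[OF irr U c]
  using unitary_repD(1)[OF U g] ij by (simp add: mult_smult_assoc_mat[of _ n n _ n])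

lemma central_character_norm:
  assumes D: "D \<in> irr_classes G T" and c: "c \<in> center G"
  shows "cmod (central_character G D c) = 1"
proof -
  obtain U where irr: "irreducible_rep G T U" and DU: "D = irr_class G T U" using irr_classesE[OF D] .
  obtain n where n: "n > 0" "unitary_rep G T n U" using irreducible_rep_unitary[OF irr] .
  note U = unitary_matD[OF unitary_repD(2)[OF n(2) center_carrier[OF c]]]
  let ?z = "central_character G D c"
  have "1 = (mat_adjoint (U c) * U c) $$ (0, 0)" using U(3) n by simp
  also have "\<dots> = (\<Sum>l<n. cnj (U c $$ (l, 0)) * U c $$ (l, 0))"
    unfolding mat_mult_index[OF U(2,1) n(1) n(1)]
    by (intro sum.cong refl) (use U(1) n(1) in simp)
  also have "\<dots> = (\<Sum>l<n. if l = 0 then cnj ?z * ?z else 0)"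
    unfolding DU by (intro sum.cong refl) (simp add: central_value_entry[OF irr n(2) c] n(1))
  also have "\<dots> = cnj ?z * ?z" using n(1) by simp
  finally have "complex_of_real ((cmod ?z)\<^sup>2) = 1" unfolding complex_norm_square by (simp add: mult.commute)
  then have "(cmod ?z)\<^sup>2 = 1" by (metis of_real_eq_1_iff)
  then show ?thesis by (metis norm_ge_zero power2_eq_1_iff zero_le_one neg_0_le_iff_le not_one_le_zero)
qed

text \<open>On the centre the character equals the corner entry of any representative and inherits
  continuity and multiplicativity from it.\<close>

lemma central_character_in_dual:
  assumes D: "D \<in> irr_classes G T"
  shows "central_character G D \<in> carrier (center_dual G T)"
proof -
  obtain U where irr: "irreducible_rep G T U" and DU: "D = irr_class G T U" using irr_classesE[OF D] .
  obtain n where n: "n > 0" "unitary_rep G T n U" using irreducible_rep_unitary[OF irr] .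
  let ?X = "central_character G D"
  have val: "U c $$ (0, 0) = ?X c" if "c \<in> center G" for c
    unfolding DU by (simp add: central_value_entry[OF irr n(2) that n(1) n(1)])
  have "?X \<in> extensional (center G)" unfolding central_character_def by (rule restrict_extensional)
  moreover have "cmod (?X c) = 1" if "c \<in> center G" for c by (rule central_character_norm[OF D that])
  moreover have "?X (c \<otimes> d) = ?X c * ?X d" if "c \<in> center G" "d \<in> center G" for c d
    using val[OF subgroup.m_closed[OF center_subgroup that]] val[OF that(2)]
      central_value_translate[OF irr n(2) that(1) center_carrier[OF that(2)] n(1) n(1)] DU by simp
  moreover have "continuous_map (subtopology T (center G)) euclidean ?X"
  proof (rule continuous_map_eq)
    show "continuous_map (subtopology T (center G)) euclidean (coef U 0 0)"
      by (rule continuous_map_from_subtopology[OF unitary_rep_cont[OF n(2) n(1) n(1)]])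
  qed (simp add: val)
  ultimately show ?thesis by (simp add: center_dual_def character_group_def)
qed

lemma linked_central_character:
  assumes l: "linked U V W"
    and irr: "irreducible_rep G T U" "irreducible_rep G T V" "irreducible_rep G T W"
    and c: "c \<in> center G"
  shows "central_character G (irr_class G T W) c =
    central_character G (irr_class G T U) c * central_character G (irr_class G T V) c" (is "?w = ?u * ?v")
proof -
  obtain n m r where U: "unitary_rep G T n U" and V: "unitary_rep G T m V" and W: "unitary_rep G T r W"
    using linked_unitary_repE[OF l] .
  obtain a b p q i j where idx: "a < n" "b < n" "p < m" "q < m" "i < r" "j < r"
    and nz: "hc (\<lambda>g. U g $$ (a, b) * V g $$ (p, q) * cnj (W g $$ (i, j))) \<noteq> 0"
    using linkedE[OF l U V W] .
  let ?f = "\<lambda>g. U g $$ (a, b) * V g $$ (p, q) * cnj (W g $$ (i, j))"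
  have f: "ccont ?f"
    by (intro ccont_mult ccont_cnj unitary_rep_cont[OF U] unitary_rep_cont[OF V] unitary_rep_cont[OF W] idx)
  have cG: "c \<in> carrier G" by (rule center_carrier[OF c])
  have "hc ?f = hc (\<lambda>g. ?f (c \<otimes> g))" by (rule hc_left[OF f cG, symmetric])
  also have "\<dots> = hc (\<lambda>g. (?u * ?v * cnj ?w) * ?f g)"
  proof (rule hc_cong[OF continuous_map_translate(1)[OF f cG]])
    fix g assume g: "g \<in> carrier G"
    show "?f (c \<otimes> g) = (?u * ?v * cnj ?w) * ?f g"
      by (simp add: central_value_translate[OF irr(1) U c g idx(1,2)] mult_ac
        central_value_translate[OF irr(2) V c g idx(3,4)] central_value_translate[OF irr(3) W c g idx(5,6)])
  qed
  also have "\<dots> = (?u * ?v * cnj ?w) * hc ?f" by (rule hc_cmult[OF f])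
  finally have "hc ?f = (?u * ?v * cnj ?w) * hc ?f" .
  with nz have 1: "?u * ?v * cnj ?w = 1" by (simp only: mult_cancel_right1 not_False_eq_True simp_thms)
  have "?w * cnj ?w = 1"
    using central_character_norm[OF irr_class_in[OF irr(3)] c] by (simp add: complex_norm_square[symmetric])
  then have "?u * ?v = (?u * ?v * cnj ?w) * ?w" by (simp add: mult_ac)
  then show ?thesis using 1 by simp
qed

lemma class_prod_central_character:
  assumes D0: "D0 \<in> irr_classes G T" and D1: "D1 \<in> irr_classes G T"
    and D: "D \<in> class_prod G T D0 D1" and c: "c \<in> center G"
  shows "central_character G D c = central_character G D0 c * central_character G D1 c"
proof -
  obtain W where W: "irreducible_rep G T W" "D = irr_class G T W"
    using irr_classesE[OF subsetD[OF class_prod_subset D]] .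
  obtain U where U: "U \<in> D0" using irr_classes_nonempty[OF D0] .
  obtain V where V: "V \<in> D1" using irr_classes_nonempty[OF D1] .
  note U' = irr_classes_memD[OF D0 U] and V' = irr_classes_memD[OF D1 V]
  have "linked U V W" using class_prod_iff_linked[OF U D0 V D1 W(1)] D W(2) by simp
  from linked_central_character[OF this U'(1) V'(1) W(1) c] show ?thesis
    using U'(2) V'(2) W(2) by simp
qed

lemma central_character_conj:
  assumes irr: "irreducible_rep G T U" and c: "c \<in> center G"
  shows "central_character G (irr_class G T (conj_rep U)) c = cnj (central_character G (irr_class G T U) c)"
proof -
  obtain n where n: "n > 0" "unitary_rep G T n U" using irreducible_rep_unitary[OF irr] .
  have Uc: "U c \<in> carrier_mat n n" by (rule unitary_repD(1)[OF n(2) center_carrier[OF c]])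
  show ?thesis
    using central_value_entry[OF irr n(2) c n(1) n(1)] conj_rep_entry[where U=U, OF Uc n(1) n(1)]
      central_value_entry[OF irreducible_rep_conj[OF irr] unitary_rep_conj[OF n(2)] c n(1) n(1)] by simp
qed

section \<open>The trivial class and products along chains\<close>

lemma unitary_rep_trivial: "unitary_rep G T 1 (\<lambda>_. 1\<^sub>m 1)"
  unfolding unitary_rep_def unitary_mat_def by simp

lemma irreducible_rep_trivial: "irreducible_rep G T (\<lambda>_. 1\<^sub>m 1)"
  unfolding irreducible_rep_iff
proof (intro exI[of _ 1] conjI allI impI)
  show "unitary_rep G T 1 (\<lambda>_. 1\<^sub>m 1)" by (rule unitary_rep_trivial)
  fix W :: "complex vec set"
  assume W: "vec_subspace 1 W \<and> (\<forall>g\<in>carrier G. \<forall>w\<in>W. 1\<^sub>m 1 *\<^sub>v w \<in> W)"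
  note W' = conjunct1[OF W, unfolded vec_subspace_def]
  show "W = {0\<^sub>v 1} \<or> W = carrier_vec 1"
  proof (rule disjCI)
    assume "W \<noteq> carrier_vec 1"
    have "w = 0\<^sub>v 1" if w: "w \<in> W" for w
    proof (rule ccontr)
      have wc: "w \<in> carrier_vec 1" using W' w by blast
      assume "w \<noteq> 0\<^sub>v 1"
      then have "w $ 0 \<noteq> 0" using wc by (auto intro!: eq_vecI)
      have "v \<in> W" if v: "v \<in> carrier_vec 1" for v
      proof -
        have "v = (v $ 0 / w $ 0) \<cdot>\<^sub>v w" using v wc \<open>w $ 0 \<noteq> 0\<close> by (intro eq_vecI) auto
        then show ?thesis using W' w by metis
      qed
      then show False using \<open>W \<noteq> carrier_vec 1\<close> W' by blast
    qed
    then show "W = {0\<^sub>v 1}" using W' by blast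
  qed
qed simp

lemma trivial_class_eq: "trivial_class G T = irr_class G T (\<lambda>_. 1\<^sub>m 1)"
  by (simp add: trivial_class_def irr_class_def)

lemma trivial_class_in: "trivial_class G T \<in> irr_classes G T"
  unfolding trivial_class_eq by (rule irr_class_in[OF irreducible_rep_trivial])

lemma central_character_trivial: "c \<in> center G \<Longrightarrow> central_character G (trivial_class G T) c = 1"
  using central_value_entry[OF irreducible_rep_trivial unitary_rep_trivial, of c 0 0]
  unfolding trivial_class_eq by simp

lemma chain_prod_Nil: "chain_prod G T D [] = {D}"
  by (simp add: chain_prod_def)

lemma chain_prod_snoc: "chain_prod G T D (Ds @ [E]) = (\<Union>F\<in>chain_prod G T D Ds. class_prod G T F E)"
  by (simp add: chain_prod_def set_prod_def)

lemma chain_prod_in_irr_classes: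
  assumes "D \<in> irr_classes G T"
  shows "chain_prod G T D Ds \<subseteq> irr_classes G T"
proof (cases Ds rule: rev_cases)
  case Nil
  then show ?thesis using assms by (simp add: chain_prod_Nil)
next
  case (snoc Ds' E)
  then show ?thesis using class_prod_subset by (auto simp: chain_prod_snoc)
qed

text \<open>Each further factor multiplies the common value by its own character. Only constancy
  matters later, hence the existential quantifier.\<close>

lemma chain_prod_central_character:
  assumes D: "D \<in> irr_classes G T" and c: "c \<in> center G"
  shows "Ds \<in> lists (irr_classes G T) \<Longrightarrow>
    \<exists>z. \<forall>F\<in>chain_prod G T D Ds. central_character G F c = z"
proof (induction Ds rule: rev_induct)
  case Nil
  show ?case by (simp add: chain_prod_Nil)
next
  case (snoc E Ds)
  have E: "E \<in> irr_classes G T" and Ds: "Ds \<in> lists (irr_classes G T)" using snoc.prems by auto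
  obtain z where z: "\<forall>F\<in>chain_prod G T D Ds. central_character G F c = z" using snoc.IH[OF Ds] ..
  have "central_character G F c = z * central_character G E c"
    if F: "F \<in> chain_prod G T D (Ds @ [E])" for F
  proof -
    obtain X where X: "X \<in> chain_prod G T D Ds" "F \<in> class_prod G T X E"
      using F unfolding chain_prod_snoc by (elim UN_E)
    show ?thesis
      using class_prod_central_character[OF subsetD[OF chain_prod_in_irr_classes[OF D] X(1)] E X(2) c]
        bspec[OF z X(1)] by simp
  qed
  then show ?case by blast
qed

lemma chain_equiv_central_character:
  assumes "chain_equiv G T D D'" "c \<in> center G"
  shows "central_character G D c = central_character G D' c"
proof -
  obtain D1 Ds where D1: "D1 \<in> irr_classes G T" and Ds: "Ds \<in> lists (irr_classes G T)"
    and D: "D \<in> chain_prod G T D1 Ds" "D' \<in> chain_prod G T D1 Ds"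
    using assms(1) unfolding chain_equiv_def by (elim bexE conjE)
  obtain z where "\<forall>F\<in>chain_prod G T D1 Ds. central_character G F c = z"
    using chain_prod_central_character[OF D1 assms(2) Ds] ..
  then show ?thesis using D by simp
qed

text \<open>Chain equivalence with \<open>D\<close> itself as first factor. In this form a chain can
  be prolonged by a class and its conjugate without losing \<open>D\<close>.\<close>

definition chain_from :: "('a \<Rightarrow> complex mat) set \<Rightarrow> ('a \<Rightarrow> complex mat) set \<Rightarrow> bool" where
  "chain_from D E \<longleftrightarrow> (\<exists>Ds\<in>lists (irr_classes G T). D \<in> chain_prod G T D Ds \<and> E \<in> chain_prod G T D Ds)"

lemma chain_from_refl: "chain_from D D"
  unfolding chain_from_def by (rule bexI[of _ "[]"]) (simp_all add: chain_prod_Nil)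

text \<open>The product is prolonged by \<open>V\<close> and its conjugate. By reciprocity
  \<open>U\<close> recurs in U x V x conj V, so \<open>D\<close> stays in the product, while the
  path from \<open>E\<close> through \<open>X\<close> brings in \<open>F\<close>.\<close>

lemma chain_from_step:
  assumes DE: "chain_from D (irr_class G T E)" and D: "D \<in> irr_classes G T"
    and irr: "irreducible_rep G T E" "irreducible_rep G T V" "irreducible_rep G T X" "irreducible_rep G T F"
    and l: "linked E V X" "linked X (conj_rep V) F"
  shows "chain_from D (irr_class G T F)"
proof -
  let ?c = "irr_class G T"
  obtain Ds where Ds: "Ds \<in> lists (irr_classes G T)" "D \<in> chain_prod G T D Ds" "?c E \<in> chain_prod G T D Ds"
    using DE unfolding chain_from_def by (elim bexE conjE)
  have irrV': "irreducible_rep G T (conj_rep V)" by (rule irreducible_rep_conj[OF irr(2)])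
  have mem: "?c Z' \<in> chain_prod G T D (Ds @ [?c V, ?c (conj_rep V)])"
    if Z: "irreducible_rep G T Z" "?c Z \<in> chain_prod G T D Ds" and Y: "irreducible_rep G T Y"
      and Z': "irreducible_rep G T Z'" and l: "linked Z V Y" "linked Y (conj_rep V) Z'" for Z Y Z'
  proof -
    have "?c Y \<in> class_prod G T (?c Z) (?c V)"
      using class_prod_iff_linked[OF irr_class_self[OF Z(1)] irr_class_in[OF Z(1)]
          irr_class_self[OF irr(2)] irr_class_in[OF irr(2)] Y] l(1) by simp
    then have 1: "?c Y \<in> chain_prod G T D (Ds @ [?c V])"
      unfolding chain_prod_snoc by (rule UN_I[OF Z(2)])
    have "?c Z' \<in> class_prod G T (?c Y) (?c (conj_rep V))"
      using class_prod_iff_linked[OF irr_class_self[OF Y] irr_class_in[OF Y]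
          irr_class_self[OF irrV'] irr_class_in[OF irrV'] Z'] l(2) by simp
    then have "?c Z' \<in> chain_prod G T D ((Ds @ [?c V]) @ [?c (conj_rep V)])"
      unfolding chain_prod_snoc[of D "Ds @ [?c V]"] by (rule UN_I[OF 1])
    then show ?thesis by simp
  qed
  obtain U where U: "irreducible_rep G T U" "D = ?c U" using irr_classesE[OF D] .
  obtain Y where Y: "irreducible_rep G T Y" "linked U V Y"
    using tensor_constituent_exists[OF U(1) irr(2)] by (elim exE conjE)
  have "D \<in> chain_prod G T D (Ds @ [?c V, ?c (conj_rep V)])"
    using mem[OF U(1) _ Y(1) U(1) Y(2) linked_dual[OF Y(2)]] Ds(2) U(2) by simp
  moreover have "?c F \<in> chain_prod G T D (Ds @ [?c V, ?c (conj_rep V)])"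
    by (rule mem[OF irr(1) Ds(3) irr(3,4) l])
  moreover have "Ds @ [?c V, ?c (conj_rep V)] \<in> lists (irr_classes G T)"
    using Ds(1) irr_class_in[OF irr(2)] irr_class_in[OF irrV'] by simp
  ultimately show ?thesis unfolding chain_from_def by blast
qed

lemma chain_from_chain_equiv:
  "D \<in> irr_classes G T \<Longrightarrow> chain_from D E \<Longrightarrow> chain_equiv G T D E"
  unfolding chain_from_def chain_equiv_def by blast

end

lemma unitary_mat_entry_norm:
  assumes S: "unitary_mat n S" and ij: "i < n" "j < n"
  shows "cmod (S $$ (i, j)) \<le> 1"
proof -
  note S' = unitary_matD[OF S]
  have "1 = (mat_adjoint S * S) $$ (j, j)" using S'(3) ij by simp
  also have "\<dots> = (\<Sum>l<n. cnj (S $$ (l, j)) * S $$ (l, j))"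
    unfolding mat_mult_index[OF S'(2,1) ij(2,2)]
    by (intro sum.cong refl) (use S'(1) ij in simp)
  also have "\<dots> = complex_of_real (\<Sum>l<n. (cmod (S $$ (l, j)))\<^sup>2)"
    unfolding of_real_sum complex_norm_square by (simp add: mult.commute)
  finally have "complex_of_real 1 = complex_of_real (\<Sum>l<n. (cmod (S $$ (l, j)))\<^sup>2)"
    by (simp only: of_real_1)
  then have "(\<Sum>l<n. (cmod (S $$ (l, j)))\<^sup>2) = 1" by (simp only: of_real_eq_iff)
  moreover have "(cmod (S $$ (i, j)))\<^sup>2 \<le> (\<Sum>l<n. (cmod (S $$ (l, j)))\<^sup>2)"
    by (rule member_le_sum) (use ij in auto)
  ultimately have "(cmod (S $$ (i, j)))\<^sup>2 \<le> 1\<^sup>2" by simp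
  then show ?thesis by (rule power2_le_imp_le) simp
qed

context compact_group
begin

section \<open>Separation by irreducible representations\<close>

text \<open>By complete reducibility a representation that does not send \<open>z\<close> to the
  identity has an irreducible summand with the same property.\<close>

lemma irreducible_reps_separate:
  assumes z: "z \<in> carrier G"
    and triv: "\<And>V n. irreducible_rep G T V \<Longrightarrow> unitary_rep G T n V \<Longrightarrow> V z = 1\<^sub>m n"
  shows "z = \<one>"
proof (rule ccontr)
  assume "z \<noteq> \<one>"
  from unitary_rep_separates[OF z this] obtain n U where U: "unitary_rep G T n U" "U z \<noteq> 1\<^sub>m n"
    by (elim exE conjE)
  obtain Us where Us: "\<forall>V\<in>set Us. irreducible_rep G T V" and e: "unitarily_equiv G U (direct_sum_rep Us)"
    using complete_reducibility[OF U(1)] by (elim exE conjE)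
  obtain S where eS: "\<forall>g\<in>carrier G. direct_sum_rep Us g \<in> carrier_mat n n \<and>
      S * U g = direct_sum_rep Us g * S \<and> U g = mat_adjoint S * direct_sum_rep Us g * S"
    using unitarily_equiv_conjugation[OF e is_group U(1)] by (elim exE conjE)
  have "V z = V \<one>" if "V \<in> set Us" for V
  proof -
    have irr: "irreducible_rep G T V" using Us that by simp
    obtain m where m: "m > 0" "unitary_rep G T m V" using irreducible_rep_unitary[OF irr] .
    show ?thesis using triv[OF irr m(2)] unitary_rep_one[OF is_group m(2)] by simp
  qed
  then have "map (\<lambda>V. V z) Us = map (\<lambda>V. V \<one>) Us" by simp
  then have "direct_sum_rep Us z = direct_sum_rep Us \<one>" by (simp only: direct_sum_rep_def)
  moreover have "U z = mat_adjoint S * direct_sum_rep Us z * S" using bspec[OF eS z] by simp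
  moreover have "U \<one> = mat_adjoint S * direct_sum_rep Us \<one> * S" using bspec[OF eS one_closed] by simp
  ultimately have "U z = U \<one>" by simp
  then show False using U(2) unitary_rep_one[OF is_group U(1)] by simp
qed

text \<open>A converse of the scalar action of the centre: in every irreducible representation
  \<open>z \<otimes> g\<close> and \<open>g \<otimes> z\<close> have the same image, and these
  representations separate points.\<close>

lemma center_if_scalar:
  assumes z: "z \<in> carrier G"
    and scal: "\<And>V n. irreducible_rep G T V \<Longrightarrow> unitary_rep G T n V \<Longrightarrow> \<exists>k. V z = k \<cdot>\<^sub>m 1\<^sub>m n"
  shows "z \<in> center G"
proof -
  have "z \<otimes> g = g \<otimes> z" if g: "g \<in> carrier G" for g
  proof -
    have c: "z \<otimes> g \<in> carrier G" "g \<otimes> z \<in> carrier G" "inv (g \<otimes> z) \<in> carrier G" using z g by simp_all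
    have "(z \<otimes> g) \<otimes> inv (g \<otimes> z) = \<one>"
    proof (rule irreducible_reps_separate)
      show "(z \<otimes> g) \<otimes> inv (g \<otimes> z) \<in> carrier G" using c by simp
      fix V n assume irr: "irreducible_rep G T V" and V: "unitary_rep G T n V"
      obtain k where k: "V z = k \<cdot>\<^sub>m 1\<^sub>m n" using scal[OF irr V] ..
      note Vg = unitary_repD(1)[OF V g]
      have "V (z \<otimes> g) = V (g \<otimes> z)"
        unfolding unitary_rep_mult[OF V z g] unitary_rep_mult[OF V g z] k
        using Vg by (simp add: mult_smult_assoc_mat[of _ n n _ n] mult_smult_distrib[of _ n n _ n])
      then have "V ((z \<otimes> g) \<otimes> inv (g \<otimes> z)) = V ((g \<otimes> z) \<otimes> inv (g \<otimes> z))"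
        by (simp only: unitary_rep_mult[OF V c(1,3)] unitary_rep_mult[OF V c(2,3)])
      also have "\<dots> = V \<one>" using c by simp
      also have "\<dots> = 1\<^sub>m n" by (rule unitary_rep_one[OF is_group V])
      finally show "V ((z \<otimes> g) \<otimes> inv (g \<otimes> z)) = 1\<^sub>m n" .
    qed
    then show ?thesis using c by (metis inv_inv inv_equality)
  qed
  then show ?thesis using z by (simp add: center_def)
qed

text \<open>The products of entries with conjugate entries determine a nonzero matrix up to a scalar
  factor, so \<open>V y\<close> is a multiple of \<open>V x\<close> for every irreducible
  \<open>V\<close>.\<close>

lemma center_separation:
  assumes x: "x \<in> carrier G" and y: "y \<in> carrier G"
    and eq: "\<And>V n a b c d. irreducible_rep G T V \<Longrightarrow> unitary_rep G T n V \<Longrightarrow> a < n \<Longrightarrow> b < n \<Longrightarrow> c < n \<Longrightarrow> d < n \<Longrightarrow>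
      V x $$ (a, b) * cnj (V x $$ (c, d)) = V y $$ (a, b) * cnj (V y $$ (c, d))"
  shows "inv x \<otimes> y \<in> center G"
proof (rule center_if_scalar)
  show "inv x \<otimes> y \<in> carrier G" using x y by simp
  fix V n assume irr: "irreducible_rep G T V" and V: "unitary_rep G T n V"
  have n: "n > 0" by (rule irreducible_repD(1)[OF is_group irr V])
  note X = unitary_matD[OF unitary_repD(2)[OF V x]] and Y = unitary_matD[OF unitary_repD(2)[OF V y]]
  \<comment> \<open>A column of a unitary matrix has length 1, so column 0 contains an entry that
    can serve as a divisor.\<close>
  have "\<exists>c<n. V y $$ (c, 0) \<noteq> 0"
  proof (rule ccontr)
    assume "\<not> ?thesis"
    then have z: "V y $$ (c, 0) = 0" if "c < n" for c using that by simp
    have "(1\<^sub>m n :: complex mat) $$ (0, 0) = (\<Sum>l<n. mat_adjoint (V y) $$ (0, l) * V y $$ (l, 0))"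
      unfolding Y(3)[symmetric] by (rule mat_mult_index[OF Y(2,1) n n])
    also have "\<dots> = 0" by (intro sum.neutral) (simp add: z)
    finally show False using n by simp
  qed
  then obtain c where c: "c < n" "V y $$ (c, 0) \<noteq> 0" by (elim exE conjE)
  \<comment> \<open>Obtained by solving the hypothesis, with the conjugated entry at
    \<open>(c, 0)\<close>, for the entries of \<open>V y\<close>.\<close>
  let ?k = "cnj (V x $$ (c, 0)) / cnj (V y $$ (c, 0))"
  have "V y = ?k \<cdot>\<^sub>m V x"
  proof (rule eq_matI)
    fix a b assume "a < dim_row (?k \<cdot>\<^sub>m V x)" "b < dim_col (?k \<cdot>\<^sub>m V x)"
    then have ab: "a < n" "b < n" using X(1) by auto
    then show "V y $$ (a, b) = (?k \<cdot>\<^sub>m V x) $$ (a, b)"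
      using eq[OF irr V ab c(1) n] c(2) X(1) by (simp add: field_simps)
  qed (use X(1) Y(1) in auto)
  then have "V (inv x \<otimes> y) = mat_adjoint (V x) * (?k \<cdot>\<^sub>m V x)"
    using unitary_rep_mult[OF V inv_closed[OF x] y] unitary_rep_inv[OF is_group V x] by simp
  also have "\<dots> = ?k \<cdot>\<^sub>m 1\<^sub>m n" using mult_smult_distrib[OF X(2,1)] X(3) by simp
  finally show "\<exists>k. V (inv x \<otimes> y) = k \<cdot>\<^sub>m 1\<^sub>m n" by - (rule exI[of _ ?k])
qed

text \<open>With a general test function \<open>f\<close> the factors of a product of coefficients
  can be split off one after the other.\<close>

lemma tensor_nonzero_cip:
  assumes f: "ccont f" and U: "unitary_rep G T n U" and V: "unitary_rep G T m V"
    and idx: "a < n" "b < n" "c < m" "d < m"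
    and nz: "hc (\<lambda>g. f g * cnj (U g $$ (a, b) * V g $$ (c, d))) \<noteq> 0"
  shows "\<exists>X r p q. irreducible_rep G T X \<and> unitary_rep G T r X \<and> p < r \<and> q < r \<and>
    linked U V X \<and> cip f (coef X p q) \<noteq> 0"
proof -
  have UV: "unitary_rep G T (n * m) (tensor_rep U V)" by (rule unitary_rep_tensor[OF U V])
  have lt: "x * m + y < n * m" if "x < n" "y < m" for x y
  proof -
    have "x * m + y < (x + 1) * m" using that by simp
    also have "\<dots> \<le> n * m" using that by (intro mult_right_mono) auto
    finally show ?thesis .
  qed
  note lts = lt[OF idx(1,3)] lt[OF idx(2,4)]
  have "cip f (coef (tensor_rep U V) (a * m + c) (b * m + d)) = hc (\<lambda>g. f g * cnj (U g $$ (a, b) * V g $$ (c, d)))"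
    unfolding cip_def
  proof (rule hc_cong[OF ccont_mult[OF f ccont_cnj[OF unitary_rep_cont[OF UV lts]]]])
    fix g assume "g \<in> carrier G"
    then show "f g * cnj (tensor_rep U V g $$ (a * m + c, b * m + d)) = f g * cnj (U g $$ (a, b) * V g $$ (c, d))"
      using idx
      by (simp add: tensor_rep_def kronecker_index[OF unitary_repD(1)[OF U] unitary_repD(1)[OF V] lts])
  qed
  with nz have "cip f (coef (tensor_rep U V) (a * m + c) (b * m + d)) \<noteq> 0" by simp
  from constituent_of_nonzero_cip[OF f UV lts this]
  obtain X r p q where X: "irreducible_rep G T X" "unitary_rep G T r X" "p < r" "q < r"
    "irr_class G T X \<in> irr_constituents G T (tensor_rep U V)" "cip f (coef X p q) \<noteq> 0" by (elim exE conjE)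
  have "linked U V X" using linked_iff_constituent[OF U V X(1)] X(5) by simp
  with X show ?thesis
    by - (rule exI[of _ X], rule exI[of _ r], rule exI[of _ p], rule exI[of _ q], simp)
qed

text \<open>The continuous functions whose Fourier transform is supported on the representations
  reachable from \<open>D\<close>.\<close>

definition reachable_functions :: "('a \<Rightarrow> complex mat) set \<Rightarrow> ('a \<Rightarrow> complex) set" where
  "reachable_functions D = {f. ccont f \<and> (\<forall>W m i j. irreducible_rep G T W \<longrightarrow> unitary_rep G T m W \<longrightarrow>
     i < m \<longrightarrow> j < m \<longrightarrow> \<not> chain_from D (irr_class G T W) \<longrightarrow> cip f (coef W i j) = 0)}"

lemma reachable_functionsI:
  assumes "ccont f"
    "\<And>W m i j. irreducible_rep G T W \<Longrightarrow> unitary_rep G T m W \<Longrightarrow> i < m \<Longrightarrow> j < m \<Longrightarrow>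
      \<not> chain_from D (irr_class G T W) \<Longrightarrow> cip f (coef W i j) = 0"
  shows "f \<in> reachable_functions D"
  unfolding reachable_functions_def mem_Collect_eq
  by (intro conjI allI impI, rule assms(1), rule assms(2), assumption+)

lemma reachable_functionsD:
  assumes "f \<in> reachable_functions D"
  shows "ccont f"
    "irreducible_rep G T W \<Longrightarrow> unitary_rep G T m W \<Longrightarrow> i < m \<Longrightarrow> j < m \<Longrightarrow>
      \<not> chain_from D (irr_class G T W) \<Longrightarrow> cip f (coef W i j) = 0"
proof -
  show "ccont f" using assms by (simp add: reachable_functions_def)
  have "\<forall>W m i j. irreducible_rep G T W \<longrightarrow> unitary_rep G T m W \<longrightarrow>
     i < m \<longrightarrow> j < m \<longrightarrow> \<not> chain_from D (irr_class G T W) \<longrightarrow> cip f (coef W i j) = 0"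
    using assms unfolding reachable_functions_def mem_Collect_eq by (rule conjunct2)
  from this[rule_format, of W m i j]
  show "cip f (coef W i j) = 0" if "irreducible_rep G T W" "unitary_rep G T m W" "i < m" "j < m"
    "\<not> chain_from D (irr_class G T W)" using that by simp
qed

text \<open>Suppose the product had a component at an unreachable \<open>W\<close>. Splitting off
  the conjugated entry gives an \<open>X\<close> in W x V, and splitting off the other entry an
  \<open>E\<close> in X x conj V at which \<open>f\<close> has a component, so \<open>E\<close> is
  reachable. Reciprocity reverses both steps and reaches \<open>W\<close> from
  \<open>E\<close>.\<close>

lemma reachable_functions_absorb:
  assumes D: "D \<in> irr_classes G T" and f: "f \<in> reachable_functions D"
    and irrV: "irreducible_rep G T V" and V: "unitary_rep G T n V"
    and idx: "a < n" "b < n" "c < n" "d < n"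
  shows "(\<lambda>g. (V g $$ (a, b) * cnj (V g $$ (c, d))) * f g) \<in> reachable_functions D"
proof (rule reachable_functionsI)
  note fc = reachable_functionsD(1)[OF f] and cV = unitary_rep_cont[OF V]
  show c1: "ccont (\<lambda>g. (V g $$ (a, b) * cnj (V g $$ (c, d))) * f g)"
    by (intro ccont_mult ccont_cnj fc cV idx)
  fix W m i j assume irrW: "irreducible_rep G T W" and W: "unitary_rep G T m W" and ij: "i < m" "j < m"
    and not_reach: "\<not> chain_from D (irr_class G T W)"
  show "cip (\<lambda>g. (V g $$ (a, b) * cnj (V g $$ (c, d))) * f g) (coef W i j) = 0"
  proof (rule ccontr)
    assume nz: "cip (\<lambda>g. (V g $$ (a, b) * cnj (V g $$ (c, d))) * f g) (coef W i j) \<noteq> 0"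
    have V': "unitary_rep G T n (conj_rep V)" by (rule unitary_rep_conj[OF V])
    have "hc (\<lambda>g. (V g $$ (a, b) * f g) * cnj (W g $$ (i, j) * V g $$ (c, d))) \<noteq> 0"
      using nz by (simp add: cip_def mult_ac)
    from tensor_nonzero_cip[OF ccont_mult[OF cV[OF idx(1,2)] fc] W V ij idx(3,4) this]
    obtain X r p q where X: "irreducible_rep G T X" "unitary_rep G T r X" "p < r" "q < r" "linked W V X"
      "cip (\<lambda>g. V g $$ (a, b) * f g) (coef X p q) \<noteq> 0" by (elim exE conjE)
    note cX = unitary_rep_cont[OF X(2-4)]
    have "hc (\<lambda>g. f g * cnj (X g $$ (p, q) * conj_rep V g $$ (a, b))) = cip (\<lambda>g. V g $$ (a, b) * f g) (coef X p q)"
      unfolding cip_def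
    proof (rule hc_cong)
      show "ccont (\<lambda>g. f g * cnj (X g $$ (p, q) * conj_rep V g $$ (a, b)))"
        by (intro ccont_mult ccont_cnj fc cX unitary_rep_cont[OF V'] idx)
      fix g assume g: "g \<in> carrier G"
      from conj_rep_entry[where U = V, OF unitary_repD(1)[OF V g] idx(1,2)]
      show "f g * cnj (X g $$ (p, q) * conj_rep V g $$ (a, b)) = V g $$ (a, b) * f g * cnj (X g $$ (p, q))"
        by (simp add: mult_ac)
    qed
    with X(6) have "hc (\<lambda>g. f g * cnj (X g $$ (p, q) * conj_rep V g $$ (a, b))) \<noteq> 0" by simp
    from tensor_nonzero_cip[OF fc X(2) V' X(3,4) idx(1,2) this]
    obtain E s k l where E: "irreducible_rep G T E" "unitary_rep G T s E" "k < s" "l < s"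
      "linked X (conj_rep V) E" "cip f (coef E k l) \<noteq> 0" by (elim exE conjE)
    have reach: "chain_from D (irr_class G T E)"
      using reachable_functionsD(2)[OF f E(1-4)] E(6) by (rule contrapos_np[rotated])
    have "linked E V X" using linked_dual[OF E(5)] by simp
    from chain_from_step[OF reach D E(1) irrV X(1) irrW this linked_dual[OF X(5)]] not_reach
    show False by simp
  qed
qed

lemma equal_central_characters_chain:
  assumes irr: "irreducible_rep G T U" "irreducible_rep G T U'"
    and eq: "\<And>c. c \<in> center G \<Longrightarrow>
      central_character G (irr_class G T U) c = central_character G (irr_class G T U') c"
  shows "chain_from (irr_class G T U) (irr_class G T U')"
proof (rule ccontr)
  assume not_reach: "\<not> ?thesis"
  let ?D = "irr_class G T U"
  have D: "?D \<in> irr_classes G T" by (rule irr_class_in[OF irr(1)])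
  obtain n where n: "n > 0" "unitary_rep G T n U" using irreducible_rep_unitary[OF irr(1)] .
  obtain n' where n': "n' > 0" "unitary_rep G T n' U'" using irreducible_rep_unitary[OF irr(2)] .
  let ?u = "coef U 0 0" and ?v = "coef U' 0 0"
  let ?S = "reachable_functions ?D"
  have cu: "ccont ?u" and cv: "ccont ?v"
    by (rule unitary_rep_cont[OF n(2) n(1) n(1)], rule unitary_rep_cont[OF n'(2) n'(1) n'(1)])
  have uS: "?u \<in> ?S"
  proof (rule reachable_functionsI[OF cu], rule ccontr)
    fix W m i j assume W: "irreducible_rep G T W" "unitary_rep G T m W" "i < m" "j < m"
      "\<not> chain_from ?D (irr_class G T W)" and nz: "cip ?u (coef W i j) \<noteq> 0"
    from irreducible_coef_orthogonal[OF W(1) irr(1) W(2) n(2) n(1) n(1) W(3,4) nz]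
    have "irr_class G T W = ?D" by (rule irr_class_eq[OF W(1) irr(1)])
    then show False using W(5) chain_from_refl by simp
  qed
  let ?F = "\<lambda>g. ?v g * cnj (?u g)"
  have cF: "ccont ?F" by (intro ccont_mult ccont_cnj cu cv)
  \<comment> \<open>\<open>?F g * ?u g * cnj (?v g)\<close> equals \<open>h g * cnj (h g)\<close>,
    so \<open>cip h h\<close> is the pairing of \<open>F u\<close> with the coefficient of
    \<open>U'\<close> and must be shown to vanish for a contradiction.\<close>
  define h where "h = (\<lambda>g. ?u g * ?v g)"
  have ch: "ccont h" unfolding h_def by (intro ccont_mult cu cv)
  have "h \<one> \<noteq> 0" using unitary_rep_one[OF is_group n(2)] unitary_rep_one[OF is_group n'(2)] n(1) n'(1)
    by (simp add: h_def)
  then have hh: "cip h h \<noteq> 0" by (rule cip_self_nonzero[OF ch one_closed])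
  \<comment> \<open>Entries of unitary matrices are bounded by 1, so with the factor 2 of
    \<open>hc_bound\<close> an error below \<open>e\<close> changes the pairing by at most half of
    \<open>cmod (cip h h)\<close>.\<close>
  define e where "e = cmod (cip h h) / 4"
  have e: "e > 0" using hh by (simp add: e_def)
  let ?B = "{b. \<exists>V m p q r s. irreducible_rep G T V \<and> unitary_rep G T m V \<and> p < m \<and> q < m \<and> r < m \<and> s < m \<and>
    b = (\<lambda>g. V g $$ (p, q) * cnj (V g $$ (r, s)))}"
  have BI: "(\<lambda>g. V g $$ (p, q) * cnj (V g $$ (r, s))) \<in> ?B"
    if "irreducible_rep G T V" "unitary_rep G T m V" "p < m" "q < m" "r < m" "s < m" for V m p q r s
    unfolding mem_Collect_eq
    by (rule exI[of _ V], rule exI[of _ m], rule exI[of _ p], rule exI[of _ q], rule exI[of _ r], rule exI[of _ s])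
      (simp add: that)
  have "\<exists>a. ccont a \<and> (\<forall>f\<in>?S. (\<lambda>x. a x * f x) \<in> ?S) \<and> (\<forall>x\<in>carrier G. cmod (?F x - a x) < e)"
  proof (rule multiplier_approximation[where B = ?B])
    show "ccont f" if "f \<in> ?S" for f by (rule reachable_functionsD(1)[OF that])
    show "(\<lambda>x. f x + h x) \<in> ?S" if fh: "f \<in> ?S" "h \<in> ?S" for f h
    proof (rule reachable_functionsI)
      note c = reachable_functionsD(1)[OF fh(1)] reachable_functionsD(1)[OF fh(2)]
      show "ccont (\<lambda>x. f x + h x)" using c by (rule continuous_map_add)
      fix W m i j assume W: "irreducible_rep G T W" "unitary_rep G T m W" "i < m" "j < m"
        "\<not> chain_from ?D (irr_class G T W)"
      note cW = ccont_cnj[OF unitary_rep_cont[OF W(2-4)]]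
      show "cip (\<lambda>x. f x + h x) (coef W i j) = 0"
        using hc_add[OF ccont_mult[OF c(1) cW] ccont_mult[OF c(2) cW]]
          reachable_functionsD(2)[OF fh(1) W] reachable_functionsD(2)[OF fh(2) W]
        by (simp add: cip_def distrib_right)
    qed
    show "(\<lambda>x. k * f x) \<in> ?S" if f: "f \<in> ?S" for f k
    proof (rule reachable_functionsI)
      note c = reachable_functionsD(1)[OF f]
      show "ccont (\<lambda>x. k * f x)" by (rule ccont_mult[OF ccont_const c])
      fix W m i j assume W: "irreducible_rep G T W" "unitary_rep G T m W" "i < m" "j < m"
        "\<not> chain_from ?D (irr_class G T W)"
      note cW = ccont_cnj[OF unitary_rep_cont[OF W(2-4)]]
      show "cip (\<lambda>x. k * f x) (coef W i j) = 0"
        using hc_cmult[OF ccont_mult[OF c cW], of k] reachable_functionsD(2)[OF f W]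
        by (simp add: cip_def mult.assoc)
    qed
    fix b assume "b \<in> ?B"
    then obtain V m p q r s where V: "irreducible_rep G T V" "unitary_rep G T m V"
      and idx: "p < m" "q < m" "r < m" "s < m" and b: "b = (\<lambda>g. V g $$ (p, q) * cnj (V g $$ (r, s)))"
      unfolding mem_Collect_eq by (elim exE conjE)
    show "ccont b" unfolding b by (intro ccont_mult ccont_cnj unitary_rep_cont[OF V(2)] idx)
    fix f assume f: "f \<in> ?S"
    show "(\<lambda>x. b x * f x) \<in> ?S" unfolding b by (rule reachable_functions_absorb[OF D f V idx])
    show "(\<lambda>x. cnj (b x) * f x) \<in> ?S"
      using reachable_functions_absorb[OF D f V idx(3,4,1,2)] by (simp add: b mult.commute)
  next
    show "?F x = ?F y" if x: "x \<in> carrier G" and y: "y \<in> carrier G" and xy: "\<And>b. b \<in> ?B \<Longrightarrow> b x = b y" for x y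
    proof -
      define z where "z = inv x \<otimes> y"
      have z: "z \<in> center G"
        unfolding z_def by (rule center_separation[OF x y xy[OF BI]])
      have "y = x \<otimes> z" unfolding z_def using x y by (simp add: m_assoc[symmetric])
      then have yz: "y = z \<otimes> x" using center_commutes[OF z x] by simp
      \<comment> \<open>Translation by \<open>z\<close> multiplies the coefficient of
        \<open>U'\<close> by \<open>?w\<close> and the conjugated coefficient of \<open>U\<close> by
        \<open>cnj ?w\<close>; this is where the equality of the central characters enters.\<close>
      let ?w = "central_character G ?D z"
      have "?w * cnj ?w = 1" using central_character_norm[OF D z] by (simp add: complex_norm_square[symmetric])
      moreover have "?F y = (?w * cnj ?w) * ?F x"
        unfolding yz using eq[OF z] central_value_translate[OF irr(1) n(2) z x n(1) n(1)]
          central_value_translate[OF irr(2) n'(2) z x n'(1) n'(1)] by (simp add: mult_ac)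
      ultimately show ?thesis by simp
    qed
  qed (use cF e in auto)
  then obtain a where a: "ccont a" "\<forall>f\<in>?S. (\<lambda>x. a x * f x) \<in> ?S" "\<forall>x\<in>carrier G. cmod (?F x - a x) < e"
    by (elim exE conjE)
  \<comment> \<open>The multiplier keeps \<open>?u\<close> among the reachable functions, so the
    product has no component at the unreachable \<open>U'\<close>.\<close>
  have 0: "hc (\<lambda>x. a x * ?u x * cnj (?v x)) = 0"
    using reachable_functionsD(2)[OF bspec[OF a(2) uS] irr(2) n'(2) n'(1) n'(1) not_reach]
    by (simp add: cip_def)
  have ca: "ccont (\<lambda>x. a x * ?u x * cnj (?v x))" by (intro ccont_mult ccont_cnj cu cv a(1))
  have cd: "ccont (\<lambda>x. (?F x - a x) * ?u x * cnj (?v x))"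
    by (intro ccont_mult ccont_cnj cu cv continuous_map_diff a(1))
  have "cip h h = hc (\<lambda>x. (?F x - a x) * ?u x * cnj (?v x) + a x * ?u x * cnj (?v x))"
    unfolding cip_def h_def by (simp add: algebra_simps)
  also have "\<dots> = hc (\<lambda>x. (?F x - a x) * ?u x * cnj (?v x))"
    unfolding hc_add[OF cd ca] 0 by simp
  finally have hh_eq: "cip h h = hc (\<lambda>x. (?F x - a x) * ?u x * cnj (?v x))" .
  have "cmod (cip h h) \<le> 2 * e"
    unfolding hh_eq
  proof (rule hc_bound[OF cd])
    fix x assume x: "x \<in> carrier G"
    have "cmod (?F x - a x) * cmod (?u x) * cmod (?v x) \<le> e * 1 * 1"
      using a(3) x e unitary_mat_entry_norm[OF unitary_repD(2)[OF n(2) x] n(1) n(1)]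
        unitary_mat_entry_norm[OF unitary_repD(2)[OF n'(2) x] n'(1) n'(1)]
      by (intro mult_mono) (simp_all add: less_imp_le)
    then show "cmod ((?F x - a x) * ?u x * cnj (?v x)) \<le> e" by (simp add: norm_mult)
  qed
  then show False using e unfolding e_def by simp
qed

text \<open>From here on chain classes are handled through their central characters; being an
  equivalence relation and compatibility with products become equalities of functions.\<close>

lemma chain_equiv_iff:
  assumes D: "D \<in> irr_classes G T" and D': "D' \<in> irr_classes G T"
  shows "chain_equiv G T D D' \<longleftrightarrow> central_character G D = central_character G D'"
proof
  assume "chain_equiv G T D D'"
  then have "central_character G D c = central_character G D' c" if "c \<in> center G" for c
    using chain_equiv_central_character that by simp
  then show "central_character G D = central_character G D'"
    unfolding central_character_def by (auto simp: restrict_def fun_eq_iff)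
next
  assume eq: "central_character G D = central_character G D'"
  obtain U where U: "irreducible_rep G T U" "D = irr_class G T U" using irr_classesE[OF D] .
  obtain U' where U': "irreducible_rep G T U'" "D' = irr_class G T U'" using irr_classesE[OF D'] .
  have "chain_from D D'"
    unfolding U(2) U'(2) by (rule equal_central_characters_chain[OF U(1) U'(1)]) (use eq U(2) U'(2) in simp)
  then show "chain_equiv G T D D'" by (rule chain_from_chain_equiv[OF D])
qed


section \<open>The centre as a compact group\<close>

text \<open>An intersection of equalisers, closed by the Hausdorff property; closedness is what
  makes the centre compact.\<close>

lemma closedin_center: "closedin T (center G)"
proof -
  have "closedin T {z \<in> topspace T. z \<otimes> g = g \<otimes> z}" if g: "g \<in> carrier G" for g
    using continuous_map_translate[OF continuous_map_id[of T, unfolded id_def] g]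
    by (intro closedin_continuous_maps_eq[OF Hausdorff])
  then have "closedin T (\<Inter>g\<in>carrier G. {z \<in> topspace T. z \<otimes> g = g \<otimes> z})"
    using one_closed by (intro closedin_INT) auto
  moreover have "(\<Inter>g\<in>carrier G. {z \<in> topspace T. z \<otimes> g = g \<otimes> z}) = center G"
    using one_closed by (auto simp: center_def topspace_eq)
  ultimately show ?thesis by simp
qed

text \<open>Makes the mean and the theorem on separating characters available for the centre in
  place of the whole group.\<close>

lemma compact_group_center: "compact_group (G\<lparr>carrier := center G\<rparr>) (subtopology T (center G))"
proof -
  let ?Z = "G\<lparr>carrier := center G\<rparr>" and ?TZ = "subtopology T (center G)"
  interpret Z: group ?Z by (rule subgroup_imp_group[OF center_subgroup])
  have top: "topspace ?TZ = center G" using center_carrier by (auto simp: topspace_eq)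
  have "continuous_map (prod_topology ?TZ ?TZ) T (\<lambda>(x, y). x \<otimes> y)"
    unfolding subtopology_Times[symmetric] by (rule continuous_map_from_subtopology[OF continuous_mult])
  then have mult: "continuous_map (prod_topology ?TZ ?TZ) ?TZ (\<lambda>(x, y). x \<otimes> y)"
    using top subgroup.m_closed[OF center_subgroup]
    by (intro continuous_map_into_subtopology) auto
  have "continuous_map ?TZ T (\<lambda>x. inv x)" by (rule continuous_map_from_subtopology[OF continuous_inv])
  then have "continuous_map ?TZ ?TZ (\<lambda>x. inv x)"
    using top subgroup.m_inv_closed[OF center_subgroup] by (intro continuous_map_into_subtopology) auto
  then have inv: "continuous_map ?TZ ?TZ (\<lambda>x. inv\<^bsub>?Z\<^esub> x)"
    by (rule continuous_map_eq) (simp add: top m_inv_consistent[OF center_subgroup])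
  show ?thesis
  proof (intro compact_group.intro topological_group.intro topological_group_axioms.intro compact_group_axioms.intro)
    show "group ?Z" by (rule Z.is_group)
    show "topspace ?TZ = carrier ?Z" using top by simp
    show "continuous_map (prod_topology ?TZ ?TZ) ?TZ (\<lambda>(x, y). x \<otimes>\<^bsub>?Z\<^esub> y)" using mult by simp
    show "continuous_map ?TZ ?TZ (\<lambda>x. inv\<^bsub>?Z\<^esub> x)" by (rule inv)
    show "compact_space ?TZ"
      by (rule compact_space_subtopology[OF closedin_compact_space[OF compact closedin_center]])
    show "Hausdorff_space ?TZ" by (rule Hausdorff_space_subtopology[OF Hausdorff])
  qed
qed

lemma central_character_eqI:
  "(\<And>c. c \<in> center G \<Longrightarrow> central_character G D c = central_character G D' c) \<Longrightarrow>
    central_character G D = central_character G D'"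
  unfolding central_character_def by (auto simp: restrict_def fun_eq_iff)

text \<open>On the centre an irreducible representation is determined by its character, so
  \<open>inv x \<otimes> y\<close> is trivial in all of them.\<close>

lemma central_characters_separate:
  assumes x: "x \<in> center G" and y: "y \<in> center G"
    and eq: "\<And>D. D \<in> irr_classes G T \<Longrightarrow> central_character G D x = central_character G D y"
  shows "x = y"
proof -
  have c: "x \<in> carrier G" "y \<in> carrier G" "inv x \<in> carrier G" using x y by (simp_all add: center_carrier)
  have "inv x \<otimes> y = \<one>"
  proof (rule irreducible_reps_separate)
    show "inv x \<otimes> y \<in> carrier G" using c by simp
    fix V n assume V: "irreducible_rep G T V" "unitary_rep G T n V"
    have "V x = V y"
      using central_value[OF V x] central_value[OF V y] eq[OF irr_class_in[OF V(1)]] by simp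
    then have "V (inv x \<otimes> y) = V (inv x \<otimes> x)"
      by (simp only: unitary_rep_mult[OF V(2) c(3,2)] unitary_rep_mult[OF V(2) c(3,1)])
    also have "\<dots> = V \<one>" using c by simp
    also have "\<dots> = 1\<^sub>m n" by (rule unitary_rep_one[OF is_group V(2)])
    finally show "V (inv x \<otimes> y) = 1\<^sub>m n" .
  qed
  then have "x \<otimes> (inv x \<otimes> y) = x" using c by simp
  then show ?thesis using c by (simp add: m_assoc[symmetric])
qed

text \<open>The closure conditions on a separating family are met by representations: a constituent
  of a tensor product gives the product of two characters, the conjugate representation the
  conjugate, and the trivial class the unit.\<close>

lemma central_characters_exhaust:
  "central_character G ` irr_classes G T = carrier (center_dual G T)"
  unfolding center_dual_def
proof (rule compact_group.separating_characters_exhaust[OF compact_group_center])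
  let ?Z = "G\<lparr>carrier := center G\<rparr>" and ?L = "central_character G ` irr_classes G T"
  have memI: "\<chi> \<in> ?L" if "D \<in> irr_classes G T" "\<chi> \<in> extensional (center G)"
    "\<And>c. c \<in> center G \<Longrightarrow> \<chi> c = central_character G D c" for D \<chi>
  proof (rule image_eqI[OF _ that(1)], rule extensionalityI[OF that(2)])
    show "central_character G D \<in> extensional (center G)"
      unfolding central_character_def by (rule restrict_extensional)
  qed (rule that(3))
  show "?L \<subseteq> carrier (character_group ?Z (subtopology T (center G)))"
    using central_character_in_dual unfolding center_dual_def by (rule image_subsetI)
  show "(\<lambda>x\<in>carrier ?Z. 1) \<in> ?L"
    by (rule memI[OF trivial_class_in]) (simp_all add: central_character_trivial)
  show "(\<lambda>x\<in>carrier ?Z. \<chi> x * \<psi> x) \<in> ?L" if L: "\<chi> \<in> ?L" "\<psi> \<in> ?L" for \<chi> \<psi>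
  proof -
    obtain D0 where D0: "D0 \<in> irr_classes G T" "\<chi> = central_character G D0" using L(1) by (rule imageE)
    obtain D1 where D1: "D1 \<in> irr_classes G T" "\<psi> = central_character G D1" using L(2) by (rule imageE)
    obtain D where D: "D \<in> class_prod G T D0 D1" using class_prod_nonempty[OF D0(1) D1(1)] by blast
    show ?thesis
      by (rule memI[OF subsetD[OF class_prod_subset D]])
        (simp_all add: class_prod_central_character[OF D0(1) D1(1) D] D0(2) D1(2))
  qed
  show "(\<lambda>x\<in>carrier ?Z. cnj (\<chi> x)) \<in> ?L" if L: "\<chi> \<in> ?L" for \<chi>
  proof -
    obtain D where D: "D \<in> irr_classes G T" "\<chi> = central_character G D" using L by (rule imageE)
    obtain U where U: "irreducible_rep G T U" "D = irr_class G T U" using irr_classesE[OF D(1)] .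
    show ?thesis
      by (rule memI[OF irr_class_in[OF irreducible_rep_conj[OF U(1)]]])
        (simp_all add: central_character_conj[OF U(1)] D(2) U(2))
  qed
  show "x = y" if "x \<in> carrier ?Z" "y \<in> carrier ?Z" "\<And>\<chi>. \<chi> \<in> ?L \<Longrightarrow> \<chi> x = \<chi> y" for x y
    by (rule central_characters_separate) (use that in simp_all)
qed

section \<open>The group of chain classes\<close>

lemma mem_chain_class:
  "D \<in> irr_classes G T \<Longrightarrow> E \<in> chain_class G T D \<longleftrightarrow>
    E \<in> irr_classes G T \<and> central_character G D = central_character G E"
  by (auto simp: chain_class_def chain_equiv_iff)

lemma chain_class_eq_iff:
  assumes "D \<in> irr_classes G T" "D' \<in> irr_classes G T"
  shows "chain_class G T D = chain_class G T D' \<longleftrightarrow> central_character G D = central_character G D'"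
proof
  assume "chain_class G T D = chain_class G T D'"
  then have "D' \<in> chain_class G T D" using mem_chain_class[OF assms(2)] assms(2) by simp
  then show "central_character G D = central_character G D'" using mem_chain_class[OF assms(1)] by simp
next
  assume "central_character G D = central_character G D'"
  then show "chain_class G T D = chain_class G T D'"
    by (intro Set.set_eqI) (simp only: mem_chain_class[OF assms(1)] mem_chain_class[OF assms(2)])
qed

text \<open>The unions in \<open>chain_mult\<close> run over all representatives, but every class
  they collect has the central character of \<open>D\<close>, so they amount to a single
  class.\<close>

lemma chain_mult_eq:
  assumes D0: "D0 \<in> irr_classes G T" and D1: "D1 \<in> irr_classes G T" and D: "D \<in> class_prod G T D0 D1"
  shows "chain_class G T D0 \<otimes>\<^bsub>chain_group G T\<^esub> chain_class G T D1 = chain_class G T D"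
proof -
  have same: "chain_class G T E = chain_class G T D"
    if X: "X \<in> chain_class G T D0" and Y: "Y \<in> chain_class G T D1" and E: "E \<in> class_prod G T X Y" for X Y E
  proof -
    have X': "X \<in> irr_classes G T" "central_character G D0 = central_character G X"
      using X mem_chain_class[OF D0] by simp_all
    have Y': "Y \<in> irr_classes G T" "central_character G D1 = central_character G Y"
      using Y mem_chain_class[OF D1] by simp_all
    have "central_character G E = central_character G D"
      by (rule central_character_eqI)
        (simp add: class_prod_central_character[OF X'(1) Y'(1) E] class_prod_central_character[OF D0 D1 D] X'(2) Y'(2))
    then show ?thesis
      using chain_class_eq_iff[OF subsetD[OF class_prod_subset E] subsetD[OF class_prod_subset D]] by simp
  qed
  have mem: "D0 \<in> chain_class G T D0" "D1 \<in> chain_class G T D1" using D0 D1 mem_chain_class by simp_all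
  have "chain_class G T D \<subseteq> chain_mult G T (chain_class G T D0) (chain_class G T D1)"
  proof
    fix E assume "E \<in> chain_class G T D"
    then show "E \<in> chain_mult G T (chain_class G T D0) (chain_class G T D1)"
      unfolding chain_mult_def set_chain_class_def
      by (intro UN_I[where a = D0] UN_I[where a = D1] UN_I[where a = D] mem D)
  qed
  moreover have "chain_mult G T (chain_class G T D0) (chain_class G T D1) \<subseteq> chain_class G T D"
    unfolding chain_mult_def set_chain_class_def by (intro UN_least equalityD1) (rule same)
  ultimately show ?thesis by (simp add: chain_group_def)
qed

lemma chain_mult_exists:
  assumes "D0 \<in> irr_classes G T" "D1 \<in> irr_classes G T"
  obtains D where "D \<in> irr_classes G T"
    "chain_class G T D0 \<otimes>\<^bsub>chain_group G T\<^esub> chain_class G T D1 = chain_class G T D"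
    "\<forall>c\<in>center G. central_character G D c = central_character G D0 c * central_character G D1 c"
proof -
  obtain D where D: "D \<in> class_prod G T D0 D1" using class_prod_nonempty[OF assms] by blast
  show thesis
    by (rule that[OF subsetD[OF class_prod_subset D] chain_mult_eq[OF assms D]])
      (simp add: class_prod_central_character[OF assms D])
qed

lemma chain_group_carrier: "carrier (chain_group G T) = chain_class G T ` irr_classes G T"
  by (simp add: chain_group_def)

lemma chain_group_one: "\<one>\<^bsub>chain_group G T\<^esub> = chain_class G T (trivial_class G T)"
  by (simp add: chain_group_def)

text \<open>Each law is the corresponding law for functions on the centre, since
  \<open>chain_mult_exists\<close> turns products of classes into products of central
  characters.\<close>

lemma comm_group_chain_group: "comm_group (chain_group G T)"
proof (rule comm_groupI)
  let ?C = "chain_group G T" and ?c = "chain_class G T"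
  have eqI: "?c D = ?c D'" if "D \<in> irr_classes G T" "D' \<in> irr_classes G T"
    "\<And>c. c \<in> center G \<Longrightarrow> central_character G D c = central_character G D' c" for D D'
    using chain_class_eq_iff[OF that(1,2)] central_character_eqI that(3) by simp
  show "\<one>\<^bsub>?C\<^esub> \<in> carrier ?C"
    unfolding chain_group_one chain_group_carrier by (rule imageI[OF trivial_class_in])
  fix x assume "x \<in> carrier ?C"
  then obtain D where D: "D \<in> irr_classes G T" "x = ?c D" unfolding chain_group_carrier by (elim imageE)
  obtain E where E: "E \<in> irr_classes G T" "\<one>\<^bsub>?C\<^esub> \<otimes>\<^bsub>?C\<^esub> x = ?c E"
    "\<forall>c\<in>center G. central_character G E c = central_character G (trivial_class G T) c * central_character G D c"
    using chain_mult_exists[OF trivial_class_in D(1)] unfolding chain_group_one D(2) .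
  show "\<one>\<^bsub>?C\<^esub> \<otimes>\<^bsub>?C\<^esub> x = x"
    unfolding E(2) unfolding D(2) by (rule eqI[OF E(1) D(1)]) (simp add: E(3) central_character_trivial)
  show "\<exists>y\<in>carrier ?C. y \<otimes>\<^bsub>?C\<^esub> x = \<one>\<^bsub>?C\<^esub>"
  proof -
    obtain U where U: "irreducible_rep G T U" "D = irr_class G T U" using irr_classesE[OF D(1)] .
    \<comment> \<open>The conjugate class is the inverse because central characters have modulus
      1.\<close>
    let ?D' = "irr_class G T (conj_rep U)"
    have D': "?D' \<in> irr_classes G T" by (rule irr_class_in[OF irreducible_rep_conj[OF U(1)]])
    obtain F where F: "F \<in> irr_classes G T" "?c ?D' \<otimes>\<^bsub>?C\<^esub> ?c D = ?c F"
      "\<forall>c\<in>center G. central_character G F c = central_character G ?D' c * central_character G D c"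
      using chain_mult_exists[OF D' D(1)] .
    have "central_character G F c = central_character G (trivial_class G T) c" if c: "c \<in> center G" for c
    proof -
      have "central_character G D c * cnj (central_character G D c) = 1"
        using central_character_norm[OF D(1) c] by (simp add: complex_norm_square[symmetric])
      then show ?thesis
        unfolding bspec[OF F(3) c] central_character_trivial[OF c]
        using central_character_conj[OF U(1) c] U(2) by (simp add: mult.commute)
    qed
    then have "?c ?D' \<otimes>\<^bsub>?C\<^esub> x = \<one>\<^bsub>?C\<^esub>"
      unfolding D(2) F(2) chain_group_one by (rule eqI[OF F(1) trivial_class_in])
    then show ?thesis
      by (rule bexI) (simp add: chain_group_carrier D')
  qed
  fix y assume "y \<in> carrier ?C"
  then obtain D1 where D1: "D1 \<in> irr_classes G T" "y = ?c D1" unfolding chain_group_carrier by (elim imageE)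
  obtain P where P: "P \<in> irr_classes G T" "?c D \<otimes>\<^bsub>?C\<^esub> ?c D1 = ?c P"
    "\<forall>c\<in>center G. central_character G P c = central_character G D c * central_character G D1 c"
    using chain_mult_exists[OF D(1) D1(1)] .
  obtain Q where Q: "Q \<in> irr_classes G T" "?c D1 \<otimes>\<^bsub>?C\<^esub> ?c D = ?c Q"
    "\<forall>c\<in>center G. central_character G Q c = central_character G D1 c * central_character G D c"
    using chain_mult_exists[OF D1(1) D(1)] .
  show "x \<otimes>\<^bsub>?C\<^esub> y \<in> carrier ?C" unfolding D(2) D1(2) P(2) chain_group_carrier by (rule imageI[OF P(1)])
  show "x \<otimes>\<^bsub>?C\<^esub> y = y \<otimes>\<^bsub>?C\<^esub> x"
    unfolding D(2) D1(2) P(2) Q(2) by (rule eqI[OF P(1) Q(1)]) (simp add: P(3) Q(3) mult.commute)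
  fix z assume "z \<in> carrier ?C"
  then obtain D2 where D2: "D2 \<in> irr_classes G T" "z = ?c D2" unfolding chain_group_carrier by (elim imageE)
  obtain R where R: "R \<in> irr_classes G T" "?c P \<otimes>\<^bsub>?C\<^esub> ?c D2 = ?c R"
    "\<forall>c\<in>center G. central_character G R c = central_character G P c * central_character G D2 c"
    using chain_mult_exists[OF P(1) D2(1)] .
  obtain M where M: "M \<in> irr_classes G T" "?c D1 \<otimes>\<^bsub>?C\<^esub> ?c D2 = ?c M"
    "\<forall>c\<in>center G. central_character G M c = central_character G D1 c * central_character G D2 c"
    using chain_mult_exists[OF D1(1) D2(1)] .
  obtain N where N: "N \<in> irr_classes G T" "?c D \<otimes>\<^bsub>?C\<^esub> ?c M = ?c N"
    "\<forall>c\<in>center G. central_character G N c = central_character G D c * central_character G M c"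
    using chain_mult_exists[OF D(1) M(1)] .
  show "x \<otimes>\<^bsub>?C\<^esub> y \<otimes>\<^bsub>?C\<^esub> z = x \<otimes>\<^bsub>?C\<^esub> (y \<otimes>\<^bsub>?C\<^esub> z)"
    unfolding D(2) D1(2) D2(2) P(2) M(2) R(2) N(2)
    by (rule eqI[OF R(1) N(1)]) (simp add: P(3) M(3) R(3) N(3) mult.assoc)
qed

lemma central_character_iso:
  "\<exists>\<eta>\<in>iso (chain_group G T) (center_dual G T).
     \<forall>D\<in>irr_classes G T. \<eta> (chain_class G T D) = central_character G D"
proof -
  let ?C = "chain_group G T" and ?Z = "center_dual G T"
  \<comment> \<open>An arbitrary member represents the class; \<open>mem_chain_class\<close> makes
    the value independent of the choice.\<close>
  define \<eta> where "\<eta> = (\<lambda>X. central_character G (SOME D. D \<in> X))"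
  have \<eta>: "\<eta> (chain_class G T D) = central_character G D" if D: "D \<in> irr_classes G T" for D
  proof -
    have "D \<in> chain_class G T D" using D mem_chain_class by simp
    then have "(SOME E. E \<in> chain_class G T D) \<in> chain_class G T D" by (rule someI)
    then show ?thesis using mem_chain_class[OF D] by (simp add: \<eta>_def)
  qed
  have "\<eta> \<in> hom ?C ?Z"
  proof (rule homI)
    fix x assume "x \<in> carrier ?C"
    then obtain D where D: "D \<in> irr_classes G T" "x = chain_class G T D"
      unfolding chain_group_carrier by (elim imageE)
    show "\<eta> x \<in> carrier ?Z" unfolding D(2) \<eta>[OF D(1)] by (rule central_character_in_dual[OF D(1)])
    fix y assume "y \<in> carrier ?C"
    then obtain D1 where D1: "D1 \<in> irr_classes G T" "y = chain_class G T D1"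
      unfolding chain_group_carrier by (elim imageE)
    obtain P where P: "P \<in> irr_classes G T"
      "chain_class G T D \<otimes>\<^bsub>?C\<^esub> chain_class G T D1 = chain_class G T P"
      "\<forall>c\<in>center G. central_character G P c = central_character G D c * central_character G D1 c"
      using chain_mult_exists[OF D(1) D1(1)] .
    have "central_character G P = (\<lambda>c\<in>center G. central_character G D c * central_character G D1 c)"
      using P(3) by (intro extensionalityI[of _ "center G"]) (simp_all add: central_character_def)
    also have "\<dots> = central_character G D \<otimes>\<^bsub>?Z\<^esub> central_character G D1"
      by (simp add: center_dual_def character_group_def)
    finally show "\<eta> (x \<otimes>\<^bsub>?C\<^esub> y) = \<eta> x \<otimes>\<^bsub>?Z\<^esub> \<eta> y"
      unfolding D(2) D1(2) P(2) \<eta>[OF P(1)] \<eta>[OF D(1)] \<eta>[OF D1(1)] .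
  qed
  moreover have "inj_on \<eta> (carrier ?C)"
    unfolding chain_group_carrier
  proof (rule inj_onI, elim imageE)
    fix x y D D' assume D: "D \<in> irr_classes G T" "x = chain_class G T D"
      and D': "D' \<in> irr_classes G T" "y = chain_class G T D'" and eq: "\<eta> x = \<eta> y"
    show "x = y"
      using eq unfolding D(2) D'(2) \<eta>[OF D(1)] \<eta>[OF D'(1)] chain_class_eq_iff[OF D(1) D'(1)] .
  qed
  moreover have "\<eta> ` carrier ?C = carrier ?Z"
    unfolding chain_group_carrier image_image central_characters_exhaust[symmetric]
    by (rule image_cong[OF refl \<eta>])
  ultimately have "\<eta> \<in> iso ?C ?Z" by (simp add: iso_def bij_betw_def)
  then show ?thesis using \<eta> by blast
qed

end

theorem theorem5p5:
  fixes G :: "('g, 'b) monoid_scheme" and T :: "'g topology"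
  assumes "compact_group G T"
    and "\<not> comm_group G"
  shows
    "(comm_group (chain_group G T) \<and>
      (\<forall>D0\<in>irr_classes G T. \<forall>D1\<in>irr_classes G T.
         class_prod G T D0 D1 \<noteq> {} \<and>
         (\<forall>D\<in>class_prod G T D0 D1.
            chain_class G T D0 \<otimes>\<^bsub>chain_group G T\<^esub> chain_class G T D1 = chain_class G T D)))
     \<and>
     ((\<forall>D\<in>irr_classes G T. \<forall>D'\<in>irr_classes G T.
         chain_class G T D = chain_class G T D' \<longrightarrow>
         central_character G D = central_character G D') \<and>
      (\<exists>\<eta>\<in>iso (chain_group G T) (center_dual G T).
         \<forall>D\<in>irr_classes G T. \<eta> (chain_class G T D) = central_character G D))"
proof -
  interpret compact_group G T by (rule assms(1))
  show ?thesis
    using comm_group_chain_group central_character_iso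
    by (intro conjI ballI impI) (simp_all add: class_prod_nonempty chain_mult_eq chain_class_eq_iff)
qed

end
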